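(* Assume ignorability ($Y(t)\perp T\mid X$ for all $t\in\mathcal{T}$) and overlap: $Q_{T,X}\ll P_{T,X}$ and $\frac{\partial Q_{T,X}}{\partial P_{T,X}}\le W_0$ for some $W_0>0$. Let $\mathrm{IPM}_{\mathcal{F}}\in\{\mathcal{W}_1,\mathrm{MMD}_{\mathcal{K}}\}$, where $\mathcal{K}$ is a continuous kernel on $\mathcal{Z}$. Let $\mathbf{w}$ be the CBDM weights $$\mathbf{w}=\operatorname*{arg\,min}_{\mathbf{w}'\in\Lambda_n;\ w'_i\le W/n\ \forall i}\ \mathrm{IPM}^2_{\mathcal{F}}\big(\hat P^{\mathbf{w}'}_{T,X},\hat Q_{T,X}\big)+\lambda R_n(\mathbf{w}')$$ with $W>W_0$ and $\hat Q_{T,X}=\hat P_T\otimes\hat P_X$. Assume that $\mathcal{G}$ is $B$-bounded and that $R_n(\mathcal{G}\circ\mathbf{T})$ converges (a.s.) to zero. Let $\hat g^n_{\mathbf{w}}\in\mathcal{G}$ be the minimizer over $g\in\mathcal{G}$ of $\sum_{i=1}^nw_i(Y_i-g(T_i))^2$. Then $$\mathcal{R}^\mu_T(\hat g^n_{\mathbf{w}})\xrightarrow[n\to+\infty]{a.s.}\inf_{g\in\mathcal{G}}\mathcal{R}^\mu_T(g)$$ if at least one of the following conditions is satisfied: (a) There exist two classes $\mathcal{F}_0$ (functions on $\mathcal{Z}$) and $\mathcal{G}_0$ (functions of $t$) such that: $\tau$ is approximable by $\mathcal{F}_0$; all $g\in\mathcal{G}$ are $(\gamma,0)$-approximable by $\mathcal{G}_0$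 for some fixed $\gamma$; and $\{2f\cdot g+g'\cdot g'':\ f\in\mathcal{F}_0,\ g,g',g''\in\mathcal{G}_0\cup\{0\}\}\subset\mathcal{F}$. (b) The implicit model of the CBDM weights is well-specified. Furthermore, $\rho^*$ is strongly convex and smooth on any finite sub-interval of $\big(\frac{d\rho}{dx}(0^+),\frac{d\rho}{dx}(W^-)\big)$. (This last assumption is true when $\rho(x)=x^2$ or $\rho(x)=x\log x$ on $[0,W]$.)
   Context: Setting: $(T_i,X_i,Y_i)_{i\ge1}$ are i.i.d. copies of $(T,X,Y)$, with treatment $T$ (values in $\mathbb{R}^{d_T}$), covariates $X$ (values in $\mathbb{R}^{d_X}$), potential outcomes $Y(t)$, observed outcome $Y=Y(T)$. $\mathcal{T}$ is the support of the law $P_T$ of $T$. The supports $\mathcal{Z}\subset\mathbb{R}^{d_T}\times\mathbb{R}^{d_X}$ of $P_{T,X}$ and $\mathcal{Y}\subset\mathbb{R}$ of $P_Y$ are compact. $Q_{T,X}=P_T\otimes P_X$, $Q_T=P_T$. $\mu(t)=\mathbb{E}[Y(t)]$, $\tau(t,x)=\mathbb{E}[Y\mid T=t,X=x]$, $\mathcal{R}^\mu_T(g)=\mathbb{E}_{Q_T}[(\mu(T)-g(T))^2]$. $\mathcal{G}$ is a class of real functions on $\mathcal{T}$; it is $B$-bounded if $|g-g'|\le B$ on $\mathcal{Z}$ for all $g,g'\in\mathcal{G}$ (viewing $g(t,x)=g(t)$). $R_n(\mathcal{G}\circ\mathbf{T})=\frac2n\mathbb{E}_{\boldsymbol\xi}[\sup_{g\in\mathcal{G}}\sum_{i=1}^n\xi_ig(T_i)]$,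 with $\mathbf{T}=\{T_1,\dots,T_n\}$ and $\xi_i$ i.i.d. uniform on $\{-1,1\}$, is the Rademacher complexity. Weights: $\Lambda_n=\{\mathbf{w}\in\mathbb{R}^n:\mathbf{w}\ge0,\sum_iw_i=1\}$; $\lambda\ge0$; $\hat P^{\mathbf{w}}_{T,X}=\sum_iw_i\delta_{(T_i,X_i)}$; $\hat P_T,\hat P_X$ are the marginal empirical distributions of $T_1,\dots,T_n$ and $X_1,\dots,X_n$; $R_n(\mathbf{w})=n^{-2}\sum_{i=1}^n\rho(nw_i)$, with $\rho$ strictly convex and continuous on $[0,W]$ and differentiable on $(0,W)$, extended by $\rho=+\infty$ outside $[0,W]$. $\rho^*(x)=\sup_y(yx-\rho(y))$ is its Legendre transform. $\frac{d\rho}{dx}(0^+)$, $\frac{d\rho}{dx}(W^-)$ are the (possibly infinite) one-sided limits of the derivative. "Smooth" means having Lipschitz derivative. $\mathrm{IPM}_{\mathcal{F}}(P_0,Q_0)=\sup_{f\in\mathcal{F}}|\mathbb{E}_{P_0}[f(Z)]-\mathbb{E}_{Q_0}[f(Z)]|$. $\mathcal{W}_1$ (Wasserstein-1 distance) is the IPM with $\mathcal{F}$ the functions on $\mathcal{Z}$ with Lipschitz constant at most $1$ for the Euclidean distance; $\mathrm{MMD}_{\mathcal{K}}$ is the IPM with $\mathcal{F}$ the unit ball of the RKHS of $\mathcal{K}$. A function $f$ is $(\gamma,\epsilon)$-approximable by a class $\mathcal{C}$ if for some $k$ there exist $f_1,\dots,f_k\in\mathcal{C}$ and $\lambda_1,\dots,\lambda_k\in\mathbb{R}$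 with $\sum_i|\lambda_i|\le\gamma$ and $\|f-\sum_i\lambda_if_i\|_\infty\le\epsilon$; it is approximable by $\mathcal{C}$ if for every $\epsilon>0$ it is $(\gamma,\epsilon)$-approximable by $\mathcal{C}$ for some $\gamma\ge0$. The implicit model of the CBDM weights is well-specified if $\mathrm{IPM}_{\mathcal{F}}=\mathrm{MMD}_{\mathcal{K}}$, where $\mathcal{K}$ is continuous with finite-dimensional RKHS $\mathcal{H}$, and $\frac{\partial Q_{T,X}}{\partial P_{T,X}}=\frac{d\rho^*}{dx}(\mu+f)$ for some $\mu\in\mathbb{R}$ (a constant, unrelated to the dose-response function) and $f\in\mathcal{H}$.
   Formalization: Added: potential outcomes jointly measurable, with Y(t) a limit of Y along countable roundings of t; functions in G Borel, G pointwise separable; weights a measurable function of the (T_i,X_i); F_0 nonempty in (a); lambda > 0 in (b). Without these the claim can fail. *)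

theory Defs
  imports "HOL-Probability.Probability"
begin

section \<open>Probability\<close>

definition measure_support :: "'a::topological_space measure \<Rightarrow> 'a set" where
  "measure_support P = {x. \<forall>U. open U \<longrightarrow> x \<in> U \<longrightarrow> emeasure P U > 0}"

definition gen_subalgebra :: "'w measure \<Rightarrow> 'c measure \<Rightarrow> ('w \<Rightarrow> 'c) \<Rightarrow> 'w measure" where
  "gen_subalgebra M N V = vimage_algebra (space M) V N"

definition cond_indep ::
  "'w measure \<Rightarrow> 'c measure \<Rightarrow> ('w \<Rightarrow> 'c) \<Rightarrow> 'd measure \<Rightarrow> ('w \<Rightarrow> 'd) \<Rightarrow> 'e measure \<Rightarrow> ('w \<Rightarrow> 'e) \<Rightarrow> bool"
  where
  "cond_indep M N1 U N2 V N3 X \<longleftrightarrow>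
    (\<forall>A\<in>sets N1. \<forall>C\<in>sets N2. AE \<omega> in M.
      real_cond_exp M (gen_subalgebra M N3 X) (indicator (U -` A \<inter> V -` C)) \<omega> =
      real_cond_exp M (gen_subalgebra M N3 X) (indicator (U -` A)) \<omega> *
      real_cond_exp M (gen_subalgebra M N3 X) (indicator (V -` C)) \<omega>)"

text \<open>Path regularity of the potential outcomes: the outcome at the treatment received is the limit
  of the outcomes at countably-valued roundings \<open>\<pi> n\<close> of that treatment, both for the actual
  treatment and for almost every fixed treatment level. Continuous paths, right-continuous paths
  over an interval and countable sets of treatments are covered. Some such condition is needed for
  ignorability at each single \<open>t\<close> to say anything about \<open>Y(T)\<close> when \<open>T\<close> has no atoms: for
  \<open>Y(t) = 1\<close> if \<open>T = t\<close> and \<open>0\<close> otherwise, every \<open>Y(t)\<close> vanishes almost surely but \<open>Y(T) = 1\<close>.\<close>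

definition regular_outcomes ::
  "'w measure \<Rightarrow> ('w \<Rightarrow> 'a::euclidean_space) \<Rightarrow> ('a \<Rightarrow> 'w \<Rightarrow> real) \<Rightarrow> bool" where
  "regular_outcomes M T Y \<longleftrightarrow>
    (\<exists>\<pi> :: nat \<Rightarrow> 'a \<Rightarrow> 'a.
      (\<forall>n. \<pi> n \<in> borel_measurable borel \<and> countable (range (\<pi> n)) \<and>
           \<pi> n ` measure_support (distr M borel T) \<subseteq> measure_support (distr M borel T)) \<and>
      (AE \<omega> in M. (\<lambda>n. Y (\<pi> n (T \<omega>)) \<omega>) \<longlonglongrightarrow> Y (T \<omega>) \<omega>) \<and>
      (AE t in distr M borel T. AE \<omega> in M. (\<lambda>n. Y (\<pi> n t) \<omega>) \<longlonglongrightarrow> Y t \<omega>))"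

section \<open>Function classes\<close>

definition bounded_class :: "real \<Rightarrow> ('a \<times> 'b) set \<Rightarrow> ('a \<Rightarrow> real) set \<Rightarrow> bool" where
  "bounded_class B Z G \<longleftrightarrow> (\<forall>g\<in>G. \<forall>g'\<in>G. \<forall>(t, x)\<in>Z. \<bar>g t - g' t\<bar> \<le> B)"

text \<open>The usual measurability condition for empirical processes, under which suprema over the class
  are random variables. Without it, small Rademacher complexity does not imply a uniform law of
  large numbers.\<close>

definition pointwise_separable :: "'a set \<Rightarrow> ('a \<Rightarrow> real) set \<Rightarrow> bool" where
  "pointwise_separable D G \<longleftrightarrow>
    (\<exists>G'\<subseteq>G. countable G' \<and>
      (\<forall>g\<in>G. \<exists>s. (\<forall>m. s m \<in> G') \<and> (\<forall>t\<in>D. (\<lambda>m. s m t) \<longlonglongrightarrow> g t)))"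

definition rademacher_complexity :: "nat \<Rightarrow> ('a \<Rightarrow> real) set \<Rightarrow> (nat \<Rightarrow> 'a) \<Rightarrow> real" where
  "rademacher_complexity n G t =
    2 / real n * measure_pmf.expectation (pmf_of_set ({..<n} \<rightarrow>\<^sub>E {-1, 1}))
      (\<lambda>\<xi>. SUP g\<in>G. \<Sum>i<n. \<xi> i * g (t i))"

definition approximable_within ::
  "'z set \<Rightarrow> ('z \<Rightarrow> real) set \<Rightarrow> real \<Rightarrow> real \<Rightarrow> ('z \<Rightarrow> real) \<Rightarrow> bool" where
  "approximable_within D C \<gamma> \<epsilon> f \<longleftrightarrow>
    (\<exists>k fs cs. (\<forall>i<k::nat. fs i \<in> C) \<and> (\<Sum>i<k. \<bar>cs i\<bar>) \<le> \<gamma> \<and>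
      (\<forall>z\<in>D. \<bar>f z - (\<Sum>i<k. cs i * fs i z)\<bar> \<le> \<epsilon>))"

definition approximable :: "'z set \<Rightarrow> ('z \<Rightarrow> real) set \<Rightarrow> ('z \<Rightarrow> real) \<Rightarrow> bool" where
  "approximable D C f \<longleftrightarrow> (\<forall>\<epsilon>>0. \<exists>\<gamma>\<ge>0. approximable_within D C \<gamma> \<epsilon> f)"

section \<open>Integral probability metrics\<close>

definition ipm :: "('z \<Rightarrow> real) set \<Rightarrow> 'z measure \<Rightarrow> 'z measure \<Rightarrow> real" where
  "ipm F P Q = (SUP f\<in>F. \<bar>(\<integral>z. f z \<partial>P) - (\<integral>z. f z \<partial>Q)\<bar>)"

text \<open>A function on \<open>Z\<close> is represented by any total function with the right values on \<open>Z\<close>; the two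
  classes below are closed under changing values outside \<open>Z\<close>. The distance on a product type is
  the Euclidean one.\<close>

definition lipschitz_class :: "'z::metric_space set \<Rightarrow> ('z \<Rightarrow> real) set" where
  "lipschitz_class Z = {f. 1-lipschitz_on Z f}"

text \<open>The reproducing kernel Hilbert space \<open>H\<close> of \<open>K\<close> on \<open>Z\<close>, with inner product \<open>ip\<close>. Elements of
  \<open>H\<close> are normalised to vanish outside \<open>Z\<close>. Symmetry and positive semidefiniteness of \<open>K\<close> on \<open>Z\<close>
  follow from the reproducing property.\<close>

definition rkhs ::
  "'z set \<Rightarrow> ('z \<Rightarrow> 'z \<Rightarrow> real) \<Rightarrow> ('z \<Rightarrow> real) set \<Rightarrow> (('z \<Rightarrow> real) \<Rightarrow> ('z \<Rightarrow> real) \<Rightarrow> real) \<Rightarrow> bool"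
  where
  "rkhs Z K H ip \<longleftrightarrow>
    (\<forall>f\<in>H. \<forall>z. z \<notin> Z \<longrightarrow> f z = 0) \<and>
    (\<lambda>_. 0) \<in> H \<and>
    (\<forall>f\<in>H. \<forall>g\<in>H. (\<lambda>z. f z + g z) \<in> H) \<and>
    (\<forall>c. \<forall>f\<in>H. (\<lambda>z. c * f z) \<in> H) \<and>
    (\<forall>f\<in>H. \<forall>g\<in>H. ip f g = ip g f) \<and>
    (\<forall>f\<in>H. \<forall>g\<in>H. \<forall>h\<in>H. ip (\<lambda>z. f z + g z) h = ip f h + ip g h) \<and>
    (\<forall>c. \<forall>f\<in>H. \<forall>g\<in>H. ip (\<lambda>z. c * f z) g = c * ip f g) \<and>
    (\<forall>f\<in>H. ip f f \<ge> 0 \<and> (ip f f = 0 \<longrightarrow> f = (\<lambda>_. 0))) \<and>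
    (\<forall>s :: nat \<Rightarrow> 'z \<Rightarrow> real.
      (\<forall>n. s n \<in> H) \<longrightarrow>
      (\<forall>e>0. \<exists>N. \<forall>m\<ge>N. \<forall>n\<ge>N. ip (\<lambda>z. s m z - s n z) (\<lambda>z. s m z - s n z) < e) \<longrightarrow>
      (\<exists>f\<in>H. (\<lambda>n. ip (\<lambda>z. s n z - f z) (\<lambda>z. s n z - f z)) \<longlonglongrightarrow> 0)) \<and>
    (\<forall>z\<in>Z. (\<lambda>y. if y \<in> Z then K z y else 0) \<in> H \<and>
      (\<forall>f\<in>H. f z = ip f (\<lambda>y. if y \<in> Z then K z y else 0)))"

definition rkhs_unit_ball ::
  "'z set \<Rightarrow> ('z \<Rightarrow> real) set \<Rightarrow> (('z \<Rightarrow> real) \<Rightarrow> ('z \<Rightarrow> real) \<Rightarrow> real) \<Rightarrow> ('z \<Rightarrow> real) set" where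
  "rkhs_unit_ball Z H ip = {f. \<exists>h\<in>H. ip h h \<le> 1 \<and> (\<forall>z\<in>Z. f z = h z)}"

definition finite_dimensional_class :: "('z \<Rightarrow> real) set \<Rightarrow> bool" where
  "finite_dimensional_class H \<longleftrightarrow>
    (\<exists>S\<subseteq>H. finite S \<and> (\<forall>f\<in>H. \<exists>c. f = (\<lambda>z. \<Sum>b\<in>S. c b * b z)))"

definition continuous_kernel_rkhs ::
  "'z::topological_space set \<Rightarrow> ('z \<Rightarrow> 'z \<Rightarrow> real) \<Rightarrow> ('z \<Rightarrow> real) set \<Rightarrow>
    (('z \<Rightarrow> real) \<Rightarrow> ('z \<Rightarrow> real) \<Rightarrow> real) \<Rightarrow> bool" where
  "continuous_kernel_rkhs Z K H ip \<longleftrightarrow>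
    continuous_on (Z \<times> Z) (\<lambda>(z, z'). K z z') \<and> rkhs Z K H ip"

section \<open>Convexity\<close>

definition strictly_convex_on :: "real set \<Rightarrow> (real \<Rightarrow> real) \<Rightarrow> bool" where
  "strictly_convex_on S f \<longleftrightarrow> convex S \<and>
    (\<forall>x\<in>S. \<forall>y\<in>S. \<forall>u\<in>{0<..<1}. x \<noteq> y \<longrightarrow>
      f ((1 - u) * x + u * y) < (1 - u) * f x + u * f y)"

definition strongly_convex_on :: "real set \<Rightarrow> (real \<Rightarrow> real) \<Rightarrow> bool" where
  "strongly_convex_on S f \<longleftrightarrow> (\<exists>m>0. convex_on S (\<lambda>x. f x - m / 2 * x\<^sup>2))"

definition smooth_on :: "real set \<Rightarrow> (real \<Rightarrow> real) \<Rightarrow> bool" where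
  "smooth_on S f \<longleftrightarrow> (\<forall>x\<in>S. f differentiable (at x)) \<and> (\<exists>L. L-lipschitz_on S (deriv f))"

text \<open>Legendre transform of the extension of \<open>\<rho>\<close> by \<open>+\<infinity>\<close> outside \<open>[0, W]\<close>: points outside
  \<open>[0, W]\<close> do not contribute to the supremum.\<close>

definition legendre :: "real \<Rightarrow> (real \<Rightarrow> real) \<Rightarrow> real \<Rightarrow> real" where
  "legendre W \<rho> x = (SUP y\<in>{0..W}. y * x - \<rho> y)"

definition legendre_regular :: "real \<Rightarrow> (real \<Rightarrow> real) \<Rightarrow> bool" where
  "legendre_regular W \<rho> \<longleftrightarrow>
    (\<forall>I. is_interval I \<and> bounded I \<and>
      (\<forall>x\<in>I. Lim (at_right 0) (\<lambda>y. ereal (deriv \<rho> y)) < ereal x \<and>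
             ereal x < Lim (at_left W) (\<lambda>y. ereal (deriv \<rho> y))) \<longrightarrow>
      strongly_convex_on I (legendre W \<rho>) \<and> smooth_on I (legendre W \<rho>))"

section \<open>Weights\<close>

text \<open>Samples are sequences \<open>z\<close> of which only the entries \<open>z i\<close> with \<open>i < n\<close> are used. The empirical
  measures live on the discrete \<open>\<sigma>\<close>-algebra, so that all functions can be integrated.\<close>

definition weighted_empirical :: "nat \<Rightarrow> (nat \<Rightarrow> real) \<Rightarrow> (nat \<Rightarrow> 'z) \<Rightarrow> 'z measure" where
  "weighted_empirical n w z =
    distr (point_measure {..<n} (\<lambda>i. ennreal (w i))) (count_space UNIV) z"

definition empirical_pmf :: "nat \<Rightarrow> (nat \<Rightarrow> 'z) \<Rightarrow> 'z pmf" where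
  "empirical_pmf n z = map_pmf z (pmf_of_set {..<n})"

definition empirical_target :: "nat \<Rightarrow> (nat \<Rightarrow> 'a \<times> 'b) \<Rightarrow> ('a \<times> 'b) measure" where
  "empirical_target n z =
    measure_pmf (pair_pmf (empirical_pmf n (\<lambda>i. fst (z i))) (empirical_pmf n (\<lambda>i. snd (z i))))"

definition feasible_weights :: "nat \<Rightarrow> real \<Rightarrow> (nat \<Rightarrow> real) \<Rightarrow> bool" where
  "feasible_weights n W w \<longleftrightarrow>
    (\<forall>i<n. 0 \<le> w i) \<and> (\<Sum>i<n. w i) = 1 \<and> (\<forall>i<n. w i \<le> W / real n)"

definition weight_regularizer :: "nat \<Rightarrow> (real \<Rightarrow> real) \<Rightarrow> (nat \<Rightarrow> real) \<Rightarrow> real" where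
  "weight_regularizer n \<rho> w = (\<Sum>i<n. \<rho> (real n * w i)) / (real n)\<^sup>2"

definition cbdm_weights ::
  "(('a \<times> 'b) \<Rightarrow> real) set \<Rightarrow> real \<Rightarrow> (real \<Rightarrow> real) \<Rightarrow> real \<Rightarrow> nat \<Rightarrow> (nat \<Rightarrow> 'a \<times> 'b) \<Rightarrow>
    (nat \<Rightarrow> real) \<Rightarrow> bool" where
  "cbdm_weights F lam \<rho> W n z w \<longleftrightarrow>
    is_arg_min
      (\<lambda>w'. (ipm F (weighted_empirical n w' z) (empirical_target n z))\<^sup>2
             + lam * weight_regularizer n \<rho> w')
      (feasible_weights n W) w"

definition well_specified ::
  "('z::topological_space) set \<Rightarrow> 'z measure \<Rightarrow> 'z measure \<Rightarrow> ('z \<Rightarrow> real) set \<Rightarrow> real \<Rightarrow>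
    (real \<Rightarrow> real) \<Rightarrow> bool" where
  "well_specified Z P Q F W \<rho> \<longleftrightarrow>
    (\<exists>K H ip. continuous_kernel_rkhs Z K H ip \<and> finite_dimensional_class H \<and>
      F = rkhs_unit_ball Z H ip \<and>
      (\<exists>c. \<exists>f\<in>H. AE z in P. RN_deriv P Q z = ennreal (deriv (legendre W \<rho>) (c + f z))))"

section \<open>Risk\<close>

definition dose_risk :: "'a measure \<Rightarrow> ('a \<Rightarrow> real) \<Rightarrow> ('a \<Rightarrow> real) \<Rightarrow> ennreal" where
  "dose_risk P \<mu> g = (\<integral>\<^sup>+t. ennreal ((\<mu> t - g t)\<^sup>2) \<partial>P)"

end

theory Submission
  imports Defs
begin

text \<open>The weighted empirical risk of \<open>g\<close> relative to a fixed \<open>g0\<close> is a weighted mean of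
  \<open>(g - g0)\<^sup>2 + 2 (g0 - \<tau>) (g - g0)\<close> minus twice a weighted mean of the noise \<open>Y - \<tau>(T, X)\<close> times \<open>g - g0\<close>.
  Given treatments and covariates the weights are deterministic, so the noise term is a multiplier
  process, controlled uniformly by the Rademacher complexity through contraction. Normalised density
  ratios are nearly feasible weights that balance every equicontinuous class, and optimality passes
  this on to the CBDM weights over \<open>F\<close>; in case (a) the remaining loss is a limit of combinations of
  elements of \<open>F\<close>. In case (b), comparison with weights that balance the finite-dimensional space up to
  \<open>O(1/n)\<close> shows that the optimal weights converge in mean to the density ratio, and a uniform law of
  large numbers for the ratio-weighted loss applies. Ignorability and path regularity identify
  \<open>\<mu>(t)\<close> with the \<open>P\<^sub>X\<close>-mean of \<open>\<tau>(t, \<cdot>)\<close>, which turns the limit into a difference of risks.\<close>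

section \<open>Sign averages and contraction\<close>

text \<open>Boundedness of \<open>G\<close> concerns differences only, so g and its loss may be
  unbounded; hence every estimate is for the excess over a base point \<open>g0\<close> of finite
  risk, and infinite risk throughout \<open>G\<close> is settled separately. The Rademacher
  complexity tends to zero without a rate: the noise is bounded exponentially on the event that the
  complexity is already small, and the uniform law of large numbers is read off from independent
  blocks of fixed length. Each weight depends on all treatments and covariates, so the weighted
  summands are not independent; only the conditional centring of each noise factor survives, and it
  suffices to exchange noise for signs inside an exponential moment. In case (b) the penalty is
  itself of order 1/n, and normalised density ratios typically have squared imbalance of that same
  order, so comparison with them would say nothing about the penalty of the optimum. A comparator
  with imbalance O(1/n) has squared imbalance O(1/n^2), and after multiplication by n only the two
  penalties are compared.\<close>

definition sign_cube :: "nat => (nat => real) set" where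
 "sign_cube n = {..<n} \<rightarrow>\<^sub>E {-1, 1}"

text \<open>A finite sum rather than an expectation over \<open>pmf_of_set\<close>: linearity needs
  no integrability, and induction can split off one sign at a time through
  \<open>cube_avg_Suc\<close>. The two agree by \<open>rademacher_complexity_cube\<close>.\<close>

definition cube_avg :: "nat => ((nat => real) => real) => real" where
 "cube_avg n f = (\<Sum>\<xi>\<in>sign_cube n. f \<xi>) / 2 ^ n"

lemma finite_sign_cube [simp]: "finite (sign_cube n)"
 unfolding sign_cube_def by (intro finite_PiE) auto

lemma card_sign_cube: "card (sign_cube n) = 2 ^ n"
 unfolding sign_cube_def by (simp add: card_PiE numeral_2_eq_2)

lemma sign_cube_0: "sign_cube 0 = {\<lambda>_. undefined}"
 unfolding sign_cube_def by simp

lemma sign_cube_Suc: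
 "sign_cube (Suc n) = (\<lambda>\<xi>. \<xi>(n := 1)) ` sign_cube n \<union> (\<lambda>\<xi>. \<xi>(n := -1)) ` sign_cube n"
 unfolding sign_cube_def lessThan_Suc PiE_insert_eq by auto

lemma sum_sign_cube_Suc:
 "(\<Sum>\<xi>\<in>sign_cube (Suc n). f \<xi>) = (\<Sum>\<xi>\<in>sign_cube n. f (\<xi>(n := 1)) + f (\<xi>(n := -1)))"
proof -
 \<comment> \<open>Extensionality: members of \<open>sign_cube n\<close> are
   \<open>undefined\<close> at n, so overwriting that coordinate forgets nothing.\<close>
 have inj: "inj_on (\<lambda>\<xi>. \<xi>(n := c)) (sign_cube n)" for c :: real
 proof (rule inj_onI)
  fix x y :: "nat => real" assume "x \<in> sign_cube n" "y \<in> sign_cube n" "x(n := c) = y(n := c)"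
  moreover have "x n = undefined" "y n = undefined"
   using calculation(1,2) unfolding sign_cube_def by (auto simp: PiE_def extensional_def)
  ultimately show "x = y" by (metis fun_upd_triv fun_upd_upd)
 qed
 have disj: "(\<lambda>\<xi>. \<xi>(n := 1)) ` sign_cube n \<inter> (\<lambda>\<xi>. \<xi>(n := -1)) ` sign_cube n = {}"
 proof -
  have "x(n := 1) ~= y(n := -1)" for x y :: "nat => real"
   by (metis fun_upd_same one_neq_neg_one)
  then show ?thesis by blast
 qed
 show ?thesis
  unfolding sign_cube_Suc using inj disj
  by (subst sum.union_disjoint) (auto simp: sum.reindex sum.distrib)
qed

lemma cube_avg_0: "cube_avg 0 f = f (\<lambda>_. undefined)"
 unfolding cube_avg_def sign_cube_0 by simp

lemma cube_avg_Suc: "cube_avg (Suc n) f = cube_avg n (\<lambda>\<xi>. (f (\<xi>(n := 1)) + f (\<xi>(n := -1))) / 2)"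
 unfolding cube_avg_def sum_sign_cube_Suc by (simp add: sum_divide_distrib[symmetric])

lemma cube_avg_mono: "(\<And>\<xi>. \<xi> \<in> sign_cube n ==> f \<xi> <= g \<xi>) ==> cube_avg n f <= cube_avg n g"
 unfolding cube_avg_def by (intro divide_right_mono sum_mono) auto

lemma cube_avg_cong: "(\<And>\<xi>. \<xi> \<in> sign_cube n ==> f \<xi> = g \<xi>) ==> cube_avg n f = cube_avg n g"
 unfolding cube_avg_def by simp

lemma cube_avg_add: "cube_avg n (\<lambda>\<xi>. f \<xi> + g \<xi>) = cube_avg n f + cube_avg n g"
 unfolding cube_avg_def by (simp add: sum.distrib add_divide_distrib)

lemma cube_avg_cmult: "cube_avg n (\<lambda>\<xi>. c * f \<xi>) = c * cube_avg n f"
 unfolding cube_avg_def by (simp add: sum_distrib_left[symmetric])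

lemma cube_avg_const: "cube_avg n (\<lambda>\<xi>. c) = c"
 unfolding cube_avg_def by (simp add: card_sign_cube)

lemma cube_avg_abs_le:
 assumes "\<And>\<xi>. \<xi> \<in> sign_cube n ==> \<bar>f \<xi>\<bar> <= c" shows "\<bar>cube_avg n f\<bar> <= c"
proof -
 have "cube_avg n f <= cube_avg n (\<lambda>_. c)" "cube_avg n (\<lambda>_. -c) <= cube_avg n f"
  using assms by (auto intro!: cube_avg_mono simp: abs_le_iff minus_le_iff)
 then show ?thesis by (simp add: cube_avg_const)
qed

lemma sign_cube_vals: "\<xi> \<in> sign_cube n ==> i < n ==> \<xi> i = 1 \<or> \<xi> i = -1"
 unfolding sign_cube_def by (auto simp: PiE_def Pi_def)

lemma sign_cube_abs: "\<xi> \<in> sign_cube n ==> i < n ==> \<bar>\<xi> i\<bar> = 1"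
 using sign_cube_vals by fastforce

lemma rademacher_complexity_cube:
 "rademacher_complexity n G t = 2 / real n * cube_avg n (\<lambda>\<xi>. SUP g\<in>G. \<Sum>i<n. \<xi> i * g (t i))"
proof -
 have ne: "sign_cube n ~= {}" using card_sign_cube[of n] by (metis card.empty power_not_zero zero_neq_numeral)
 have "measure_pmf.expectation (pmf_of_set (sign_cube n)) f = cube_avg n f" for f
  using ne by (subst integral_pmf_of_set) (auto simp: cube_avg_def card_sign_cube)
 then show ?thesis
  unfolding rademacher_complexity_def sign_cube_def by simp
qed

lemma cube_avg_coordinate: "cube_avg n (\<lambda>\<xi>. \<Sum>i<n. \<xi> i * a i) = 0"
proof (induction n)
 case 0 then show ?case by (simp add: cube_avg_0)
next
 case (Suc n)
 have "cube_avg (Suc n) (\<lambda>\<xi>. \<Sum>i<Suc n. \<xi> i * a i) = cube_avg n (\<lambda>\<xi>. \<Sum>i<n. \<xi> i * a i)"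
  unfolding cube_avg_Suc by (intro cube_avg_cong) simp
 with Suc show ?case by simp
qed

text \<open>Hoeffding's lemma for a fair two-point law: \<open>Hoeffdings_lemma_aux\<close> at
  probability 1/2 with h the distance of the points, exponentiated and multiplied by
  \<open>exp x\<close>. For x = h and y = -h it is the familiar bound of cosh h by
  exp(h^2/2).\<close>

lemma cosh_le_exp_half_square:
 fixes x y :: real
 shows "(exp x + exp y) / 2 <= exp ((x + y) / 2 + (x - y)\<^sup>2 / 8)"
proof -
 have *: "ln (1 + (1/2) * (exp h - 1)) - h * (1/2) <= h\<^sup>2 / 8" if "h >= 0" for h :: real
  using Hoeffdings_lemma_aux[of h "1/2"] that by (simp add: algebra_simps)
 have main: "(exp x + exp y) / 2 <= exp ((x + y) / 2 + (x - y)\<^sup>2 / 8)" if "x <= y" for x y :: real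
 proof -
  have "ln (1 + (1/2) * (exp (y - x) - 1)) <= (y-x)\<^sup>2/8 + (y-x)/2"
   using *[of "y - x"] that by linarith
  moreover have "0 < 1 + (1/2) * (exp (y - x) - 1)" 
   by (simp add: field_simps add_pos_pos)
  ultimately have "1 + (1/2) * (exp (y - x) - 1) <= exp ((y-x)\<^sup>2/8 + (y-x)/2)"
   by (metis exp_le_cancel_iff exp_ln)
  then have "exp x * (1 + (1/2) * (exp (y - x) - 1)) <= exp x * exp ((y-x)\<^sup>2/8 + (y-x)/2)"
   by simp
  also have "\<dots> = exp ((x + y) / 2 + (x - y)\<^sup>2 / 8)"
   by (simp add: exp_add[symmetric] power2_commute field_simps)
  also have "exp x * (1 + (1/2) * (exp (y - x) - 1)) = (exp x + exp y) / 2"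
   by (simp add: exp_diff field_simps)
  finally show ?thesis .
 qed
 show ?thesis
  using main[of x y] main[of y x] by (cases "x <= y") (simp_all add: power2_commute add.commute)
qed

text \<open>Only the two endpoints of each coordinate interact, so the moment generating function
 factorises one coordinate at a time.\<close>

lemma cube_avg_exp_le:
 assumes "\<And>\<xi> i. \<xi> \<in> sign_cube n ==> i < n ==> \<bar>f (\<xi>(i := 1)) - f (\<xi>(i := -1))\<bar> <= 2 * b"
 shows "cube_avg n (\<lambda>\<xi>. exp (f \<xi>)) <= exp (cube_avg n f + real n * b\<^sup>2 / 2)"
 using assms
proof (induction n arbitrary: f)
 case 0
 then show ?case by (simp add: cube_avg_0)
next
 case (Suc n)
 \<comment> \<open>Averaging out the last sign keeps the mean,
   \<open>cube_avg n h = cube_avg (Suc n) f\<close>, and keeps the bound on the effect of each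
   remaining flip, so the induction hypothesis applies to \<open>h\<close>.\<close>
 define h where "h \<xi> = (f (\<xi>(n := 1)) + f (\<xi>(n := -1))) / 2" for \<xi>
 have ext: "\<xi>(n := c) \<in> sign_cube (Suc n)" if "\<xi> \<in> sign_cube n" "c = 1 \<or> c = -1" for \<xi> c
  using that unfolding sign_cube_Suc by auto
 have flip: "\<bar>h (\<xi>(i := 1)) - h (\<xi>(i := -1))\<bar> <= 2 * b" if "\<xi> \<in> sign_cube n" "i < n" for \<xi> i
 proof -
  have "\<bar>f ((\<xi>(n := c))(i := 1)) - f ((\<xi>(n := c))(i := -1))\<bar> <= 2 * b" if "c = 1 \<or> c = -1" for c
   by (rule Suc.prems[OF ext[OF \<open>\<xi> \<in> sign_cube n\<close> that]]) (use \<open>i < n\<close> in simp)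
  from this[of 1] this[of "-1"]
  have "\<bar>f ((\<xi>(n := 1))(i := 1)) - f ((\<xi>(n := 1))(i := -1))\<bar> <= 2 * b"
   "\<bar>f ((\<xi>(n := -1))(i := 1)) - f ((\<xi>(n := -1))(i := -1))\<bar> <= 2 * b" by auto
  moreover have "(\<xi>(i := d))(n := c) = (\<xi>(n := c))(i := d)" for c d
   using \<open>i < n\<close> by auto
  moreover have "\<bar>(p + q) / 2 - (r + s) / 2\<bar> <= 2 * b" if "\<bar>p - r\<bar> <= 2 * b" "\<bar>q - s\<bar> <= 2 * b" for p q r s
   using that by (auto simp: abs_le_iff field_simps)
  ultimately show ?thesis
   unfolding h_def by simp
 qed
 have "cube_avg (Suc n) (\<lambda>\<xi>. exp (f \<xi>)) <= cube_avg n (\<lambda>\<xi>. exp (b\<^sup>2 / 2) * exp (h \<xi>))"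
  unfolding cube_avg_Suc
 proof (rule cube_avg_mono)
  fix \<xi> assume \<xi>: "\<xi> \<in> sign_cube n"
  have "\<bar>f (\<xi>(n := 1)) - f (\<xi>(n := -1))\<bar> <= 2 * b"
   using Suc.prems[OF ext[OF \<xi>, of 1] lessI] by (simp only: fun_upd_upd simp_thms)
  then have "(f (\<xi>(n := 1)) - f (\<xi>(n := -1)))\<^sup>2 <= (2 * b)\<^sup>2"
   using abs_le_square_iff[of "f (\<xi>(n := 1)) - f (\<xi>(n := -1))" "2 * b"] by auto
  then have "exp (h \<xi> + (f (\<xi>(n := 1)) - f (\<xi>(n := -1)))\<^sup>2 / 8) <= exp (b\<^sup>2 / 2) * exp (h \<xi>)"
   by (simp add: power_mult_distrib exp_add[symmetric])
  with cosh_le_exp_half_square[of "f (\<xi>(n := 1))" "f (\<xi>(n := -1))"]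
  show "(exp (f (\<xi>(n := 1))) + exp (f (\<xi>(n := -1)))) / 2 <= exp (b\<^sup>2 / 2) * exp (h \<xi>)"
   unfolding h_def by (rule order_trans)
 qed
 also have "\<dots> <= exp (b\<^sup>2 / 2) * exp (cube_avg n h + real n * b\<^sup>2 / 2)"
  unfolding cube_avg_cmult by (intro mult_left_mono Suc.IH flip) auto
 also have "\<dots> = exp (cube_avg (Suc n) f + real (Suc n) * b\<^sup>2 / 2)"
 proof -
  have "cube_avg (Suc n) f = cube_avg n h"
   unfolding cube_avg_Suc h_def ..
  then show ?thesis by (simp add: exp_add[symmetric] algebra_simps add_divide_distrib)
 qed
 finally show ?case .
qed

section \<open>Contraction and extreme signs for suprema\<close>

lemma bdd_above_cmult_add:
 fixes f g :: "'k => real"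
 assumes "bounded (range f)" "bounded (range g)"
 shows "bounded (range (\<lambda>k. f k + c * g k))"
proof -
 have "bounded (range (\<lambda>k. c * g k))"
  using bounded_scaling[OF assms(2), of c] by (simp add: image_image)
 then show ?thesis using assms(1) by (intro bounded_plus_comp)
qed

lemma bounded_cmult_comp:
 fixes f :: "'k => real"
 assumes "bounded (range f)" shows "bounded (range (\<lambda>k. c * f k))"
 using bounded_scaling[OF assms, of c] by (simp add: image_image)

lemma bounded_sum_comp:
 fixes f :: "'i => 'k => real"
 assumes "\<And>i. i \<in> I ==> bounded (range (f i))"
 shows "bounded (range (\<lambda>k. \<Sum>i\<in>I. f i k))"
 using assms by (induction I rule: infinite_finite_induct) (auto intro!: bounded_plus_comp)

text \<open>For fixed k and l the increment \<open>a k - a l\<close> is at most the modulus of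
  \<open>b k - b l\<close>, which is \<open>b k - b l\<close> or \<open>b l - b k\<close>: one of
  the two indices goes into the supremum with plus, the other into the one with minus. The resulting
  bound is free of k and l, so suprema over both may be taken in turn.\<close>

lemma contraction_step:
 fixes p q a b :: "'k => real"
 assumes bd: "bounded (range p)" "bounded (range a)" "bounded (range b)"
  and lip: "\<And>k l. \<bar>a k - a l\<bar> <= \<bar>b k - b l\<bar>"
 shows "(SUP k. p k + a k) + (SUP k. p k - a k) <= (SUP k. p k + b k) + (SUP k. p k - b k)"
proof -
 let ?R = "(SUP k. p k + b k) + (SUP k. p k - b k)"
 have bb: "bdd_above (range (\<lambda>k. p k + b k))" "bdd_above (range (\<lambda>k. p k - b k))"
  using bdd_above_cmult_add[OF bd(1,3), of 1] bdd_above_cmult_add[OF bd(1,3), of "-1"]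
  by (auto intro: bounded_imp_bdd_above)
 have *: "(p k + a k) + (p l - a l) <= ?R" for k l
 proof -
  have up: "p k + b k <= (SUP k. p k + b k)" "p k - b k <= (SUP k. p k - b k)" for k
   using bb by (auto intro!: cSUP_upper)
  show ?thesis
   using up(1)[of k] up(2)[of l] up(1)[of l] up(2)[of k] lip[of k l] by (auto simp: abs_if split: if_splits)
 qed
 have "(SUP k. p k + a k) <= ?R - (p l - a l)" for l
  using *[of _ l] by (intro cSUP_least) (auto simp: algebra_simps)
 then have "(SUP k. p k - a k) <= ?R - (SUP k. p k + a k)"
  by (intro cSUP_least) (auto simp: algebra_simps)
 then show ?thesis by simp
qed

text \<open>The Ledoux--Talagrand contraction principle.\<close>

lemma rademacher_contraction:
 fixes a b :: "'k => nat => real" and \<psi> :: "'k => real"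
 assumes "bounded (range \<psi>)"
  and "\<And>i. i < n ==> bounded (range (\<lambda>k. a k i))" "\<And>i. i < n ==> bounded (range (\<lambda>k. b k i))"
  and "\<And>i k l. i < n ==> \<bar>a k i - a l i\<bar> <= \<bar>b k i - b l i\<bar>"
 shows "cube_avg n (\<lambda>\<xi>. SUP k. \<psi> k + (\<Sum>i<n. \<xi> i * a k i))
  <= cube_avg n (\<lambda>\<xi>. SUP k. \<psi> k + (\<Sum>i<n. \<xi> i * b k i))"
 using assms
proof (induction n arbitrary: \<psi>)
 case 0
 then show ?case by (simp add: cube_avg_0)
next
 case (Suc n)
 \<comment> \<open>The offset \<psi> absorbs the sign just fixed. The induction hypothesis exchanges
   \<open>a\<close> for \<open>b\<close> in the first n coordinates with \<open>a k n\<close> frozen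
   in the offset; \<open>contraction_step\<close> then exchanges the last coordinate.\<close>
 have bp: "bounded (range (\<lambda>k. \<psi> k + c * a k n))" for c
  using Suc.prems by (intro bdd_above_cmult_add) auto
 have IH: "cube_avg n (\<lambda>\<xi>. SUP k. (\<psi> k + c * a k n) + (\<Sum>i<n. \<xi> i * a k i))
  <= cube_avg n (\<lambda>\<xi>. SUP k. (\<psi> k + c * a k n) + (\<Sum>i<n. \<xi> i * b k i))" for c
  using Suc.prems bp by (intro Suc.IH) auto
 have ext: "(SUP k. \<psi> k + (\<Sum>i<Suc n. (\<xi>(n := c)) i * d k i))
   = (SUP k. (\<psi> k + c * d k n) + (\<Sum>i<n. \<xi> i * d k i))" for \<xi> c and d :: "'k => nat => real"
  by (intro SUP_cong) (auto simp: algebra_simps)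
 have "cube_avg (Suc n) (\<lambda>\<xi>. SUP k. \<psi> k + (\<Sum>i<Suc n. \<xi> i * a k i))
  = (cube_avg n (\<lambda>\<xi>. SUP k. (\<psi> k + 1 * a k n) + (\<Sum>i<n. \<xi> i * a k i))
   + cube_avg n (\<lambda>\<xi>. SUP k. (\<psi> k + (-1) * a k n) + (\<Sum>i<n. \<xi> i * a k i))) / 2"
  unfolding cube_avg_Suc ext by (simp only: cube_avg_def sum_divide_distrib[symmetric] sum.distrib) (simp add: add_divide_distrib)
 also have "\<dots> <= (cube_avg n (\<lambda>\<xi>. SUP k. (\<psi> k + 1 * a k n) + (\<Sum>i<n. \<xi> i * b k i))
   + cube_avg n (\<lambda>\<xi>. SUP k. (\<psi> k + (-1) * a k n) + (\<Sum>i<n. \<xi> i * b k i))) / 2"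
  using IH[of 1] IH[of "-1"] by (intro divide_right_mono add_mono) auto
 also have "\<dots> = cube_avg n (\<lambda>\<xi>. ((SUP k. (\<psi> k + 1 * a k n) + (\<Sum>i<n. \<xi> i * b k i))
   + (SUP k. (\<psi> k + (-1) * a k n) + (\<Sum>i<n. \<xi> i * b k i))) / 2)"
  by (simp only: cube_avg_def sum_divide_distrib[symmetric] sum.distrib) (simp add: add_divide_distrib)
 also have "\<dots> <= cube_avg n (\<lambda>\<xi>. ((SUP k. (\<psi> k + 1 * b k n) + (\<Sum>i<n. \<xi> i * b k i))
   + (SUP k. (\<psi> k + (-1) * b k n) + (\<Sum>i<n. \<xi> i * b k i))) / 2)"
 proof (rule cube_avg_mono)
  fix \<xi> assume "\<xi> \<in> sign_cube n"
  define p where "p k = \<psi> k + (\<Sum>i<n. \<xi> i * b k i)" for k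
  have "bounded (range p)"
   unfolding p_def using Suc.prems(1,3)
   by (intro bounded_plus_comp bounded_sum_comp) (auto intro!: bounded_cmult_comp)
  then have "(SUP k. p k + a k n) + (SUP k. p k - a k n) <= (SUP k. p k + b k n) + (SUP k. p k - b k n)"
   using Suc.prems by (intro contraction_step) auto
  then show "((SUP k. (\<psi> k + 1 * a k n) + (\<Sum>i<n. \<xi> i * b k i))
   + (SUP k. (\<psi> k + (-1) * a k n) + (\<Sum>i<n. \<xi> i * b k i))) / 2
   <= ((SUP k. (\<psi> k + 1 * b k n) + (\<Sum>i<n. \<xi> i * b k i))
   + (SUP k. (\<psi> k + (-1) * b k n) + (\<Sum>i<n. \<xi> i * b k i))) / 2"
   by (simp add: p_def algebra_simps)
 qed
 also have "\<dots> = cube_avg (Suc n) (\<lambda>\<xi>. SUP k. \<psi> k + (\<Sum>i<Suc n. \<xi> i * b k i))"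
  unfolding cube_avg_Suc ext ..
 finally show ?case .
qed

text \<open>Writing \<open>v\<^sub>i\<close> as the mean of a two-point distribution on \<open>{-c, c}\<close>, the right-hand side is the
 mean of the left-hand side over independent such signs; the inequality is Jensen's.\<close>

lemma exp_SUP_le_cube:
 fixes x :: "'k => nat => real" and \<psi> :: "'k => real"
 assumes "bounded (range \<psi>)" "\<And>i. i < n ==> bounded (range (\<lambda>k. x k i))"
  and "c > 0" "\<And>i. i < n ==> \<bar>v i\<bar> <= c"
 shows "exp (SUP k. \<psi> k + (\<Sum>i<n. v i * x k i))
  <= cube_avg n (\<lambda>\<xi>. (\<Prod>i<n. 1 + \<xi> i * v i / c) * exp (SUP k. \<psi> k + (\<Sum>i<n. \<xi> i * c * x k i)))"
 using assms
proof (induction n arbitrary: \<psi>)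
 case 0
 then show ?case by (simp add: cube_avg_0)
next
 case (Suc n)
 define E where "E s = exp (SUP k. (\<psi> k + s * x k n) + (\<Sum>i<n. v i * x k i))" for s
 define p where "p = (1 + v n / c) / 2"
 have p: "0 <= p" "p <= 1" and vn: "v n = p * c + (1 - p) * (- c)"
  using Suc.prems(3) Suc.prems(4)[of n] unfolding p_def by (auto simp: field_simps abs_le_iff)
 have bS: "bounded (range (\<lambda>k. (\<psi> k + s * x k n) + (\<Sum>i<n. v i * x k i)))" for s
  using Suc.prems(1,2)
  by (intro bounded_plus_comp bounded_sum_comp) (auto intro!: bounded_cmult_comp)
 have conv: "E (v n) <= p * E c + (1 - p) * E (- c)"
 proof -
  let ?S = "\<lambda>s. SUP k. (\<psi> k + s * x k n) + (\<Sum>i<n. v i * x k i)"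
  have "?S (v n) <= p * ?S c + (1 - p) * ?S (- c)"
  proof (rule cSUP_least)
   fix k :: 'k
   have up: "(\<psi> k + s * x k n) + (\<Sum>i<n. v i * x k i) <= ?S s" for s
    by (intro cSUP_upper bounded_imp_bdd_above bS) auto
   then have "p * ((\<psi> k + c * x k n) + (\<Sum>i<n. v i * x k i)) + (1 - p) * ((\<psi> k + (- c) * x k n) + (\<Sum>i<n. v i * x k i))
    <= p * ?S c + (1 - p) * ?S (- c)"
    using p by (intro add_mono mult_left_mono up) auto
   moreover have "(\<psi> k + v n * x k n) + (\<Sum>i<n. v i * x k i) = p * ((\<psi> k + c * x k n) + (\<Sum>i<n. v i * x k i)) + (1 - p) * ((\<psi> k + (- c) * x k n) + (\<Sum>i<n. v i * x k i))"
    unfolding vn by (simp add: algebra_simps)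
   ultimately show "(\<psi> k + v n * x k n) + (\<Sum>i<n. v i * x k i) <= p * ?S c + (1 - p) * ?S (- c)" by simp
  qed simp
  then have "E (v n) <= exp ((1 - p) * ?S (- c) + p * ?S c)" unfolding E_def by simp
  also have "\<dots> <= (1 - p) * exp (?S (- c)) + p * exp (?S c)"
   using convex_onD[OF convex_on_exp[of 1], of p "?S (- c)" "?S c"] p by simp
  finally show ?thesis unfolding E_def by simp
 qed
 have IH: "E s <= cube_avg n (\<lambda>\<xi>. (\<Prod>i<n. 1 + \<xi> i * v i / c) * exp (SUP k. (\<psi> k + s * x k n) + (\<Sum>i<n. \<xi> i * c * x k i)))" for s
  unfolding E_def using Suc.prems by (intro Suc.IH bdd_above_cmult_add) auto
 have "exp (SUP k. \<psi> k + (\<Sum>i<Suc n. v i * x k i)) = E (v n)"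
  unfolding E_def by (simp add: algebra_simps)
 also note conv
 also have "p * E c + (1 - p) * E (- c) \<le>
   p * cube_avg n (\<lambda>\<xi>. (\<Prod>i<n. 1 + \<xi> i * v i / c) * exp (SUP k. (\<psi> k + c * x k n) + (\<Sum>i<n. \<xi> i * c * x k i)))
   + (1 - p) * cube_avg n (\<lambda>\<xi>. (\<Prod>i<n. 1 + \<xi> i * v i / c) * exp (SUP k. (\<psi> k + (- c) * x k n) + (\<Sum>i<n. \<xi> i * c * x k i)))"
  using p by (intro add_mono mult_left_mono IH) auto
 also have "\<dots> = cube_avg (Suc n) (\<lambda>\<xi>. (\<Prod>i<Suc n. 1 + \<xi> i * v i / c) * exp (SUP k. \<psi> k + (\<Sum>i<Suc n. \<xi> i * c * x k i)))"
  unfolding cube_avg_Suc cube_avg_cmult[symmetric] cube_avg_add[symmetric]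
 proof (rule cube_avg_cong)
  fix \<xi> assume "\<xi> \<in> sign_cube n"
  have e: "(SUP k. \<psi> k + (\<Sum>i<Suc n. (\<xi>(n := s)) i * c * x k i)) = (SUP k. (\<psi> k + s * c * x k n) + (\<Sum>i<n. \<xi> i * c * x k i))" for s
   by (intro SUP_cong) (auto simp: algebra_simps)
  have f: "(\<Prod>i<Suc n. 1 + (\<xi>(n := s)) i * v i / c) = (\<Prod>i<n. 1 + \<xi> i * v i / c) * (1 + s * v n / c)" for s
   by simp
  \<comment> \<open>The factor \<open>1 + \<xi> n * v n / c\<close> is the density of the two-point
    law with mean \<open>v n\<close> against the fair sign, so its two values are 2p and 2(1 -
    p).\<close>
  have mix: "p * (R * A) + (1 - p) * (R * D) = (R * X * A + R * Y * D) / 2"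
   if "p = X / 2" "1 - p = Y / 2" for R A D X Y
   unfolding that(2) unfolding that(1) by (simp add: algebra_simps)
  have "1 - p = (1 + (-1) * v n / c) / 2" "p = (1 + 1 * v n / c) / 2" unfolding p_def by (auto simp: field_simps)
  from mix[OF this(2,1)] show "p * ((\<Prod>i<n. 1 + \<xi> i * v i / c) * exp (SUP k. (\<psi> k + c * x k n) + (\<Sum>i<n. \<xi> i * c * x k i)))
   + (1 - p) * ((\<Prod>i<n. 1 + \<xi> i * v i / c) * exp (SUP k. (\<psi> k + (- c) * x k n) + (\<Sum>i<n. \<xi> i * c * x k i)))
   = ((\<Prod>i<Suc n. 1 + (\<xi>(n := 1)) i * v i / c) * exp (SUP k. \<psi> k + (\<Sum>i<Suc n. (\<xi>(n := 1)) i * c * x k i))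
   + (\<Prod>i<Suc n. 1 + (\<xi>(n := -1)) i * v i / c) * exp (SUP k. \<psi> k + (\<Sum>i<Suc n. (\<xi>(n := -1)) i * c * x k i))) / 2"
   unfolding e f by simp
 qed
 finally show ?case .
qed

section \<open>Exponential bounds for noise\<close>

text \<open>Half of \<open>rademacher_complexity\<close>, for a sequence of functions: a supremum
  over a countable family stays measurable in the sample, which a supremum over \<open>G\<close>
  need not be.\<close>

definition rademacher_avg :: "(nat => 'z => real) => nat => (nat => 'z) => real" where
 "rademacher_avg u n v = cube_avg n (\<lambda>\<xi>. SUP k. \<Sum>i<n. \<xi> i * u k (v i)) / real n"

lemma borel_measurable_cube_avg [measurable (raw)]:
 "(\<And>\<xi>. \<xi> \<in> sign_cube n ==> (\<lambda>x. f x \<xi>) \<in> borel_measurable M) ==> (\<lambda>x. cube_avg n (f x)) \<in> borel_measurable M"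
 unfolding cube_avg_def by (intro borel_measurable_divide borel_measurable_sum) auto

lemma bounded_rangeI: "(\<And>k. \<bar>f k\<bar> <= c) ==> bounded (range (f :: 'k => real))"
 by (auto simp: bounded_iff)

lemma bdd_above_rangeI: "(\<And>k. \<bar>f k\<bar> <= c) ==> bdd_above (range (f :: 'k => real))"
 by (rule bounded_imp_bdd_above, rule bounded_rangeI) auto

lemma sum_abs_le_card:
 fixes f :: "nat => real" shows "(\<And>i. i < n ==> \<bar>f i\<bar> <= c) ==> \<bar>\<Sum>i<n. f i\<bar> <= real n * c"
 by (rule order_trans[OF sum_abs]) (use sum_bounded_above[of "{..<n}" "\<lambda>i. \<bar>f i\<bar>" c] in simp)

lemma abs_SUP_le:
 fixes f :: "'k => real" assumes "\<And>k. \<bar>f k\<bar> <= c" shows "\<bar>SUP k. f k\<bar> <= c"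
proof (rule cSup_abs_le)
 show "\<And>x. x \<in> range f ==> \<bar>x\<bar> <= c" using assms by auto
qed auto

lemma borel_measurable_SUP_bounded [measurable (raw)]:
 fixes f :: "nat => 'x => real"
 assumes "\<And>k. f k \<in> borel_measurable M" "\<And>k x. x \<in> space M ==> \<bar>f k x\<bar> <= c x"
 shows "(\<lambda>x. SUP k. f k x) \<in> borel_measurable M"
 by (rule borel_measurable_cSUP) (use assms in \<open>auto intro!: bdd_above_rangeI\<close>)

locale bounded_functions =
 fixes u :: "nat => 'z => real" and Nz :: "'z measure" and B :: real
 assumes u_measurable [measurable]: "\<And>k. u k \<in> borel_measurable Nz"
  and u_bounded: "\<And>k z. \<bar>u k z\<bar> <= B"
begin

lemma B_nonneg: "0 <= B" using u_bounded[of undefined undefined] by linarith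

lemma signed_sum_bound: "\<xi> \<in> sign_cube n ==> \<bar>\<Sum>i<n. \<xi> i * u k (v i)\<bar> <= real n * B"
 using u_bounded by (intro sum_abs_le_card) (simp add: abs_mult sign_cube_abs)

lemma rademacher_avg_measurable [measurable]:
 "rademacher_avg u n \<in> borel_measurable (Pi\<^sub>M {..<n} (\<lambda>_. Nz))"
 unfolding rademacher_avg_def
 by (intro borel_measurable_divide borel_measurable_cube_avg borel_measurable_const
   borel_measurable_SUP_bounded[where c = "\<lambda>_. real n * B"] signed_sum_bound) measurable

lemma rademacher_avg_abs_le: "\<bar>rademacher_avg u n v\<bar> <= B"
proof -
 have "\<bar>cube_avg n (\<lambda>\<xi>. SUP k. \<Sum>i<n. \<xi> i * u k (v i))\<bar> <= real n * B"
  by (intro cube_avg_abs_le abs_SUP_le signed_sum_bound)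
 then show ?thesis
  unfolding rademacher_avg_def using B_nonneg by (cases "n = 0") (auto simp: abs_divide field_simps)
qed

lemma cube_avg_sup_le:
 assumes "\<theta> >= 0"
 shows "cube_avg n (\<lambda>\<xi>. SUP k. \<Sum>i<n. \<xi> i * \<theta> * u k (v i)) <= \<theta> * real n * rademacher_avg u n v"
proof -
  have "cube_avg n (\<lambda>\<xi>. SUP k. \<Sum>i<n. \<xi> i * \<theta> * u k (v i)) <= cube_avg n (\<lambda>\<xi>. \<theta> * (SUP k. \<Sum>i<n. \<xi> i * u k (v i)))"
  proof (rule cube_avg_mono)
   fix \<xi> assume \<xi>: "\<xi> \<in> sign_cube n"
   show "(SUP k. \<Sum>i<n. \<xi> i * \<theta> * u k (v i)) <= \<theta> * (SUP k. \<Sum>i<n. \<xi> i * u k (v i))"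
   proof (rule cSUP_least)
    fix k
    have "(\<Sum>i<n. \<xi> i * \<theta> * u k (v i)) = \<theta> * (\<Sum>i<n. \<xi> i * u k (v i))"
     by (simp add: sum_distrib_left algebra_simps)
    also have "\<dots> <= \<theta> * (SUP k. \<Sum>i<n. \<xi> i * u k (v i))"
     by (intro mult_left_mono cSUP_upper bdd_above_rangeI[OF signed_sum_bound[OF \<xi>]] assms) auto
    finally show "(\<Sum>i<n. \<xi> i * \<theta> * u k (v i)) <= \<theta> * (SUP k. \<Sum>i<n. \<xi> i * u k (v i))" .
   qed simp
  qed
  also have "\<dots> = \<theta> * real n * rademacher_avg u n v"
   unfolding cube_avg_cmult rademacher_avg_def by (cases "n = 0") (auto simp: cube_avg_0)
  finally show ?thesis .
qed

text \<open>Flipping one sign moves the supremum by at most \<open>2 * \<theta> * B\<close>, so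
  \<open>cube_avg_exp_le\<close> gives a sub-Gaussian bound around the mean of the supremum, and
  that mean is at most \<theta> n times the Rademacher average.\<close>

lemma cube_avg_exp_sup_le:
 assumes "\<theta> >= 0"
 shows "cube_avg n (\<lambda>\<xi>. exp (SUP k. \<Sum>i<n. \<xi> i * \<theta> * u k (v i)))
  <= exp (\<theta> * real n * rademacher_avg u n v + \<theta>\<^sup>2 * B\<^sup>2 * real n / 2)"
proof -
 define f where "f \<xi> = (SUP k. \<Sum>i<n. \<xi> i * \<theta> * u k (v i))" for \<xi> :: "nat => real"
 have bd: "bdd_above (range (\<lambda>k. \<Sum>i<n. \<xi> i * \<theta> * u k (v i)))" for \<xi> :: "nat => real"
 proof (intro bounded_imp_bdd_above bounded_sum_comp bounded_rangeI)
  show "\<bar>\<xi> i * \<theta> * u k (v i)\<bar> <= \<bar>\<xi> i * \<theta>\<bar> * B" for i k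
   unfolding abs_mult using u_bounded by (intro mult_left_mono) auto
 qed
 have flip_le: "f (\<xi>(i := s)) <= f (\<xi>(i := t)) + 2 * (\<theta> * B)"
  if "i < n" "\<bar>s\<bar> = 1" "\<bar>t\<bar> = 1" for \<xi> i s t
  unfolding f_def
 proof (rule cSUP_least)
  fix k
  have eq: "(\<Sum>j<n. (\<xi>(i := c)) j * \<theta> * u k (v j)) = c * \<theta> * u k (v i) + (\<Sum>j\<in>{..<n}-{i}. \<xi> j * \<theta> * u k (v j))" for c
   using \<open>i < n\<close> by (subst sum.remove[of _ i]) auto
  have "\<bar>(s - t) * \<theta> * u k (v i)\<bar> <= 2 * \<theta> * B"
   unfolding abs_mult using that assms u_bounded by (intro mult_mono) auto
  then have "(\<Sum>j<n. (\<xi>(i := s)) j * \<theta> * u k (v j)) <= (\<Sum>j<n. (\<xi>(i := t)) j * \<theta> * u k (v j)) + 2 * (\<theta> * B)"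
   unfolding eq by (simp only: abs_le_iff left_diff_distrib) (simp add: algebra_simps)
  also have "\<dots> <= (SUP k. \<Sum>j<n. (\<xi>(i := t)) j * \<theta> * u k (v j)) + 2 * (\<theta> * B)"
   by (intro add_right_mono cSUP_upper bd) auto
  finally show "(\<Sum>j<n. (\<xi>(i := s)) j * \<theta> * u k (v j)) <= (SUP k. \<Sum>j<n. (\<xi>(i := t)) j * \<theta> * u k (v j)) + 2 * (\<theta> * B)" .
 qed simp
 have "cube_avg n (\<lambda>\<xi>. exp (f \<xi>)) <= exp (cube_avg n f + real n * (\<theta> * B)\<^sup>2 / 2)"
 proof (rule cube_avg_exp_le)
  fix \<xi> i assume "i < n"
  then show "\<bar>f (\<xi>(i := 1)) - f (\<xi>(i := -1))\<bar> <= 2 * (\<theta> * B)"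
   using flip_le[of i 1 "-1" \<xi>] flip_le[of i "-1" 1 \<xi>] by (simp only: abs_le_iff) auto
 qed
 also have "cube_avg n f <= \<theta> * real n * rademacher_avg u n v"
  unfolding f_def by (rule cube_avg_sup_le[OF assms])
 finally show ?thesis
  unfolding f_def by (simp add: power_mult_distrib algebra_simps)
qed

end

text \<open>Conditionally on the observed coordinates \<open>z\<close> the noise factors have mean one; they are
 integrated out one sample point at a time.\<close>

lemma integral_noise_product:
 fixes L :: "'s measure" and Nz :: "'z measure" and e :: "'s => real" and z :: "'s => 'z"
  and a :: "nat => (nat => 'z) => real" and \<psi> :: "(nat => 'z) => real"
 assumes "prob_space L" and z [measurable]: "z \<in> measurable L Nz"
  and e [measurable]: "e \<in> borel_measurable L" and e_le: "\<And>s. \<bar>e s\<bar> <= c0"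
  and zero: "\<And>h K. h \<in> borel_measurable Nz ==> (\<And>x. \<bar>h x\<bar> <= K) ==> (\<integral>s. h (z s) * e s \<partial>L) = 0"
  and a [measurable]: "\<And>i. i < n ==> a i \<in> borel_measurable (Pi\<^sub>M {..<n} (\<lambda>_. Nz))"
  and a_le: "\<And>i v. \<bar>a i v\<bar> <= A"
  and \<psi> [measurable]: "\<psi> \<in> borel_measurable (Pi\<^sub>M {..<n} (\<lambda>_. Nz))" and \<psi>_le: "\<And>v. \<bar>\<psi> v\<bar> <= K"
  and I: "I \<subseteq> {..<n}"
 shows "(\<integral>v. \<psi> (\<lambda>i\<in>{..<n}. z (v i)) * (\<Prod>i\<in>I. 1 + a i (\<lambda>i\<in>{..<n}. z (v i)) * e (v i)) \<partial>Pi\<^sub>M {..<n} (\<lambda>_. L))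
  = (\<integral>v. \<psi> (\<lambda>i\<in>{..<n}. z (v i)) \<partial>Pi\<^sub>M {..<n} (\<lambda>_. L))"
proof -
 interpret L: prob_space L by fact
 interpret PP: product_prob_space "\<lambda>_::nat. L" by standard
 interpret PP': prob_space "Pi\<^sub>M {..<n} (\<lambda>_. L)" by (rule prob_space_PiM) (rule assms)
 let ?P = "Pi\<^sub>M {..<n} (\<lambda>_. L)"
 let ?z = "\<lambda>v. \<lambda>i\<in>{..<n}. z (v i)"
 have zm [measurable]: "?z \<in> measurable ?P (Pi\<^sub>M {..<n} (\<lambda>_. Nz))" by measurable
 have c0: "0 <= c0" using e_le[of undefined] by linarith
 have A: "0 <= A" using a_le[of undefined undefined] by linarith
 have prod_le: "\<bar>\<Prod>i\<in>J. 1 + a i v * e (x i)\<bar> <= (1 + A * c0) ^ card J" for J v x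
 proof -
  have "\<bar>1 + a i v * e (x i)\<bar> <= 1 + A * c0" for i
   using mult_mono[OF a_le[of i v] e_le[of "x i"]] A by (simp add: abs_mult[symmetric] abs_le_iff)
  then have "(\<Prod>i\<in>J. \<bar>1 + a i v * e (x i)\<bar>) <= (\<Prod>i\<in>J. 1 + A * c0)"
   by (intro prod_mono) auto
  then show ?thesis by (simp add: abs_prod)
 qed
 have fm: "(\<lambda>v. a i (?z v) * e (v i)) \<in> borel_measurable ?P" if "i < n" for i
 proof -
  have "(\<lambda>v. v i) \<in> measurable ?P L" using that by (intro measurable_component_singleton) simp
  from measurable_compose[OF this e] measurable_compose[OF zm a[OF that]]
  show ?thesis by (intro borel_measurable_times)
 qed
 show ?thesis
  using finite_subset[OF I finite_lessThan] I
 proof (induction I rule: finite_induct)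
  case empty then show ?case by simp
 next
  case (insert j I)
  then have j: "j < n" and In: "I \<subseteq> {..<n}" by auto
  have K: "0 <= K" using \<psi>_le[of undefined] by linarith
  define f where "f v = \<psi> (?z v) * (\<Prod>i\<in>I. 1 + a i (?z v) * e (v i)) * a j (?z v) * e (v j)" for v
  have prodm [measurable]: "(\<lambda>v. \<Prod>i\<in>I. 1 + a i (?z v) * e (v i)) \<in> borel_measurable ?P"
   using In by (intro borel_measurable_prod borel_measurable_add fm) auto
  have am [measurable]: "(\<lambda>v. a j (?z v) * e (v j)) \<in> borel_measurable ?P" using fm[OF j] .
  have fint: "integrable ?P f"
  proof (rule PP'.integrable_const_bound[where B = "K * (1 + A * c0) ^ card I * (A * c0)"])
   have "\<bar>f v\<bar> <= K * (1 + A * c0) ^ card I * (A * c0)" for v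
    unfolding f_def mult.assoc[of _ "a j (?z v)"] abs_mult
    using prod_le \<psi>_le a_le e_le K A c0 by (intro mult_mono mult_nonneg_nonneg) auto
   then show "AE v in ?P. norm (f v) <= K * (1 + A * c0) ^ card I * (A * c0)" by simp
   show "f \<in> borel_measurable ?P" unfolding f_def mult.assoc[of _ "a j _"] by measurable
  qed
  have gint: "integrable ?P (\<lambda>v. \<psi> (?z v) * (\<Prod>i\<in>I. 1 + a i (?z v) * e (v i)))"
  proof (rule PP'.integrable_const_bound[where B = "K * (1 + A * c0) ^ card I"])
   have "\<bar>\<psi> (?z v) * (\<Prod>i\<in>I. 1 + a i (?z v) * e (v i))\<bar> <= K * (1 + A * c0) ^ card I" for v
    unfolding abs_mult using prod_le \<psi>_le K A c0 by (intro mult_mono mult_nonneg_nonneg) auto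
   then show "AE v in ?P. norm (\<psi> (?z v) * (\<Prod>i\<in>I. 1 + a i (?z v) * e (v i))) <= K * (1 + A * c0) ^ card I" by simp
  qed measurable
  define J where "J = {..<n} - {j}"
  have J: "insert j J = {..<n}" "finite J" "j \<notin> J" using j unfolding J_def by auto
  have "integral\<^sup>L ?P f = (\<integral>x. (\<integral>y. f (x(j := y)) \<partial>L) \<partial>Pi\<^sub>M J (\<lambda>_. L))"
   using PP.product_integral_insert[OF J(2,3), of f] fint unfolding J(1) by simp
  also have "\<dots> = (\<integral>x. 0 \<partial>Pi\<^sub>M J (\<lambda>_. L))"
  proof (rule Bochner_Integration.integral_cong[OF refl])
   fix x assume x: "x \<in> space (Pi\<^sub>M J (\<lambda>_. L))"
   \<comment> \<open>All sample points but j are frozen. Since j is not in I, the factor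
     \<open>e\<close> of point j occurs once, and everything else sees point j only through
     \<open>z\<close>; the assumption \<open>zero\<close> then annihilates the inner
     integral.\<close>
   define Xz where "Xz \<zeta> = (\<lambda>i\<in>{..<n}. if i = j then \<zeta> else z (x i))" for \<zeta>
   have xi: "x i \<in> space L" if "i < n" "i ~= j" for i
    using x that unfolding J_def by (auto simp: space_PiM)
   have [measurable]: "Xz \<in> measurable Nz (Pi\<^sub>M {..<n} (\<lambda>_. Nz))"
    unfolding Xz_def
   proof (rule measurable_restrict)
    fix i assume "i \<in> {..<n}"
    then show "(\<lambda>\<zeta>. if i = j then \<zeta> else z (x i)) \<in> measurable Nz Nz"
     using measurable_space[OF z xi] by (cases "i = j") auto
   qed
   define h where "h \<zeta> = \<psi> (Xz \<zeta>) * (\<Prod>i\<in>I. 1 + a i (Xz \<zeta>) * e (x i)) * a j (Xz \<zeta>)" for \<zeta>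
   have ai: "(\<lambda>\<zeta>. a i (Xz \<zeta>)) \<in> borel_measurable Nz" if "i < n" for i
    using a[OF that] by measurable
   have hm: "h \<in> borel_measurable Nz"
    unfolding h_def using In j
    by (intro borel_measurable_times borel_measurable_prod borel_measurable_add ai) auto
   have hb: "\<bar>h \<zeta>\<bar> <= K * (1 + A * c0) ^ card I * A" for \<zeta>
    unfolding h_def abs_mult using prod_le \<psi>_le a_le K A c0 by (intro mult_mono mult_nonneg_nonneg) auto
   have "f (x(j := y)) = h (z y) * e y" for y
   proof -
    have "?z (x(j := y)) = Xz (z y)" unfolding Xz_def by (auto simp: restrict_def)
    moreover have "(\<Prod>i\<in>I. 1 + a i v * e ((x(j := y)) i)) = (\<Prod>i\<in>I. 1 + a i v * e (x i))" for v
     using insert.hyps by (intro prod.cong) auto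
    ultimately show ?thesis unfolding f_def h_def by (simp only: fun_upd_same)
   qed
   then show "(\<integral>y. f (x(j := y)) \<partial>L) = 0" using zero[OF hm hb] by simp
  qed
  finally have "integral\<^sup>L ?P f = 0" by simp
  moreover have "\<psi> (?z v) * (\<Prod>i\<in>insert j I. 1 + a i (?z v) * e (v i))
   = \<psi> (?z v) * (\<Prod>i\<in>I. 1 + a i (?z v) * e (v i)) + f v" for v
   unfolding f_def using insert.hyps by (simp add: algebra_simps)
  ultimately show ?case
   using insert.IH[OF In] Bochner_Integration.integral_add[OF gint fint] by (simp only: add_0_right)
 qed
qed

text \<open>\<open>centred\<close> is the statement E[e | z] = 0 tested against bounded functions of
  \<open>z\<close>, in the form in which \<open>integral_noise_product\<close> uses it one sample
  point at a time. The strict signs of \<open>c0\<close> and \<open>B\<close> allow division by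
  them.\<close>

locale noise_model = bounded_functions u Nz B + L: prob_space L
 for u :: "nat => 'z => real" and Nz :: "'z measure" and B :: real and L :: "'s measure" +
 fixes z :: "'s => 'z" and e :: "'s => real" and c0 :: real
 assumes z [measurable]: "z \<in> measurable L Nz"
  and e [measurable]: "e \<in> borel_measurable L" and e_le: "\<And>s. \<bar>e s\<bar> <= c0"
  and centred: "\<And>h K. h \<in> borel_measurable Nz ==> (\<And>x. \<bar>h x\<bar> <= K) ==> (\<integral>s. h (z s) * e s \<partial>L) = 0"
  and c0_pos: "0 < c0" and B_pos: "0 < B"
begin

text \<open>Chernoff's method. The event that the Rademacher average is at most \<delta> depends on
  \<open>zs\<close> alone, so its indicator passes through the integration of the noise.
  \<open>exp_SUP_le_cube\<close> and \<open>integral_noise_product\<close> replace the noise by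
  signs of size \<open>A * c0\<close>, whose supremum has mean at most
  \<open>A * c0 * \<delta> * n\<close> on the event; the threshold is twice that.\<close>

lemma noise_tail_bound:
 fixes a :: "nat => (nat => 'z) => real"
 assumes a [measurable]: "\<And>i. i < n ==> a i \<in> borel_measurable (Pi\<^sub>M {..<n} (\<lambda>_. Nz))"
  and a_le: "\<And>i v. \<bar>a i v\<bar> <= A" and A_pos: "0 < A" and "0 < \<delta>"
 defines "zs \<equiv> \<lambda>v. \<lambda>i\<in>{..<n}. z (v i)"
 shows "measure (Pi\<^sub>M {..<n} (\<lambda>_. L)) {v \<in> space (Pi\<^sub>M {..<n} (\<lambda>_. L)). rademacher_avg u n (zs v) <= \<delta> \<and>
   (\<exists>k. (\<Sum>i<n. a i (zs v) * e (v i) * u k (z (v i))) >= 2 * (A * c0) * \<delta> * real n)}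
  <= exp (- (\<delta>\<^sup>2 / (2 * B\<^sup>2)) * real n)"
proof -
 let ?P = "Pi\<^sub>M {..<n} (\<lambda>_. L)"
 interpret PP': prob_space ?P by (rule prob_space_PiM) (rule L.prob_space_axioms)
 have zm [measurable]: "zs \<in> measurable ?P (Pi\<^sub>M {..<n} (\<lambda>_. Nz))" unfolding zs_def by measurable
 define c where "c = A * c0"
 have c: "c > 0" unfolding c_def using A_pos c0_pos by simp
 \<comment> \<open>Minimiser of the final exponent, the quadratic \<open>(c * \<theta>)\<^sup>2 *
   B\<^sup>2 * n / 2 - c * \<theta> * \<delta> * n\<close>, whose minimum is
   \<open>- \<delta>\<^sup>2 * n / (2 * B\<^sup>2)\<close>.\<close>
 define \<theta> where "\<theta> = \<delta> / (c * B\<^sup>2)"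
 have \<theta>: "\<theta> > 0" unfolding \<theta>_def using c B_pos \<open>0 < \<delta>\<close> by simp
 define E where "E v = (if rademacher_avg u n v <= \<delta> then 1 else 0 :: real)" for v
 have E [measurable]: "E \<in> borel_measurable (Pi\<^sub>M {..<n} (\<lambda>_. Nz))" unfolding E_def by measurable
 define \<Phi> where "\<Phi> v = (SUP k. \<Sum>i<n. a i (zs v) * e (v i) * (\<theta> * u k (z (v i))))" for v
 define g where "g \<xi> \<zeta> = (SUP k. \<Sum>i<n. \<xi> i * c * (\<theta> * u k (\<zeta> i)))" for \<xi> :: "nat => real" and \<zeta>
 have ae_le: "\<bar>a i (zs v) * e (v i)\<bar> <= c" for i v
  unfolding c_def abs_mult using a_le e_le A_pos c0_pos by (intro mult_mono) auto
 have u\<theta>: "\<bar>\<theta> * u k x\<bar> <= \<theta> * B" for k x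
  using \<theta> u_bounded by (simp add: abs_mult)
 have term_le: "\<bar>\<Sum>i<n. a i (zs v) * e (v i) * (\<theta> * u k (z (v i)))\<bar> <= real n * (c * (\<theta> * B))" for k v
  unfolding abs_mult[of "a _ _ * e _"] 
  by (rule sum_abs_le_card, unfold abs_mult[of "a _ _ * e _"], rule mult_mono[OF ae_le u\<theta>]) (use c in auto)
 have g_le: "\<bar>g \<xi> \<zeta>\<bar> <= real n * (c * (\<theta> * B))" if "\<xi> \<in> sign_cube n" for \<xi> \<zeta>
  unfolding g_def
 proof (intro abs_SUP_le sum_abs_le_card)
  fix k i assume "i < n"
  then have "\<bar>\<xi> i * c\<bar> = c" using c sign_cube_abs[OF that] by (simp add: abs_mult)
  then show "\<bar>\<xi> i * c * (\<theta> * u k (\<zeta> i))\<bar> <= c * (\<theta> * B)"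
   unfolding abs_mult[of "\<xi> i * c"] using c u\<theta> by simp
 qed
 have gm [measurable]: "g \<xi> \<in> borel_measurable (Pi\<^sub>M {..<n} (\<lambda>_. Nz))" if "\<xi> \<in> sign_cube n" for \<xi>
  unfolding g_def
 proof (rule borel_measurable_SUP_bounded[where c = "\<lambda>_. real n * (c * (\<theta> * B))"])
  fix k \<zeta>
  show "\<bar>\<Sum>i<n. \<xi> i * c * (\<theta> * u k (\<zeta> i))\<bar> <= real n * (c * (\<theta> * B))"
  proof (rule sum_abs_le_card)
   fix i assume "i < n"
   then have "\<bar>\<xi> i * c\<bar> = c" using c sign_cube_abs[OF that] by (simp add: abs_mult)
   then show "\<bar>\<xi> i * c * (\<theta> * u k (\<zeta> i))\<bar> <= c * (\<theta> * B)"
    unfolding abs_mult[of "\<xi> i * c"] using c u\<theta> by simp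
  qed
 qed measurable
 have am: "(\<lambda>v. a i (zs v)) \<in> borel_measurable ?P" if "i < n" for i
  using a[OF that] by measurable
 have \<Phi>m [measurable]: "\<Phi> \<in> borel_measurable ?P"
  unfolding \<Phi>_def
 proof (rule borel_measurable_SUP_bounded[OF _ term_le])
  fix k show "(\<lambda>v. \<Sum>i<n. a i (zs v) * e (v i) * (\<theta> * u k (z (v i)))) \<in> borel_measurable ?P"
   by (intro borel_measurable_sum borel_measurable_times am) auto
 qed
 have Ezm [measurable]: "(\<lambda>v. E (zs v)) \<in> borel_measurable ?P" by measurable
 have E01: "0 <= E v" "E v <= 1" for v unfolding E_def by auto
 have \<Phi>_le: "\<bar>\<Phi> v\<bar> <= real n * (c * (\<theta> * B))" for v
  unfolding \<Phi>_def by (rule abs_SUP_le[OF term_le])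
 have int\<Phi>: "integrable ?P (\<lambda>v. E (zs v) * exp (\<Phi> v))"
 proof (rule PP'.integrable_const_bound[where B = "1 * exp (real n * (c * (\<theta> * B)))"])
  have "\<bar>E (zs v) * exp (\<Phi> v)\<bar> <= 1 * exp (real n * (c * (\<theta> * B)))" for v
   unfolding abs_mult using E01 \<Phi>_le by (intro mult_mono) (auto simp: abs_le_iff)
  then show "AE v in ?P. norm (E (zs v) * exp (\<Phi> v)) <= 1 * exp (real n * (c * (\<theta> * B)))" by simp
 qed measurable
 \<comment> \<open>For fixed signs the product consists of factors one plus centred noise times a
   function of \<open>zs v\<close>. Integration replaces it by 1, so the two-point densities
   disappear and only \<open>E * exp (g \<xi>)\<close> is left to average over fair signs.\<close>
 define Q where "Q \<xi> v = E (zs v) * exp (g \<xi> (zs v)) * (\<Prod>i<n. 1 + (\<xi> i / c * a i (zs v)) * e (v i))" for \<xi> v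
 have Q_eq: "(\<integral>v. Q \<xi> v \<partial>?P) = (\<integral>v. E (zs v) * exp (g \<xi> (zs v)) \<partial>?P)" and Q_int: "integrable ?P (Q \<xi>)"
  and Eg_int: "integrable ?P (\<lambda>v. E (zs v) * exp (g \<xi> (zs v)))"
  if \<xi>: "\<xi> \<in> sign_cube n" for \<xi>
 proof -
  \<comment> \<open>\<open>integral_noise_product\<close> wants the coefficients bounded at every
    index, while signs are controlled below n only; hence the value 0 from n on.\<close>
  have b1: "\<bar>(if i < n then \<xi> i / c * a i v else 0)\<bar> <= A / c" for i v
   using a_le[of i v] A_pos c sign_cube_abs[OF \<xi>, of i] by (auto simp: abs_mult divide_simps)
  have b2: "\<bar>E v * exp (g \<xi> v)\<bar> <= 1 * exp (real n * (c * (\<theta> * B)))" for v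
   unfolding abs_mult using E01 g_le[OF \<xi>, of v] by (intro mult_mono) (auto simp: abs_le_iff)
  have [measurable]: "g \<xi> \<in> borel_measurable (Pi\<^sub>M {..<n} (\<lambda>_. Nz))" by (rule gm[OF \<xi>])
  have "(\<integral>v. (E (zs v) * exp (g \<xi> (zs v))) * (\<Prod>i<n. 1 + (if i < n then \<xi> i / c * a i (zs v) else 0) * e (v i)) \<partial>?P) = (\<integral>v. E (zs v) * exp (g \<xi> (zs v)) \<partial>?P)"
   unfolding zs_def
   by (rule integral_noise_product[OF _ z e e_le centred _ b1 _ b2]) (auto intro!: L.prob_space_axioms)
  then show "(\<integral>v. Q \<xi> v \<partial>?P) = (\<integral>v. E (zs v) * exp (g \<xi> (zs v)) \<partial>?P)"
   unfolding Q_def by simp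
  show Eg: "integrable ?P (\<lambda>v. E (zs v) * exp (g \<xi> (zs v)))"
   by (rule PP'.integrable_const_bound[where B = "1 * exp (real n * (c * (\<theta> * B)))"])
    (use b2 in auto)
  have "\<bar>\<Prod>i<n. 1 + (\<xi> i / c * a i (zs v)) * e (v i)\<bar> <= 2 ^ n" for v
  proof -
   have "\<bar>1 + (\<xi> i / c * a i (zs v)) * e (v i)\<bar> <= 2" if "i < n" for i
   proof -
    have "\<bar>(\<xi> i / c * a i (zs v)) * e (v i)\<bar> <= 1"
     using ae_le[of i v] c sign_cube_abs[OF \<xi> that] by (simp add: abs_mult divide_simps)
    moreover have "\<bar>1 + t\<bar> <= 2" if "\<bar>t\<bar> <= 1" for t :: real using that by auto
    ultimately show ?thesis by blast
   qed
   then have "(\<Prod>i<n. \<bar>1 + (\<xi> i / c * a i (zs v)) * e (v i)\<bar>) <= (\<Prod>i<n. 2)"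
    by (intro prod_mono) auto
   then show ?thesis by (simp add: abs_prod)
  qed
  then have "\<bar>Q \<xi> v\<bar> <= (1 * exp (real n * (c * (\<theta> * B)))) * 2 ^ n" for v
   unfolding Q_def abs_mult[of "E (zs v) * exp (g \<xi> (zs v))"] using b2 by (intro mult_mono) auto
  moreover have "Q \<xi> \<in> borel_measurable ?P"
   unfolding Q_def
   by (intro borel_measurable_times borel_measurable_prod borel_measurable_add am) auto
  ultimately show "integrable ?P (Q \<xi>)"
   by (intro PP'.integrable_const_bound[where B = "(1 * exp (real n * (c * (\<theta> * B)))) * 2 ^ n"]) auto
 qed
 have pointwise: "E (zs v) * exp (\<Phi> v) <= cube_avg n (\<lambda>\<xi>. Q \<xi> v)" for v
 proof -
  have "exp (\<Phi> v) = exp (SUP k. 0 + (\<Sum>i<n. (a i (zs v) * e (v i)) * (\<theta> * u k (z (v i)))))"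
   unfolding \<Phi>_def by simp
  also have "\<dots> <= cube_avg n (\<lambda>\<xi>. (\<Prod>i<n. 1 + \<xi> i * (a i (zs v) * e (v i)) / c) * exp (SUP k. 0 + (\<Sum>i<n. \<xi> i * c * (\<theta> * u k (z (v i))))))"
   using c ae_le by (intro exp_SUP_le_cube bounded_rangeI[OF u\<theta>]) auto
  finally have "E (zs v) * exp (\<Phi> v) <= E (zs v) * \<dots>" using E01 by (intro mult_left_mono)
  also have "\<dots> = cube_avg n (\<lambda>\<xi>. Q \<xi> v)"
   unfolding cube_avg_cmult[symmetric] Q_def g_def zs_def by (intro cube_avg_cong) (simp add: mult_ac)
  finally show ?thesis .
 qed
 have int_cube: "(\<integral>v. cube_avg n (\<lambda>\<xi>. f \<xi> v) \<partial>?P) = cube_avg n (\<lambda>\<xi>. \<integral>v. f \<xi> v \<partial>?P)"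
  and int_cube': "integrable ?P (\<lambda>v. cube_avg n (\<lambda>\<xi>. f \<xi> v))"
  if "\<And>\<xi>. \<xi> \<in> sign_cube n ==> integrable ?P (f \<xi>)" for f
  unfolding cube_avg_def using that by (auto simp: Bochner_Integration.integral_sum)
 have "(\<integral>v. E (zs v) * exp (\<Phi> v) \<partial>?P) <= (\<integral>v. cube_avg n (\<lambda>\<xi>. Q \<xi> v) \<partial>?P)"
  by (intro integral_mono int\<Phi> int_cube' Q_int pointwise)
 also have "\<dots> = cube_avg n (\<lambda>\<xi>. \<integral>v. Q \<xi> v \<partial>?P)"
  by (rule int_cube[OF Q_int])
 also have "\<dots> = cube_avg n (\<lambda>\<xi>. \<integral>v. E (zs v) * exp (g \<xi> (zs v)) \<partial>?P)"
  by (intro cube_avg_cong Q_eq)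
 also have "\<dots> = (\<integral>v. cube_avg n (\<lambda>\<xi>. E (zs v) * exp (g \<xi> (zs v))) \<partial>?P)"
  by (rule int_cube[OF Eg_int, symmetric])
 also have "\<dots> <= (\<integral>v. exp ((c * \<theta>) * real n * \<delta> + (c * \<theta>)\<^sup>2 * B\<^sup>2 * real n / 2) \<partial>?P)"
 proof (intro integral_mono int_cube' Eg_int)
  fix v
  have "cube_avg n (\<lambda>\<xi>. E (zs v) * exp (g \<xi> (zs v))) = E (zs v) * cube_avg n (\<lambda>\<xi>. exp (SUP k. \<Sum>i<n. \<xi> i * (c * \<theta>) * u k (zs v i)))"
   unfolding cube_avg_cmult g_def by (simp add: mult_ac)
  also have "\<dots> <= E (zs v) * exp ((c * \<theta>) * real n * rademacher_avg u n (zs v) + (c * \<theta>)\<^sup>2 * B\<^sup>2 * real n / 2)"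
   using c \<theta> E01 by (intro mult_left_mono cube_avg_exp_sup_le) auto
  also have "\<dots> <= exp ((c * \<theta>) * real n * \<delta> + (c * \<theta>)\<^sup>2 * B\<^sup>2 * real n / 2)"
   using c \<theta> unfolding E_def by (auto intro!: mult_left_mono)
  finally show "cube_avg n (\<lambda>\<xi>. E (zs v) * exp (g \<xi> (zs v))) <= exp ((c * \<theta>) * real n * \<delta> + (c * \<theta>)\<^sup>2 * B\<^sup>2 * real n / 2)" .
 qed (auto intro: PP'.integrable_const)
 finally have main: "(\<integral>v. E (zs v) * exp (\<Phi> v) \<partial>?P) <= exp ((c * \<theta>) * real n * \<delta> + (c * \<theta>)\<^sup>2 * B\<^sup>2 * real n / 2)"
  by (simp add: PP'.prob_space)
 define x where "x = 2 * c * \<delta> * real n"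
 let ?ev = "{v \<in> space ?P. rademacher_avg u n (zs v) <= \<delta> \<and> (\<exists>k. (\<Sum>i<n. a i (zs v) * e (v i) * u k (z (v i))) >= x)}"
 have "exp (\<theta> * x) * measure ?P ?ev <= exp (\<theta> * x) * measure ?P {v \<in> space ?P. exp (\<theta> * x) <= E (zs v) * exp (\<Phi> v)}"
 proof (intro mult_left_mono PP'.finite_measure_mono subsetI)
  fix v assume v: "v \<in> ?ev"
  then obtain k where k: "(\<Sum>i<n. a i (zs v) * e (v i) * u k (z (v i))) >= x" by auto
  have "\<theta> * x <= \<theta> * (\<Sum>i<n. a i (zs v) * e (v i) * u k (z (v i)))" using k \<theta> by (intro mult_left_mono) auto
  also have "\<dots> = (\<Sum>i<n. a i (zs v) * e (v i) * (\<theta> * u k (z (v i))))"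
   by (simp add: sum_distrib_left algebra_simps)
  also have "\<dots> <= \<Phi> v" unfolding \<Phi>_def by (intro cSUP_upper bdd_above_rangeI[OF term_le]) auto
  finally show "v \<in> {v \<in> space ?P. exp (\<theta> * x) <= E (zs v) * exp (\<Phi> v)}" using v by (auto simp: E_def)
 next
  show "{v \<in> space ?P. exp (\<theta> * x) <= E (zs v) * exp (\<Phi> v)} \<in> sets ?P" by measurable
 qed auto
 also have "\<dots> <= (\<integral>v. E (zs v) * exp (\<Phi> v) \<partial>?P)"
 proof -
  have "measure ?P {v \<in> space ?P. exp (\<theta> * x) <= E (zs v) * exp (\<Phi> v)} <= (\<integral>v. E (zs v) * exp (\<Phi> v) \<partial>?P) / exp (\<theta> * x)"
   using E01 by (intro integral_Markov_inequality_measure[OF int\<Phi>, of "space ?P"]) auto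
  then show ?thesis by (simp add: field_simps)
 qed
 also note main
 finally have "measure ?P ?ev <= exp ((c * \<theta>) * real n * \<delta> + (c * \<theta>)\<^sup>2 * B\<^sup>2 * real n / 2) / exp (\<theta> * x)"
  by (simp add: field_simps)
 also have "\<dots> = exp ((c * \<theta>) * real n * \<delta> + (c * \<theta>)\<^sup>2 * B\<^sup>2 * real n / 2 - \<theta> * x)"
  by (simp add: exp_diff)
 also have "(c * \<theta>) * real n * \<delta> + (c * \<theta>)\<^sup>2 * B\<^sup>2 * real n / 2 - \<theta> * x = - (\<delta>\<^sup>2 / (2 * B\<^sup>2)) * real n"
  unfolding \<theta>_def x_def using c B_pos by (simp add: field_simps power2_eq_square)
 finally show ?thesis unfolding x_def c_def zs_def .
qed

end

section \<open>Samples and uniform laws of large numbers\<close>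

lemma (in prob_space) integrable_bounded:
 fixes f :: "'a => real"
 assumes "f \<in> borel_measurable M" "\<And>x. \<bar>f x\<bar> <= c"
 shows "integrable M f"
 using assms by (intro integrable_const_bound[where B = c]) auto

lemma (in prob_space) abs_integral_le:
 fixes f :: "'a => real"
 assumes "f \<in> borel_measurable M" "\<And>x. \<bar>f x\<bar> <= c"
 shows "\<bar>\<integral>x. f x \<partial>M\<bar> <= c"
proof -
 have "\<bar>\<integral>x. f x \<partial>M\<bar> <= (\<integral>x. \<bar>f x\<bar> \<partial>M)"
  using integral_norm_bound[of M f] by simp
 also have "\<dots> <= (\<integral>x. c \<partial>M)"
  using integrable_bounded[OF assms] assms(2) by (intro integral_mono) auto
 finally show ?thesis by (simp add: prob_space)
qed

lemma summable_exp_neg: "\<kappa> > 0 ==> summable (\<lambda>n. exp (- \<kappa> * real n))"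
 using summable_geometric[of "exp (- \<kappa>)"] by (simp add: exp_of_nat_mult[symmetric] mult.commute)

lemma (in prob_space) AE_eventually_notin:
 assumes [measurable]: "\<And>n. A n \<in> events" and "\<And>n. prob (A n) <= C * exp (- \<kappa> * real n)" "\<kappa> > 0"
 shows "AE x in M. \<forall>\<^sub>F n in sequentially. x \<notin> A n"
proof -
 have "summable (\<lambda>n. prob (A n))"
  using assms(2) by (intro summable_comparison_test'[OF summable_mult[OF summable_exp_neg[OF assms(3)], of C], of 0]) auto
 then have "AE x in M. \<forall>\<^sub>F n in sequentially. x \<in> space M - A n"
  by (intro borel_cantelli_AE1) (auto simp: emeasure_eq_measure)
 then show ?thesis by (auto elim: eventually_mono)
qed

text \<open>Monotonicity in \<delta> reduces the uncountable quantifier to \<delta> = 1/(m+1), at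
  the cost of countably many null sets.\<close>

lemma AE_all_pos:
 fixes P :: "real => 'a => bool"
 assumes "\<And>\<delta>. \<delta> > 0 ==> AE x in M. P \<delta> x" "\<And>\<delta> \<delta>' x. P \<delta> x ==> \<delta> <= \<delta>' ==> P \<delta>' x"
 shows "AE x in M. \<forall>\<delta>>0. P \<delta> x"
proof -
 have "AE x in M. \<forall>m::nat. P (1 / real (Suc m)) x"
  unfolding AE_all_countable using assms(1) by simp
 then show ?thesis
 proof eventually_elim
  case (elim x)
  show ?case
  proof (intro allI impI)
   fix \<delta> :: real assume "\<delta> > 0"
   then obtain m where "inverse (real (Suc m)) < \<delta>" using reals_Archimedean by blast
   then show "P \<delta> x" using elim[rule_format, of m] assms(2) by (auto simp: inverse_eq_divide)
  qed
 qed
qed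

text \<open>Hoeffding's inequality makes deviations of size \<delta> n exponentially unlikely, hence
  summable over n for each \<delta>, and Borel-Cantelli applies.\<close>

lemma (in prob_space) slln_bounded:
 fixes X :: "nat => 'a => real"
 assumes indep: "indep_vars (\<lambda>_. borel) X UNIV" and bd: "\<And>i x. \<bar>X i x\<bar> <= b"
  and m: "\<And>i. expectation (X i) = m"
 shows "AE x in M. (\<lambda>n. (\<Sum>i<n. X i x) / real n) \<longlonglongrightarrow> m"
proof -
 have [measurable]: "X i \<in> borel_measurable M" for i using indep unfolding indep_vars_def by auto
 \<comment> \<open>The added 1 keeps the interval of Hoeffding's inequality nondegenerate when b =
   0.\<close>
 define c where "c = b + 1"
 have c: "c > 0" using bd[of undefined undefined] unfolding c_def by linarith
 have "AE x in M. \<forall>\<^sub>F n in sequentially. \<bar>(\<Sum>i<n. X i x) - real n * m\<bar> <= \<delta> * real n" if \<delta>: "\<delta> > 0" for \<delta>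
 proof -
  have "AE x in M. \<forall>\<^sub>F n in sequentially. x \<notin> {x \<in> space M. \<bar>(\<Sum>i<n. X i x) - real n * m\<bar> >= \<delta> * real n}"
  proof (rule AE_eventually_notin[where C = 2])
   fix n
   show "prob {x \<in> space M. \<bar>(\<Sum>i<n. X i x) - real n * m\<bar> >= \<delta> * real n} <= 2 * exp (- (\<delta>\<^sup>2 / (2 * c\<^sup>2)) * real n)"
   proof (cases "n = 0")
    case True then show ?thesis by (auto intro: order_trans[OF prob_le_1])
   next
    case False
    interpret H: Hoeffding_ineq M "{..<n}" X "\<lambda>_. -c" "\<lambda>_. c" "real n * m"
    proof unfold_locales
     show "indep_vars (\<lambda>_. borel) X {..<n}" by (rule indep_vars_subset[OF indep]) simp
     show "AE x in M. X i x \<in> {- c..c}" for i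
     proof (rule AE_I2)
      fix x show "X i x \<in> {- c..c}" using bd[of i x] by (auto simp: c_def abs_le_iff)
     qed
     show "real n * m \<equiv> \<Sum>i<n. expectation (X i)" by (simp add: m)
    qed auto
    have "prob {x \<in> space M. \<bar>(\<Sum>i<n. X i x) - real n * m\<bar> >= \<delta> * real n} <= 2 * exp (- 2 * (\<delta> * real n)\<^sup>2 / (\<Sum>i<n. (c - (- c))\<^sup>2))"
     using \<delta> c False by (intro H.Hoeffding_ineq_abs_ge) auto
    also have "- 2 * (\<delta> * real n)\<^sup>2 / (\<Sum>i<n. (c - (- c))\<^sup>2) = - (\<delta>\<^sup>2 / (2 * c\<^sup>2)) * real n"
     using False c by (simp add: power2_eq_square field_simps)
    finally show ?thesis .
   qed
  qed (use \<delta> c in auto)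
  then show ?thesis by (auto elim!: eventually_mono simp: not_le less_imp_le)
 qed
 then have "AE x in M. \<forall>\<delta>>0. \<forall>\<^sub>F n in sequentially. \<bar>(\<Sum>i<n. X i x) - real n * m\<bar> <= \<delta> * real n"
 proof (rule AE_all_pos)
  fix \<delta> \<delta>' :: real and x assume *: "\<forall>\<^sub>F n in sequentially. \<bar>(\<Sum>i<n. X i x) - real n * m\<bar> <= \<delta> * real n" "\<delta> <= \<delta>'"
  show "\<forall>\<^sub>F n in sequentially. \<bar>(\<Sum>i<n. X i x) - real n * m\<bar> <= \<delta>' * real n"
   using *(1)
  proof eventually_elim
   case (elim n)
   then show ?case using mult_right_mono[OF *(2), of "real n"] by linarith
  qed
 qed
 then show ?thesis
 proof eventually_elim
  case (elim x)
  show ?case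
  proof (rule tendstoI)
   fix \<epsilon> :: real assume "\<epsilon> > 0"
   then have "\<forall>\<^sub>F n in sequentially. \<bar>(\<Sum>i<n. X i x) - real n * m\<bar> <= \<epsilon> / 2 * real n"
    using elim half_gt_zero by blast
   then show "\<forall>\<^sub>F n in sequentially. dist ((\<Sum>i<n. X i x) / real n) m < \<epsilon>"
    using eventually_gt_at_top[of 0]
   proof eventually_elim
    case (elim n)
    have "dist ((\<Sum>i<n. X i x) / real n) m = \<bar>(\<Sum>i<n. X i x) - real n * m\<bar> / real n"
     using elim by (simp add: dist_real_def field_simps abs_divide)
    also have "\<dots> <= \<epsilon> / 2" using elim by (simp add: field_simps)
    finally show ?case using \<open>\<epsilon> > 0\<close> by simp
   qed
  qed
 qed
qed

section \<open>Independent samples of a common law\<close>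

locale iid_sample = prob_space M for M :: "'w measure" +
 fixes S :: "nat => 'w => 's" and N L :: "'s measure"
 assumes indep: "indep_vars (\<lambda>_. N) S UNIV" and law: "\<And>i. distr M N (S i) = L"
begin

lemma S_measurable [measurable]: "S i \<in> measurable M N"
 using indep unfolding indep_vars_def by auto

lemma sets_L [measurable_cong]: "sets L = sets N"
 using law[of 0] by auto

lemma measurable_L: "measurable L K = measurable N K"
 by (rule measurable_cong_sets[OF sets_L refl])

lemma prob_space_L: "prob_space L"
 using prob_space_distr[OF S_measurable[of 0]] law by simp

sublocale L: prob_space L by (rule prob_space_L)

lemma AE_S: "AE s in L. \<phi> s ==> AE \<omega> in M. \<phi> (S i \<omega>)"
 unfolding law[of i, symmetric] by (rule AE_distrD) measurable

lemma integral_S: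
 fixes h :: "'s => real"
 shows "h \<in> borel_measurable N ==> (\<integral>\<omega>. h (S i \<omega>) \<partial>M) = (\<integral>s. h s \<partial>L)"
 unfolding law[of i, symmetric] by (subst integral_distr) auto

lemma slln:
 fixes h :: "'s => real"
 assumes [measurable]: "h \<in> borel_measurable N" and "\<And>s. \<bar>h s\<bar> <= b"
 shows "AE \<omega> in M. (\<lambda>n. (\<Sum>i<n. h (S i \<omega>)) / real n) \<longlonglongrightarrow> (\<integral>s. h s \<partial>L)"
proof (rule slln_bounded[where X = "\<lambda>i \<omega>. h (S i \<omega>)"])
 show "indep_vars (\<lambda>_. borel) (\<lambda>i \<omega>. h (S i \<omega>)) UNIV"
  by (rule indep_vars_compose2[OF indep]) simp
qed (use assms in \<open>auto intro!: integral_S\<close>)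

lemma indep_blocks:
 assumes "disjoint_family K"
 shows "indep_vars (\<lambda>j. Pi\<^sub>M (K j) (\<lambda>_. N)) (\<lambda>j \<omega>. \<lambda>i\<in>K j. S i \<omega>) UNIV"
 using indep_vars_restrict[OF indep, of UNIV K] assms by simp

text \<open>The map \<sigma> is the identity for the sample itself and a shift by
  \<open>j * m\<close> for the j-th block in \<open>uniform_lln\<close>. The law is the same product
  in both cases, so block statistics are identically distributed.\<close>

lemma distr_subsample:
 assumes "inj \<sigma>" "n > 0"
 shows "distr M (Pi\<^sub>M {..<n} (\<lambda>_. N)) (\<lambda>\<omega>. \<lambda>i\<in>{..<n}. S (\<sigma> i) \<omega>) = Pi\<^sub>M {..<n} (\<lambda>_. L)"
proof -
 have "indep_vars (\<lambda>j. N) (\<lambda>j \<omega>. (\<lambda>v. v (\<sigma> j)) (\<lambda>i\<in>{\<sigma> j}. S i \<omega>)) UNIV"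
  using assms(1)
  by (rule_tac indep_vars_compose2[OF indep_blocks[of "\<lambda>j. {\<sigma> j}"]]) (auto simp: disjoint_family_on_def inj_eq)
 then have "indep_vars (\<lambda>j. N) (\<lambda>j. S (\<sigma> j)) UNIV" by simp
 from indep_vars_subset[OF this, of "{..<n}"]
 have "indep_vars (\<lambda>j. N) (\<lambda>j. S (\<sigma> j)) {..<n}" by simp
 then show ?thesis
  using assms(2) by (subst (asm) indep_vars_iff_distr_eq_PiM') (auto simp: law cong: PiM_cong)
qed

lemma measure_subsample:
 assumes "inj \<sigma>" "n > 0" "Measurable.pred (Pi\<^sub>M {..<n} (\<lambda>_. L)) \<phi>"
 shows "prob {\<omega> \<in> space M. \<phi> (\<lambda>i\<in>{..<n}. S (\<sigma> i) \<omega>)}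
  = measure (Pi\<^sub>M {..<n} (\<lambda>_. L)) {v \<in> space (Pi\<^sub>M {..<n} (\<lambda>_. L)). \<phi> v}"
proof -
 have sP: "sets (Pi\<^sub>M {..<n} (\<lambda>_. L)) = sets (Pi\<^sub>M {..<n} (\<lambda>_. N))"
  by (intro sets_PiM_cong) (auto simp: sets_L)
 have "{v \<in> space (Pi\<^sub>M {..<n} (\<lambda>_. L)). \<phi> v} \<in> sets (Pi\<^sub>M {..<n} (\<lambda>_. N))"
  unfolding sP[symmetric] using assms(3) by measurable
 then have "measure (Pi\<^sub>M {..<n} (\<lambda>_. L)) {v \<in> space (Pi\<^sub>M {..<n} (\<lambda>_. L)). \<phi> v}
  = prob ((\<lambda>\<omega>. \<lambda>i\<in>{..<n}. S (\<sigma> i) \<omega>) -` {v \<in> space (Pi\<^sub>M {..<n} (\<lambda>_. L)). \<phi> v} \<inter> space M)"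
  by (subst (1) distr_subsample[OF assms(1,2), symmetric], subst measure_distr) auto
 also have "(\<lambda>\<omega>. \<lambda>i\<in>{..<n}. S (\<sigma> i) \<omega>) -` {v \<in> space (Pi\<^sub>M {..<n} (\<lambda>_. L)). \<phi> v} \<inter> space M
  = {\<omega> \<in> space M. \<phi> (\<lambda>i\<in>{..<n}. S (\<sigma> i) \<omega>)}"
  using measurable_space[OF S_measurable] sets_eq_imp_space_eq[OF sets_L] by (auto simp: space_PiM)
 finally show ?thesis by simp
qed

lemma integral_subsample:
 fixes f :: "(nat => 's) => real"
 assumes "inj \<sigma>" "n > 0" "f \<in> borel_measurable (Pi\<^sub>M {..<n} (\<lambda>_. N))"
 shows "(\<integral>\<omega>. f (\<lambda>i\<in>{..<n}. S (\<sigma> i) \<omega>) \<partial>M) = (\<integral>v. f v \<partial>Pi\<^sub>M {..<n} (\<lambda>_. L))"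
 unfolding distr_subsample[OF assms(1,2), symmetric] using assms(3) by (subst integral_distr) auto

lemma rademacher_avg_restrict: "rademacher_avg u n (\<lambda>i\<in>{..<n}. v i) = rademacher_avg u n v"
 unfolding rademacher_avg_def by simp

text \<open>Borel-Cantelli on the events of \<open>noise_tail_bound\<close>, whose side condition on
  the Rademacher average holds eventually by assumption. The coefficients may change with n and
  depend on all observed coordinates at once.\<close>

theorem weighted_noise_vanishes:
 fixes a :: "nat => nat => (nat => 'z) => real"
 assumes nm: "noise_model u Nz B L z e c0"
  and a: "\<And>n i. i < n ==> a n i \<in> borel_measurable (Pi\<^sub>M {..<n} (\<lambda>_. Nz))"
  and a_le: "\<And>n i v. \<bar>a n i v\<bar> <= A" and A: "0 < A"
  and rad: "AE \<omega> in M. (\<lambda>n. rademacher_avg u n (\<lambda>i. z (S i \<omega>))) \<longlonglongrightarrow> 0"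
 shows "AE \<omega> in M. \<forall>\<delta>>0. \<forall>\<^sub>F n in sequentially. \<forall>k.
  (\<Sum>i<n. a n i (\<lambda>i\<in>{..<n}. z (S i \<omega>)) * e (S i \<omega>) * u k (z (S i \<omega>))) <= \<delta> * real n"
proof -
 interpret noise_model u Nz B L z e c0 by fact
 have z' [measurable]: "z \<in> measurable N Nz" using z unfolding measurable_L .
 have e' [measurable]: "e \<in> borel_measurable N" using e unfolding measurable_L .
 show ?thesis
 proof (rule AE_all_pos)
  fix \<delta> :: real assume \<delta>: "\<delta> > 0"
  \<comment> \<open>Chosen so that the threshold \<open>2 * (A * c0) * d\<close> of
    \<open>noise_tail_bound\<close> equals \<delta>.\<close>
  define d where "d = \<delta> / (2 * (A * c0))"
  have d: "d > 0" unfolding d_def using A c0_pos \<delta> by simp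
  define zs where "zs n v = (\<lambda>i\<in>{..<n}. z (v i))" for n and v :: "nat => 's"
  define ev where "ev n v \<longleftrightarrow> rademacher_avg u n (zs n v) <= d \<and>
   (\<exists>k. (\<Sum>i<n. a n i (zs n v) * e (v i) * u k (z (v i))) >= 2 * (A * c0) * d * real n)" for n v
  have zsm: "zs n \<in> measurable (Pi\<^sub>M {..<n} (\<lambda>_. N)) (Pi\<^sub>M {..<n} (\<lambda>_. Nz))" for n
   unfolding zs_def by measurable
  have ev_meas: "Measurable.pred (Pi\<^sub>M {..<n} (\<lambda>_. N)) (ev n)" for n
  proof -
   note [measurable] = zsm
   have "(\<lambda>v. \<Sum>i<n. a n i (zs n v) * e (v i) * u k (z (v i))) \<in> borel_measurable (Pi\<^sub>M {..<n} (\<lambda>_. N))" for k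
   proof (rule borel_measurable_sum)
    fix i assume i: "i \<in> {..<n}"
    then have "i < n" by simp
    have vi [measurable]: "(\<lambda>v. v i) \<in> measurable (Pi\<^sub>M {..<n} (\<lambda>_. N)) N"
     using i by (rule measurable_component_singleton)
    have "(\<lambda>v. a n i (zs n v)) \<in> borel_measurable (Pi\<^sub>M {..<n} (\<lambda>_. N))"
     by (rule measurable_compose[OF zsm a[OF \<open>i < n\<close>]])
    moreover have "(\<lambda>v. e (v i)) \<in> borel_measurable (Pi\<^sub>M {..<n} (\<lambda>_. N))"
     by (rule measurable_compose[OF vi e'])
    moreover have "(\<lambda>v. u k (z (v i))) \<in> borel_measurable (Pi\<^sub>M {..<n} (\<lambda>_. N))"
     by (rule measurable_compose[OF measurable_compose[OF vi z'] u_measurable])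
    ultimately show "(\<lambda>v. a n i (zs n v) * e (v i) * u k (z (v i))) \<in> borel_measurable (Pi\<^sub>M {..<n} (\<lambda>_. N))"
     by (intro borel_measurable_times)
   qed
   note [measurable] = this
   show ?thesis unfolding ev_def by measurable
  qed
  have sP: "sets (Pi\<^sub>M {..<n} (\<lambda>_. L)) = sets (Pi\<^sub>M {..<n} (\<lambda>_. N))" for n :: nat
   by (intro sets_PiM_cong) (auto simp: sets_L)
  have Sm: "(\<lambda>\<omega>. \<lambda>i\<in>{..<n}. S i \<omega>) \<in> measurable M (Pi\<^sub>M {..<n} (\<lambda>_. N))" for n by measurable
  have "AE \<omega> in M. \<forall>\<^sub>F n in sequentially. \<omega> \<notin> {\<omega> \<in> space M. ev n (\<lambda>i\<in>{..<n}. S i \<omega>)}"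
  proof (rule AE_eventually_notin[where C = 1])
   fix n
   show "{\<omega> \<in> space M. ev n (\<lambda>i\<in>{..<n}. S i \<omega>)} \<in> events"
    using measurable_compose[OF Sm ev_meas] by simp
   show "prob {\<omega> \<in> space M. ev n (\<lambda>i\<in>{..<n}. S i \<omega>)} <= 1 * exp (- (d\<^sup>2 / (2 * B\<^sup>2)) * real n)"
   proof (cases "n = 0")
    case False
    have "prob {\<omega> \<in> space M. ev n (\<lambda>i\<in>{..<n}. S (id i) \<omega>)}
     = measure (Pi\<^sub>M {..<n} (\<lambda>_. L)) {v \<in> space (Pi\<^sub>M {..<n} (\<lambda>_. L)). ev n v}"
     using False ev_meas[of n] by (intro measure_subsample) (auto cong: measurable_cong_sets[OF sP])
    also have "\<dots> <= exp (- (d\<^sup>2 / (2 * B\<^sup>2)) * real n)"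
     unfolding ev_def zs_def by (rule noise_tail_bound[OF a a_le A d])
    finally show ?thesis by simp
   qed simp
  qed (use d B_pos in auto)
  moreover have "AE \<omega> in M. \<forall>\<^sub>F n in sequentially. rademacher_avg u n (\<lambda>i. z (S i \<omega>)) <= d"
   using rad
  proof eventually_elim
   case (elim \<omega>)
   show ?case using order_tendstoD(2)[OF elim d] by eventually_elim simp
  qed
  ultimately show "AE \<omega> in M. \<forall>\<^sub>F n in sequentially. \<forall>k.
   (\<Sum>i<n. a n i (\<lambda>i\<in>{..<n}. z (S i \<omega>)) * e (S i \<omega>) * u k (z (S i \<omega>))) <= \<delta> * real n"
   using AE_space
  proof eventually_elim
   case (elim \<omega>)
   show ?case
    using elim(1,2)
   proof eventually_elim
    case (elim n)
    have eq: "zs n (\<lambda>i\<in>{..<n}. S i \<omega>) = (\<lambda>i\<in>{..<n}. z (S i \<omega>))" unfolding zs_def by auto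
    have "2 * (A * c0) * d = \<delta>" unfolding d_def using A c0_pos by simp
    moreover have "(\<Sum>i<n. a n i (\<lambda>i\<in>{..<n}. z (S i \<omega>)) * e ((\<lambda>i\<in>{..<n}. S i \<omega>) i) * u k (z ((\<lambda>i\<in>{..<n}. S i \<omega>) i)))
     = (\<Sum>i<n. a n i (\<lambda>i\<in>{..<n}. z (S i \<omega>)) * e (S i \<omega>) * u k (z (S i \<omega>)))" for k
     by (intro sum.cong) auto
    ultimately show ?case
     using elim \<open>\<omega> \<in> space M\<close>
     by (auto simp only: ev_def eq rademacher_avg_restrict mem_Collect_eq) (metis linorder_le_cases)
   qed
  qed
 next
  fix \<delta> \<delta>' :: real and \<omega>
  assume *: "\<forall>\<^sub>F n in sequentially. \<forall>k.
   (\<Sum>i<n. a n i (\<lambda>i\<in>{..<n}. z (S i \<omega>)) * e (S i \<omega>) * u k (z (S i \<omega>))) <= \<delta> * real n" and "\<delta> <= \<delta>'"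
  show "\<forall>\<^sub>F n in sequentially. \<forall>k.
   (\<Sum>i<n. a n i (\<lambda>i\<in>{..<n}. z (S i \<omega>)) * e (S i \<omega>) * u k (z (S i \<omega>))) <= \<delta>' * real n"
   using *
  proof eventually_elim
   case (elim n)
   have "\<delta> * real n <= \<delta>' * real n" using \<open>\<delta> <= \<delta>'\<close> by (intro mult_right_mono) auto
   with elim show ?case by (meson order_trans)
  qed
 qed
qed

end

text \<open>With E the mean of \<open>l k\<close>, the term \<open>p k + (l k y - E)\<close> is the
  midpoint of \<open>p k + 2 * l k y\<close> and \<open>p k - 2 * E\<close>. The latter is the mean
  of \<open>p k - 2 * l k\<close>, hence at most the mean of its supremum. This takes the place of a
  ghost sample.\<close>

lemma (in prob_space) one_step_symmetrization:
 fixes p :: "nat => real" and l :: "nat => 'a => real"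
 assumes [measurable]: "\<And>k. l k \<in> borel_measurable M"
  and b: "\<And>k x. \<bar>l k x\<bar> <= b" and c: "\<And>k. \<bar>p k\<bar> <= c"
 shows "(\<integral>y. (SUP k. p k + (l k y - (\<integral>x. l k x \<partial>M))) \<partial>M)
  <= ((\<integral>y. (SUP k. p k + 2 * l k y) \<partial>M) + (\<integral>y. (SUP k. p k - 2 * l k y) \<partial>M)) / 2"
proof -
 have e: "\<bar>\<integral>x. l k x \<partial>M\<bar> <= b" for k by (rule abs_integral_le) (use b in auto)
 have lint: "integrable M (l k)" for k
  by (rule integrable_bounded[where c = b]) (use b in auto)
 have b1: "\<bar>p k + 2 * l k y\<bar> <= c + 2 * b" "\<bar>p k - 2 * l k y\<bar> <= c + 2 * b"
  "\<bar>p k + (l k y - (\<integral>x. l k x \<partial>M))\<bar> <= c + 2 * b" for k y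
  using b[of k y] c[of k] e[of k] by (auto simp: abs_le_iff)
 have m: "(\<lambda>y. SUP k. p k + 2 * l k y) \<in> borel_measurable M" "(\<lambda>y. SUP k. p k - 2 * l k y) \<in> borel_measurable M"
  "(\<lambda>y. SUP k. p k + (l k y - (\<integral>x. l k x \<partial>M))) \<in> borel_measurable M"
  using b1 by (intro borel_measurable_SUP_bounded[where c = "\<lambda>_. c + 2 * b"]; auto)+
 note int = integrable_bounded[OF m(1) abs_SUP_le[OF b1(1)]] integrable_bounded[OF m(2) abs_SUP_le[OF b1(2)]]
  integrable_bounded[OF m(3) abs_SUP_le[OF b1(3)]]
 let ?R = "\<integral>y. (SUP k. p k - 2 * l k y) \<partial>M"
 have "(\<integral>y. (SUP k. p k + (l k y - (\<integral>x. l k x \<partial>M))) \<partial>M) <= (\<integral>y. ((SUP k. p k + 2 * l k y) + ?R) / 2 \<partial>M)"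
 proof (intro integral_mono int)
  show "integrable M (\<lambda>y. ((SUP k. p k + 2 * l k y) + ?R) / 2)" using int by simp
  fix y
  show "(SUP k. p k + (l k y - (\<integral>x. l k x \<partial>M))) <= ((SUP k. p k + 2 * l k y) + ?R) / 2"
  proof (rule cSUP_least)
   fix k
   have "p k - 2 * (\<integral>x. l k x \<partial>M) = (\<integral>y. p k - 2 * l k y \<partial>M)"
    using lint by (simp add: prob_space)
   also have "\<dots> <= ?R"
   proof (intro integral_mono int)
    show "integrable M (\<lambda>y. p k - 2 * l k y)" using lint by simp
    show "p k - 2 * l k y <= (SUP k. p k - 2 * l k y)" for y
     by (intro cSUP_upper bdd_above_rangeI[OF b1(2)]) auto
   qed
   finally have "p k - 2 * (\<integral>x. l k x \<partial>M) <= ?R" .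
   moreover have "p k + 2 * l k y <= (SUP k. p k + 2 * l k y)"
    by (intro cSUP_upper bdd_above_rangeI[OF b1(1)]) auto
   ultimately show "p k + (l k y - (\<integral>x. l k x \<partial>M)) <= ((SUP k. p k + 2 * l k y) + ?R) / 2" by simp
  qed simp
 qed
 also have "\<dots> = ((\<integral>y. (SUP k. p k + 2 * l k y) \<partial>M) + ?R) / 2"
  using int by (simp add: prob_space)
 finally show ?thesis .
qed

text \<open>Both orders of integration serve \<open>symmetrization\<close>, which first integrates
  the last coordinate with the others frozen, then the others with the last frozen. \<open>f\<close>
  stands for \<open>F\<close> after overwriting coordinate n.\<close>

lemma integral_PiM_Suc:
 fixes F :: "(nat => 's) => real" and f :: "(nat => 's) => 's => real"
 assumes L: "prob_space L"
  and F: "F \<in> borel_measurable (Pi\<^sub>M {..<Suc n} (\<lambda>_. L))" "\<And>v. \<bar>F v\<bar> <= c"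
  and f: "(\<lambda>(x, y). f x y) \<in> borel_measurable (Pi\<^sub>M {..<n} (\<lambda>_. L) \<Otimes>\<^sub>M L)"
  and eq: "\<And>x y. F (x(n := y)) = f x y"
 shows "(\<integral>v. F v \<partial>Pi\<^sub>M {..<Suc n} (\<lambda>_. L)) = (\<integral>x. (\<integral>y. f x y \<partial>L) \<partial>Pi\<^sub>M {..<n} (\<lambda>_. L))"
  and "(\<integral>v. F v \<partial>Pi\<^sub>M {..<Suc n} (\<lambda>_. L)) = (\<integral>y. (\<integral>x. f x y \<partial>Pi\<^sub>M {..<n} (\<lambda>_. L)) \<partial>L)"
proof -
 interpret L: prob_space L by (rule L)
 interpret PP: product_prob_space "\<lambda>_::nat. L" by standard
 interpret P0: prob_space "Pi\<^sub>M {..<n} (\<lambda>_. L)" by (rule prob_space_PiM) (rule L)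
 interpret P1: prob_space "Pi\<^sub>M {..<Suc n} (\<lambda>_. L)" by (rule prob_space_PiM) (rule L)
 interpret Q: pair_prob_space "Pi\<^sub>M {..<n} (\<lambda>_. L)" L ..
 have "integrable (Pi\<^sub>M (insert n {..<n}) (\<lambda>_. L)) F"
  using P1.integrable_bounded[OF F] by (simp add: lessThan_Suc)
 from PP.product_integral_insert[OF _ _ this]
 show 1: "(\<integral>v. F v \<partial>Pi\<^sub>M {..<Suc n} (\<lambda>_. L)) = (\<integral>x. (\<integral>y. f x y \<partial>L) \<partial>Pi\<^sub>M {..<n} (\<lambda>_. L))"
  by (simp add: eq lessThan_Suc)
 have "\<bar>case p of (x, y) => f x y\<bar> <= c" for p
  using F(2) by (auto simp: eq[symmetric] split: prod.split)
 from Q.integrable_bounded[OF f this]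
 have "(\<integral>y. (\<integral>x. f x y \<partial>Pi\<^sub>M {..<n} (\<lambda>_. L)) \<partial>L) = (\<integral>x. (\<integral>y. f x y \<partial>L) \<partial>Pi\<^sub>M {..<n} (\<lambda>_. L))"
  by (rule Q.Fubini_integral)
 with 1 show "(\<integral>v. F v \<partial>Pi\<^sub>M {..<Suc n} (\<lambda>_. L)) = (\<integral>y. (\<integral>x. f x y \<partial>Pi\<^sub>M {..<n} (\<lambda>_. L)) \<partial>L)" by simp
qed

text \<open>Induction on the sample size with an offset: \<open>one_step_symmetrization\<close>
  treats the last point inside, then the order of integration is exchanged and the induction
  hypothesis applies for each fixed last point, now part of the offset.\<close>

lemma symmetrization:
 fixes l :: "nat => 's => real" and \<psi> :: "nat => real"
 assumes "prob_space L" and l [measurable]: "\<And>k. l k \<in> borel_measurable L"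
  and b: "\<And>k x. \<bar>l k x\<bar> <= b" and c: "\<And>k. \<bar>\<psi> k\<bar> <= c"
 shows "(\<integral>v. (SUP k. \<psi> k + (\<Sum>i<n. l k (v i) - (\<integral>x. l k x \<partial>L))) \<partial>Pi\<^sub>M {..<n} (\<lambda>_. L))
  <= (\<integral>v. cube_avg n (\<lambda>\<xi>. SUP k. \<psi> k + (\<Sum>i<n. \<xi> i * (2 * l k (v i)))) \<partial>Pi\<^sub>M {..<n} (\<lambda>_. L))"
 using c
proof (induction n arbitrary: \<psi> c)
 case 0
 then show ?case by (simp add: cube_avg_0)
next
 case (Suc n)
 interpret L: prob_space L by (rule assms)
 interpret P0: prob_space "Pi\<^sub>M {..<n} (\<lambda>_. L)" by (rule prob_space_PiM) (rule assms)
 interpret P1: prob_space "Pi\<^sub>M {..<Suc n} (\<lambda>_. L)" by (rule prob_space_PiM) (rule assms)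
 let ?P0 = "Pi\<^sub>M {..<n} (\<lambda>_. L)" and ?P1 = "Pi\<^sub>M {..<Suc n} (\<lambda>_. L)"
 define E where "E k = (\<integral>x. l k x \<partial>L)" for k
 have E: "\<bar>E k\<bar> <= b" for k unfolding E_def by (rule L.abs_integral_le) (use b in auto)
 have bc: "\<bar>l k x - E k\<bar> <= 2 * b" for k x using b[of k x] E[of k] by (auto simp: abs_le_iff)
 have bn: "\<bar>\<Sum>i<m. l k (v i) - E k\<bar> <= real m * (2 * b)" for k m v by (rule sum_abs_le_card) (rule bc)
 have bp: "\<bar>\<psi> k + (\<Sum>i<m. l k (v i) - E k)\<bar> <= c + real m * (2 * b)" for k m v
  using Suc.prems[of k] bn[of k v m] by (auto simp: abs_le_iff)
 have bx: "\<bar>\<Sum>i<m. \<xi> i * (2 * l k (v i))\<bar> <= real m * (2 * b)" if "\<xi> \<in> sign_cube m" for k m v \<xi>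
  using b by (intro sum_abs_le_card) (simp add: abs_mult sign_cube_abs[OF that])
 have bs: "\<bar>\<psi> k + s * l k y\<bar> <= c + 2 * b" if "\<bar>s\<bar> = 2" for k y s
  using abs_triangle_ineq[of "\<psi> k" "s * l k y"] Suc.prems[of k] b[of k y] that by (simp add: abs_mult)
 define F where "F v = (SUP k. \<psi> k + (\<Sum>i<Suc n. l k (v i) - E k))" for v
 \<comment> \<open>In \<open>G\<close> only the last point is symmetrised, with s = 2 or -2 standing
   for twice its sign; in \<open>H\<close> all points are. The induction hypothesis compares the two
   for each s.\<close>
 define G where "G s v = (SUP k. (\<psi> k + s * l k (v n)) + (\<Sum>i<n. l k (v i) - E k))" for s v
 define H where "H s v = cube_avg n (\<lambda>\<xi>. SUP k. (\<psi> k + s * l k (v n)) + (\<Sum>i<n. \<xi> i * (2 * l k (v i))))" for s v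
 have Gb: "\<bar>(\<psi> k + s * l k y) + (\<Sum>i<n. l k (x i) - E k)\<bar> <= (c + 2 * b) + real n * (2 * b)" if "\<bar>s\<bar> = 2" for k y x s
  using abs_triangle_ineq[of "\<psi> k + s * l k y" "\<Sum>i<n. l k (x i) - E k"] bs[OF that, of k y] bn[of k x n] by linarith
 have Hb: "\<bar>(\<psi> k + s * l k y) + (\<Sum>i<n. \<xi> i * (2 * l k (x i)))\<bar> <= (c + 2 * b) + real n * (2 * b)" if "\<bar>s\<bar> = 2" "\<xi> \<in> sign_cube n" for k y x s \<xi>
  using abs_triangle_ineq[of "\<psi> k + s * l k y" "\<Sum>i<n. \<xi> i * (2 * l k (x i))"] bs[OF that(1), of k y] bx[OF that(2), of k x] by linarith
 have F1: "F (x(n := y)) = (SUP k. (\<psi> k + (\<Sum>i<n. l k (x i) - E k)) + (l k y - E k))" for x y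
  unfolding F_def by (intro SUP_cong) auto
 have G1: "G s (x(n := y)) = (SUP k. (\<psi> k + s * l k y) + (\<Sum>i<n. l k (x i) - E k))" for x y s
  unfolding G_def by (intro SUP_cong) auto
 have H1: "H s (x(n := y)) = cube_avg n (\<lambda>\<xi>. SUP k. (\<psi> k + s * l k y) + (\<Sum>i<n. \<xi> i * (2 * l k (x i))))" for x y s
  unfolding H_def by (intro cube_avg_cong SUP_cong) auto
 have Fm: "F \<in> borel_measurable ?P1"
  unfolding F_def by (rule borel_measurable_SUP_bounded[OF _ bp]) measurable
 have Fm2: "(\<lambda>(x, y). SUP k. (\<psi> k + (\<Sum>i<n. l k (x i) - E k)) + (l k y - E k)) \<in> borel_measurable (?P0 \<Otimes>\<^sub>M L)"
  unfolding case_prod_beta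
 proof (rule borel_measurable_SUP_bounded[where c = "\<lambda>_. (c + real n * (2 * b)) + 2 * b"])
  show "\<bar>(\<psi> k + (\<Sum>i<n. l k (fst p i) - E k)) + (l k (snd p) - E k)\<bar> <= (c + real n * (2 * b)) + 2 * b" for k p
   using abs_triangle_ineq[of "\<psi> k + (\<Sum>i<n. l k (fst p i) - E k)" "l k (snd p) - E k"] bp[of k "fst p" n] bc[of k "snd p"]
   by linarith
 qed measurable
 have Gm: "G s \<in> borel_measurable ?P1" if "\<bar>s\<bar> = 2" for s
  unfolding G_def by (rule borel_measurable_SUP_bounded[OF _ Gb[OF that]]) measurable
 have Gm2: "(\<lambda>(x, y). SUP k. (\<psi> k + s * l k y) + (\<Sum>i<n. l k (x i) - E k)) \<in> borel_measurable (?P0 \<Otimes>\<^sub>M L)" if "\<bar>s\<bar> = 2" for s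
  unfolding case_prod_beta by (rule borel_measurable_SUP_bounded[OF _ Gb[OF that]]) measurable
 have Hm: "H s \<in> borel_measurable ?P1" if "\<bar>s\<bar> = 2" for s
  unfolding H_def by (rule borel_measurable_cube_avg, rule borel_measurable_SUP_bounded[OF _ Hb[OF that]]) measurable
 have Hm2: "(\<lambda>(x, y). cube_avg n (\<lambda>\<xi>. SUP k. (\<psi> k + s * l k y) + (\<Sum>i<n. \<xi> i * (2 * l k (x i))))) \<in> borel_measurable (?P0 \<Otimes>\<^sub>M L)" if "\<bar>s\<bar> = 2" for s
  unfolding case_prod_beta by (rule borel_measurable_cube_avg, rule borel_measurable_SUP_bounded[OF _ Hb[OF that]]) measurable
 have Fle: "\<bar>F v\<bar> <= c + real (Suc n) * (2 * b)" for v unfolding F_def by (rule abs_SUP_le[OF bp])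
 have Gle: "\<bar>G s v\<bar> <= (c + 2 * b) + real n * (2 * b)" if "\<bar>s\<bar> = 2" for v s unfolding G_def by (rule abs_SUP_le[OF Gb[OF that]])
 have Hle: "\<bar>H s v\<bar> <= (c + 2 * b) + real n * (2 * b)" if "\<bar>s\<bar> = 2" for v s
  unfolding H_def by (rule cube_avg_abs_le, rule abs_SUP_le[OF Hb[OF that]])
 note FI = integral_PiM_Suc[OF assms(1) Fm Fle Fm2 F1]
 note GI = integral_PiM_Suc[OF assms(1) Gm Gle Gm2 G1]
 note HI = integral_PiM_Suc[OF assms(1) Hm Hle Hm2 H1]
 have Gint: "integrable ?P0 (\<lambda>x. \<integral>y. (SUP k. (\<psi> k + s * l k y) + (\<Sum>i<n. l k (x i) - E k)) \<partial>L)" if "\<bar>s\<bar> = 2" for s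
 proof (rule P0.integrable_bounded)
  show "(\<lambda>x. \<integral>y. (SUP k. (\<psi> k + s * l k y) + (\<Sum>i<n. l k (x i) - E k)) \<partial>L) \<in> borel_measurable ?P0"
   using L.borel_measurable_lebesgue_integral[OF Gm2[OF that]] .
  show "\<bar>\<integral>y. (SUP k. (\<psi> k + s * l k y) + (\<Sum>i<n. l k (x i) - E k)) \<partial>L\<bar> <= (c + 2 * b) + real n * (2 * b)" for x
  proof (rule L.abs_integral_le)
   show "(\<lambda>y. SUP k. (\<psi> k + s * l k y) + (\<Sum>i<n. l k (x i) - E k)) \<in> borel_measurable L"
    by (rule borel_measurable_SUP_bounded[OF _ Gb[OF that]]) measurable
  qed (rule abs_SUP_le[OF Gb[OF that]])
 qed
 have "(\<integral>v. F v \<partial>?P1) <= (\<integral>x. ((\<integral>y. (SUP k. (\<psi> k + 2 * l k y) + (\<Sum>i<n. l k (x i) - E k)) \<partial>L)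
    + (\<integral>y. (SUP k. (\<psi> k + (-2) * l k y) + (\<Sum>i<n. l k (x i) - E k)) \<partial>L)) / 2 \<partial>?P0)"
  unfolding FI(1)
 proof (rule integral_mono)
  show "integrable ?P0 (\<lambda>x. \<integral>y. (SUP k. (\<psi> k + (\<Sum>i<n. l k (x i) - E k)) + (l k y - E k)) \<partial>L)"
  proof (rule P0.integrable_bounded)
   show "(\<lambda>x. \<integral>y. (SUP k. (\<psi> k + (\<Sum>i<n. l k (x i) - E k)) + (l k y - E k)) \<partial>L) \<in> borel_measurable ?P0"
    using L.borel_measurable_lebesgue_integral[OF Fm2] .
   have bb: "\<bar>(\<psi> k + (\<Sum>i<n. l k (x i) - E k)) + (l k y - E k)\<bar> <= (c + real n * (2 * b)) + 2 * b" for k y x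
    using abs_triangle_ineq[of "\<psi> k + (\<Sum>i<n. l k (x i) - E k)" "l k y - E k"] bp[of k x n] bc[of k y]
    by linarith
   show "\<bar>\<integral>y. (SUP k. (\<psi> k + (\<Sum>i<n. l k (x i) - E k)) + (l k y - E k)) \<partial>L\<bar> <= (c + real n * (2 * b)) + 2 * b" for x
   proof (rule L.abs_integral_le)
    show "(\<lambda>y. SUP k. (\<psi> k + (\<Sum>i<n. l k (x i) - E k)) + (l k y - E k)) \<in> borel_measurable L"
     by (rule borel_measurable_SUP_bounded[OF _ bb]) measurable
   qed (rule abs_SUP_le[OF bb])
  qed
  fix x
  have comm: "(\<psi> k + (\<Sum>i<n. l k (x i) - E k)) + 2 * l k y = (\<psi> k + 2 * l k y) + (\<Sum>i<n. l k (x i) - E k)"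
   "(\<psi> k + (\<Sum>i<n. l k (x i) - E k)) - 2 * l k y = (\<psi> k + (-2) * l k y) + (\<Sum>i<n. l k (x i) - E k)" for k y
   by auto
  show "(\<integral>y. (SUP k. (\<psi> k + (\<Sum>i<n. l k (x i) - E k)) + (l k y - E k)) \<partial>L) <= ((\<integral>y. (SUP k. (\<psi> k + 2 * l k y) + (\<Sum>i<n. l k (x i) - E k)) \<partial>L)
    + (\<integral>y. (SUP k. (\<psi> k + (-2) * l k y) + (\<Sum>i<n. l k (x i) - E k)) \<partial>L)) / 2"
  proof -
   define p where "p k = \<psi> k + (\<Sum>i<n. l k (x i) - E k)" for k
   have "(\<integral>y. (SUP k. p k + (l k y - (\<integral>x. l k x \<partial>L))) \<partial>L)
    <= ((\<integral>y. (SUP k. p k + 2 * l k y) \<partial>L) + (\<integral>y. (SUP k. p k - 2 * l k y) \<partial>L)) / 2"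
    by (rule L.one_step_symmetrization[where c = "c + real n * (2 * b)", OF l b]) (use bp p_def in simp)
   then show ?thesis unfolding E_def[symmetric] p_def comm .
  qed
 qed (use Gint[of 2] Gint[of "-2"] in simp)
 also have "\<dots> = ((\<integral>v. G 2 v \<partial>?P1) + (\<integral>v. G (-2) v \<partial>?P1)) / 2"
  using Gint[of 2] Gint[of "-2"] GI(1)[of 2] GI(1)[of "-2"] by simp
 also have "\<dots> <= ((\<integral>v. H 2 v \<partial>?P1) + (\<integral>v. H (-2) v \<partial>?P1)) / 2"
 proof -
  have "(\<integral>v. G s v \<partial>?P1) <= (\<integral>v. H s v \<partial>?P1)" if s: "\<bar>s\<bar> = 2" for s
   unfolding GI(2)[OF s s s] HI(2)[OF s s s]
  proof (rule integral_mono)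
   show "integrable L (\<lambda>y. \<integral>x. (SUP k. (\<psi> k + s * l k y) + (\<Sum>i<n. l k (x i) - E k)) \<partial>?P0)"
   proof (rule L.integrable_bounded)
    show "(\<lambda>y. \<integral>x. (SUP k. (\<psi> k + s * l k y) + (\<Sum>i<n. l k (x i) - E k)) \<partial>?P0) \<in> borel_measurable L"
     using P0.borel_measurable_lebesgue_integral[of "\<lambda>y x. SUP k. (\<psi> k + s * l k y) + (\<Sum>i<n. l k (x i) - E k)" L]
      measurable_pair_swap[OF Gm2[OF s]] by (simp add: case_prod_beta)
    show "\<bar>\<integral>x. (SUP k. (\<psi> k + s * l k y) + (\<Sum>i<n. l k (x i) - E k)) \<partial>?P0\<bar> <= (c + 2 * b) + real n * (2 * b)" for y
    proof (rule P0.abs_integral_le)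
     show "(\<lambda>x. SUP k. (\<psi> k + s * l k y) + (\<Sum>i<n. l k (x i) - E k)) \<in> borel_measurable ?P0"
      by (rule borel_measurable_SUP_bounded[OF _ Gb[OF s]]) measurable
    qed (rule abs_SUP_le[OF Gb[OF s]])
   qed
   show "integrable L (\<lambda>y. \<integral>x. cube_avg n (\<lambda>\<xi>. SUP k. (\<psi> k + s * l k y) + (\<Sum>i<n. \<xi> i * (2 * l k (x i)))) \<partial>?P0)"
   proof (rule L.integrable_bounded)
    show "(\<lambda>y. \<integral>x. cube_avg n (\<lambda>\<xi>. SUP k. (\<psi> k + s * l k y) + (\<Sum>i<n. \<xi> i * (2 * l k (x i)))) \<partial>?P0) \<in> borel_measurable L"
     using P0.borel_measurable_lebesgue_integral[of "\<lambda>y x. cube_avg n (\<lambda>\<xi>. SUP k. (\<psi> k + s * l k y) + (\<Sum>i<n. \<xi> i * (2 * l k (x i))))" L]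
      measurable_pair_swap[OF Hm2[OF s]] by (simp add: case_prod_beta)
    show "\<bar>\<integral>x. cube_avg n (\<lambda>\<xi>. SUP k. (\<psi> k + s * l k y) + (\<Sum>i<n. \<xi> i * (2 * l k (x i)))) \<partial>?P0\<bar> <= (c + 2 * b) + real n * (2 * b)" for y
    proof (rule P0.abs_integral_le)
     show "(\<lambda>x. cube_avg n (\<lambda>\<xi>. SUP k. (\<psi> k + s * l k y) + (\<Sum>i<n. \<xi> i * (2 * l k (x i))))) \<in> borel_measurable ?P0"
      by (rule borel_measurable_cube_avg, rule borel_measurable_SUP_bounded[OF _ Hb[OF s]]) measurable
    qed (rule cube_avg_abs_le, rule abs_SUP_le[OF Hb[OF s]])
   qed
   fix y
   show "(\<integral>x. (SUP k. (\<psi> k + s * l k y) + (\<Sum>i<n. l k (x i) - E k)) \<partial>?P0)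
    <= (\<integral>x. cube_avg n (\<lambda>\<xi>. SUP k. (\<psi> k + s * l k y) + (\<Sum>i<n. \<xi> i * (2 * l k (x i)))) \<partial>?P0)"
    unfolding E_def by (rule Suc.IH[where c = "c + 2 * b"]) (rule bs[OF s])
  qed
  from this[of 2] this[of "-2"] show ?thesis by simp
 qed
 also have "\<dots> = (\<integral>v. (H 2 v + H (-2) v) / 2 \<partial>?P1)"
  using P1.integrable_bounded[OF Hm Hle] by simp
 also have "(\<lambda>v. (H 2 v + H (-2) v) / 2) = (\<lambda>v. cube_avg (Suc n) (\<lambda>\<xi>. SUP k. \<psi> k + (\<Sum>i<Suc n. \<xi> i * (2 * l k (v i)))))"
 proof
  fix v
  have *: "(SUP k. \<psi> k + (\<Sum>i<Suc n. (\<xi>(n := t)) i * (2 * l k (v i)))) = (SUP k. (\<psi> k + (2 * t) * l k (v n)) + (\<Sum>i<n. \<xi> i * (2 * l k (v i))))" for \<xi> t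
   by (intro SUP_cong) auto
  have "(H 2 v + H (-2) v) / 2 = cube_avg n (\<lambda>\<xi>. (1 / 2) * ((SUP k. (\<psi> k + 2 * l k (v n)) + (\<Sum>i<n. \<xi> i * (2 * l k (v i))))
   + (SUP k. (\<psi> k + (-2) * l k (v n)) + (\<Sum>i<n. \<xi> i * (2 * l k (v i))))))"
   unfolding cube_avg_cmult cube_avg_add H_def by simp
  also have "\<dots> = cube_avg (Suc n) (\<lambda>\<xi>. SUP k. \<psi> k + (\<Sum>i<Suc n. \<xi> i * (2 * l k (v i))))"
   unfolding cube_avg_Suc * by (intro cube_avg_cong) simp
  finally show "(H 2 v + H (-2) v) / 2 = cube_avg (Suc n) (\<lambda>\<xi>. SUP k. \<psi> k + (\<Sum>i<Suc n. \<xi> i * (2 * l k (v i))))" .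
 qed
 finally show ?case unfolding F_def E_def .
qed

context iid_sample
begin

text \<open>For blocks of fixed length m the supremum over n points is at most the sum of the block
  suprema \<open>D m\<close>, apart from an incomplete block. These are independent, bounded and of
  mean at most \<open>2 * C * m * r m\<close> by symmetrization and contraction, so the law of large
  numbers for blocks leaves about \<open>2 * C * r m\<close> per point, small for a suitable
  m.\<close>

theorem uniform_lln:
 fixes l u :: "nat => 's => real"
 assumes bf: "bounded_functions u N B"
  and l [measurable]: "\<And>k. l k \<in> borel_measurable N" and b: "\<And>k s. \<bar>l k s\<bar> <= b"
  and lip: "\<And>k j s. \<bar>l k s - l j s\<bar> <= C * \<bar>u k s - u j s\<bar>" and C: "0 <= C"
  and rad: "AE \<omega> in M. (\<lambda>n. rademacher_avg u n (\<lambda>i. S i \<omega>)) \<longlonglongrightarrow> 0"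
 shows "AE \<omega> in M. \<forall>\<delta>>0. \<forall>\<^sub>F n in sequentially. \<forall>k.
  (\<Sum>i<n. l k (S i \<omega>) - (\<integral>s. l k s \<partial>L)) <= \<delta> * real n"
proof -
 interpret bounded_functions u N B by fact
 define E where "E k = (\<integral>s. l k s \<partial>L)" for k
 have E: "\<bar>E k\<bar> <= b" for k unfolding E_def by (rule L.abs_integral_le) (use b in auto)
 have b0: "0 <= b" using b[of undefined undefined] by linarith
 have bc: "\<bar>l k x - E k\<bar> <= 2 * b" for k x using b[of k x] E[of k] by (auto simp: abs_le_iff)
 define D where "D m v = (SUP k. \<Sum>i<m. l k (v i) - E k)" for m and v :: "nat => 's"
 have Db: "\<bar>\<Sum>i<m. l k (v i) - E k\<bar> <= real m * (2 * b)" for k v m by (rule sum_abs_le_card) (rule bc)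
 have Dm [measurable]: "D m \<in> borel_measurable (Pi\<^sub>M {..<m} (\<lambda>_. N))" for m
  unfolding D_def by (rule borel_measurable_SUP_bounded[OF _ Db]) measurable
 have Dle: "\<bar>D m v\<bar> <= real m * (2 * b)" for m v unfolding D_def by (rule abs_SUP_le[OF Db])
 have sP: "sets (Pi\<^sub>M {..<m} (\<lambda>_. L)) = sets (Pi\<^sub>M {..<m} (\<lambda>_. N))" for m :: nat
  by (intro sets_PiM_cong) (auto simp: sets_L)
 have mP: "measurable (Pi\<^sub>M {..<m} (\<lambda>_. L)) K = measurable (Pi\<^sub>M {..<m} (\<lambda>_. N)) K" for m :: nat and K :: "real measure"
  by (rule measurable_cong_sets[OF sP refl])
 have Sm: "(\<lambda>\<omega>. \<lambda>i\<in>{..<m}. S (\<sigma> i) \<omega>) \<in> measurable M (Pi\<^sub>M {..<m} (\<lambda>_. N))" for m and \<sigma> :: "nat => nat" by measurable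
 define r where "r m = (\<integral>\<omega>. rademacher_avg u m (\<lambda>i. S i \<omega>) \<partial>M)" for m
 have radm [measurable]: "(\<lambda>\<omega>. rademacher_avg u m (\<lambda>i. S i \<omega>)) \<in> borel_measurable M" for m
  using measurable_compose[OF Sm[of "\<lambda>i. i" m] rademacher_avg_measurable[of m]] by (simp only: rademacher_avg_restrict)
 \<comment> \<open>Almost sure convergence turns into convergence of means because the averages are
   bounded by \<open>B\<close>.\<close>
 have r0: "r \<longlonglongrightarrow> 0"
 proof -
  have "(\<lambda>m. \<integral>\<omega>. rademacher_avg u m (\<lambda>i. S i \<omega>) \<partial>M) \<longlonglongrightarrow> (\<integral>\<omega>. 0 \<partial>M)"
   by (rule integral_dominated_convergence[where w = "\<lambda>_. B"]) (use rad rademacher_avg_abs_le in auto)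
  then show ?thesis unfolding r_def by simp
 qed
 have ED: "(\<integral>v. D m v \<partial>Pi\<^sub>M {..<m} (\<lambda>_. L)) <= 2 * C * real m * r m" if m: "m > 0" for m
 proof -
  let ?P = "Pi\<^sub>M {..<m} (\<lambda>_. L)"
  interpret P: prob_space ?P by (rule prob_space_PiM) (rule prob_space_L)
  have lL: "l k \<in> borel_measurable L" for k using l unfolding measurable_L .
  have lb: "\<bar>\<Sum>i<m. \<xi> i * (2 * l k (v i))\<bar> <= real m * (2 * b)" if "\<xi> \<in> sign_cube m" for \<xi> k v
   using b by (intro sum_abs_le_card) (simp add: abs_mult sign_cube_abs[OF that])
  have "(\<integral>v. D m v \<partial>?P) = (\<integral>v. (SUP k. 0 + (\<Sum>i<m. l k (v i) - (\<integral>x. l k x \<partial>L))) \<partial>?P)"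
   unfolding D_def E_def by simp
  also have "\<dots> <= (\<integral>v. cube_avg m (\<lambda>\<xi>. SUP k. 0 + (\<Sum>i<m. \<xi> i * (2 * l k (v i)))) \<partial>?P)"
   by (rule symmetrization[where c = 0, OF prob_space_L lL b]) simp
  also have "\<dots> <= (\<integral>v. 2 * C * real m * rademacher_avg u m v \<partial>?P)"
  proof (rule integral_mono)
   show "integrable ?P (\<lambda>v. cube_avg m (\<lambda>\<xi>. SUP k. 0 + (\<Sum>i<m. \<xi> i * (2 * l k (v i)))))"
   proof (rule P.integrable_bounded)
    show "(\<lambda>v. cube_avg m (\<lambda>\<xi>. SUP k. 0 + (\<Sum>i<m. \<xi> i * (2 * l k (v i))))) \<in> borel_measurable ?P"
     unfolding add_0 mP by (rule borel_measurable_cube_avg, rule borel_measurable_SUP_bounded[OF _ lb]) measurable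
    show "\<bar>cube_avg m (\<lambda>\<xi>. SUP k. 0 + (\<Sum>i<m. \<xi> i * (2 * l k (v i))))\<bar> <= real m * (2 * b)" for v
     unfolding add_0 by (rule cube_avg_abs_le, rule abs_SUP_le[OF lb])
   qed
   show "integrable ?P (\<lambda>v. 2 * C * real m * rademacher_avg u m v)"
    using rademacher_avg_measurable[of m] rademacher_avg_abs_le
    by (intro integrable_mult_right P.integrable_bounded[where c = B]) (auto simp: mP)
   fix v
   have "cube_avg m (\<lambda>\<xi>. SUP k. 0 + (\<Sum>i<m. \<xi> i * (2 * l k (v i))))
    <= cube_avg m (\<lambda>\<xi>. SUP k. 0 + (\<Sum>i<m. \<xi> i * (2 * C * u k (v i))))"
   proof (rule rademacher_contraction)
    show "bounded (range (\<lambda>k. 2 * l k (v i)))" for i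
     by (rule bounded_rangeI[where c = "2 * b"]) (use b in \<open>auto simp: abs_mult\<close>)
    show "bounded (range (\<lambda>k. 2 * C * u k (v i)))" for i
     by (intro bounded_cmult_comp bounded_rangeI[OF u_bounded])
    show "\<bar>2 * l k (v i) - 2 * l j (v i)\<bar> <= \<bar>2 * C * u k (v i) - 2 * C * u j (v i)\<bar>" for i k j
    proof -
     have "2 * l k (v i) - 2 * l j (v i) = 2 * (l k (v i) - l j (v i))"
      "2 * C * u k (v i) - 2 * C * u j (v i) = 2 * C * (u k (v i) - u j (v i))"
      by (simp_all add: algebra_simps)
     then show ?thesis using lip[of k "v i" j] C by (simp add: abs_mult)
    qed
   qed auto
   also have "\<dots> = cube_avg m (\<lambda>\<xi>. SUP k. \<Sum>i<m. \<xi> i * (2 * C) * u k (v i))"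
    by (simp add: mult.assoc)
   also have "\<dots> <= 2 * C * real m * rademacher_avg u m v"
    using C by (intro cube_avg_sup_le) simp
   finally show "cube_avg m (\<lambda>\<xi>. SUP k. 0 + (\<Sum>i<m. \<xi> i * (2 * l k (v i)))) <= 2 * C * real m * rademacher_avg u m v" .
  qed
  also have "\<dots> = 2 * C * real m * (\<integral>v. rademacher_avg u m v \<partial>?P)" by simp
  also have "(\<integral>v. rademacher_avg u m v \<partial>?P) = r m"
   unfolding r_def using integral_subsample[of "\<lambda>i. i" m "rademacher_avg u m"] m
   by (simp only: rademacher_avg_restrict rademacher_avg_measurable inj_on_id2)
  finally show ?thesis .
 qed
 have blocks: "AE \<omega> in M. (\<lambda>k. (\<Sum>j<k. D m (\<lambda>i. S (j * m + i) \<omega>)) / real k) \<longlonglongrightarrow> (\<integral>v. D m v \<partial>Pi\<^sub>M {..<m} (\<lambda>_. L))" if m: "m > 0" for m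
 proof (rule slln_bounded[where X = "\<lambda>j \<omega>. D m (\<lambda>i. S (j * m + i) \<omega>)"])
  have Dr: "D m (\<lambda>i\<in>{..<m}. v i) = D m v" for v unfolding D_def by simp
  show "\<bar>D m (\<lambda>i. S (j * m + i) \<omega>)\<bar> <= real m * (2 * b)" for j \<omega> by (rule Dle)
  show "(\<integral>\<omega>. D m (\<lambda>i. S (j * m + i) \<omega>) \<partial>M) = (\<integral>v. D m v \<partial>Pi\<^sub>M {..<m} (\<lambda>_. L))" for j
   using integral_subsample[of "\<lambda>i. j * m + i" m "D m"] m Dm by (simp only: Dr) (auto simp: inj_on_def)
  define K where "K j = {j * m..<j * m + m}" for j
  have disj: "disjoint_family K"
   unfolding disjoint_family_on_def
  proof safe
   fix p q x assume "p ~= q" "x \<in> K p" "x \<in> K q"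
   then have "x div m = p" "x div m = q"
    unfolding K_def using m by (auto intro!: div_nat_eqI simp: algebra_simps)
   with \<open>p ~= q\<close> show "x \<in> {}" by simp
  qed
  have "indep_vars (\<lambda>_. borel) (\<lambda>j \<omega>. (\<lambda>v. D m (\<lambda>i\<in>{..<m}. v (j * m + i))) (\<lambda>i\<in>K j. S i \<omega>)) UNIV"
  proof (rule indep_vars_compose2[OF indep_blocks[OF disj]])
   fix j :: nat
   have "(\<lambda>v. \<lambda>i\<in>{..<m}. v (j * m + i)) \<in> measurable (Pi\<^sub>M (K j) (\<lambda>_. N)) (Pi\<^sub>M {..<m} (\<lambda>_. N))"
    by (intro measurable_restrict measurable_component_singleton) (auto simp: K_def)
   from measurable_compose[OF this Dm]
   show "(\<lambda>v. D m (\<lambda>i\<in>{..<m}. v (j * m + i))) \<in> borel_measurable (Pi\<^sub>M (K j) (\<lambda>_. N))" .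
  qed
  moreover have "D m (\<lambda>i\<in>{..<m}. (\<lambda>i\<in>K j. S i \<omega>) (j * m + i)) = D m (\<lambda>i. S (j * m + i) \<omega>)" for j \<omega>
   unfolding Dr D_def K_def by (intro SUP_cong sum.cong refl) auto
  ultimately show "indep_vars (\<lambda>_. borel) (\<lambda>j \<omega>. D m (\<lambda>i. S (j * m + i) \<omega>)) UNIV"
   by (simp only:)
 qed
 then have "AE \<omega> in M. \<forall>m. (\<lambda>k. (\<Sum>j<k. D (Suc m) (\<lambda>i. S (j * Suc m + i) \<omega>)) / real k) \<longlonglongrightarrow> (\<integral>v. D (Suc m) v \<partial>Pi\<^sub>M {..<Suc m} (\<lambda>_. L))"
  unfolding AE_all_countable by blast
 then show ?thesis
 proof eventually_elim
  case (elim \<omega>)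
  show ?case
  proof (intro allI impI)
   fix \<delta> :: real assume \<delta>: "\<delta> > 0"
   have "(\<lambda>m. 2 * C * r (Suc m)) \<longlonglongrightarrow> 2 * C * 0"
    by (intro tendsto_intros LIMSEQ_Suc[OF r0])
   then have "\<forall>\<^sub>F m in sequentially. 2 * C * r (Suc m) < \<delta> / 4"
    using \<delta> by (intro order_tendstoD(2)) auto
   \<comment> \<open>One block length is fixed here. The slack between \<delta> / 4 and \<delta> / 2
     absorbs the fluctuation of the block means.\<close>
   then obtain m0 where m0: "2 * C * r (Suc m0) < \<delta> / 4" by (auto simp: eventually_sequentially)
   define m where "m = Suc m0"
   have m: "m > 0" unfolding m_def by simp
   have "(\<integral>v. D m v \<partial>Pi\<^sub>M {..<m} (\<lambda>_. L)) < \<delta> / 2 * real m"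
   proof -
    have "2 * C * r m * real m < \<delta> / 2 * real m"
     using m m0 \<delta> unfolding m_def[symmetric] by (intro mult_strict_right_mono) auto
    then show ?thesis using ED[OF m] by (simp add: mult_ac)
   qed
   then have "\<forall>\<^sub>F k in sequentially. (\<Sum>j<k. D m (\<lambda>i. S (j * m + i) \<omega>)) / real k < \<delta> / 2 * real m"
    using elim[rule_format, of m0] unfolding m_def[symmetric] by (rule order_tendstoD(2)[rotated])
   moreover have "filterlim (\<lambda>n. n div m) sequentially sequentially"
    using m by (intro filterlim_at_top_div_const_nat) auto
   ultimately have ev: "\<forall>\<^sub>F n in sequentially. (\<Sum>j<n div m. D m (\<lambda>i. S (j * m + i) \<omega>)) / real (n div m) < \<delta> / 2 * real m"
    by (rule eventually_compose_filterlim)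
   have "\<forall>\<^sub>F n in sequentially. real n > 4 * b * real m / \<delta>"
    using filterlim_real_sequentially by (rule filterlim_at_top_dense[THEN iffD1, rule_format])
   with ev eventually_ge_at_top[of m]
   show "\<forall>\<^sub>F n in sequentially. \<forall>k. (\<Sum>i<n. l k (S i \<omega>) - (\<integral>s. l k s \<partial>L)) <= \<delta> * real n"
   proof eventually_elim
    case (elim n)
    \<comment> \<open>The fewer than m points after the q full blocks cost at most 2 b each, which
      the choice of n keeps below \<delta> n / 2.\<close>
    define q where "q = n div m"
    have q: "q > 0" unfolding q_def using elim(2) m by (simp add: div_greater_zero_iff)
    have qm: "q * m <= n" "n < q * m + m" unfolding q_def using dividend_less_div_times[OF m, of n] by simp_all
    show ?case
    proof
     fix k
     have split: "(\<Sum>i<q' * m. f i) = (\<Sum>j<q'. \<Sum>i<m. f (j * m + i))" for q' and f :: "nat => real"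
     proof (induction q')
      case (Suc q')
      have "(\<Sum>i<Suc q' * m. f i) = (\<Sum>i<q' * m. f i) + (\<Sum>i=q'*m..<q'*m+m. f i)"
       using sum.atLeastLessThan_concat[of 0 "q' * m" "q' * m + m" f] by (simp add: atLeast0LessThan add.commute)
      also have "(\<Sum>i=q'*m..<q'*m+m. f i) = (\<Sum>i<m. f (q' * m + i))"
       using sum.shift_bounds_nat_ivl[of f 0 "q' * m" m] by (simp add: atLeast0LessThan add.commute)
      finally show ?case using Suc by simp
     qed simp
     have "(\<Sum>i<n. l k (S i \<omega>) - E k) = (\<Sum>i<q * m. l k (S i \<omega>) - E k) + (\<Sum>i=q*m..<n. l k (S i \<omega>) - E k)"
      using sum.atLeastLessThan_concat[of 0 "q * m" n "\<lambda>i. l k (S i \<omega>) - E k"] qm by (simp add: atLeast0LessThan)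
     also have "(\<Sum>i=q*m..<n. l k (S i \<omega>) - E k) <= real (card {q*m..<n}) * (2 * b)"
      using bc by (intro sum_bounded_above) (auto simp: abs_le_iff)
     also have "\<dots> <= real m * (2 * b)"
     proof (intro mult_right_mono)
      have "card {q*m..<n} <= m" using qm by simp
      then show "real (card {q*m..<n}) <= real m" by (simp only: of_nat_le_iff)
     qed (use b0 in simp)
     also have "(\<Sum>i<q * m. l k (S i \<omega>) - E k) <= (\<Sum>j<q. D m (\<lambda>i. S (j * m + i) \<omega>))"
      unfolding split D_def by (intro sum_mono cSUP_upper bdd_above_rangeI[OF Db]) auto
     also have "\<dots> <= \<delta> / 2 * real m * real q"
      using elim(1) q unfolding q_def[symmetric] by (simp add: divide_less_eq less_imp_le)
     also have "\<dots> <= \<delta> / 2 * real n"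
     proof -
      have "real q * real m <= real n" using qm(1) by (metis of_nat_le_iff of_nat_mult)
      then have "\<delta> / 2 * (real q * real m) <= \<delta> / 2 * real n" using \<delta> by (intro mult_left_mono) auto
      then show ?thesis by (simp add: mult_ac)
     qed
     also have "real m * (2 * b) <= \<delta> / 2 * real n" using elim(3) \<delta> by (simp add: field_simps)
     finally show "(\<Sum>i<n. l k (S i \<omega>) - (\<integral>s. l k s \<partial>L)) <= \<delta> * real n" unfolding E_def by simp
    qed
   qed
  qed
 qed
qed

end

section \<open>Legendre duality\<close>

lemma legendre_eqI:
 assumes "y \<in> {0..W}" "\<And>y'. y' \<in> {0..W} ==> y' * s - \<rho> y' <= y * s - \<rho> y"
 shows "legendre W \<rho> s = y * s - \<rho> y"
 unfolding legendre_def by (rule cSup_eq_maximum) (use assms in auto)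

locale strictly_convex_cost =
 fixes W :: real and \<rho> :: "real => real"
 assumes W_pos: "0 < W" and strict: "strictly_convex_on {0..W} \<rho>" and cont: "continuous_on {0..W} \<rho>"
begin

text \<open>The midpoint gap is continuous and, by strict convexity, positive on the compact set of
  pairs at distance at least \<delta>, so it attains a positive minimum. This replaces a modulus of
  strong convexity for \<rho>.\<close>

lemma uniform_midpoint_gap:
 assumes "\<delta> > 0"
 shows "\<exists>\<kappa>>0. \<forall>x\<in>{0..W}. \<forall>y\<in>{0..W}. \<delta> <= \<bar>x - y\<bar> \<longrightarrow> \<rho> ((x + y) / 2) + \<kappa> <= (\<rho> x + \<rho> y) / 2"
proof -
 define K where "K = {p \<in> {0..W} \<times> {0..W}. \<delta> <= \<bar>fst p - snd p\<bar>}"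
 define g where "g p = (\<rho> (fst p) + \<rho> (snd p)) / 2 - \<rho> ((fst p + snd p) / 2)" for p
 have "closed {p :: real \<times> real. \<delta> <= \<bar>fst p - snd p\<bar>}"
  by (intro closed_Collect_le continuous_intros)
 then have "compact (({0..W} \<times> {0..W}) \<inter> {p. \<delta> <= \<bar>fst p - snd p\<bar>})"
  by (intro compact_Int_closed compact_Times) auto
 moreover have "({0..W} \<times> {0..W}) \<inter> {p. \<delta> <= \<bar>fst p - snd p\<bar>} = K" unfolding K_def by auto
 ultimately have K: "compact K" by simp
 have gpos: "g p > 0" if "p \<in> K" for p
 proof -
  have "fst p \<in> {0..W}" "snd p \<in> {0..W}" "fst p ~= snd p" using that assms unfolding K_def by auto
  then have "\<rho> ((1 - 1/2) * fst p + 1/2 * snd p) < (1 - 1/2) * \<rho> (fst p) + 1/2 * \<rho> (snd p)"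
   using strict[unfolded strictly_convex_on_def] by (metis greaterThanLessThan_iff half_gt_zero less_numeral_extra(1) field_sum_of_halves less_add_same_cancel1)
  then show ?thesis unfolding g_def by (simp add: add_divide_distrib)
 qed
 have gc: "continuous_on K g"
  unfolding g_def
  by (intro continuous_intros continuous_on_compose2[OF cont]) (auto simp: K_def)
 show ?thesis
 proof (cases "K = {}")
  case True
  then show ?thesis unfolding K_def by (intro exI[of _ 1]) auto
 next
  case False
  then obtain p where p: "p \<in> K" "\<And>q. q \<in> K ==> g p <= g q"
   using continuous_attains_inf[OF K _ gc] by blast
  show ?thesis
  proof (intro exI[of _ "g p"] conjI ballI impI)
   fix x y assume "x \<in> {0..W}" "y \<in> {0..W}" "\<delta> <= \<bar>x - y\<bar>"
   then have "g p <= g (x, y)" by (intro p(2)) (auto simp: K_def)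
   then show "\<rho> ((x + y) / 2) + g p <= (\<rho> x + \<rho> y) / 2"
    unfolding g_def fst_conv snd_conv by linarith
  qed (use gpos p in auto)
 qed
qed

text \<open>The point where the Legendre transform is attained. By \<open>deriv_legendre\<close> it
  is the derivative of the transform, so well-specification says that the density ratio is
  \<open>maximizer\<close> of c + f.\<close>

definition maximizer :: "real => real" where
 "maximizer s = (SOME y. y \<in> {0..W} \<and> (\<forall>y'\<in>{0..W}. y' * s - \<rho> y' <= y * s - \<rho> y))"

lemma maximizer: "maximizer s \<in> {0..W}" "y \<in> {0..W} ==> y * s - \<rho> y <= maximizer s * s - \<rho> (maximizer s)"
proof -
 have "\<exists>y\<in>{0..W}. \<forall>y'\<in>{0..W}. y' * s - \<rho> y' <= y * s - \<rho> y"
  using W_pos by (intro continuous_attains_sup continuous_intros cont) auto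
 then have "\<exists>y. y \<in> {0..W} \<and> (\<forall>y'\<in>{0..W}. y' * s - \<rho> y' <= y * s - \<rho> y)" by blast
 from someI_ex[OF this] show "maximizer s \<in> {0..W}"
  "y \<in> {0..W} ==> y * s - \<rho> y <= maximizer s * s - \<rho> (maximizer s)"
  unfolding maximizer_def by blast+
qed

lemma legendre_maximizer: "legendre W \<rho> s = maximizer s * s - \<rho> (maximizer s)"
 by (rule legendre_eqI) (use maximizer in auto)

text \<open>The midpoint of y and the maximiser does no better than the maximiser, so the excess at
  y is at least twice the midpoint gap. The constant is uniform in s because a linear tilt leaves
  the midpoint gap unchanged.\<close>

lemma bregman_gap:
 assumes "\<delta> > 0"
 shows "\<exists>\<kappa>>0. \<forall>s. \<forall>y\<in>{0..W}. \<delta> <= \<bar>y - maximizer s\<bar> \<longrightarrow>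
  \<rho> (maximizer s) - s * maximizer s + \<kappa> <= \<rho> y - s * y"
proof -
 obtain \<kappa> where \<kappa>: "\<kappa> > 0"
  "\<And>x y. x \<in> {0..W} ==> y \<in> {0..W} ==> \<delta> <= \<bar>x - y\<bar> ==> \<rho> ((x + y) / 2) + \<kappa> <= (\<rho> x + \<rho> y) / 2"
  using uniform_midpoint_gap[OF assms] by blast
 show ?thesis
 proof (intro exI[of _ "2 * \<kappa>"] conjI allI ballI impI)
  fix s y assume y: "y \<in> {0..W}" and d: "\<delta> <= \<bar>y - maximizer s\<bar>"
  have mid: "(y + maximizer s) / 2 \<in> {0..W}" using y maximizer(1)[of s] by auto
  have "(y + maximizer s) / 2 * s - \<rho> ((y + maximizer s) / 2) <= maximizer s * s - \<rho> (maximizer s)"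
   using maximizer(2)[OF mid] .
  then show "\<rho> (maximizer s) - s * maximizer s + 2 * \<kappa> <= \<rho> y - s * y"
   using \<kappa>(2)[OF y maximizer(1) d] by (simp add: field_simps)
 qed (use \<kappa> in simp)
qed

text \<open>Were \<open>maximizer x\<close> at distance \<delta> or more from
  \<open>maximizer s\<close>, the gap at s together with optimality at x would give \<kappa> <= (x -
  s) times their difference, which is at most |x - s| W. Hence the radius \<kappa> / W.\<close>

lemma isCont_maximizer: "isCont maximizer s"
 unfolding isCont_def
proof (rule LIM_I)
 fix \<delta> :: real assume "0 < \<delta>"
 from bregman_gap[OF this] obtain \<kappa> where \<kappa>: "\<kappa> > 0"
  "\<And>s y. y \<in> {0..W} ==> \<delta> <= \<bar>y - maximizer s\<bar> ==> \<rho> (maximizer s) - s * maximizer s + \<kappa> <= \<rho> y - s * y"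
  by blast
 show "\<exists>r>0. \<forall>x. x ~= s \<and> norm (x - s) < r \<longrightarrow> norm (maximizer x - maximizer s) < \<delta>"
 proof (intro exI[of _ "\<kappa> / W"] conjI allI impI)
  fix x assume x: "x ~= s \<and> norm (x - s) < \<kappa> / W"
  show "norm (maximizer x - maximizer s) < \<delta>"
  proof (rule ccontr)
   assume "\<not> norm (maximizer x - maximizer s) < \<delta>"
   then have "\<rho> (maximizer s) - s * maximizer s + \<kappa> <= \<rho> (maximizer x) - s * maximizer x"
    by (intro \<kappa>(2) maximizer(1)) auto
   with maximizer(2)[OF maximizer(1), of s x] have "\<kappa> <= (x - s) * (maximizer x - maximizer s)"
    by (simp add: algebra_simps)
   also have "\<dots> <= \<bar>x - s\<bar> * \<bar>maximizer x - maximizer s\<bar>"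
    by (metis abs_ge_self abs_mult)
   also have "\<dots> <= \<bar>x - s\<bar> * W"
    using maximizer(1)[of x] maximizer(1)[of s] by (intro mult_left_mono) auto
   also have "\<dots> < \<kappa>" using x W_pos by (simp add: field_simps)
   finally show False by simp
  qed
 qed (use \<kappa> W_pos in simp)
qed

text \<open>Envelope argument: the maximisers at s and x are subgradients at their points and
  sandwich the difference quotient; continuity of the maximiser closes the gap.\<close>

lemma deriv_legendre: "deriv (legendre W \<rho>) s = maximizer s"
proof -
 have lo: "maximizer s * (x - s) <= legendre W \<rho> x - legendre W \<rho> s" for x s
  using maximizer(2)[OF maximizer(1), of s x] unfolding legendre_maximizer by (simp add: algebra_simps)
 have "(legendre W \<rho> has_real_derivative maximizer s) (at s)"
  unfolding has_field_derivative_iff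
 proof (rule tendstoI)
  fix e :: real assume "e > 0"
  then have "\<forall>\<^sub>F x in at s. dist (maximizer x) (maximizer s) < e"
   using isCont_maximizer[of s] by (auto simp: isCont_def intro: tendstoD)
  moreover have "\<forall>\<^sub>F x in at s. x ~= s" by (simp add: eventually_at_filter)
  ultimately show "\<forall>\<^sub>F x in at s. dist ((legendre W \<rho> x - legendre W \<rho> s) / (x - s)) (maximizer s) < e"
  proof eventually_elim
   case (elim x)
   then have ne: "x ~= s" by simp
   have "\<bar>(legendre W \<rho> x - legendre W \<rho> s) - maximizer s * (x - s)\<bar> <= \<bar>(maximizer x - maximizer s) * (x - s)\<bar>"
    using lo[of s x] lo[of x s] by (simp add: algebra_simps)
   moreover have "(legendre W \<rho> x - legendre W \<rho> s) / (x - s) - maximizer s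
    = ((legendre W \<rho> x - legendre W \<rho> s) - maximizer s * (x - s)) / (x - s)"
    using ne by (simp add: diff_divide_distrib)
   ultimately have "\<bar>(legendre W \<rho> x - legendre W \<rho> s) / (x - s) - maximizer s\<bar> <= \<bar>maximizer x - maximizer s\<bar>"
    using ne by (simp only: abs_divide abs_mult) (simp add: pos_divide_le_eq)
   then show ?case using elim by (simp add: dist_real_def)
  qed
 qed
 then show ?thesis by (rule DERIV_imp_deriv)
qed

end

section \<open>The transforms of the square and of the entropy\<close>

lemma convex_on_transform:
 assumes "convex_on I g" "\<And>x. x \<in> I ==> f x = g x" shows "convex_on I f"
 using assms unfolding convex_on_def by (metis convexD)

text \<open>Slopes strictly between the one-sided limits 0 and 2W have the interior maximiser x/2,
  so the transform is x^2/4 there: subtracting the quadratic of modulus 1/2 leaves the zero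
  function, and the derivative x/2 is 1/2-Lipschitz.\<close>

lemma legendre_regular_square:
 assumes "0 < W" shows "legendre_regular W (\<lambda>x. x\<^sup>2)"
 unfolding legendre_regular_def
proof (intro allI impI)
 fix I :: "real set"
 assume I: "is_interval I \<and> bounded I \<and> (\<forall>x\<in>I. Lim (at_right 0) (\<lambda>y. ereal (deriv (\<lambda>x. x\<^sup>2) y)) < ereal x \<and>
  ereal x < Lim (at_left W) (\<lambda>y. ereal (deriv (\<lambda>x. x\<^sup>2) y)))"
 have d: "deriv (\<lambda>x. x\<^sup>2) y = 2 * y" for y :: real
  by (rule DERIV_imp_deriv) (auto intro!: derivative_eq_intros)
 have "((\<lambda>y. ereal (2 * y)) \<longlongrightarrow> ereal (2 * 0)) (at_right 0)" "((\<lambda>y. ereal (2 * y)) \<longlongrightarrow> ereal (2 * W)) (at_left W)"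
  by (rule tendsto_ereal, intro tendsto_intros)+
 then have "Lim (at_right 0) (\<lambda>y. ereal (2 * y)) = ereal (2 * 0)" "Lim (at_left W) (\<lambda>y. ereal (2 * y)) = ereal (2 * W)"
  by (auto intro!: tendsto_Lim)
 with I have I': "x \<in> {0<..<2 * W}" if "x \<in> I" for x using that by (auto simp: d)
 have eq: "legendre W (\<lambda>x. x\<^sup>2) x = x\<^sup>2 / 4" if "x \<in> {0<..<2 * W}" for x
 proof -
  have "y * x - y\<^sup>2 <= x / 2 * x - (x / 2)\<^sup>2" for y
   using zero_le_power2[of "y - x / 2"] by (simp add: power2_eq_square algebra_simps)
  then have "legendre W (\<lambda>x. x\<^sup>2) x = x / 2 * x - (x / 2)\<^sup>2"
   using that by (intro legendre_eqI) auto
  then show ?thesis by (simp add: power2_eq_square)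
 qed
 have der: "(legendre W (\<lambda>x. x\<^sup>2) has_real_derivative x / 2) (at x)" if "x \<in> {0<..<2 * W}" for x
 proof (rule has_field_derivative_transform_within_open[of "\<lambda>x. x\<^sup>2 / 4" _ _ "{0<..<2 * W}"])
  show "((\<lambda>x. x\<^sup>2 / 4) has_real_derivative x / 2) (at x)" by (auto intro!: derivative_eq_intros)
 qed (use that eq in auto)
 have "convex_on I (\<lambda>x. legendre W (\<lambda>x. x\<^sup>2) x - (1 / 2) / 2 * x\<^sup>2)"
 proof -
  have z: "legendre W (\<lambda>x. x\<^sup>2) x - (1 / 2) / 2 * x\<^sup>2 = 0" if "x \<in> I" for x
   using eq[OF I'[OF that]] by simp
  have cI: "convex I" using I is_interval_convex by blast
  then have "convex_on I (\<lambda>x. 0 :: real)" by (simp add: convex_on_def)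
  then show ?thesis by (rule convex_on_transform) (rule z)
 qed
 moreover have "(1/2)-lipschitz_on I (deriv (legendre W (\<lambda>x. x\<^sup>2)))"
  by (intro lipschitz_onI) (simp_all add: DERIV_imp_deriv[OF der[OF I']] dist_real_def diff_divide_distrib[symmetric])
 ultimately show "strongly_convex_on I (legendre W (\<lambda>x. x\<^sup>2)) \<and> smooth_on I (legendre W (\<lambda>x. x\<^sup>2))"
  unfolding strongly_convex_on_def smooth_on_def
  using der[OF I'] by (auto intro: exI[of _ "1/2"] simp: real_differentiable_def)
qed

lemma exp_lipschitz_on:
 fixes I :: "real set" assumes "\<And>x. x \<in> I ==> x <= b"
 shows "(exp (b - 1))-lipschitz_on I (\<lambda>x. exp (x - 1))"
proof (rule lipschitz_onI)
 have main: "exp (x - 1) - exp (y - 1) <= exp (b - 1) * (x - y)" if "x \<in> I" "y <= x" for x y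
 proof -
  have "exp (x - 1) * (1 + (y - x)) <= exp (x - 1) * exp (y - x)"
   by (intro mult_left_mono) (auto simp: add.commute)
  also have "\<dots> = exp (y - 1)" by (simp add: exp_add[symmetric])
  finally have "exp (x - 1) - exp (y - 1) <= exp (x - 1) * (x - y)" by (simp add: algebra_simps)
  also have "\<dots> <= exp (b - 1) * (x - y)" using that assms by (intro mult_right_mono) auto
  finally show ?thesis .
 qed
 show "dist (exp (x - 1)) (exp (y - 1)) <= exp (b - 1) * dist x y" if "x \<in> I" "y \<in> I" for x y
 proof (cases "y <= x")
  case True
  then show ?thesis using main[of x y] that by (simp add: dist_real_def)
 next
  case False
  then show ?thesis using main[of y x] that by (simp add: dist_real_def)
 qed
qed simp

text \<open>For slopes below ln W + 1 the maximiser is exp(x - 1), which is also the value of the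
  transform and its derivative.\<close>

lemma legendre_regular_entropy:
 assumes "0 < W" shows "legendre_regular W (\<lambda>x. x * ln x)"
 unfolding legendre_regular_def
proof (intro allI impI)
 fix I :: "real set"
 assume I: "is_interval I \<and> bounded I \<and> (\<forall>x\<in>I. Lim (at_right 0) (\<lambda>y. ereal (deriv (\<lambda>x. x * ln x) y)) < ereal x \<and>
  ereal x < Lim (at_left W) (\<lambda>y. ereal (deriv (\<lambda>x. x * ln x) y)))"
 have d: "deriv (\<lambda>x. x * ln x) y = ln y + 1" if "y > 0" for y :: real
  by (rule DERIV_imp_deriv) (use that in \<open>auto intro!: derivative_eq_intros\<close>)
 have "((\<lambda>y. ereal (ln y + 1)) \<longlongrightarrow> ereal (ln W + 1)) (at_left W)"
  using assms by (auto intro!: tendsto_intros)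
 moreover have "\<forall>\<^sub>F y in at_left W. ereal (ln y + 1) = ereal (deriv (\<lambda>x. x * ln x) y)"
 proof -
  have "\<forall>\<^sub>F y in at_left W. y \<in> {0<..<W}" using eventually_at_left_real[OF assms] .
  then show ?thesis by eventually_elim (simp add: d)
 qed
 ultimately have "((\<lambda>y. ereal (deriv (\<lambda>x. x * ln x) y)) \<longlongrightarrow> ereal (ln W + 1)) (at_left W)"
  by (rule Lim_transform_eventually)
 then have "Lim (at_left W) (\<lambda>y. ereal (deriv (\<lambda>x. x * ln x) y)) = ereal (ln W + 1)"
  by (intro tendsto_Lim) auto
 with I have I': "x \<in> {..<ln W + 1}" if "x \<in> I" for x using that by auto
 have eq: "legendre W (\<lambda>x. x * ln x) x = exp (x - 1)" if "x \<in> {..<ln W + 1}" for x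
 proof -
  have up: "y * x - y * ln y <= exp (x - 1)" if "y \<in> {0..W}" for y
  proof (cases "y = 0")
   case False
   then have y: "y > 0" using that by auto
   have "y * (1 + (x - 1 - ln y)) <= y * exp (x - 1 - ln y)"
    using y by (intro mult_left_mono exp_ge_add_one_self) simp
   also have "\<dots> = exp (x - 1)" using y by (simp add: exp_diff)
   finally show ?thesis by (simp add: algebra_simps)
  qed simp
  have "exp (x - 1) < exp (ln W)" using that by (subst exp_less_cancel_iff) auto
  then have mem: "exp (x - 1) \<in> {0..W}" using assms by simp
  have "legendre W (\<lambda>x. x * ln x) x = exp (x - 1) * x - exp (x - 1) * ln (exp (x - 1))"
   using up by (intro legendre_eqI[OF mem]) (simp add: algebra_simps)
  then show ?thesis by (simp add: algebra_simps)
 qed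
 have der: "(legendre W (\<lambda>x. x * ln x) has_real_derivative exp (x - 1)) (at x)" if "x \<in> {..<ln W + 1}" for x
 proof (rule has_field_derivative_transform_within_open[of "\<lambda>x. exp (x - 1)" _ _ "{..<ln W + 1}"])
  show "((\<lambda>x. exp (x - 1)) has_real_derivative exp (x - 1)) (at x)" by (auto intro!: derivative_eq_intros)
 qed (use that eq in auto)
 \<comment> \<open>Boundedness of the interval supplies the modulus of strong convexity: the second
   derivative exp(x - 1) is at least exp(a - 1). At the upper end the slope bound ln W + 1 gives the
   Lipschitz constant.\<close>
 obtain a where a: "\<And>x. x \<in> I ==> a <= x" using I bounded_imp_bdd_below[of I] by (auto simp: bdd_below_def)
 have cI: "convex I" using I is_interval_convex by blast
 have "convex_on I (\<lambda>x. exp (x - 1) - exp (a - 1) / 2 * x\<^sup>2)"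
 proof (rule f''_ge0_imp_convex[OF cI])
  show "((\<lambda>x. exp (x - 1) - exp (a - 1) / 2 * x\<^sup>2) has_real_derivative exp (x - 1) - exp (a - 1) * x) (at x)" for x
   by (auto intro!: derivative_eq_intros)
  show "((\<lambda>x. exp (x - 1) - exp (a - 1) * x) has_real_derivative exp (x - 1) - exp (a - 1)) (at x)" for x
   by (auto intro!: derivative_eq_intros)
  show "0 <= exp (x - 1) - exp (a - 1)" if "x \<in> I" for x using a[OF that] by simp
 qed
 then have cv: "convex_on I (\<lambda>x. legendre W (\<lambda>x. x * ln x) x - exp (a - 1) / 2 * x\<^sup>2)"
  by (rule convex_on_transform) (use eq[OF I'] in simp)
 have "(exp (ln W + 1 - 1))-lipschitz_on I (\<lambda>x. exp (x - 1))"
  by (rule exp_lipschitz_on) (use I' in \<open>auto intro: less_imp_le\<close>)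
 then have "(exp (ln W + 1 - 1))-lipschitz_on I (deriv (legendre W (\<lambda>x. x * ln x)))"
  by (rule lipschitz_on_transform) (use DERIV_imp_deriv[OF der[OF I']] in auto)
 with cv show "strongly_convex_on I (legendre W (\<lambda>x. x * ln x)) \<and> smooth_on I (legendre W (\<lambda>x. x * ln x))"
  unfolding strongly_convex_on_def smooth_on_def real_differentiable_def
  using der[OF I'] exp_gt_zero by blast
qed

section \<open>Identification of the dose-response function\<close>

text \<open>Points outside the support are covered by null open sets, hence by the null members of a
  countable basis.\<close>

lemma AE_measure_support:
 fixes P :: "'a::second_countable_topology measure"
 assumes sP: "sets P = sets borel"
 shows "AE x in P. x \<in> measure_support P"
proof -
 obtain \<B> :: "'a set set" where \<B>: "countable \<B>" "topological_basis \<B>"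
  using ex_countable_basis by blast
 define \<N> where "\<N> = {U \<in> \<B>. emeasure P U = 0}"
 have "AE x in P. \<forall>U\<in>\<N>. x \<notin> U"
 proof (rule AE_ball_countable[THEN iffD2, rule_format])
  show "countable \<N>" unfolding \<N>_def using \<B>(1) by simp
  fix U assume "U \<in> \<N>"
  then have "open U" "emeasure P U = 0" using topological_basis_open[OF \<B>(2)] unfolding \<N>_def by auto
  then show "AE x in P. x \<notin> U" by (intro AE_not_in) (auto simp: null_sets_def sP)
 qed
 then show ?thesis
 proof eventually_elim
  case (elim x)
  show ?case unfolding measure_support_def
  proof (intro CollectI allI impI)
   fix U assume "open U" "x \<in> U"
   then obtain V where V: "V \<in> \<B>" "x \<in> V" "V \<subseteq> U" using topological_basisE[OF \<B>(2)] by metis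
   then have "emeasure P V ~= 0" using elim unfolding \<N>_def by auto
   moreover have "emeasure P V <= emeasure P U" using V \<open>open U\<close> by (intro emeasure_mono) (auto simp: sP)
   ultimately show "emeasure P U > 0" by (metis not_gr_zero le_zero_eq)
  qed
 qed
qed

lemma closed_measure_support: "closed (measure_support P)"
proof -
 have "- measure_support P = \<Union>{U. open U \<and> \<not> emeasure P U > 0}"
  unfolding measure_support_def by auto
 then show ?thesis unfolding closed_def by (auto intro!: open_Union)
qed

lemma measure_support_nullI:
 "open U ==> emeasure P U = 0 ==> U \<inter> measure_support P = {}"
 unfolding measure_support_def by auto

text \<open>Doob--Dynkin for bounded functions.\<close>

lemma vimage_algebra_factorization:
 fixes f :: "'a => real"
 assumes f: "f \<in> borel_measurable (vimage_algebra \<Omega> V N)" and V: "V \<in> \<Omega> \<rightarrow> space N"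
  and c: "\<And>x. x \<in> \<Omega> ==> \<bar>f x\<bar> <= c"
 obtains g where "g \<in> borel_measurable N" "\<And>x. x \<in> \<Omega> ==> g (V x) = f x" "\<And>y. \<bar>g y\<bar> <= \<bar>c\<bar>"
proof -
 define C where "C = \<bar>c\<bar>"
 \<comment> \<open>Rationals clipped to [-C, C]: \<open>f\<close> is recovered as the supremum of
   the \<open>r n\<close> below it, each superlevel set being a preimage under \<open>V\<close>. The
   default value -C keeps the resulting function bounded also off the range of
   \<open>V\<close>.\<close>
 define r where "r n = max (- C) (min C (real_of_rat (from_nat_into UNIV n)))" for n
 have C0: "0 <= C" unfolding C_def by simp
 have rC: "- C <= r n" "r n <= C" for n unfolding r_def using C0 by auto
 have fC: "\<bar>f x\<bar> <= C" if "x \<in> \<Omega>" for x using c[OF that] unfolding C_def by linarith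
 have "\<exists>B\<in>sets N. {x \<in> \<Omega>. r n < f x} = V -` B \<inter> \<Omega>" for n
 proof -
  have "{x \<in> space (vimage_algebra \<Omega> V N). r n < f x} \<in> sets (vimage_algebra \<Omega> V N)"
   using f by measurable
  then show ?thesis using V by (auto simp: sets_vimage_algebra2)
 qed
 then obtain A where A: "\<And>n. A n \<in> sets N" "\<And>n. {x \<in> \<Omega>. r n < f x} = V -` A n \<inter> \<Omega>" by metis
 define g where "g y = (SUP n. if y \<in> A n then r n else - C)" for y
 have bd: "\<bar>if y \<in> A n then r n else - C\<bar> <= C" for y n using rC[of n] C0 by (auto simp: abs_le_iff minus_le_iff)
 show ?thesis
 proof (rule that)
  show "g \<in> borel_measurable N"
   unfolding g_def
   by (rule borel_measurable_SUP_bounded[OF _ bd]) (use A in measurable)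
  show "\<bar>g y\<bar> <= \<bar>c\<bar>" for y unfolding g_def C_def[symmetric] by (rule abs_SUP_le[OF bd])
  fix x assume x: "x \<in> \<Omega>"
  have mem: "V x \<in> A n \<longleftrightarrow> r n < f x" for n using A(2)[of n] x by auto
  show "g (V x) = f x"
  proof (rule antisym)
   show "g (V x) <= f x"
    unfolding g_def using fC[OF x] by (intro cSUP_least) (auto simp: mem abs_le_iff)
   show "f x <= g (V x)"
   proof (rule dense_le)
    fix a assume a: "a < f x"
    have up: "(if V x \<in> A n then r n else - C) <= g (V x)" for n
     unfolding g_def by (intro cSUP_upper bdd_above_rangeI[OF bd]) auto
    obtain q where q: "a < real_of_rat q" "real_of_rat q < f x" using of_rat_dense[OF a] by blast
    obtain n where n: "from_nat_into UNIV n = q"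
     using from_nat_into_surj[of "UNIV :: rat set" q] by (auto simp: countableI_type)
    have "a <= max (- C) (real_of_rat q)" using q by simp
    also have "max (- C) (real_of_rat q) = r n"
     unfolding r_def n using q fC[OF x] by auto
    also have "r n <= g (V x)"
    proof (cases "r n < f x")
     case True then show ?thesis using up[of n] mem by simp
    next
     case False
     then have "r n = - C" using q unfolding r_def n by (auto simp: max_def min_def split: if_splits)
     then show ?thesis using up[of n] rC[of n] by (auto split: if_splits)
    qed
    finally show "a <= g (V x)" .
   qed
  qed
 qed
qed

text \<open>Independent centred variables are orthogonal, so only the diagonal terms of the squared
  sum have nonzero mean.\<close>

lemma (in prob_space) expectation_square_sum_indep:
 fixes X :: "nat => 'a => real"
 assumes indep: "indep_vars (\<lambda>_. borel) X UNIV"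
  and i1: "\<And>i. integrable M (X i)" and i2: "\<And>i. integrable M (\<lambda>x. (X i x)\<^sup>2)"
  and z: "\<And>i. expectation (X i) = 0" and v: "\<And>i. expectation (\<lambda>x. (X i x)\<^sup>2) <= v"
 shows "integrable M (\<lambda>x. (\<Sum>i<n. X i x)\<^sup>2)" "expectation (\<lambda>x. (\<Sum>i<n. X i x)\<^sup>2) <= real n * v"
proof -
 have cross: "integrable M (\<lambda>x. X i x * X j x) \<and> expectation (\<lambda>x. X i x * X j x) = 0" if "i ~= j" for i j
 proof -
  have "indep_var (Pi\<^sub>M {i} (\<lambda>_. borel)) (\<lambda>x. \<lambda>l\<in>{i}. X l x) (Pi\<^sub>M {j} (\<lambda>_. borel)) (\<lambda>x. \<lambda>l\<in>{j}. X l x)"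
   using indep_var_restrict[OF indep, of "{i}" "{j}"] that by simp
  then have "indep_var borel ((\<lambda>v. v i) \<circ> (\<lambda>x. \<lambda>l\<in>{i}. X l x)) borel ((\<lambda>v. v j) \<circ> (\<lambda>x. \<lambda>l\<in>{j}. X l x))"
   by (rule indep_var_compose) auto
  then have "indep_var borel (X i) borel (X j)" by (simp add: comp_def)
  from indep_var_lebesgue_integral[OF this i1 i1] indep_var_integrable[OF this i1 i1] show ?thesis by (simp add: z)
 qed
 have prodint: "integrable M (\<lambda>x. X i x * X j x)" for i j
  using cross i2 by (cases "i = j") (auto simp: power2_eq_square)
 have eq: "(\<Sum>i<n. X i x)\<^sup>2 = (\<Sum>i<n. \<Sum>j<n. X i x * X j x)" for x
  by (simp add: power2_eq_square sum_product)
 show "integrable M (\<lambda>x. (\<Sum>i<n. X i x)\<^sup>2)" unfolding eq using prodint by simp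
 have "expectation (\<lambda>x. (\<Sum>i<n. X i x)\<^sup>2) = (\<Sum>i<n. \<Sum>j<n. expectation (\<lambda>x. X i x * X j x))"
  unfolding eq using prodint by (simp add: Bochner_Integration.integral_sum)
 also have "\<dots> = (\<Sum>i<n. \<Sum>j<n. if j = i then expectation (\<lambda>x. (X i x)\<^sup>2) else 0)"
  using cross by (intro sum.cong refl) (auto simp: power2_eq_square)
 also have "\<dots> = (\<Sum>i<n. expectation (\<lambda>x. (X i x)\<^sup>2))" by simp
 also have "\<dots> <= real n * v" using sum_bounded_above[of "{..<n}" "\<lambda>i. expectation (\<lambda>x. (X i x)\<^sup>2)" v] v by simp
 finally show "expectation (\<lambda>x. (\<Sum>i<n. X i x)\<^sup>2) <= real n * v" .
qed

text \<open>Along \<open>n = 2\<^sup>k\<close> Chebyshev's inequality is summable, and monotonicity of the partial sums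
 costs a factor two in between.\<close>

lemma (in iid_sample) dyadic_upper_lln:
 fixes h :: "'s => real"
 assumes h [measurable]: "h \<in> borel_measurable N" and h0: "\<And>s. 0 <= h s" and h2: "integrable L (\<lambda>s. (h s)\<^sup>2)"
  and m: "(\<integral>s. h s \<partial>L) < m"
 shows "AE \<omega> in M. \<forall>\<^sub>F n in sequentially. (\<Sum>i<n. h (S i \<omega>)) <= 2 * m * real n"
proof -
 have hL: "h \<in> borel_measurable L" using h unfolding measurable_L .
 have h1: "integrable L h" using h2 hL by (rule L.square_integrable_imp_integrable[rotated])
 define E where "E = (\<integral>s. h s \<partial>L)"
 define d where "d = m - E"
 have d: "d > 0" using m unfolding d_def E_def by simp
 define X where "X i \<omega> = h (S i \<omega>) - E" for i \<omega>
 have intS: "integrable M (\<lambda>\<omega>. f (S i \<omega>))" if "integrable L f" "f \<in> borel_measurable N" for f :: "'s => real" and i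
  using that unfolding law[of i, symmetric] by (subst (asm) integrable_distr_eq) auto
 have i1: "integrable M (X i)" for i unfolding X_def using intS[OF h1 h] by simp
 have sqint: "integrable L (\<lambda>s. (h s - E)\<^sup>2)" unfolding power2_diff using h1 h2 by simp
 have i2: "integrable M (\<lambda>\<omega>. (X i \<omega>)\<^sup>2)" for i unfolding X_def by (rule intS[OF sqint]) measurable
 have ind: "indep_vars (\<lambda>_. borel) X UNIV"
  unfolding X_def by (rule indep_vars_compose2[OF indep, where Y = "\<lambda>_ s. h s - E"]) simp
 have z: "expectation (X i) = 0" for i
  unfolding X_def using integral_S[of "\<lambda>s. h s - E" i] h1 by (simp add: E_def L.prob_space)
 define v where "v = (\<integral>s. (h s - E)\<^sup>2 \<partial>L)"
 have v: "expectation (\<lambda>\<omega>. (X i \<omega>)\<^sup>2) = v" for i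
  unfolding X_def v_def by (rule integral_S) measurable
 have v0: "0 <= v" unfolding v_def by simp
 note sq = expectation_square_sum_indep[OF ind i1 i2 z, of v]
 have [measurable]: "X i \<in> borel_measurable M" for i using i1 by auto
 have "AE \<omega> in M. \<forall>\<^sub>F k in sequentially. \<omega> \<notin> {\<omega> \<in> space M. (d * 2 ^ k)\<^sup>2 <= (\<Sum>i<2^k. X i \<omega>)\<^sup>2}"
 \<comment> \<open>At n = 2^k the Chebyshev bound is (v / d^2) 2^(-k); the rate \<kappa> = ln 2 puts
   it into exponential form.\<close>
 proof (rule AE_eventually_notin[where C = "v / d\<^sup>2" and \<kappa> = "ln 2"])
  fix k :: nat
  have "prob {\<omega> \<in> space M. (d * 2 ^ k)\<^sup>2 <= (\<Sum>i<2^k. X i \<omega>)\<^sup>2} <= expectation (\<lambda>\<omega>. (\<Sum>i<2^k. X i \<omega>)\<^sup>2) / (d * 2 ^ k)\<^sup>2"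
   using d sq(1)[of "2^k"] by (intro integral_Markov_inequality_measure[of _ _ "space M"]) (auto simp: v)
  also have "\<dots> <= real (2 ^ k) * v / (d * 2 ^ k)\<^sup>2"
   using sq(2)[of "2^k"] v by (intro divide_right_mono) auto
  also have "\<dots> = v / d\<^sup>2 * exp (- ln 2 * real k)"
  proof -
   have "exp (- ln 2 * real k) = 1 / 2 ^ k"
    by (simp add: exp_minus exp_of_nat2_mult inverse_eq_divide)
   then show ?thesis using d by (simp add: power2_eq_square field_simps)
  qed
  finally show "prob {\<omega> \<in> space M. (d * 2 ^ k)\<^sup>2 <= (\<Sum>i<2^k. X i \<omega>)\<^sup>2} <= v / d\<^sup>2 * exp (- ln 2 * real k)" .
 qed auto
 with AE_space show ?thesis
 proof eventually_elim
  case (elim \<omega>)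
  from elim(2) obtain K where K: "\<And>k. k >= K ==> (\<Sum>i<2^k. X i \<omega>)\<^sup>2 < (d * 2 ^ k)\<^sup>2"
   using elim(1) by (auto simp: eventually_sequentially not_le)
  have dy: "(\<Sum>i<2^k. h (S i \<omega>)) <= m * 2 ^ k" if "k >= K" for k
  proof -
   have "(\<Sum>i<2^k. X i \<omega>) < d * 2 ^ k"
    using K[OF that] d by (rule_tac power2_less_imp_less) auto
   then show ?thesis unfolding X_def d_def by (simp add: sum_subtractf algebra_simps)
  qed
  have "0 <= (\<integral>s. h s \<partial>L)" using h0 by (intro Bochner_Integration.integral_nonneg) auto
  with m have m0: "0 <= m" by linarith
  show ?case
   unfolding eventually_sequentially
  proof (intro exI[of _ "2 ^ K"] allI impI)
   fix n :: nat assume n: "2 ^ K <= n"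
   then have n0: "n > 0" by (metis gr0I le_zero_eq power_not_zero zero_neq_numeral)
   define k where "k = floor_log n"
   have k: "2 ^ k <= n" "n < 2 ^ (k + 1)" unfolding k_def using n0 floor_log_exp2_le floor_log_exp2_gt by auto
   have "2 ^ K < (2 :: nat) ^ (k + 1)" using n k by linarith
   then have "K < k + 1" by (rule power_less_imp_less_exp[rotated]) simp
   then have "K <= k + 1" by simp
   have "(\<Sum>i<n. h (S i \<omega>)) <= (\<Sum>i<2^(k+1). h (S i \<omega>))"
    using k h0 by (intro sum_mono2) auto
   also have "\<dots> <= m * 2 ^ (k + 1)" by (rule dy) fact
   also have "\<dots> <= m * (2 * real n)"
   proof (rule mult_left_mono[OF _ m0])
    have "(2 :: real) ^ (k + 1) = 2 * real (2 ^ k)" by simp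
    also have "\<dots> <= 2 * real n" using k(1) by (simp only: of_nat_le_iff mult_le_cancel_left_pos zero_less_numeral)
    finally show "(2 :: real) ^ (k + 1) <= 2 * real n" .
   qed
   finally show "(\<Sum>i<n. h (S i \<omega>)) <= 2 * m * real n" by simp
  qed
 qed
qed

section \<open>Reweighting by the density ratio\<close>

locale dose_response = prob_space M for M :: "'w measure" +
 fixes T :: "'w => 'a::euclidean_space" and X :: "'w => 'b::euclidean_space"
  and Ypot :: "'a => 'w => real" and Y :: "'w => real"
  and P Q :: "('a \<times> 'b) measure" and PT :: "'a measure" and PX :: "'b measure" and W\<^sub>0 :: real
 assumes T_measurable [measurable]: "T \<in> borel_measurable M" and X_measurable [measurable]: "X \<in> borel_measurable M"
  and Ypot_measurable [measurable]: "(\<lambda>(t, \<omega>). Ypot t \<omega>) \<in> borel_measurable (borel \<Otimes>\<^sub>M M)"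
  and regular: "regular_outcomes M T Ypot"
  and Y_def: "\<And>\<omega>. Y \<omega> = Ypot (T \<omega>) \<omega>"
  and P_def: "P = distr M borel (\<lambda>\<omega>. (T \<omega>, X \<omega>))"
  and PT_def: "PT = distr M borel T" and PX_def: "PX = distr M borel X" and Q_def: "Q = PT \<Otimes>\<^sub>M PX"
  and ignorable: "\<And>t. t \<in> measure_support PT ==> cond_indep M borel (Ypot t) borel T borel X"
  and Q_ac: "absolutely_continuous P Q" and W0_pos: "0 < W\<^sub>0" and overlap: "AE z in P. RN_deriv P Q z <= ennreal W\<^sub>0"
begin

abbreviation TX :: "'w => 'a \<times> 'b" where "TX \<equiv> \<lambda>\<omega>. (T \<omega>, X \<omega>)"

lemma sets_P [measurable_cong, simp]: "sets P = sets borel" and space_P [simp]: "space P = UNIV"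
 and sets_PT [measurable_cong, simp]: "sets PT = sets borel" and space_PT [simp]: "space PT = UNIV"
 and sets_PX [measurable_cong, simp]: "sets PX = sets borel" and space_PX [simp]: "space PX = UNIV"
 unfolding P_def PT_def PX_def by simp_all

lemma sets_Q [measurable_cong, simp]: "sets Q = sets borel" and space_Q [simp]: "space Q = UNIV"
proof -
 have "sets Q = sets (borel \<Otimes>\<^sub>M borel)"
  unfolding Q_def by (rule sets_pair_measure_cong) simp_all
 then have *: "sets Q = sets borel" by (simp only: borel_prod)
 then show "sets Q = sets borel" .
 from sets_eq_imp_space_eq[OF *] show "space Q = UNIV" by simp
qed

lemma measurable_P: "measurable P K = measurable borel K"
 by (rule measurable_cong_sets) simp_all

lemma TX_measurable [measurable]: "TX \<in> borel_measurable M"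
 by (rule borel_measurable_Pair) measurable

sublocale P: prob_space P unfolding P_def by (rule prob_space_distr) measurable
sublocale PT: prob_space PT unfolding PT_def by (rule prob_space_distr) measurable
sublocale PX: prob_space PX unfolding PX_def by (rule prob_space_distr) measurable
sublocale PTX: pair_prob_space PT PX ..
sublocale Q: prob_space Q unfolding Q_def by (rule PTX.prob_space_axioms)

lemma Ypot_meas1 [measurable]: "Ypot t \<in> borel_measurable M"
 using measurable_compose[OF measurable_Pair1'[of t borel M] Ypot_measurable] by (simp add: space_borel)

lemma Ypot_comp [measurable (raw)]:
 "f \<in> measurable N borel ==> g \<in> measurable N M ==> (\<lambda>x. Ypot (f x) (g x)) \<in> borel_measurable N"
 using measurable_compose[OF measurable_Pair Ypot_measurable] by simp

lemma Y_measurable [measurable]: "Y \<in> borel_measurable M"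
 unfolding Y_def by measurable

text \<open>A version of dQ/dP that is real and bounded by \<open>W\<^sub>0\<close> at every point,
  so that later bounds carry no exceptional sets. Overlap makes the truncation invisible almost
  everywhere.\<close>

definition r :: "'a \<times> 'b => real" where "r z = min W\<^sub>0 (enn2real (RN_deriv P Q z))"

lemma r_measurable [measurable]: "r \<in> borel_measurable borel"
 unfolding r_def using borel_measurable_RN_deriv[of P Q] unfolding measurable_P by measurable

lemma r_bounds: "0 <= r z" "r z <= W\<^sub>0"
 unfolding r_def using W0_pos by auto

lemma r_abs_le: "\<bar>r z\<bar> <= W\<^sub>0" using r_bounds[of z] by simp

lemma AE_r_eq: "AE z in P. RN_deriv P Q z = ennreal (r z)"
 using overlap
proof eventually_elim
 case (elim z)
 then have "RN_deriv P Q z < top" by (metis ennreal_less_top le_less_trans)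
 then have e: "ennreal (enn2real (RN_deriv P Q z)) = RN_deriv P Q z" by simp
 then have "enn2real (RN_deriv P Q z) <= W\<^sub>0"
  using elim W0_pos by (metis ennreal_le_iff less_imp_le)
 then show ?case unfolding r_def using e by simp
qed

lemma Q_density: "Q = density P (\<lambda>z. ennreal (r z))"
proof -
 have 1: "density P (RN_deriv P Q) = Q"
  by (rule P.density_RN_deriv[OF Q_ac]) simp
 have 2: "density P (RN_deriv P Q) = density P (\<lambda>z. ennreal (r z))"
 proof (rule density_cong)
  show "(\<lambda>z. ennreal (r z)) \<in> borel_measurable P" unfolding measurable_P by measurable
 qed (use AE_r_eq in auto)
 show ?thesis by (rule trans[OF 1[symmetric] 2])
qed

lemma nn_integral_P: "f \<in> borel_measurable borel ==> (\<integral>\<^sup>+z. f z \<partial>P) = (\<integral>\<^sup>+\<omega>. f (TX \<omega>) \<partial>M)"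
 unfolding P_def by (rule nn_integral_distr) measurable

lemma nn_integral_Q: "f \<in> borel_measurable borel ==> (\<integral>\<^sup>+z. f z \<partial>Q) = (\<integral>\<^sup>+\<omega>. ennreal (r (TX \<omega>)) * f (TX \<omega>) \<partial>M)"
proof -
 assume f: "f \<in> borel_measurable borel"
 have "(\<integral>\<^sup>+z. f z \<partial>Q) = (\<integral>\<^sup>+z. ennreal (r z) * f z \<partial>P)"
  by (subst Q_density, rule nn_integral_density) (use f in \<open>simp_all add: measurable_P\<close>)
 also have "\<dots> = (\<integral>\<^sup>+\<omega>. ennreal (r (TX \<omega>)) * f (TX \<omega>) \<partial>M)"
  by (rule nn_integral_P) (use f in measurable)
 finally show ?thesis .
qed

lemma integral_Q: 
 fixes f :: "'a \<times> 'b => real"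
 shows "f \<in> borel_measurable borel ==> (\<integral>z. f z \<partial>Q) = (\<integral>z. r z * f z \<partial>P)"
proof -
 assume f: "f \<in> borel_measurable borel"
 have "(\<integral>z. f z \<partial>density P (\<lambda>z. ennreal (r z))) = (\<integral>z. r z * f z \<partial>P)"
  using f r_bounds by (subst integral_density) (auto simp: measurable_P)
 then show ?thesis by (simp only: Q_density[symmetric])
qed

lemma AE_Q: "AE z in P. \<phi> z ==> AE z in Q. \<phi> z"
 by (rule absolutely_continuous_AE[OF _ Q_ac]) simp

abbreviation FX :: "'w measure" where "FX \<equiv> gen_subalgebra M borel X"
abbreviation FTX :: "'w measure" where "FTX \<equiv> gen_subalgebra M borel TX"

lemma subalgebra_gen: "V \<in> measurable M N ==> subalgebra M (gen_subalgebra M N V)"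
 unfolding subalgebra_def gen_subalgebra_def
 by (auto simp: measurable_iff_sets)

lemma measurable_gen: "V \<in> measurable M N ==> f \<in> measurable N K ==> (\<lambda>\<omega>. f (V \<omega>)) \<in> measurable (gen_subalgebra M N V) K"
 unfolding gen_subalgebra_def
 using measurable_space[of V M N] by (intro measurable_compose[OF measurable_vimage_algebra1, of V _ N f K]) auto

sublocale FX: sigma_finite_subalgebra M FX
 by (intro finite_measure_subalgebra_is_sigma_finite finite_measure_subalgebra.intro
   finite_measure_axioms finite_measure_subalgebra_axioms.intro subalgebra_gen) measurable

sublocale FTX: sigma_finite_subalgebra M FTX
 by (intro finite_measure_subalgebra_is_sigma_finite finite_measure_subalgebra.intro
   finite_measure_axioms finite_measure_subalgebra_axioms.intro subalgebra_gen) measurable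

text \<open>Under the density r(T, X) the outcome Y(s) is independent of T: given X the two are
  independent, and the conditional mean of \<open>indicator C (T \<omega>) * r (TX \<omega>)\<close>
  given X is the constant P_T(C), because r turns P into the product of its marginals.\<close>

lemma reweighted_independence:
 assumes s: "s \<in> measure_support PT" and C: "C \<in> sets borel" and A: "A \<in> sets borel"
 shows "(\<integral>\<^sup>+\<omega>. indicator A (Ypot s \<omega>) * (indicator C (T \<omega>) * ennreal (r (TX \<omega>))) \<partial>M)
  = emeasure PT C * emeasure (distr M borel (Ypot s)) A"
proof -
 note [measurable] = C A
 define U where "U = (indicator (Ypot s -` A) :: 'w => real)"
 define p where "p = real_cond_exp M FX U"
 have U_eq: "U \<omega> = indicator A (Ypot s \<omega>)" for \<omega> unfolding U_def by (auto simp: indicator_def)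
 have U [measurable]: "U \<in> borel_measurable M" unfolding U_eq by measurable
 have U01: "0 <= U \<omega>" "U \<omega> <= 1" "\<bar>U \<omega>\<bar> <= 1" for \<omega> unfolding U_def by (auto simp: indicator_def)
 have Uint: "integrable M U" by (rule integrable_bounded) (use U01 in auto)
 have pFX [measurable]: "p \<in> borel_measurable FX" unfolding p_def by simp
 have pM [measurable]: "p \<in> borel_measurable M" unfolding p_def by simp
 have pint: "integrable M p" unfolding p_def by (rule FX.real_cond_exp_int(1)[OF Uint])
 have p01: "AE \<omega> in M. 0 <= p \<omega> \<and> p \<omega> <= 1"
  using FX.real_cond_exp_ge_c[OF Uint, of 0] FX.real_cond_exp_le_c[OF Uint, of 1] U01 unfolding p_def by auto
 \<comment> \<open>Ignorability compares these two measures on rectangles only. Rectangles generate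
   the Borel sets, so the measures agree and integrate r, which is no product, alike. Thus the
   indicator of A may be replaced by its conditional probability \<open>p\<close> given X.\<close>
 define m1 where "m1 = distr (density M (\<lambda>\<omega>. ennreal (U \<omega>))) borel TX"
 define m2 where "m2 = distr (density M (\<lambda>\<omega>. ennreal (p \<omega>))) borel TX"
 have em: "emeasure (distr (density M (\<lambda>\<omega>. ennreal (f \<omega>))) borel TX) E
   = (\<integral>\<^sup>+\<omega>. ennreal (f \<omega>) * indicator E (TX \<omega>) \<partial>M)"
  if f: "f \<in> borel_measurable M" and E: "E \<in> sets borel" for f :: "'w => real" and E :: "('a \<times> 'b) set"
 proof -
  have "emeasure (distr (density M (\<lambda>\<omega>. ennreal (f \<omega>))) borel TX) E
   = (\<integral>\<^sup>+z. indicator E z \<partial>distr (density M (\<lambda>\<omega>. ennreal (f \<omega>))) borel TX)"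
   using E by simp
  also have "\<dots> = (\<integral>\<^sup>+\<omega>. indicator E (TX \<omega>) \<partial>density M (\<lambda>\<omega>. ennreal (f \<omega>)))"
   using E by (intro nn_integral_distr) auto
  also have "\<dots> = (\<integral>\<^sup>+\<omega>. ennreal (f \<omega>) * indicator E (TX \<omega>) \<partial>M)"
  proof (rule nn_integral_density)
   show "(\<lambda>\<omega>. indicator E (TX \<omega>)) \<in> borel_measurable M"
    by (rule measurable_compose[OF TX_measurable borel_measurable_indicator[OF E]])
  qed (use f in simp)
  finally show ?thesis .
 qed
 have rect: "emeasure m1 (C' \<times> D) = emeasure m2 (C' \<times> D)" if CD [measurable]: "C' \<in> sets borel" "D \<in> sets borel" for C' :: "'a set" and D :: "'b set"
 proof -
  have CDm: "C' \<times> D \<in> sets borel" using CD by (simp add: borel_prod[symmetric])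
  define V where "V = (indicator (T -` C') :: 'w => real)"
  define UV where "UV = (indicator (Ypot s -` A \<inter> T -` C') :: 'w => real)"
  define d where "d \<omega> = (indicator D (X \<omega>) :: real)" for \<omega>
  have UV_eq: "UV \<omega> = U \<omega> * V \<omega>" for \<omega> unfolding U_def V_def UV_def by (auto simp: indicator_def)
  have V_eq: "V \<omega> = indicator C' (T \<omega>)" for \<omega> unfolding V_def by (auto simp: indicator_def)
  have Vm [measurable]: "V \<in> borel_measurable M" unfolding V_eq by measurable
  have UVm [measurable]: "UV \<in> borel_measurable M" unfolding UV_eq by measurable
  have dFX [measurable]: "d \<in> borel_measurable FX" unfolding d_def by (rule measurable_gen) measurable
  have dM [measurable]: "d \<in> borel_measurable M" unfolding d_def by measurable
  have V01: "0 <= V \<omega>" "\<bar>V \<omega>\<bar> <= 1" "0 <= d \<omega>" "\<bar>d \<omega>\<bar> <= 1" for \<omega> unfolding V_def d_def by (auto simp: indicator_def)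
  have i1: "integrable M (\<lambda>\<omega>. d \<omega> * UV \<omega>)"
   by (rule integrable_bounded[where c = 1]) (auto simp: UV_def d_def indicator_def)
  have i2: "integrable M (\<lambda>\<omega>. (d \<omega> * p \<omega>) * V \<omega>)"
  proof (rule Bochner_Integration.integrable_bound[OF pint])
   have "\<bar>d \<omega> * p \<omega> * V \<omega>\<bar> <= 1 * \<bar>p \<omega>\<bar> * 1" for \<omega>
    unfolding abs_mult using V01 by (intro mult_mono) auto
   then show "AE \<omega> in M. norm (d \<omega> * p \<omega> * V \<omega>) <= norm (p \<omega>)" by simp
  qed measurable
  have ci: "AE \<omega> in M. real_cond_exp M FX UV \<omega> = p \<omega> * real_cond_exp M FX V \<omega>"
   using ignorable[OF s] A CD(1) unfolding cond_indep_def p_def U_def V_def UV_def by blast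
  have "(\<integral>\<omega>. d \<omega> * UV \<omega> \<partial>M) = (\<integral>\<omega>. d \<omega> * real_cond_exp M FX UV \<omega> \<partial>M)"
   by (rule FX.real_cond_exp_intg(2)[symmetric]) (use i1 in auto)
  also have "\<dots> = (\<integral>\<omega>. (d \<omega> * p \<omega>) * real_cond_exp M FX V \<omega> \<partial>M)"
   by (rule integral_cong_AE) (use ci in \<open>auto simp: mult_ac\<close>)
  also have "\<dots> = (\<integral>\<omega>. (d \<omega> * p \<omega>) * V \<omega> \<partial>M)"
   by (rule FX.real_cond_exp_intg(2)) (use i2 in auto)
  finally have eq: "(\<integral>\<omega>. d \<omega> * UV \<omega> \<partial>M) = (\<integral>\<omega>. (d \<omega> * p \<omega>) * V \<omega> \<partial>M)" .
  have "emeasure m1 (C' \<times> D) = (\<integral>\<^sup>+\<omega>. ennreal (d \<omega> * UV \<omega>) \<partial>M)"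
   unfolding m1_def em[OF U CDm]
   by (intro nn_integral_cong) (auto simp: UV_eq V_eq d_def indicator_def)
  also have "\<dots> = ennreal (\<integral>\<omega>. d \<omega> * UV \<omega> \<partial>M)"
   by (rule nn_integral_eq_integral[OF i1]) (auto simp: UV_eq V01 U01)
  also have "\<dots> = (\<integral>\<^sup>+\<omega>. ennreal ((d \<omega> * p \<omega>) * V \<omega>) \<partial>M)"
   unfolding eq using p01 by (intro nn_integral_eq_integral[OF i2, symmetric]) (auto simp: V01)
  also have "\<dots> = emeasure m2 (C' \<times> D)"
   unfolding m2_def em[OF pM CDm]
   by (intro nn_integral_cong) (auto simp: V_eq d_def indicator_def)
  finally show ?thesis .
 qed
 have m12: "m1 = m2"
 proof (rule measure_eqI_generator_eq[where E = "{C \<times> D | C D. C \<in> sets borel \<and> D \<in> sets borel}" and \<Omega> = UNIV and A = "\<lambda>_. UNIV"])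
  show "Int_stable {C \<times> D | C D. C \<in> sets (borel :: 'a measure) \<and> D \<in> sets (borel :: 'b measure)}"
  proof (rule Int_stableI)
   fix a b assume "a \<in> {C \<times> D | C D. C \<in> sets (borel :: 'a measure) \<and> D \<in> sets (borel :: 'b measure)}"
    "b \<in> {C \<times> D | C D. C \<in> sets (borel :: 'a measure) \<and> D \<in> sets (borel :: 'b measure)}"
   then obtain C1 D1 C2 D2 where "a = C1 \<times> D1" "b = C2 \<times> D2" "C1 \<in> sets borel" "C2 \<in> sets borel" "D1 \<in> sets borel" "D2 \<in> sets borel" by auto
   then show "a \<inter> b \<in> {C \<times> D | C D. C \<in> sets (borel :: 'a measure) \<and> D \<in> sets (borel :: 'b measure)}"
    by (intro CollectI exI[of _ "C1 \<inter> C2"] exI[of _ "D1 \<inter> D2"]) auto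
  qed
  have sb: "sets (borel :: ('a \<times> 'b) measure) = sigma_sets UNIV {C \<times> D | C D. C \<in> sets borel \<and> D \<in> sets borel}"
   unfolding borel_prod[symmetric] sets_pair_measure by simp
  show "sets m1 = sigma_sets UNIV {C \<times> D | C D. C \<in> sets borel \<and> D \<in> sets borel}"
   "sets m2 = sigma_sets UNIV {C \<times> D | C D. C \<in> sets borel \<and> D \<in> sets borel}"
   unfolding m1_def m2_def sb[symmetric] by simp_all
  show "range (\<lambda>_. UNIV) \<subseteq> {C \<times> D | C D. C \<in> sets (borel :: 'a measure) \<and> D \<in> sets (borel :: 'b measure)}"
   by (auto intro!: exI[of _ UNIV])
  show "emeasure m1 UNIV ~= \<infinity>" for i :: nat
  proof -
   have "emeasure m1 UNIV = (\<integral>\<^sup>+\<omega>. ennreal (U \<omega>) \<partial>M)"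
    unfolding m1_def using em[OF U, of UNIV] by simp
   also have "\<dots> = ennreal (\<integral>\<omega>. U \<omega> \<partial>M)" by (rule nn_integral_eq_integral[OF Uint]) (auto simp: U01)
   finally show ?thesis by simp
  qed
 next
  fix E assume "E \<in> {C \<times> D | C D. C \<in> sets (borel :: 'a measure) \<and> D \<in> sets (borel :: 'b measure)}"
  then show "emeasure m1 E = emeasure m2 E" using rect by blast
 qed auto
 define h where "h z = indicator C (fst z) * r z" for z
 have "fst \<in> measurable (borel :: ('a \<times> 'b) measure) (borel :: 'a measure)"
  by (intro borel_measurable_continuous_onI continuous_intros)
 then have [measurable]: "h \<in> borel_measurable borel" unfolding h_def by measurable
 have h0: "0 <= h z" "\<bar>h z\<bar> <= W\<^sub>0" for z using r_bounds[of z] W0_pos unfolding h_def by (auto simp: indicator_def)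
 have nn: "(\<integral>\<^sup>+\<omega>. ennreal (f \<omega>) * ennreal (h (TX \<omega>)) \<partial>M) = (\<integral>\<^sup>+z. ennreal (h z) \<partial>distr (density M (\<lambda>\<omega>. ennreal (f \<omega>))) borel TX)"
  if [measurable]: "f \<in> borel_measurable M" for f
  by (subst nn_integral_distr) (auto simp: nn_integral_density)
 have hint: "integrable M (\<lambda>\<omega>. h (TX \<omega>))" by (rule integrable_bounded[OF _ h0(2)]) measurable
 \<comment> \<open>Characterisation of the conditional mean: over the event that X lies in D both
   sides integrate to Q(C x D) = P_T(C) P_X(D).\<close>
 have ce: "AE \<omega> in M. real_cond_exp M FX (\<lambda>\<omega>. h (TX \<omega>)) \<omega> = measure PT C"
 proof (rule FX.real_cond_exp_charact[OF _ hint])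
  fix A' assume "A' \<in> sets FX"
  then obtain D where D [measurable]: "D \<in> sets borel" and A': "A' = X -` D \<inter> space M"
   unfolding gen_subalgebra_def by (auto simp: sets_vimage_algebra2)
  have CDm: "C \<times> D \<in> sets borel" using C D by (simp add: borel_prod[symmetric])
  have i3: "integrable M (\<lambda>\<omega>. indicator D (X \<omega>) * h (TX \<omega>))"
  proof (rule integrable_bounded[where c = W\<^sub>0])
   show "\<bar>indicator D (X \<omega>) * h (TX \<omega>)\<bar> <= W\<^sub>0" for \<omega> using h0[of "(TX \<omega>)"] W0_pos by (auto simp: indicator_def)
  qed measurable
  have "ennreal (\<integral>\<omega>. indicator D (X \<omega>) * h (TX \<omega>) \<partial>M) = (\<integral>\<^sup>+\<omega>. ennreal (indicator D (X \<omega>) * h (TX \<omega>)) \<partial>M)"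
   using h0 by (intro nn_integral_eq_integral[OF i3, symmetric]) auto
  also have "\<dots> = (\<integral>\<^sup>+\<omega>. ennreal (r (TX \<omega>)) * indicator (C \<times> D) (TX \<omega>) \<partial>M)"
   by (intro nn_integral_cong) (auto simp: h_def indicator_def)
  also have "\<dots> = (\<integral>\<^sup>+z. indicator (C \<times> D) z \<partial>Q)" using CDm by (subst nn_integral_Q) auto
  also have "\<dots> = emeasure PT C * emeasure PX D"
   using CDm C D unfolding Q_def by (simp add: PX.emeasure_pair_measure_Times borel_prod)
  also have "\<dots> = ennreal (measure PT C * measure PX D)" by (simp add: PT.emeasure_eq_measure PX.emeasure_eq_measure ennreal_mult)
  finally have "(\<integral>\<omega>. indicator D (X \<omega>) * h (TX \<omega>) \<partial>M) = measure PT C * measure PX D"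
   using h0 by (subst (asm) ennreal_inj) (auto intro!: Bochner_Integration.integral_nonneg mult_nonneg_nonneg)
  moreover have "(\<integral>\<omega>\<in>A'. h (TX \<omega>) \<partial>M) = (\<integral>\<omega>. indicator D (X \<omega>) * h (TX \<omega>) \<partial>M)"
   unfolding set_lebesgue_integral_def A' by (intro Bochner_Integration.integral_cong) (auto simp: indicator_def)
  moreover have "(\<integral>\<omega>\<in>A'. measure PT C \<partial>M) = measure PT C * measure PX D"
   unfolding PX_def measure_distr[OF X_measurable D] set_lebesgue_integral_def A' by simp
  ultimately show "(\<integral>\<omega>\<in>A'. h (TX \<omega>) \<partial>M) = (\<integral>\<omega>\<in>A'. measure PT C \<partial>M)" by simp
 qed auto
 have i4: "integrable M (\<lambda>\<omega>. p \<omega> * h (TX \<omega>))"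
 proof (rule Bochner_Integration.integrable_bound[OF integrable_mult_right[OF pint, of W\<^sub>0]])
  have "\<bar>p \<omega> * h (TX \<omega>)\<bar> <= \<bar>W\<^sub>0 * p \<omega>\<bar>" for \<omega>
   using mult_left_mono[OF h0(2), of "\<bar>p \<omega>\<bar>" "(TX \<omega>)"] W0_pos by (simp add: abs_mult mult.commute)
  then show "AE \<omega> in M. norm (p \<omega> * h (TX \<omega>)) <= norm (W\<^sub>0 * p \<omega>)" by simp
 qed measurable
 have "(\<integral>\<^sup>+\<omega>. indicator A (Ypot s \<omega>) * (indicator C (T \<omega>) * ennreal (r (TX \<omega>))) \<partial>M)
  = (\<integral>\<^sup>+\<omega>. ennreal (U \<omega>) * ennreal (h (TX \<omega>)) \<partial>M)"
  by (intro nn_integral_cong) (auto simp: U_eq h_def indicator_def)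
 also have "\<dots> = (\<integral>\<^sup>+\<omega>. ennreal (p \<omega>) * ennreal (h (TX \<omega>)) \<partial>M)"
  using m12 unfolding nn[OF U] nn[OF pM] m1_def m2_def by simp
 also have "\<dots> = (\<integral>\<^sup>+\<omega>. ennreal (p \<omega> * h (TX \<omega>)) \<partial>M)"
  using p01 h0 by (intro nn_integral_cong_AE) (auto simp: ennreal_mult)
 also have "\<dots> = ennreal (\<integral>\<omega>. p \<omega> * h (TX \<omega>) \<partial>M)"
  using p01 h0 by (intro nn_integral_eq_integral[OF i4]) auto
 also have "(\<integral>\<omega>. p \<omega> * h (TX \<omega>) \<partial>M) = (\<integral>\<omega>. p \<omega> * real_cond_exp M FX (\<lambda>\<omega>. h (TX \<omega>)) \<omega> \<partial>M)"
  by (rule FX.real_cond_exp_intg(2)[symmetric]) (use i4 in auto)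
 also have "\<dots> = (\<integral>\<omega>. p \<omega> * measure PT C \<partial>M)"
  by (rule integral_cong_AE) (use ce in auto)
 also have "\<dots> = measure PT C * (\<integral>\<omega>. U \<omega> \<partial>M)"
  unfolding p_def using FX.real_cond_exp_int(2)[OF Uint] by simp
 also have "(\<integral>\<omega>. U \<omega> \<partial>M) = measure (distr M borel (Ypot s)) A"
 proof -
  have "(\<integral>\<omega>. U \<omega> \<partial>M) = (\<integral>\<omega>. indicator (Ypot s -` A \<inter> space M) \<omega> \<partial>M)"
   by (intro Bochner_Integration.integral_cong) (auto simp: U_def indicator_def)
  then show ?thesis by (simp add: measure_distr)
 qed
 also have "ennreal (measure PT C * measure (distr M borel (Ypot s)) A) = emeasure PT C * emeasure (distr M borel (Ypot s)) A"
  using finite_measure.emeasure_eq_measure[OF prob_space.finite_measure[OF prob_space_distr[OF Ypot_meas1[of s]]]]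
  by (simp add: PT.emeasure_eq_measure ennreal_mult)
 finally show ?thesis .
qed

text \<open>The two sides integrate \<phi> against two measures on the line, which agree on sets by
  \<open>reweighted_independence\<close>.\<close>

lemma reweighted_outcome:
 fixes \<phi> :: "real => ennreal"
 assumes s: "s \<in> measure_support PT" and C: "C \<in> sets borel" and \<phi> [measurable]: "\<phi> \<in> borel_measurable borel"
 shows "(\<integral>\<^sup>+\<omega>. \<phi> (Ypot s \<omega>) * (indicator C (T \<omega>) * ennreal (r (TX \<omega>))) \<partial>M)
  = emeasure PT C * (\<integral>\<^sup>+\<omega>. \<phi> (Ypot s \<omega>) \<partial>M)"
proof -
 note [measurable] = C
 define k where "k \<omega> = indicator C (T \<omega>) * ennreal (r (TX \<omega>))" for \<omega>
 have k [measurable]: "k \<in> borel_measurable M" unfolding k_def by measurable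
 define D where "D = distr M borel (Ypot s)"
 have sD: "measurable D K = measurable borel K" for K :: "ennreal measure" unfolding D_def by simp
 have "distr (density M k) borel (Ypot s) = density D (\<lambda>_. emeasure PT C)"
 proof (rule measure_eqI)
  fix A assume "A \<in> sets (distr (density M k) borel (Ypot s))"
  then have A [measurable]: "A \<in> sets borel" by simp
  have "emeasure (distr (density M k) borel (Ypot s)) A = (\<integral>\<^sup>+y. indicator A y \<partial>distr (density M k) borel (Ypot s))"
   using A by simp
  also have "\<dots> = (\<integral>\<^sup>+\<omega>. indicator A (Ypot s \<omega>) \<partial>density M k)" by (rule nn_integral_distr) auto
  also have "\<dots> = (\<integral>\<^sup>+\<omega>. k \<omega> * indicator A (Ypot s \<omega>) \<partial>M)" by (rule nn_integral_density) auto
  also have "\<dots> = emeasure PT C * emeasure D A"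
   using reweighted_independence[OF s C A] unfolding k_def D_def by (simp only: mult_ac)
  also have "\<dots> = emeasure (density D (\<lambda>_. emeasure PT C)) A"
   using A unfolding D_def by (simp add: emeasure_density nn_integral_cmult_indicator)
  finally show "emeasure (distr (density M k) borel (Ypot s)) A = emeasure (density D (\<lambda>_. emeasure PT C)) A" .
 qed (simp add: D_def)
 then have "(\<integral>\<^sup>+y. \<phi> y \<partial>distr (density M k) borel (Ypot s)) = (\<integral>\<^sup>+y. \<phi> y \<partial>density D (\<lambda>_. emeasure PT C))"
  by (simp only:)
 also have "(\<integral>\<^sup>+y. \<phi> y \<partial>distr (density M k) borel (Ypot s)) = (\<integral>\<^sup>+\<omega>. \<phi> (Ypot s \<omega>) \<partial>density M k)"
  by (rule nn_integral_distr) auto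
 also have "\<dots> = (\<integral>\<^sup>+\<omega>. k \<omega> * \<phi> (Ypot s \<omega>) \<partial>M)" by (rule nn_integral_density) auto
 also have "(\<integral>\<^sup>+y. \<phi> y \<partial>density D (\<lambda>_. emeasure PT C)) = (\<integral>\<^sup>+y. emeasure PT C * \<phi> y \<partial>D)"
  by (rule nn_integral_density) (auto simp: sD)
 also have "\<dots> = emeasure PT C * (\<integral>\<^sup>+y. \<phi> y \<partial>D)" by (rule nn_integral_cmult) (simp add: sD)
 also have "(\<integral>\<^sup>+y. \<phi> y \<partial>D) = (\<integral>\<^sup>+\<omega>. \<phi> (Ypot s \<omega>) \<partial>M)" unfolding D_def by (rule nn_integral_distr) auto
 finally show ?thesis unfolding k_def by (simp only: mult_ac)
qed

lemma AE_T_support: "AE \<omega> in M. T \<omega> \<in> measure_support PT"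
 using AE_measure_support[OF sets_PT] unfolding PT_def by (rule AE_distrD[rotated]) measurable

lemma nn_integral_PT: "f \<in> borel_measurable borel ==> (\<integral>\<^sup>+t. f t \<partial>PT) = (\<integral>\<^sup>+\<omega>. f (T \<omega>) \<partial>M)"
 unfolding PT_def by (rule nn_integral_distr) measurable

lemma nn_integral_pick:
 fixes f :: "'s => ennreal"
 assumes "c \<in> R" shows "(\<integral>\<^sup>+s. f s * indicator {s} c \<partial>count_space R) = f c"
proof -
 have "(\<integral>\<^sup>+s. f s * indicator {s} c \<partial>count_space R) = (\<integral>\<^sup>+s. f s * indicator {c} s \<partial>count_space R)"
  by (intro nn_integral_cong) (auto simp: indicator_def)
 also have "\<dots> = f c * emeasure (count_space R) {c}"
  using assms by (intro nn_integral_indicator_singleton) auto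
 finally show ?thesis using assms by simp
qed

text \<open>On the cell where the rounded treatment equals s the outcome is the single variable
  \<open>Ypot s\<close>, so ignorability at that one s applies; countably many cells may be summed
  under the integral.\<close>

lemma reweighted_discretised:
 fixes \<phi> :: "real => ennreal"
 assumes \<pi> [measurable]: "\<pi> \<in> borel_measurable borel" and cnt: "countable (range \<pi>)"
  and supp: "\<pi> ` measure_support PT \<subseteq> measure_support PT"
  and C [measurable]: "C \<in> sets borel" and \<phi> [measurable]: "\<phi> \<in> borel_measurable borel"
 shows "(\<integral>\<^sup>+\<omega>. \<phi> (Ypot (\<pi> (T \<omega>)) \<omega>) * (indicator C (T \<omega>) * ennreal (r (TX \<omega>))) \<partial>M)
  = (\<integral>\<^sup>+t. indicator C t * (\<integral>\<^sup>+\<omega>. \<phi> (Ypot (\<pi> t) \<omega>) \<partial>M) \<partial>PT)"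
proof -
 let ?R = "range \<pi>"
 define Cs where "Cs s = C \<inter> \<pi> -` {s}" for s
 have Cs [measurable]: "Cs s \<in> sets borel" for s
 proof -
  have "\<pi> -` {s} \<inter> space borel \<in> sets borel" by (rule measurable_sets[OF \<pi>]) simp
  then show ?thesis unfolding Cs_def using C by auto
 qed
 define G where "G s = (\<integral>\<^sup>+\<omega>. \<phi> (Ypot s \<omega>) \<partial>M)" for s
 have step: "(\<integral>\<^sup>+\<omega>. \<phi> (Ypot s \<omega>) * (indicator (Cs s) (T \<omega>) * ennreal (r (TX \<omega>))) \<partial>M)
   = (\<integral>\<^sup>+\<omega>. indicator (Cs s) (T \<omega>) * G s \<partial>M)" for s
 proof (cases "s \<in> measure_support PT")
  case True
  have "(\<integral>\<^sup>+\<omega>. indicator (Cs s) (T \<omega>) * G s \<partial>M) = (\<integral>\<^sup>+t. indicator (Cs s) t * G s \<partial>PT)"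
   by (rule nn_integral_PT[symmetric]) measurable
  also have "\<dots> = emeasure PT (Cs s) * G s"
   using Cs[of s] by (subst nn_integral_multc) auto
  finally show ?thesis using reweighted_outcome[OF True Cs \<phi>] unfolding G_def by simp
 next
  \<comment> \<open>The rounding maps the support into itself and T lies in the support almost
    surely, so this cell is null.\<close>
  case False
  then have "AE \<omega> in M. indicator (Cs s) (T \<omega>) = (0 :: ennreal)"
   using AE_T_support supp by (auto simp: Cs_def indicator_def elim!: eventually_mono)
  then have "(\<integral>\<^sup>+\<omega>. \<phi> (Ypot s \<omega>) * (indicator (Cs s) (T \<omega>) * ennreal (r (TX \<omega>))) \<partial>M) = (\<integral>\<^sup>+\<omega>. 0 \<partial>M)"
   "(\<integral>\<^sup>+\<omega>. indicator (Cs s) (T \<omega>) * G s \<partial>M) = (\<integral>\<^sup>+\<omega>. 0 \<partial>M)"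
   by (intro nn_integral_cong_AE; auto)+
  then show ?thesis by simp
 qed
 have "(\<integral>\<^sup>+\<omega>. \<phi> (Ypot (\<pi> (T \<omega>)) \<omega>) * (indicator C (T \<omega>) * ennreal (r (TX \<omega>))) \<partial>M)
  = (\<integral>\<^sup>+\<omega>. (\<integral>\<^sup>+s. \<phi> (Ypot s \<omega>) * (indicator (Cs s) (T \<omega>) * ennreal (r (TX \<omega>))) \<partial>count_space ?R) \<partial>M)"
 proof (rule nn_integral_cong)
  fix \<omega>
  have "(\<integral>\<^sup>+s. \<phi> (Ypot s \<omega>) * (indicator (Cs s) (T \<omega>) * ennreal (r (TX \<omega>))) \<partial>count_space ?R)
   = (\<integral>\<^sup>+s. (\<phi> (Ypot s \<omega>) * (indicator C (T \<omega>) * ennreal (r (TX \<omega>)))) * indicator {s} (\<pi> (T \<omega>)) \<partial>count_space ?R)"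
   by (intro nn_integral_cong) (auto simp: Cs_def indicator_def)
  also have "\<dots> = \<phi> (Ypot (\<pi> (T \<omega>)) \<omega>) * (indicator C (T \<omega>) * ennreal (r (TX \<omega>)))"
   by (rule nn_integral_pick) simp
  finally show "\<phi> (Ypot (\<pi> (T \<omega>)) \<omega>) * (indicator C (T \<omega>) * ennreal (r (TX \<omega>)))
   = (\<integral>\<^sup>+s. \<phi> (Ypot s \<omega>) * (indicator (Cs s) (T \<omega>) * ennreal (r (TX \<omega>))) \<partial>count_space ?R)" by simp
 qed
 also have "\<dots> = (\<integral>\<^sup>+s. (\<integral>\<^sup>+\<omega>. \<phi> (Ypot s \<omega>) * (indicator (Cs s) (T \<omega>) * ennreal (r (TX \<omega>))) \<partial>M) \<partial>count_space ?R)"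
  using cnt by (rule nn_integral_count_space_nn_integral) measurable
 also have "\<dots> = (\<integral>\<^sup>+s. (\<integral>\<^sup>+\<omega>. indicator (Cs s) (T \<omega>) * G s \<partial>M) \<partial>count_space ?R)"
  unfolding step ..
 also have "\<dots> = (\<integral>\<^sup>+\<omega>. (\<integral>\<^sup>+s. indicator (Cs s) (T \<omega>) * G s \<partial>count_space ?R) \<partial>M)"
  by (rule nn_integral_count_space_nn_integral[OF cnt, symmetric]) measurable
 also have "\<dots> = (\<integral>\<^sup>+\<omega>. indicator C (T \<omega>) * G (\<pi> (T \<omega>)) \<partial>M)"
 proof (rule nn_integral_cong)
  fix \<omega>
  have "(\<integral>\<^sup>+s. indicator (Cs s) (T \<omega>) * G s \<partial>count_space ?R)
   = (\<integral>\<^sup>+s. (indicator C (T \<omega>) * G s) * indicator {s} (\<pi> (T \<omega>)) \<partial>count_space ?R)"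
   by (intro nn_integral_cong) (auto simp: Cs_def indicator_def)
  also have "\<dots> = indicator C (T \<omega>) * G (\<pi> (T \<omega>))" by (rule nn_integral_pick) simp
  finally show "(\<integral>\<^sup>+s. indicator (Cs s) (T \<omega>) * G s \<partial>count_space ?R) = indicator C (T \<omega>) * G (\<pi> (T \<omega>))" .
 qed
 also have "\<dots> = (\<integral>\<^sup>+t. indicator C t * G (\<pi> t) \<partial>PT)"
  unfolding G_def by (rule nn_integral_PT[symmetric]) measurable
 finally show ?thesis unfolding G_def .
qed

text \<open>Path regularity enters here: along the roundings both sides of
  \<open>reweighted_discretised\<close> converge, the left by convergence at the actual treatment,
  the right by convergence at almost every fixed level. Boundedness and continuity of \<phi> allow
  dominated convergence.\<close>

lemma reweighted_observed:
 fixes \<phi> :: "real => real"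
 assumes \<phi>: "continuous_on UNIV \<phi>" and \<phi>0: "\<And>y. 0 <= \<phi> y" and \<phi>K: "\<And>y. \<phi> y <= K" and C [measurable]: "C \<in> sets borel"
 shows "(\<integral>\<^sup>+\<omega>. ennreal (\<phi> (Y \<omega>)) * (indicator C (T \<omega>) * ennreal (r (TX \<omega>))) \<partial>M)
  = (\<integral>\<^sup>+t. indicator C t * (\<integral>\<^sup>+\<omega>. ennreal (\<phi> (Ypot t \<omega>)) \<partial>M) \<partial>PT)"
proof -
 obtain \<pi> where all: "\<forall>n. \<pi> n \<in> borel_measurable borel \<and> countable (range (\<pi> n)) \<and>
    \<pi> n ` measure_support PT \<subseteq> measure_support PT"
  and lim0: "AE \<omega> in M. (\<lambda>n. Ypot (\<pi> n (T \<omega>)) \<omega>) \<longlonglongrightarrow> Ypot (T \<omega>) \<omega>"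
  and lim2: "AE t in PT. AE \<omega> in M. (\<lambda>n. Ypot (\<pi> n t) \<omega>) \<longlonglongrightarrow> Ypot t \<omega>"
  using regular unfolding regular_outcomes_def PT_def[symmetric] by (elim exE conjE)
 have \<pi>: "\<And>n. \<pi> n \<in> borel_measurable borel" "\<And>n. countable (range (\<pi> n))"
   "\<And>n. \<pi> n ` measure_support PT \<subseteq> measure_support PT"
  using all by (simp_all only: simp_thms)
 have lim1: "AE \<omega> in M. (\<lambda>n. Ypot (\<pi> n (T \<omega>)) \<omega>) \<longlonglongrightarrow> Y \<omega>"
  using lim0 by (simp only: Y_def)
 note [measurable] = \<pi>(1)
 have [measurable]: "\<phi> \<in> borel_measurable borel" using \<phi> by (rule borel_measurable_continuous_onI)
 have \<phi>lim: "(\<lambda>n. ennreal (\<phi> (y n))) \<longlonglongrightarrow> ennreal (\<phi> l)" if "y \<longlonglongrightarrow> l" for y l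
  using \<phi> that by (intro tendsto_ennrealI) (auto simp: continuous_on_eq_continuous_at intro: isCont_tendsto_compose)
 have K0: "0 <= K" using \<phi>0 \<phi>K by (meson order_trans)
 define k where "k \<omega> = indicator C (T \<omega>) * ennreal (r (TX \<omega>))" for \<omega>
 have k [measurable]: "k \<in> borel_measurable M" unfolding k_def by measurable
 have kW: "k \<omega> <= ennreal W\<^sub>0" for \<omega> unfolding k_def using r_bounds by (auto simp: indicator_def ennreal_leI)
 have kfin: "k \<omega> ~= top" for \<omega> 
  using le_less_trans[OF kW[of \<omega>] ennreal_less_top] by simp
 have c1: "(\<lambda>n. \<integral>\<^sup>+\<omega>. ennreal (\<phi> (Ypot (\<pi> n (T \<omega>)) \<omega>)) * k \<omega> \<partial>M) \<longlonglongrightarrow> (\<integral>\<^sup>+\<omega>. ennreal (\<phi> (Y \<omega>)) * k \<omega> \<partial>M)"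
 proof (rule nn_integral_dominated_convergence[where w = "\<lambda>_. ennreal K * ennreal W\<^sub>0"])
  show "AE \<omega> in M. ennreal (\<phi> (Ypot (\<pi> n (T \<omega>)) \<omega>)) * k \<omega> <= ennreal K * ennreal W\<^sub>0" for n
   using \<phi>K kW by (intro AE_I2 mult_mono) (auto intro: ennreal_leI)
  show "AE \<omega> in M. (\<lambda>n. ennreal (\<phi> (Ypot (\<pi> n (T \<omega>)) \<omega>)) * k \<omega>) \<longlonglongrightarrow> ennreal (\<phi> (Y \<omega>)) * k \<omega>"
   using lim1
  proof eventually_elim
   case (elim \<omega>)
   show ?case
    by (rule tendsto_mult_ennreal[OF \<phi>lim[OF elim] tendsto_const]) (use kfin in auto)
  qed
  show "(\<integral>\<^sup>+\<omega>. ennreal K * ennreal W\<^sub>0 \<partial>M) < \<infinity>"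
   by (simp add: emeasure_space_1 ennreal_mult[symmetric] K0 W0_pos less_imp_le)
 qed measurable
 define G where "G t = (\<integral>\<^sup>+\<omega>. ennreal (\<phi> (Ypot t \<omega>)) \<partial>M)" for t
 have G [measurable]: "G \<in> borel_measurable borel" unfolding G_def by measurable
 have GK: "G t <= ennreal K" for t
 proof -
  have "G t <= (\<integral>\<^sup>+\<omega>. ennreal K \<partial>M)" unfolding G_def using \<phi>K by (intro nn_integral_mono) (auto intro: ennreal_leI)
  then show ?thesis by (simp add: emeasure_space_1)
 qed
 have c2: "(\<lambda>n. \<integral>\<^sup>+t. indicator C t * G (\<pi> n t) \<partial>PT) \<longlonglongrightarrow> (\<integral>\<^sup>+t. indicator C t * G t \<partial>PT)"
 proof (rule nn_integral_dominated_convergence[where w = "\<lambda>_. ennreal K"])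
  show "AE t in PT. indicator C t * G (\<pi> n t) <= ennreal K" for n
   using GK by (intro AE_I2) (auto simp: indicator_def)
  show "AE t in PT. (\<lambda>n. indicator C t * G (\<pi> n t)) \<longlonglongrightarrow> indicator C t * G t"
   using lim2
  proof eventually_elim
   case (elim t)
   have "(\<lambda>n. G (\<pi> n t)) \<longlonglongrightarrow> G t"
    unfolding G_def
   proof (rule nn_integral_dominated_convergence[where w = "\<lambda>_. ennreal K"])
    show "AE \<omega> in M. ennreal (\<phi> (Ypot (\<pi> n t) \<omega>)) <= ennreal K" for n
     using \<phi>K by (intro AE_I2) (auto intro: ennreal_leI)
    show "AE \<omega> in M. (\<lambda>n. ennreal (\<phi> (Ypot (\<pi> n t) \<omega>))) \<longlonglongrightarrow> ennreal (\<phi> (Ypot t \<omega>))"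
     using elim by eventually_elim (rule \<phi>lim)
   qed (auto simp: emeasure_space_1)
   then show ?case by (cases "t \<in> C") auto
  qed
 qed (auto simp: PT.emeasure_space_1[simplified])
 have ec: "(\<integral>\<^sup>+\<omega>. ennreal (\<phi> (Ypot (\<pi> n (T \<omega>)) \<omega>)) * k \<omega> \<partial>M) = (\<integral>\<^sup>+t. indicator C t * G (\<pi> n t) \<partial>PT)" for n
  unfolding k_def G_def by (rule reweighted_discretised[OF \<pi> C]) measurable
 have "(\<integral>\<^sup>+\<omega>. ennreal (\<phi> (Y \<omega>)) * k \<omega> \<partial>M) = (\<integral>\<^sup>+t. indicator C t * G t \<partial>PT)"
  by (rule LIMSEQ_unique[OF c1[unfolded ec] c2])
 then show ?thesis unfolding k_def G_def .
qed

text \<open>Both functions of t are densities, with respect to P_T, of the same measure on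
  treatments, as testing with sets C shows; the right-hand one arises from integrating \<kappa>
  under Q by Fubini. Densities are unique almost everywhere.\<close>

lemma outcome_law_identified:
 fixes \<phi> :: "real => real" and \<kappa> :: "'a \<times> 'b => ennreal"
 assumes \<phi>: "continuous_on UNIV \<phi>" "\<And>y. 0 <= \<phi> y" "\<And>y. \<phi> y <= K"
  and \<kappa> [measurable]: "\<kappa> \<in> borel_measurable borel"
  and eq: "\<And>C. C \<in> sets borel ==>
   (\<integral>\<^sup>+\<omega>. ennreal (\<phi> (Y \<omega>)) * (indicator C (T \<omega>) * ennreal (r (TX \<omega>))) \<partial>M)
   = (\<integral>\<^sup>+\<omega>. \<kappa> (TX \<omega>) * (indicator C (T \<omega>) * ennreal (r (TX \<omega>))) \<partial>M)"
 shows "AE t in PT. (\<integral>\<^sup>+\<omega>. ennreal (\<phi> (Ypot t \<omega>)) \<partial>M) = (\<integral>\<^sup>+x. \<kappa> (t, x) \<partial>PX)"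
proof -
 have [measurable]: "\<phi> \<in> borel_measurable borel" using \<phi>(1) by (rule borel_measurable_continuous_onI)
 have [measurable]: "(\<lambda>t. \<integral>\<^sup>+\<omega>. ennreal (\<phi> (Ypot t \<omega>)) \<partial>M) \<in> borel_measurable borel" by measurable
 have \<kappa>2: "\<kappa> \<in> borel_measurable (PT \<Otimes>\<^sub>M PX)"
  using \<kappa> unfolding Q_def[symmetric] by (simp only: measurable_cong_sets[OF sets_Q refl])
 have \<kappa>m: "(\<lambda>t. \<integral>\<^sup>+x. \<kappa> (t, x) \<partial>PX) \<in> borel_measurable PT"
  using PX.borel_measurable_nn_integral_fst[OF \<kappa>2] .
 have "density PT (\<lambda>t. \<integral>\<^sup>+\<omega>. ennreal (\<phi> (Ypot t \<omega>)) \<partial>M) = density PT (\<lambda>t. \<integral>\<^sup>+x. \<kappa> (t, x) \<partial>PX)"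
 proof (rule measure_eqI)
  fix C assume "C \<in> sets (density PT (\<lambda>t. \<integral>\<^sup>+\<omega>. ennreal (\<phi> (Ypot t \<omega>)) \<partial>M))"
  then have C [measurable]: "C \<in> sets borel" by simp
  have "emeasure (density PT (\<lambda>t. \<integral>\<^sup>+\<omega>. ennreal (\<phi> (Ypot t \<omega>)) \<partial>M)) C = (\<integral>\<^sup>+t. indicator C t * (\<integral>\<^sup>+\<omega>. ennreal (\<phi> (Ypot t \<omega>)) \<partial>M) \<partial>PT)"
   using C by (subst emeasure_density) (auto simp: mult.commute)
  also have "\<dots> = (\<integral>\<^sup>+\<omega>. \<kappa> (TX \<omega>) * (indicator C (T \<omega>) * ennreal (r (TX \<omega>))) \<partial>M)"
   unfolding eq[OF C, symmetric] by (rule reweighted_observed[OF \<phi> C, symmetric])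
  also have "\<dots> = (\<integral>\<^sup>+\<omega>. ennreal (r (TX \<omega>)) * (indicator C (fst (TX \<omega>)) * \<kappa> (TX \<omega>)) \<partial>M)"
   by (simp add: mult_ac)
  also have "\<dots> = (\<integral>\<^sup>+z. indicator C (fst z) * \<kappa> z \<partial>Q)"
  proof (rule nn_integral_Q[symmetric])
   have "fst \<in> measurable (borel :: ('a \<times> 'b) measure) (borel :: 'a measure)"
    by (intro borel_measurable_continuous_onI continuous_intros)
   then show "(\<lambda>z. indicator C (fst z) * \<kappa> z) \<in> borel_measurable borel" by measurable
  qed
  also have "\<dots> = (\<integral>\<^sup>+t. (\<integral>\<^sup>+x. indicator C t * \<kappa> (t, x) \<partial>PX) \<partial>PT)"
   unfolding Q_def
   by (subst PX.nn_integral_fst[symmetric]) (use \<kappa>2 in \<open>auto intro!: borel_measurable_times_ennreal measurable_compose[OF measurable_fst]\<close>)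
  also have "\<dots> = (\<integral>\<^sup>+t. (\<integral>\<^sup>+x. \<kappa> (t, x) \<partial>PX) * indicator C t \<partial>PT)"
   by (intro nn_integral_cong) (auto simp: indicator_def)
  also have "\<dots> = emeasure (density PT (\<lambda>t. \<integral>\<^sup>+x. \<kappa> (t, x) \<partial>PX)) C"
   using C \<kappa>m by (subst emeasure_density) auto
  finally show "emeasure (density PT (\<lambda>t. \<integral>\<^sup>+\<omega>. ennreal (\<phi> (Ypot t \<omega>)) \<partial>M)) C = emeasure (density PT (\<lambda>t. \<integral>\<^sup>+x. \<kappa> (t, x) \<partial>PX)) C" .
 qed simp
 then show ?thesis
  by (subst (asm) PT.density_unique_iff) (use \<kappa>m in auto)
qed

lemma AE_P_iff: "{z. \<phi> z} \<in> sets borel ==> (AE z in P. \<phi> z) \<longleftrightarrow> (AE \<omega> in M. \<phi> (TX \<omega>))"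
 unfolding P_def by (subst AE_distr_iff) auto

lemma regression_bounded:
 assumes \<tau> [measurable]: "\<tau> \<in> borel_measurable borel"
  and reg: "AE \<omega> in M. real_cond_exp M FTX Y \<omega> = \<tau> (TX \<omega>)"
  and C: "AE \<omega> in M. \<bar>Y \<omega>\<bar> <= C"
 shows "AE \<omega> in M. \<bar>\<tau> (TX \<omega>)\<bar> <= C"
proof -
 have Yint: "integrable M Y" by (rule integrable_const_bound[where B = C]) (use C in auto)
 have "AE \<omega> in M. - C <= real_cond_exp M FTX Y \<omega>"
  by (rule FTX.real_cond_exp_ge_c[OF Yint]) (use C in \<open>auto elim!: eventually_mono\<close>)
 moreover have "AE \<omega> in M. real_cond_exp M FTX Y \<omega> <= C"
  by (rule FTX.real_cond_exp_le_c[OF Yint]) (use C in \<open>auto elim!: eventually_mono\<close>)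
 ultimately show ?thesis using reg by eventually_elim auto
qed

lemma regression_integral:
 assumes \<tau> [measurable]: "\<tau> \<in> borel_measurable borel"
  and reg: "AE \<omega> in M. real_cond_exp M FTX Y \<omega> = \<tau> (TX \<omega>)"
  and C: "AE \<omega> in M. \<bar>Y \<omega>\<bar> <= C"
  and h [measurable]: "h \<in> borel_measurable borel" and hK: "\<And>z. \<bar>h z\<bar> <= K"
 shows "(\<integral>\<omega>. h (TX \<omega>) * Y \<omega> \<partial>M) = (\<integral>\<omega>. h (TX \<omega>) * \<tau> (TX \<omega>) \<partial>M)"
proof -
 have Yint: "integrable M Y" by (rule integrable_const_bound[where B = C]) (use C in auto)
 have i: "integrable M (\<lambda>\<omega>. h (TX \<omega>) * Y \<omega>)"
 proof (rule Bochner_Integration.integrable_bound[OF integrable_mult_right[OF Yint, of K]])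
  have "\<bar>h z * y\<bar> <= \<bar>K * y\<bar>" for z y
   unfolding abs_mult using hK[of z] by (intro mult_right_mono) auto
  then show "AE \<omega> in M. norm (h (TX \<omega>) * Y \<omega>) <= norm (K * Y \<omega>)" by simp
 qed measurable
 have hF: "(\<lambda>\<omega>. h (TX \<omega>)) \<in> borel_measurable FTX" by (rule measurable_gen[OF TX_measurable h])
 have "(\<integral>\<omega>. h (TX \<omega>) * Y \<omega> \<partial>M) = (\<integral>\<omega>. h (TX \<omega>) * real_cond_exp M FTX Y \<omega> \<partial>M)"
  by (rule FTX.real_cond_exp_intg(2)[OF i hF, symmetric]) measurable
 also have "\<dots> = (\<integral>\<omega>. h (TX \<omega>) * \<tau> (TX \<omega>) \<partial>M)"
  by (rule integral_cong_AE) (use reg in auto)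
 finally show ?thesis .
qed

text \<open>Applied to \<open>\<phi>1\<close>, \<open>outcome_law_identified\<close> yields the mean
  of the clipped Y(t). Applied to \<open>\<phi>2\<close>, which is positive exactly beyond C, it
  shows that for almost every t the outcome Y(t) stays in [-C, C] almost surely, as Y does, so
  clipping changes nothing.\<close>

theorem dose_response_identified:
 assumes \<tau> [measurable]: "\<tau> \<in> borel_measurable borel"
  and reg: "AE \<omega> in M. real_cond_exp M FTX Y \<omega> = \<tau> (TX \<omega>)"
  and C: "AE \<omega> in M. \<bar>Y \<omega>\<bar> <= C" and C0: "0 <= C"
 defines "\<tau>' \<equiv> \<lambda>z. max (- C) (min C (\<tau> z))"
 shows "AE t in PT. (\<integral>\<omega>. Ypot t \<omega> \<partial>M) = (\<integral>x. \<tau>' (t, x) \<partial>PX)"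
proof -
 \<comment> \<open>The shift by C makes the clipped outcome nonnegative, as
   \<open>outcome_law_identified\<close> requires.\<close>
 define \<phi>1 where "\<phi>1 y = max (- C) (min C y) + C" for y :: real
 define \<phi>2 where "\<phi>2 y = min 1 (max 0 (\<bar>y\<bar> - C))" for y :: real
 have \<tau>' [measurable]: "\<tau>' \<in> borel_measurable borel" unfolding \<tau>'_def by measurable
 have \<tau>'b: "- C <= \<tau>' z" "\<tau>' z <= C" for z unfolding \<tau>'_def using C0 by auto
 have \<tau>'eq: "AE \<omega> in M. \<tau>' (TX \<omega>) = \<tau> (TX \<omega>)"
  using regression_bounded[OF \<tau> reg C] by eventually_elim (auto simp: \<tau>'_def)
 have 1: "AE t in PT. (\<integral>\<^sup>+\<omega>. ennreal (\<phi>1 (Ypot t \<omega>)) \<partial>M) = (\<integral>\<^sup>+x. ennreal (\<tau>' (t, x) + C) \<partial>PX)"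
 proof (rule outcome_law_identified[where K = "2 * C"])
  show "continuous_on UNIV \<phi>1" unfolding \<phi>1_def by (intro continuous_intros)
  show "0 <= \<phi>1 y" "\<phi>1 y <= 2 * C" for y unfolding \<phi>1_def using C0 by auto
  fix D :: "'a set" assume D: "D \<in> sets borel"
  define h where "h z = indicator D (fst z) * r z" for z
  have "fst \<in> measurable (borel :: ('a \<times> 'b) measure) (borel :: 'a measure)"
   by (intro borel_measurable_continuous_onI continuous_intros)
  then have h [measurable]: "h \<in> borel_measurable borel" unfolding h_def using D by measurable
  have h0: "0 <= h z" "\<bar>h z\<bar> <= W\<^sub>0" for z using r_bounds[of z] W0_pos unfolding h_def by (auto simp: indicator_def)
  have hint: "integrable M (\<lambda>\<omega>. h (TX \<omega>))" by (rule integrable_bounded[OF _ h0(2)]) measurable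
  have b: "\<bar>h z * y\<bar> <= W\<^sub>0 * C" if "\<bar>y\<bar> <= C" for z y
   unfolding abs_mult using h0(2)[of z] that W0_pos by (intro mult_mono) auto
  have i1: "integrable M (\<lambda>\<omega>. h (TX \<omega>) * Y \<omega>)"
   by (rule integrable_const_bound[where B = "W\<^sub>0 * C"]) (use C b in auto)
  have i2: "integrable M (\<lambda>\<omega>. h (TX \<omega>) * \<tau>' (TX \<omega>))"
   by (rule integrable_bounded[where c = "W\<^sub>0 * C"]) (use \<tau>'b b in \<open>auto simp: abs_le_iff minus_le_iff\<close>)
  have "(\<integral>\<omega>. h (TX \<omega>) * Y \<omega> \<partial>M) = (\<integral>\<omega>. h (TX \<omega>) * \<tau> (TX \<omega>) \<partial>M)"
   by (rule regression_integral[OF \<tau> reg C h h0(2)])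
  also have "\<dots> = (\<integral>\<omega>. h (TX \<omega>) * \<tau>' (TX \<omega>) \<partial>M)"
   by (rule integral_cong_AE) (use \<tau>'eq in auto)
  finally have eq: "(\<integral>\<omega>. h (TX \<omega>) * (Y \<omega> + C) \<partial>M) = (\<integral>\<omega>. h (TX \<omega>) * (\<tau>' (TX \<omega>) + C) \<partial>M)"
   using i1 i2 hint by (simp add: distrib_left)
  have j1: "integrable M (\<lambda>\<omega>. h (TX \<omega>) * (Y \<omega> + C))" and j2: "integrable M (\<lambda>\<omega>. h (TX \<omega>) * (\<tau>' (TX \<omega>) + C))"
   using i1 i2 hint by (simp_all add: distrib_left)
  have "(\<integral>\<^sup>+\<omega>. ennreal (\<phi>1 (Y \<omega>)) * (indicator D (T \<omega>) * ennreal (r (TX \<omega>))) \<partial>M)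
   = (\<integral>\<^sup>+\<omega>. ennreal (h (TX \<omega>) * (Y \<omega> + C)) \<partial>M)"
  proof (rule nn_integral_cong_AE)
   show "AE \<omega> in M. ennreal (\<phi>1 (Y \<omega>)) * (indicator D (T \<omega>) * ennreal (r (TX \<omega>))) = ennreal (h (TX \<omega>) * (Y \<omega> + C))"
    using C
   proof eventually_elim
    case (elim \<omega>)
    then have "\<phi>1 (Y \<omega>) = Y \<omega> + C" "0 <= Y \<omega> + C" unfolding \<phi>1_def by auto
    then show ?case using r_bounds[of "(TX \<omega>)"] by (auto simp: h_def indicator_def ennreal_mult mult.commute)
   qed
  qed
  also have "\<dots> = ennreal (\<integral>\<omega>. h (TX \<omega>) * (Y \<omega> + C) \<partial>M)"
  proof (rule nn_integral_eq_integral[OF j1])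
   show "AE \<omega> in M. 0 <= h (TX \<omega>) * (Y \<omega> + C)"
    using C by eventually_elim (intro mult_nonneg_nonneg h0, auto)
  qed
  also have "\<dots> = (\<integral>\<^sup>+\<omega>. ennreal (h (TX \<omega>) * (\<tau>' (TX \<omega>) + C)) \<partial>M)"
   unfolding eq
  proof (rule nn_integral_eq_integral[OF j2, symmetric])
   have "0 <= \<tau>' z + C" for z using \<tau>'b[of z] by linarith
   then show "AE \<omega> in M. 0 <= h (TX \<omega>) * (\<tau>' (TX \<omega>) + C)" by (intro AE_I2 mult_nonneg_nonneg h0)
  qed
  also have "\<dots> = (\<integral>\<^sup>+\<omega>. ennreal (\<tau>' (TX \<omega>) + C) * (indicator D (T \<omega>) * ennreal (r (TX \<omega>))) \<partial>M)"
  proof (rule nn_integral_cong)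
   fix \<omega>
   have "0 <= \<tau>' (TX \<omega>) + C" using \<tau>'b[of "(TX \<omega>)"] by linarith
   then show "ennreal (h (TX \<omega>) * (\<tau>' (TX \<omega>) + C)) = ennreal (\<tau>' (TX \<omega>) + C) * (indicator D (T \<omega>) * ennreal (r (TX \<omega>)))"
    using r_bounds[of "(TX \<omega>)"] by (auto simp: h_def indicator_def ennreal_mult mult.commute)
  qed
  finally show "(\<integral>\<^sup>+\<omega>. ennreal (\<phi>1 (Y \<omega>)) * (indicator D (T \<omega>) * ennreal (r (TX \<omega>))) \<partial>M)
   = (\<integral>\<^sup>+\<omega>. ennreal (\<tau>' (TX \<omega>) + C) * (indicator D (T \<omega>) * ennreal (r (TX \<omega>))) \<partial>M)" .
 qed measurable
 have 2: "AE t in PT. (\<integral>\<^sup>+\<omega>. ennreal (\<phi>2 (Ypot t \<omega>)) \<partial>M) = (\<integral>\<^sup>+x. (\<lambda>_. 0) (t, x) \<partial>PX)"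
 proof (rule outcome_law_identified[where K = 1])
  show "continuous_on UNIV \<phi>2" unfolding \<phi>2_def by (intro continuous_intros)
  show "0 <= \<phi>2 y" "\<phi>2 y <= 1" for y unfolding \<phi>2_def by auto
  fix D :: "'a set"
  have "(\<integral>\<^sup>+\<omega>. ennreal (\<phi>2 (Y \<omega>)) * (indicator D (T \<omega>) * ennreal (r (TX \<omega>))) \<partial>M) = (\<integral>\<^sup>+\<omega>. 0 \<partial>M)"
  proof (rule nn_integral_cong_AE)
   show "AE \<omega> in M. ennreal (\<phi>2 (Y \<omega>)) * (indicator D (T \<omega>) * ennreal (r (TX \<omega>))) = 0"
    using C by eventually_elim (auto simp: \<phi>2_def)
  qed
  then show "(\<integral>\<^sup>+\<omega>. ennreal (\<phi>2 (Y \<omega>)) * (indicator D (T \<omega>) * ennreal (r (TX \<omega>))) \<partial>M)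
   = (\<integral>\<^sup>+\<omega>. 0 * (indicator D (T \<omega>) * ennreal (r (TX \<omega>))) \<partial>M)" by simp
 qed simp
 from 1 2 show ?thesis
 proof eventually_elim
  case (elim t)
  have m2: "(\<lambda>\<omega>. ennreal (\<phi>2 (Ypot t \<omega>))) \<in> borel_measurable M" unfolding \<phi>2_def by measurable
  have "AE \<omega> in M. ennreal (\<phi>2 (Ypot t \<omega>)) = 0"
   using elim(2) nn_integral_0_iff_AE[OF m2] by simp
  then have Yb: "AE \<omega> in M. \<phi>1 (Ypot t \<omega>) = Ypot t \<omega> + C"
   by eventually_elim (auto simp: \<phi>1_def \<phi>2_def min_def max_def split: if_splits)
  have p1: "\<bar>\<phi>1 y\<bar> <= 2 * C" "0 <= \<phi>1 y" for y unfolding \<phi>1_def using C0 by auto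
  have m1 [measurable]: "(\<lambda>\<omega>. \<phi>1 (Ypot t \<omega>)) \<in> borel_measurable M" unfolding \<phi>1_def by measurable
  have \<tau>'t [measurable]: "(\<lambda>x. \<tau>' (t, x)) \<in> borel_measurable PX"
  proof -
   have "(\<lambda>x. (t, x)) \<in> borel_measurable (borel :: 'b measure)" by (intro borel_measurable_continuous_onI continuous_intros)
   then have "(\<lambda>x. \<tau>' (t, x)) \<in> borel_measurable borel" by measurable
   then show ?thesis by (simp only: measurable_cong_sets[OF sets_PX refl])
  qed
  have \<tau>'c: "\<bar>\<tau>' z + C\<bar> <= 2 * C" "0 <= \<tau>' z + C" for z using \<tau>'b[of z] by auto
  have "ennreal (\<integral>\<omega>. \<phi>1 (Ypot t \<omega>) \<partial>M) = (\<integral>\<^sup>+\<omega>. ennreal (\<phi>1 (Ypot t \<omega>)) \<partial>M)"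
   by (rule nn_integral_eq_integral[symmetric], rule integrable_bounded[OF m1 p1(1)]) (use p1 in auto)
  also have "\<dots> = (\<integral>\<^sup>+x. ennreal (\<tau>' (t, x) + C) \<partial>PX)" by (rule elim(1))
  also have "\<dots> = ennreal (\<integral>x. \<tau>' (t, x) + C \<partial>PX)"
   by (rule nn_integral_eq_integral, rule PX.integrable_bounded[OF _ \<tau>'c(1)]) (use \<tau>'c in auto)
  finally have "(\<integral>\<omega>. \<phi>1 (Ypot t \<omega>) \<partial>M) = (\<integral>x. \<tau>' (t, x) + C \<partial>PX)"
   using p1 \<tau>'c by (subst (asm) ennreal_inj) (auto intro!: Bochner_Integration.integral_nonneg)
  moreover have "(\<integral>\<omega>. \<phi>1 (Ypot t \<omega>) \<partial>M) = (\<integral>\<omega>. Ypot t \<omega> + C \<partial>M)"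
   by (rule integral_cong_AE) (use Yb in auto)
  moreover have "integrable M (Ypot t)"
  proof -
   have "integrable M (\<lambda>\<omega>. \<phi>1 (Ypot t \<omega>) - C)"
    using integrable_bounded[OF m1 p1(1)] by simp
   then show ?thesis by (rule integrable_cong_AE_imp) (use Yb in auto)
  qed
  moreover have "integrable PX (\<lambda>x. \<tau>' (t, x))"
   by (rule PX.integrable_bounded[where c = C]) (use \<tau>'b in \<open>auto simp: abs_le_iff minus_le_iff\<close>)
  ultimately show ?case by (simp add: prob_space PX.prob_space[simplified])
 qed
qed

end

section \<open>Balancing classes\<close>

text \<open>Bounded oscillation is asked instead of bounded values: the Lipschitz class contains all
  constants, and a difference of two means does not see them.\<close>

definition equicontinuous_class :: "'z::metric_space set => ('z => real) set => bool" where
 "equicontinuous_class Z F \<longleftrightarrow>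
  (\<forall>\<epsilon>>0. \<exists>\<delta>>0. \<forall>f\<in>F. \<forall>z\<in>Z. \<forall>z'\<in>Z. dist z z' < \<delta> \<longrightarrow> \<bar>f z - f z'\<bar> <= \<epsilon>) \<and>
  (\<exists>D. \<forall>f\<in>F. \<forall>z\<in>Z. \<forall>z'\<in>Z. \<bar>f z - f z'\<bar> <= D)"

lemma equicontinuous_lipschitz_class:
 assumes "compact Z" shows "equicontinuous_class Z (lipschitz_class Z)"
proof -
 have l: "\<bar>f z - f z'\<bar> <= dist z z'" if "f \<in> lipschitz_class Z" "z \<in> Z" "z' \<in> Z" for f z z'
  using that lipschitz_onD[of 1 Z f z z'] unfolding lipschitz_class_def by (simp add: dist_real_def)
 obtain D where D: "\<And>z z'. z \<in> Z ==> z' \<in> Z ==> dist z z' <= D"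
  using compact_imp_bounded[OF assms] unfolding bounded_two_points by blast
 show ?thesis
  unfolding equicontinuous_class_def
 proof (intro conjI allI impI)
  fix \<epsilon> :: real assume "\<epsilon> > 0"
  then show "\<exists>\<delta>>0. \<forall>f\<in>lipschitz_class Z. \<forall>z\<in>Z. \<forall>z'\<in>Z. dist z z' < \<delta> \<longrightarrow> \<bar>f z - f z'\<bar> <= \<epsilon>"
   by (intro exI[of _ \<epsilon>]) (auto intro: order_trans[OF l])
 next
  show "\<exists>D. \<forall>f\<in>lipschitz_class Z. \<forall>z\<in>Z. \<forall>z'\<in>Z. \<bar>f z - f z'\<bar> <= D"
   by (intro exI[of _ D]) (auto intro: order_trans[OF l] D)
 qed
qed

lemma equicontinuous_class_continuous_on:
 assumes "equicontinuous_class Z F" "f \<in> F" shows "continuous_on Z f"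
proof (rule continuous_onI)
 fix z and \<epsilon> :: real assume "z \<in> Z" "0 < \<epsilon>"
 then have "\<epsilon> / 2 > 0" by simp
 then obtain \<delta> where "\<delta> > 0" "\<forall>f\<in>F. \<forall>z\<in>Z. \<forall>z'\<in>Z. dist z z' < \<delta> \<longrightarrow> \<bar>f z - f z'\<bar> <= \<epsilon> / 2"
  using assms(1) unfolding equicontinuous_class_def by blast
 with \<open>z \<in> Z\<close> \<open>0 < \<epsilon>\<close> assms(2) show "\<exists>d>0. \<forall>x'\<in>Z. dist x' z < d \<longrightarrow> dist (f x') (f z) <= \<epsilon>"
  by (intro exI[of _ \<delta>]) (fastforce simp: dist_real_def)
qed

section \<open>Kernel spaces on a compact set\<close>

locale rkhs_space =
 fixes Z :: "'z::metric_space set" and K :: "'z => 'z => real" and H :: "('z => real) set"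
  and ip :: "('z => real) => ('z => real) => real"
 assumes kernel: "continuous_kernel_rkhs Z K H ip" and compact_Z: "compact Z"
begin

definition feature :: "'z => 'z => real" where "feature z = (\<lambda>y. if y \<in> Z then K z y else 0)"

lemma is_rkhs: "rkhs Z K H ip" and K_continuous: "continuous_on (Z \<times> Z) (\<lambda>(z, z'). K z z')"
 using kernel unfolding continuous_kernel_rkhs_def by auto

lemma H_zero: "(\<lambda>_. 0) \<in> H"
 and H_add: "f \<in> H ==> g \<in> H ==> (\<lambda>z. f z + g z) \<in> H"
 and H_scale: "f \<in> H ==> (\<lambda>z. c * f z) \<in> H"
 and ip_sym: "f \<in> H ==> g \<in> H ==> ip f g = ip g f"
 and ip_add: "f \<in> H ==> g \<in> H ==> h \<in> H ==> ip (\<lambda>z. f z + g z) h = ip f h + ip g h"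
 and ip_scale: "f \<in> H ==> g \<in> H ==> ip (\<lambda>z. c * f z) g = c * ip f g"
 and ip_nonneg: "f \<in> H ==> 0 <= ip f f"
 and ip_eq_0: "f \<in> H ==> ip f f = 0 ==> f = (\<lambda>_. 0)"
 and feature_H: "z \<in> Z ==> feature z \<in> H"
 and reproducing: "z \<in> Z ==> f \<in> H ==> f z = ip f (feature z)"
 using is_rkhs unfolding rkhs_def feature_def by blast+

lemma ip_combination:
 assumes "f \<in> H" "g \<in> H" "h \<in> H"
 shows "(\<lambda>z. f z + c * g z) \<in> H" "ip (\<lambda>z. f z + c * g z) h = ip f h + c * ip g h" "ip h (\<lambda>z. f z + c * g z) = ip h f + c * ip h g"
proof -
 show m: "(\<lambda>z. f z + c * g z) \<in> H" using assms H_add[OF _ H_scale] by blast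
 show 1: "ip (\<lambda>z. f z + c * g z) h = ip f h + c * ip g h"
  using ip_add[OF assms(1) H_scale[OF assms(2)] assms(3), of c] ip_scale[OF assms(2,3), of c] by simp
 show "ip h (\<lambda>z. f z + c * g z) = ip h f + c * ip h g"
  using 1 ip_sym[OF m assms(3)] ip_sym[OF assms(1,3)] ip_sym[OF assms(2,3)] by simp
qed

lemma ip_square_combination:
 assumes "f \<in> H" "g \<in> H"
 shows "ip (\<lambda>z. f z + c * g z) (\<lambda>z. f z + c * g z) = ip f f + 2 * c * ip f g + c\<^sup>2 * ip g g"
 using ip_combination[OF assms] ip_combination[OF assms assms(1)] ip_combination[OF assms assms(2)] ip_sym[OF assms(2,1)] assms
 by (simp add: algebra_simps power2_eq_square)

lemma ip_Cauchy_Schwarz: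
 assumes f: "f \<in> H" and g: "g \<in> H" shows "(ip f g)\<^sup>2 <= ip f f * ip g g"
proof (cases "ip g g = 0")
 case True
 then have "g = (\<lambda>z. 0 * g z)" using ip_eq_0[OF g] by auto
 then have "ip f g = 0" using ip_scale[OF g f, of 0] ip_sym[OF g f] by simp
 then show ?thesis using True by simp
next
 case False
 then have pos: "ip g g > 0" using ip_nonneg[OF g] by simp
 have "0 <= ip (\<lambda>z. f z + (- (ip f g / ip g g)) * g z) (\<lambda>z. f z + (- (ip f g / ip g g)) * g z)"
  by (intro ip_nonneg ip_combination(1)[OF f g g])
 also have "\<dots> = ip f f - (ip f g)\<^sup>2 / ip g g"
  unfolding ip_square_combination[OF f g] using pos by (simp add: power2_eq_square field_simps)
 finally show ?thesis using pos by (simp add: field_simps)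
qed

lemma ip_feature: "z \<in> Z ==> z' \<in> Z ==> ip (feature z) (feature z') = K z z'"
 using reproducing[of z' "feature z"] feature_H by (simp add: feature_def)

lemma H_eval_bound:
 assumes "f \<in> H" "z \<in> Z" shows "(f z)\<^sup>2 <= ip f f * K z z"
 using ip_Cauchy_Schwarz[OF assms(1) feature_H[OF assms(2)]] reproducing[OF assms(2,1)] ip_feature assms(2) by simp

text \<open>Cauchy-Schwarz against the difference of the two kernel sections, whose squared norm is
  the bracket. Continuity of the kernel then gives one modulus for the whole unit ball.\<close>

lemma H_eval_diff:
 assumes f: "f \<in> H" and z: "z \<in> Z" "z' \<in> Z"
 shows "(f z - f z')\<^sup>2 <= ip f f * ((K z z - K z z') + (K z' z' - K z z'))"
proof -
 define d where "d = (\<lambda>y. feature z y + (-1) * feature z' y)"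
 have d: "d \<in> H" unfolding d_def using ip_combination(1)[OF feature_H feature_H feature_H] z by blast
 have "f z - f z' = ip f d"
  unfolding d_def using ip_combination(3)[OF feature_H[OF z(1)] feature_H[OF z(2)] f, of "-1"] reproducing[OF _ f] z by simp
 moreover have "ip d d = (K z z - K z z') + (K z' z' - K z z')"
  unfolding d_def ip_square_combination[OF feature_H[OF z(1)] feature_H[OF z(2)]] using z by (simp add: ip_feature)
 ultimately show ?thesis using ip_Cauchy_Schwarz[OF f d] by simp
qed

lemma kernel_bounded: "\<exists>C\<ge>0. \<forall>z\<in>Z. K z z <= C"
proof -
 have "compact ((\<lambda>(z, z'). K z z') ` (Z \<times> Z))"
  by (intro compact_continuous_image K_continuous compact_Times compact_Z)
 then have "bounded ((\<lambda>(z, z'). K z z') ` (Z \<times> Z))" by (rule compact_imp_bounded)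
 then obtain C where "\<forall>x\<in>(\<lambda>(z, z'). K z z') ` (Z \<times> Z). norm x <= C" unfolding bounded_iff by blast
 then have "\<forall>z\<in>Z. K z z <= \<bar>C\<bar>" by fastforce
 then show ?thesis by (intro exI[of _ "\<bar>C\<bar>"]) auto
qed

lemma unit_ball_bounded: "\<exists>C\<ge>0. \<forall>h\<in>H. ip h h <= 1 \<longrightarrow> (\<forall>z\<in>Z. \<bar>h z\<bar> <= C)"
proof -
 obtain C where C: "C >= 0" "\<And>z. z \<in> Z ==> K z z <= C" using kernel_bounded by blast
 show ?thesis
 proof (intro exI[of _ "sqrt C"] conjI ballI impI)
  fix h z assume h: "h \<in> H" "ip h h <= 1" "z \<in> Z"
  have K0: "0 <= K z z" using ip_nonneg[OF feature_H[OF h(3)]] ip_feature[OF h(3) h(3)] by simp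
  have "(h z)\<^sup>2 <= ip h h * K z z" by (rule H_eval_bound[OF h(1,3)])
  also have "\<dots> <= 1 * C" using h C K0 by (intro mult_mono) auto
  finally show "\<bar>h z\<bar> <= sqrt C" by (simp add: real_le_rsqrt)
 qed (use C in simp)
qed

lemma kernel_modulus:
 assumes "\<epsilon> > 0"
 shows "\<exists>\<delta>>0. \<forall>z\<in>Z. \<forall>z'\<in>Z. dist z z' < \<delta> \<longrightarrow> (K z z - K z z') + (K z' z' - K z z') <= \<epsilon>"
proof -
 have "uniformly_continuous_on (Z \<times> Z) (\<lambda>(z, z'). K z z')"
  by (intro compact_uniformly_continuous K_continuous compact_Times compact_Z)
 moreover have "\<epsilon> / 2 > 0" using assms by simp
 ultimately obtain \<delta> where \<delta>: "\<delta> > 0"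
  "\<And>p q. p \<in> Z \<times> Z ==> q \<in> Z \<times> Z ==> dist q p < \<delta> ==> dist (case q of (z, z') => K z z') (case p of (z, z') => K z z') < \<epsilon> / 2"
  unfolding uniformly_continuous_on_def by metis
 show ?thesis
 proof (intro exI[of _ \<delta>] conjI ballI impI)
  fix z z' assume z: "z \<in> Z" "z' \<in> Z" "dist z z' < \<delta>"
  have "\<bar>K z z - K z z'\<bar> < \<epsilon> / 2" using \<delta>(2)[of "(z, z')" "(z, z)"] z by (simp add: dist_Pair_Pair dist_real_def)
  moreover have "\<bar>K z' z' - K z z'\<bar> < \<epsilon> / 2" using \<delta>(2)[of "(z, z')" "(z', z')"] z by (simp add: dist_Pair_Pair dist_real_def dist_commute)
  ultimately show "(K z z - K z z') + (K z' z' - K z z') <= \<epsilon>" by linarith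
 qed (use \<delta> in simp)
qed

lemma equicontinuous_unit_ball: "equicontinuous_class Z (rkhs_unit_ball Z H ip)"
 unfolding equicontinuous_class_def
proof (intro conjI allI impI)
 fix \<epsilon> :: real assume "\<epsilon> > 0"
 then obtain \<delta> where \<delta>: "\<delta> > 0"
  "\<And>z z'. z \<in> Z ==> z' \<in> Z ==> dist z z' < \<delta> ==> (K z z - K z z') + (K z' z' - K z z') <= \<epsilon>\<^sup>2"
  using kernel_modulus[of "\<epsilon>\<^sup>2"] by auto
 show "\<exists>\<delta>>0. \<forall>f\<in>rkhs_unit_ball Z H ip. \<forall>z\<in>Z. \<forall>z'\<in>Z. dist z z' < \<delta> \<longrightarrow> \<bar>f z - f z'\<bar> <= \<epsilon>"
 proof (intro exI[of _ \<delta>] conjI ballI impI)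
  fix f z z' assume f: "f \<in> rkhs_unit_ball Z H ip" and z: "z \<in> Z" "z' \<in> Z" "dist z z' < \<delta>"
  obtain h where h: "h \<in> H" "ip h h <= 1" "\<And>z. z \<in> Z ==> f z = h z" using f unfolding rkhs_unit_ball_def by auto
  have "(h z - h z')\<^sup>2 <= ip h h * ((K z z - K z z') + (K z' z' - K z z'))" by (rule H_eval_diff[OF h(1) z(1,2)])
  also have "\<dots> <= ip h h * \<epsilon>\<^sup>2" using \<delta>(2)[OF z] ip_nonneg[OF h(1)] by (intro mult_left_mono) auto
  also have "\<dots> <= 1 * \<epsilon>\<^sup>2" using h(2) by (intro mult_right_mono) auto
  finally have "\<bar>h z - h z'\<bar> <= \<epsilon>" using \<open>\<epsilon> > 0\<close> abs_le_square_iff[of "h z - h z'" \<epsilon>] by simp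
  then show "\<bar>f z - f z'\<bar> <= \<epsilon>" using h(3) z by simp
 qed (use \<delta> in simp)
next
 obtain C where C: "\<And>h z. h \<in> H ==> ip h h <= 1 ==> z \<in> Z ==> \<bar>h z\<bar> <= C" using unit_ball_bounded by blast
 show "\<exists>D. \<forall>f\<in>rkhs_unit_ball Z H ip. \<forall>z\<in>Z. \<forall>z'\<in>Z. \<bar>f z - f z'\<bar> <= D"
 proof (intro exI[of _ "2 * C"] ballI)
  fix f z z' assume f: "f \<in> rkhs_unit_ball Z H ip" and z: "z \<in> Z" "z' \<in> Z"
  obtain h where h: "h \<in> H" "ip h h <= 1" "\<And>z. z \<in> Z ==> f z = h z" using f unfolding rkhs_unit_ball_def by auto
  show "\<bar>f z - f z'\<bar> <= 2 * C" using C[OF h(1,2) z(1)] C[OF h(1,2) z(2)] h(3) z by auto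
 qed
qed

lemma H_in_scaled_ball:
 assumes "h \<in> H" shows "\<exists>c>0. (\<lambda>z. c * h z) \<in> H \<and> ip (\<lambda>z. c * h z) (\<lambda>z. c * h z) <= 1"
proof -
 define N where "N = ip h h"
 have N: "N >= 0" unfolding N_def by (rule ip_nonneg[OF assms])
 \<comment> \<open>The squared norm becomes c times c N, and both factors are at most 1; the added 1
   covers N = 0.\<close>
 define c where "c = 1 / (N + 1)"
 have c: "c > 0" "c <= 1" unfolding c_def using N by auto
 have "ip (\<lambda>z. c * h z) (\<lambda>z. c * h z) = c * (c * N)"
  using ip_scale[OF assms H_scale[OF assms], of c c] ip_scale[OF assms assms, of c] ip_sym[OF assms H_scale[OF assms], of c]
  unfolding N_def by simp
 also have "\<dots> <= 1 * 1"
 proof (rule mult_mono)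
  show "c * N <= 1" unfolding c_def using N by (simp add: field_simps)
 qed (use c N in auto)
 finally show ?thesis using c H_scale[OF assms] by auto
qed

lemma H_continuous_on: "h \<in> H ==> continuous_on Z h"
proof -
 assume h: "h \<in> H"
 then obtain c where c: "c > 0" "(\<lambda>z. c * h z) \<in> H" "ip (\<lambda>z. c * h z) (\<lambda>z. c * h z) <= 1" using H_in_scaled_ball by blast
 then have "(\<lambda>z. c * h z) \<in> rkhs_unit_ball Z H ip" unfolding rkhs_unit_ball_def by auto
 from equicontinuous_class_continuous_on[OF equicontinuous_unit_ball this]
 have "continuous_on Z (\<lambda>z. (1 / c) * (c * h z))" by (rule continuous_on_mult_left)
 moreover have "(\<lambda>z. (1 / c) * (c * h z)) = h" using c(1) by auto
 ultimately show "continuous_on Z h" by (simp only:)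
qed

end

lemma equicontinuous_balancing_class:
 assumes "compact Z" "F = lipschitz_class Z \<or> (\<exists>K H ip. continuous_kernel_rkhs Z K H ip \<and> F = rkhs_unit_ball Z H ip)"
 shows "equicontinuous_class Z F"
 using assms equicontinuous_lipschitz_class rkhs_space.equicontinuous_unit_ball[OF rkhs_space.intro] by blast

text \<open>Neumann series: the rows of \<open>E\<close>, the deviation from the identity, have
  absolute sum at most 1/2, so the iterates \<open>y k\<close> decay like m / 2^k and their sum
  solves the system.\<close>

lemma perturbed_identity_solvable:
 fixes A :: "nat => nat => real"
 assumes A: "\<And>i j. i < d ==> j < d ==> \<bar>(if i = j then 1 else 0) - A i j\<bar> <= 1 / (2 * real d)"
  and b: "\<And>i. i < d ==> \<bar>b i\<bar> <= m"
 shows "\<exists>x. (\<forall>i<d. (\<Sum>j<d. A i j * x j) = b i) \<and> (\<forall>i<d. \<bar>x i\<bar> <= 2 * m)"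
proof (cases "d = 0")
 case False
 then have d: "d > 0" by simp
 have m: "0 <= m" using b[OF d] by linarith
 define E where "E i j = (if i = j then 1 else 0) - A i j" for i j
 define y where "y = rec_nat (\<lambda>i. b i) (\<lambda>_ v i. \<Sum>j<d. E i j * v j)"
 have y0: "y 0 i = b i" and yS: "y (Suc k) i = (\<Sum>j<d. E i j * y k j)" for i k unfolding y_def by auto
 have yb: "\<bar>y k i\<bar> <= m * (1 / 2) ^ k" if "i < d" for k i
  using that
 proof (induction k arbitrary: i)
  case 0 then show ?case using b by (simp add: y0)
 next
  case (Suc k)
  have "\<bar>y (Suc k) i\<bar> <= (\<Sum>j<d. \<bar>E i j * y k j\<bar>)" unfolding yS by (rule sum_abs)
  also have "\<dots> <= (\<Sum>j<d. 1 / (2 * real d) * (m * (1 / 2) ^ k))"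
   unfolding abs_mult using Suc A unfolding E_def[symmetric] by (intro sum_mono mult_mono) auto
  also have "\<dots> = m * (1 / 2) ^ Suc k" using d by simp
  finally show ?case .
 qed
 have geo: "summable (\<lambda>k. m * (1 / 2 :: real) ^ k)" "(\<Sum>k. m * (1 / 2 :: real) ^ k) = 2 * m"
  by (auto simp: suminf_mult suminf_geometric summable_geometric)
 have sm: "summable (\<lambda>k. y k i)" if "i < d" for i
  by (rule summable_comparison_test'[OF geo(1), of 0]) (use yb[OF that] in auto)
 define x where "x i = (\<Sum>k. y k i)" for i
 have xeq: "x i = b i + (\<Sum>j<d. E i j * x j)" if "i < d" for i
 proof -
  have "x i = y 0 i + (\<Sum>k. y (Suc k) i)" unfolding x_def using suminf_split_head[OF sm[OF that]] by simp
  also have "(\<Sum>k. y (Suc k) i) = (\<Sum>j<d. \<Sum>k. E i j * y k j)"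
   unfolding yS by (rule suminf_sum) (use sm in \<open>auto intro: summable_mult\<close>)
  also have "\<dots> = (\<Sum>j<d. E i j * x j)"
   unfolding x_def by (intro sum.cong refl suminf_mult sm) auto
  finally show ?thesis by (simp add: y0)
 qed
 show ?thesis
 proof (intro exI[of _ x] conjI allI impI)
  fix i assume i: "i < d"
  have "(\<Sum>j<d. A i j * x j) = (\<Sum>j<d. (if i = j then x j else 0) - E i j * x j)"
   unfolding E_def by (intro sum.cong) (auto simp: algebra_simps)
  also have "\<dots> = x i - (\<Sum>j<d. E i j * x j)" using i by (simp add: sum_subtractf)
  also have "\<dots> = b i" using xeq[OF i] by simp
  finally show "(\<Sum>j<d. A i j * x j) = b i" .
  have "\<bar>x i\<bar> <= (\<Sum>k. \<bar>y k i\<bar>)" unfolding x_def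
   by (rule summable_rabs, rule summable_comparison_test'[OF geo(1), of 0]) (use yb[OF i] in auto)
  also have "\<dots> <= (\<Sum>k. m * (1 / 2) ^ k)"
   by (rule suminf_le[OF yb[OF i]]) (rule summable_comparison_test'[OF geo(1), of 0], use yb[OF i] geo in auto)
  finally show "\<bar>x i\<bar> <= 2 * m" using geo(2) by simp
 qed
qed simp

text \<open>The index of the first ball containing the point, in a finite cover by balls of radius
  \<delta> / 2. Points in no ball receive the length of the list, which keeps the map total and
  measurable.\<close>

lemma compact_quantizer:
 fixes S :: "'a::{metric_space, second_countable_topology} set"
 assumes "compact S" "\<delta> > 0"
 shows "\<exists>(q :: 'a => nat) N. q \<in> measurable borel (count_space UNIV) \<and> (\<forall>x\<in>S. q x < N) \<and>
  (\<forall>x\<in>S. \<forall>y\<in>S. q x = q y \<longrightarrow> dist x y < \<delta>)"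
proof -
 have "\<delta> / 2 > 0" using assms(2) by simp
 then obtain k where k: "finite k" "S \<subseteq> (\<Union>x\<in>k. ball x (\<delta> / 2))"
  using compactE_image[OF assms(1), of UNIV "\<lambda>x. ball x (\<delta> / 2)"] by (metis UNIV_I UN_I centre_in_ball open_ball subsetI)
 obtain xs where xs: "set xs = k" using finite_list[OF k(1)] by blast
 define q where "q x = (LEAST i. length xs <= i \<or> x \<in> ball (xs ! i) (\<delta> / 2))" for x
 have "q \<in> measurable borel (count_space UNIV)"
  unfolding q_def
 proof (rule measurable_Least)
  fix i
  have "{x. length xs <= i \<or> x \<in> ball (xs ! i) (\<delta> / 2)} \<in> sets borel"
   by (cases "length xs <= i") auto
  then show "(\<lambda>x. length xs <= i \<or> x \<in> ball (xs ! i) (\<delta> / 2)) \<in> measurable borel (count_space UNIV)"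
   by (simp add: pred_def)
 qed
 moreover have q: "q x < length xs \<and> dist (xs ! q x) x < \<delta> / 2" if x: "x \<in> S" for x
 proof -
  obtain c where "c \<in> set xs" "x \<in> ball c (\<delta> / 2)" using k(2) x unfolding xs[symmetric] by blast
  then obtain i where i: "i < length xs" "x \<in> ball (xs ! i) (\<delta> / 2)" by (metis in_set_conv_nth)
  then have "q x <= i" unfolding q_def by (intro Least_le) simp
  moreover have "length xs <= q x \<or> x \<in> ball (xs ! q x) (\<delta> / 2)"
   unfolding q_def by (rule LeastI[where k = "length xs"]) simp
  ultimately show ?thesis using i by auto
 qed
 moreover have "dist x y < \<delta>" if "x \<in> S" "y \<in> S" "q x = q y" for x y
  using q[OF that(1)] q[OF that(2)] that(3) dist_triangle_half_r[of "xs ! q x" x \<delta> y] by simp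
 ultimately show ?thesis by blast
qed

text \<open>The cells are products of treatment cells and covariate cells, because the frequency of
  such a cell under the product of the empirical marginals factorises.\<close>

lemma cell_system:
 fixes Z :: "('a::{metric_space, second_countable_topology} \<times> 'b::{metric_space, second_countable_topology}) set"
 assumes "compact Z"
 obtains q1 :: "nat => 'a => nat" and q2 :: "nat => 'b => nat" and N :: "nat => nat"
 where "\<And>m. q1 m \<in> measurable borel (count_space UNIV)" "\<And>m. q2 m \<in> measurable borel (count_space UNIV)"
  "\<And>m z. z \<in> Z ==> q1 m (fst z) < N m" "\<And>m z. z \<in> Z ==> q2 m (snd z) < N m"
  "\<And>m z z'. z \<in> Z ==> z' \<in> Z ==> q1 m (fst z) = q1 m (fst z') ==> q2 m (snd z) = q2 m (snd z') ==> dist z z' < 1 / real (Suc m)"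
proof -
 have c1: "compact (fst ` Z)" and c2: "compact (snd ` Z)"
  using assms by (auto intro!: compact_continuous_image continuous_intros)
 have d: "1 / (2 * real (Suc m)) > 0" for m by simp
 obtain q1 N1 where q1: "\<And>m. q1 m \<in> measurable borel (count_space UNIV)" "\<And>m. \<forall>x\<in>fst ` Z. q1 m x < (N1 m :: nat)"
  "\<And>m. \<forall>x\<in>fst ` Z. \<forall>y\<in>fst ` Z. q1 m x = q1 m y \<longrightarrow> dist x y < 1 / (2 * real (Suc m))"
  using compact_quantizer[OF c1 d] by metis
 obtain q2 N2 where q2: "\<And>m. q2 m \<in> measurable borel (count_space UNIV)" "\<And>m. \<forall>x\<in>snd ` Z. q2 m x < (N2 m :: nat)"
  "\<And>m. \<forall>x\<in>snd ` Z. \<forall>y\<in>snd ` Z. q2 m x = q2 m y \<longrightarrow> dist x y < 1 / (2 * real (Suc m))"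
  using compact_quantizer[OF c2 d] by metis
 show ?thesis
 proof (rule that[of q1 q2 "\<lambda>m. max (N1 m) (N2 m)"])
  fix m z z' assume z: "z \<in> Z" "z' \<in> Z" "q1 m (fst z) = q1 m (fst z')" "q2 m (snd z) = q2 m (snd z')"
  have "dist z z' <= dist (fst z) (fst z') + dist (snd z) (snd z')"
   unfolding dist_prod_def by (rule sqrt_sum_squares_le_sum) auto
  also have "\<dots> < 1 / (2 * real (Suc m)) + 1 / (2 * real (Suc m))"
   using q1(3)[of m] q2(3)[of m] z by (intro add_strict_mono) auto
  also have "\<dots> = 1 / real (Suc m)" by (simp add: field_simps del: of_nat_Suc)
  finally show "dist z z' < 1 / real (Suc m)" .
 qed (use q1(1,2) q2(1,2) in \<open>auto simp: less_max_iff_disj\<close>)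
qed

text \<open>Elements of \<open>F\<close> are arbitrary off Z, hence measurability is required only
  after multiplication with the indicator.\<close>

definition test_functions :: "'z::topological_space set => ('z => real) set" where
 "test_functions Z = {f. (\<lambda>z. indicator Z z * f z) \<in> borel_measurable borel \<and> (\<exists>K. \<forall>z\<in>Z. \<bar>f z\<bar> <= K)}"

lemma test_functions_bounded: "f \<in> test_functions Z ==> \<exists>K. \<forall>z\<in>Z. \<bar>f z\<bar> <= K"
 and test_functions_measurable: "f \<in> test_functions Z ==> (\<lambda>z. indicator Z z * f z) \<in> borel_measurable borel"
 unfolding test_functions_def by auto

lemma test_functions_add:
 assumes "f \<in> test_functions Z" "g \<in> test_functions Z" shows "(\<lambda>z. f z + g z) \<in> test_functions Z"
proof -
 have 1: "(\<lambda>z. indicator Z z * (f z + g z)) = (\<lambda>z. indicator Z z * f z + indicator Z z * g z)" by (auto simp: algebra_simps)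
 obtain K K' where "\<forall>z\<in>Z. \<bar>f z\<bar> <= K" "\<forall>z\<in>Z. \<bar>g z\<bar> <= K'" using assms test_functions_bounded by metis
 then have "\<forall>z\<in>Z. \<bar>f z + g z\<bar> <= K + K'" by (meson abs_triangle_ineq add_mono order_trans)
 moreover have "(\<lambda>z. indicator Z z * (f z + g z)) \<in> borel_measurable borel"
  unfolding 1 using assms[THEN test_functions_measurable] by (intro borel_measurable_add)
 ultimately show ?thesis unfolding test_functions_def by blast
qed

lemma test_functions_mult:
 assumes "f \<in> test_functions Z" "g \<in> test_functions Z" shows "(\<lambda>z. f z * g z) \<in> test_functions Z"
proof -
 have 1: "(\<lambda>z. indicator Z z * (f z * g z)) = (\<lambda>z. (indicator Z z * f z) * (indicator Z z * g z))" by (auto simp: indicator_def)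
 obtain K K' where "\<forall>z\<in>Z. \<bar>f z\<bar> <= K" "\<forall>z\<in>Z. \<bar>g z\<bar> <= K'" using assms test_functions_bounded by metis
 then have "\<forall>z\<in>Z. \<bar>f z * g z\<bar> <= K * K'"
  unfolding abs_mult by (meson abs_ge_zero mult_mono order_trans)
 moreover have "(\<lambda>z. indicator Z z * (f z * g z)) \<in> borel_measurable borel"
  unfolding 1 by (rule borel_measurable_times[OF assms[THEN test_functions_measurable]])
 ultimately show ?thesis unfolding test_functions_def by blast
qed

lemma borel_test_function:
 assumes "Z \<in> sets borel" "f \<in> borel_measurable borel" "\<And>z. z \<in> Z ==> \<bar>f z\<bar> <= K" shows "f \<in> test_functions Z"
 using assms unfolding test_functions_def by (auto intro!: borel_measurable_times)

lemma test_functions_const: "Z \<in> sets borel ==> (\<lambda>_. c) \<in> test_functions Z"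
 by (rule borel_test_function[where K = "\<bar>c\<bar>"]) auto

lemma test_functions_scale: "Z \<in> sets borel ==> f \<in> test_functions Z ==> (\<lambda>z. c * f z) \<in> test_functions Z"
 by (intro test_functions_mult test_functions_const)

lemma test_functions_sum:
 "Z \<in> sets borel ==> (\<And>i. i \<in> I ==> f i \<in> test_functions Z) ==> (\<lambda>z. \<Sum>i\<in>I. c i * f i z) \<in> test_functions Z"
 by (induction I rule: infinite_finite_induct) (auto intro!: test_functions_add test_functions_scale test_functions_const)

lemma continuous_test_function:
 fixes Z :: "'z::t2_space set"
 assumes "compact Z" "continuous_on Z f" shows "f \<in> test_functions Z"
proof -
 have Z: "Z \<in> sets borel" using compact_imp_closed[OF assms(1)] by auto
 have "(\<lambda>z. indicator Z z *\<^sub>R f z) \<in> borel_measurable borel"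
  by (rule borel_measurable_continuous_on_indicator[OF Z assms(2)])
 moreover have "\<exists>K. \<forall>z\<in>Z. \<bar>f z\<bar> <= K"
  using compact_imp_bounded[OF compact_continuous_image[OF assms(2,1)]] by (auto simp: bounded_iff)
 ultimately show ?thesis unfolding test_functions_def by simp
qed

text \<open>Common form of three expectations: over the weighted sample, over the product of the
  empirical marginals, and under Q. Positivity is not demanded but follows from norm and
  normalisation, as in \<open>mean_on_square_nonneg\<close>.\<close>

definition mean_on :: "'z::topological_space set => (('z => real) => real) => bool" where
 "mean_on Z \<Lambda> \<longleftrightarrow>
  (\<forall>f\<in>test_functions Z. \<forall>g\<in>test_functions Z. \<forall>a b. \<Lambda> (\<lambda>z. a * f z + b * g z) = a * \<Lambda> f + b * \<Lambda> g) \<and>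
  (\<forall>f\<in>test_functions Z. \<forall>c. (\<forall>z\<in>Z. \<bar>f z\<bar> <= c) \<longrightarrow> \<bar>\<Lambda> f\<bar> <= c) \<and> \<Lambda> (\<lambda>_. 1) = 1"

lemma mean_on_combination:
 "mean_on Z \<Lambda> ==> f \<in> test_functions Z ==> g \<in> test_functions Z ==> \<Lambda> (\<lambda>z. a * f z + b * g z) = a * \<Lambda> f + b * \<Lambda> g"
 and mean_on_bound: "mean_on Z \<Lambda> ==> f \<in> test_functions Z ==> (\<And>z. z \<in> Z ==> \<bar>f z\<bar> <= c) ==> \<bar>\<Lambda> f\<bar> <= c"
 and mean_on_one: "mean_on Z \<Lambda> ==> \<Lambda> (\<lambda>_. 1) = 1"
 unfolding mean_on_def by blast+

lemma mean_on_close: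
 assumes "Z \<in> sets borel" "mean_on Z \<Lambda>" "f \<in> test_functions Z" "g \<in> test_functions Z" "\<And>z. z \<in> Z ==> \<bar>f z - g z\<bar> <= c"
 shows "\<bar>\<Lambda> f - \<Lambda> g\<bar> <= c"
proof -
 have "\<Lambda> (\<lambda>z. 1 * f z + (-1) * g z) = \<Lambda> f - \<Lambda> g" using mean_on_combination[OF assms(2,3,4), of 1 "-1"] by simp
 moreover have "\<bar>\<Lambda> (\<lambda>z. 1 * f z + (-1) * g z)\<bar> <= c"
  using assms by (intro mean_on_bound[OF assms(2)] test_functions_add test_functions_scale) auto
 ultimately show ?thesis by simp
qed

lemma mean_on_sum:
 assumes "Z \<in> sets borel" "mean_on Z \<Lambda>" "finite I" "\<And>i. i \<in> I ==> f i \<in> test_functions Z"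
 shows "\<Lambda> (\<lambda>z. \<Sum>i\<in>I. c i * f i z) = (\<Sum>i\<in>I. c i * \<Lambda> (f i))"
 using assms(3,4)
proof (induction I rule: finite_induct)
 case empty
 have "\<Lambda> (\<lambda>z. 0 * 1 + 0 * 1) = 0"
  using mean_on_combination[OF assms(2) test_functions_const[OF assms(1), of 1] test_functions_const[OF assms(1), of 1], of 0 0] by simp
 then show ?case by simp
next
 case (insert i I)
 have "\<Lambda> (\<lambda>z. c i * f i z + 1 * (\<Sum>j\<in>I. c j * f j z)) = c i * \<Lambda> (f i) + 1 * \<Lambda> (\<lambda>z. \<Sum>j\<in>I. c j * f j z)"
  using insert by (intro mean_on_combination[OF assms(2)] test_functions_sum assms(1)) auto
 with insert show ?case by simp
qed

definition sample_mean :: "nat => (nat => real) => (nat => 'z) => ('z => real) => real" where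
 "sample_mean n w z f = (\<Sum>i<n. w i * f (z i))"

text \<open>The double sum includes the diagonal i = j. For the sample, a diagonal pair is an actual
  observation with law P rather than Q.\<close>

definition target_mean :: "nat => (nat => 'a \<times> 'b) => ('a \<times> 'b => real) => real" where
 "target_mean n z f = (\<Sum>i<n. \<Sum>j<n. f (fst (z i), snd (z j))) / (real n)\<^sup>2"

lemma sample_mean_mean_on:
 assumes "\<And>i. i < n ==> z i \<in> Z" "\<And>i. i < n ==> 0 <= w i" "(\<Sum>i<n. w i) = 1"
 shows "mean_on Z (sample_mean n w z)"
 unfolding mean_on_def sample_mean_def
proof (intro conjI ballI allI impI)
 fix f :: "'a => real" and c assume f: "\<forall>z\<in>Z. \<bar>f z\<bar> <= c"
 have "\<bar>\<Sum>i<n. w i * f (z i)\<bar> <= (\<Sum>i<n. \<bar>w i * f (z i)\<bar>)" by (rule sum_abs)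
 also have "\<dots> <= (\<Sum>i<n. w i * c)"
  using assms(1,2) f by (intro sum_mono) (auto simp: abs_mult intro!: mult_left_mono)
 also have "\<dots> = c" using assms(3) by (simp add: sum_distrib_right[symmetric])
 finally show "\<bar>\<Sum>i<n. w i * f (z i)\<bar> <= c" .
qed (use assms(3) in \<open>simp_all add: sum.distrib sum_distrib_left algebra_simps\<close>)

lemma target_mean_mean_on:
 assumes "\<And>i j. i < n ==> j < n ==> (fst (z i), snd (z j)) \<in> Z" "0 < n"
 shows "mean_on Z (target_mean n z)"
 unfolding mean_on_def target_mean_def
proof (intro conjI ballI allI impI)
 fix f :: "'a \<times> 'b => real" and c assume f: "\<forall>z\<in>Z. \<bar>f z\<bar> <= c"
 have "\<bar>\<Sum>i<n. \<Sum>j<n. f (fst (z i), snd (z j))\<bar> <= (\<Sum>i<n. \<Sum>j<n. \<bar>f (fst (z i), snd (z j))\<bar>)"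
  by (rule order_trans[OF sum_abs]) (intro sum_mono sum_abs)
 also have "\<dots> <= (\<Sum>i<n. \<Sum>j<n. c)" using assms(1) f by (intro sum_mono) auto
 finally show "\<bar>(\<Sum>i<n. \<Sum>j<n. f (fst (z i), snd (z j))) / (real n)\<^sup>2\<bar> <= c"
  using assms(2) by (simp add: abs_divide power2_eq_square field_simps)
next
 show "(\<Sum>i<n. \<Sum>j<n. 1) / (real n)\<^sup>2 = 1" using assms(2) by (simp add: power2_eq_square)
qed (simp add: sum.distrib sum_distrib_left add_divide_distrib)

lemma population_mean_on:
 fixes Q :: "'z::topological_space measure"
 assumes "prob_space Q" and sQ: "sets Q = sets borel" and Z: "AE z in Q. z \<in> Z" "Z \<in> sets borel"
 shows "mean_on Z (\<lambda>f. \<integral>z. indicator Z z * f z \<partial>Q)"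
proof -
 interpret Q: prob_space Q by fact
 have mQ: "measurable Q K = measurable borel K" for K :: "real measure" by (rule measurable_cong_sets[OF sQ refl])
 have int: "integrable Q (\<lambda>z. indicator Z z * f z)" if f: "f \<in> test_functions Z" for f
 proof -
  obtain K where "\<forall>z\<in>Z. \<bar>f z\<bar> <= K" using test_functions_bounded[OF f] by blast
  then have "norm (indicator Z z * f z) <= \<bar>K\<bar>" for z by (cases "z \<in> Z") fastforce+
  then show ?thesis
   using test_functions_measurable[OF f] by (intro Q.integrable_const_bound[where B = "\<bar>K\<bar>"]) (auto simp: mQ)
 qed
 show ?thesis
  unfolding mean_on_def
 proof (intro conjI ballI allI impI)
  fix f g a b assume f: "f \<in> test_functions Z" and g: "g \<in> test_functions Z"
  have "(\<integral>z. indicator Z z * (a * f z + b * g z) \<partial>Q) = (\<integral>z. a * (indicator Z z * f z) + b * (indicator Z z * g z) \<partial>Q)"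
   by (intro Bochner_Integration.integral_cong) (auto simp: algebra_simps)
  also have "\<dots> = a * (\<integral>z. indicator Z z * f z \<partial>Q) + b * (\<integral>z. indicator Z z * g z \<partial>Q)"
   using int[OF f] int[OF g] by simp
  finally show "(\<integral>z. indicator Z z * (a * f z + b * g z) \<partial>Q) = a * (\<integral>z. indicator Z z * f z \<partial>Q) + b * (\<integral>z. indicator Z z * g z \<partial>Q)" .
 next
  fix f c assume f: "f \<in> test_functions Z" and c: "\<forall>z\<in>Z. \<bar>f z\<bar> <= c"
  have "\<bar>\<integral>z. indicator Z z * f z \<partial>Q\<bar> <= (\<integral>z. \<bar>indicator Z z * f z\<bar> \<partial>Q)"
   using integral_norm_bound[of Q "\<lambda>z. indicator Z z * f z"] by simp
  also have "\<dots> <= (\<integral>z. c \<partial>Q)"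
   using int[OF f] Z(1) c by (intro integral_mono_AE) (auto elim!: eventually_mono)
  finally show "\<bar>\<integral>z. indicator Z z * f z \<partial>Q\<bar> <= c" by (simp add: Q.prob_space)
 next
  have "(\<integral>z. indicator Z z * (1 :: real) \<partial>Q) = (\<integral>z. 1 \<partial>Q)"
  proof (rule integral_cong_AE)
   show "(\<lambda>z. indicator Z z * (1 :: real)) \<in> borel_measurable Q" unfolding mQ using Z(2) by simp
  qed (use Z(1) in \<open>auto elim!: eventually_mono\<close>)
  then show "(\<integral>z. indicator Z z * (1 :: real) \<partial>Q) = 1" by (simp add: Q.prob_space)
 qed
qed

text \<open>Over cells finer than the common modulus of continuity every f is within \<epsilon> / 3
  of a step function, and for step functions only finitely many cell frequencies matter, which do
  not depend on f.\<close>

lemma means_agree_uniformly: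
 fixes Z :: "('a::{metric_space, second_countable_topology} \<times> 'b::{metric_space, second_countable_topology}) set"
  and q1 :: "nat => 'a => nat" and q2 :: "nat => 'b => nat"
 assumes Zc: "compact Z" and Zne: "Z ~= {}" and F: "equicontinuous_class Z F"
  and q1: "\<And>m. q1 m \<in> measurable borel (count_space UNIV)" and q2: "\<And>m. q2 m \<in> measurable borel (count_space UNIV)"
  and N1: "\<And>m z. z \<in> Z ==> q1 m (fst z) < N m" and N2: "\<And>m z. z \<in> Z ==> q2 m (snd z) < N m"
  and cell: "\<And>m z z'. z \<in> Z ==> z' \<in> Z ==> q1 m (fst z) = q1 m (fst z') ==> q2 m (snd z) = q2 m (snd z') ==> dist z z' < 1 / real (Suc m)"
  and \<Lambda>: "\<forall>\<^sub>F n in sequentially. mean_on Z (\<Lambda> n)" and \<Lambda>': "\<forall>\<^sub>F n in sequentially. mean_on Z (\<Lambda>' n)"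
  and lim: "\<And>m a b. (\<lambda>n. \<Lambda> n (\<lambda>z. of_bool (q1 m (fst z) = a \<and> q2 m (snd z) = b)) - \<Lambda>' n (\<lambda>z. of_bool (q1 m (fst z) = a \<and> q2 m (snd z) = b))) \<longlonglongrightarrow> 0"
  and "\<epsilon> > 0"
 shows "\<forall>\<^sub>F n in sequentially. \<forall>f\<in>F. \<bar>\<Lambda> n f - \<Lambda>' n f\<bar> <= \<epsilon>"
proof -
 have Z: "Z \<in> sets borel" using compact_imp_closed[OF Zc] by auto
 obtain z0 where z0: "z0 \<in> Z" using Zne by blast
 obtain D where D: "\<And>f z z'. f \<in> F ==> z \<in> Z ==> z' \<in> Z ==> \<bar>f z - f z'\<bar> <= D"
  using F unfolding equicontinuous_class_def by blast
 have "\<epsilon> / 3 > 0" using \<open>\<epsilon> > 0\<close> by simp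
 then obtain \<delta> where \<delta>: "\<delta> > 0" "\<And>f z z'. f \<in> F ==> z \<in> Z ==> z' \<in> Z ==> dist z z' < \<delta> ==> \<bar>f z - f z'\<bar> <= \<epsilon> / 3"
  using F unfolding equicontinuous_class_def by blast
 obtain m where m: "1 / real (Suc m) < \<delta>" using reals_Archimedean[OF \<delta>(1)] by (auto simp: inverse_eq_divide)
 define Cs where "Cs = {..<N m} \<times> {..<N m}"
 define ind where "ind c z = (of_bool (q1 m (fst z) = fst c \<and> q2 m (snd z) = snd c) :: real)" for c :: "nat \<times> nat" and z
 \<comment> \<open>A point of Z for each cell, taken in the cell whenever the cell meets Z.\<close>
 define rp where "rp c = (if \<exists>z\<in>Z. ind c z = 1 then (SOME z. z \<in> Z \<and> ind c z = 1) else z0)" for c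
 have rp: "rp c \<in> Z" for c
 proof (cases "\<exists>z\<in>Z. ind c z = 1")
  case True
  then show ?thesis unfolding rp_def using someI_ex[of "\<lambda>z. z \<in> Z \<and> ind c z = 1"] by auto
 qed (simp add: rp_def z0)
 have rp': "ind c (rp c) = 1" if "z \<in> Z" "ind c z = 1" for c z
 proof -
  have "\<exists>z. z \<in> Z \<and> ind c z = 1" using that by blast
  from someI_ex[OF this] show ?thesis unfolding rp_def using that by auto
 qed
 have fin: "finite Cs" unfolding Cs_def by simp
 have indT: "ind c \<in> test_functions Z" for c
 proof (rule borel_test_function[OF Z, where K = 1])
  have "{z. q1 m (fst z) = fst c \<and> q2 m (snd z) = snd c} = (q1 m -` {fst c}) \<times> (q2 m -` {snd c})" by auto
  moreover have "q1 m -` {fst c} \<in> sets borel" "q2 m -` {snd c} \<in> sets borel"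
   using measurable_sets[OF q1, of "{fst c}" m] measurable_sets[OF q2, of "{snd c}" m] by auto
  ultimately have "{z. q1 m (fst z) = fst c \<and> q2 m (snd z) = snd c} \<in> sets borel"
   by (simp add: borel_prod[symmetric])
  moreover have "ind c = indicator {z. q1 m (fst z) = fst c \<and> q2 m (snd z) = snd c}"
   unfolding ind_def by (auto simp: indicator_def)
  ultimately show "ind c \<in> borel_measurable borel" by simp
 qed (simp add: ind_def)
 have one: "(\<Sum>c\<in>Cs. a c * ind c z) = a (q1 m (fst z), q2 m (snd z))" if "z \<in> Z" for z and a :: "nat \<times> nat => real"
 proof -
  have "(\<Sum>c\<in>Cs. a c * ind c z) = (\<Sum>c\<in>Cs. if c = (q1 m (fst z), q2 m (snd z)) then a c else 0)"
   unfolding ind_def by (intro sum.cong) (auto simp: prod_eq_iff)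
  then show ?thesis using fin N1[OF that, of m] N2[OF that, of m] by (simp add: Cs_def)
 qed
 have approx: "\<bar>M f - (\<Sum>c\<in>Cs. f (rp c) * M (ind c))\<bar> <= \<epsilon> / 3" if M: "mean_on Z M" and f: "f \<in> F" for M f
 proof -
  have fT: "f \<in> test_functions Z" by (rule continuous_test_function[OF Zc equicontinuous_class_continuous_on[OF F f]])
  have "\<bar>M f - M (\<lambda>z. \<Sum>c\<in>Cs. f (rp c) * ind c z)\<bar> <= \<epsilon> / 3"
  proof (rule mean_on_close[OF Z M fT])
   show "(\<lambda>z. \<Sum>c\<in>Cs. f (rp c) * ind c z) \<in> test_functions Z" by (intro test_functions_sum Z indT)
   fix z assume z: "z \<in> Z"
   let ?c = "(q1 m (fst z), q2 m (snd z))"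
   have "ind ?c z = 1" unfolding ind_def by simp
   from rp'[OF z this] have "dist z (rp ?c) < 1 / real (Suc m)"
    by (intro cell z rp) (auto simp: ind_def split: if_splits)
   then have "\<bar>f z - f (rp ?c)\<bar> <= \<epsilon> / 3" using m by (intro \<delta>(2) f z rp) auto
   then show "\<bar>f z - (\<Sum>c\<in>Cs. f (rp c) * ind c z)\<bar> <= \<epsilon> / 3" unfolding one[OF z] .
  qed
  also have "M (\<lambda>z. \<Sum>c\<in>Cs. f (rp c) * ind c z) = (\<Sum>c\<in>Cs. f (rp c) * M (ind c))"
   by (rule mean_on_sum[OF Z M fin indT])
  finally show ?thesis .
 qed
 have total: "(\<Sum>c\<in>Cs. M (ind c)) = 1" if M: "mean_on Z M" for M
 proof -
  have "(\<Sum>c\<in>Cs. 1 * M (ind c)) = M (\<lambda>z. \<Sum>c\<in>Cs. 1 * ind c z)" by (rule mean_on_sum[OF Z M fin indT, symmetric])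
  moreover have "\<bar>M (\<lambda>z. \<Sum>c\<in>Cs. 1 * ind c z) - M (\<lambda>_. 1)\<bar> <= 0"
   by (rule mean_on_close[OF Z M]) (use one[of _ "\<lambda>_. 1"] in \<open>auto intro!: test_functions_sum[of Z Cs ind "\<lambda>_. 1", simplified] test_functions_const Z indT\<close>)
  ultimately show ?thesis using mean_on_one[OF M] by simp
 qed
 have "(\<lambda>n. D * (\<Sum>c\<in>Cs. \<bar>\<Lambda> n (ind c) - \<Lambda>' n (ind c)\<bar>)) \<longlonglongrightarrow> D * (\<Sum>c\<in>Cs. \<bar>0\<bar>)"
  unfolding ind_def by (intro tendsto_intros lim)
 then have "\<forall>\<^sub>F n in sequentially. D * (\<Sum>c\<in>Cs. \<bar>\<Lambda> n (ind c) - \<Lambda>' n (ind c)\<bar>) < \<epsilon> / 3"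
  using \<open>\<epsilon> / 3 > 0\<close> by (intro order_tendstoD(2)) auto
 with \<Lambda> \<Lambda>' show ?thesis
 proof eventually_elim
  case (elim n)
  show ?case
  proof
   fix f assume f: "f \<in> F"
   \<comment> \<open>Both means give total mass one, so f(z0) may be subtracted from all
     coefficients. What remains is bounded by the oscillation D, whereas the values of f need not be
     bounded uniformly over the class.\<close>
   have "(\<Sum>c\<in>Cs. f (rp c) * \<Lambda> n (ind c)) - (\<Sum>c\<in>Cs. f (rp c) * \<Lambda>' n (ind c))
    = (\<Sum>c\<in>Cs. (f (rp c) - f z0) * (\<Lambda> n (ind c) - \<Lambda>' n (ind c))) + f z0 * ((\<Sum>c\<in>Cs. \<Lambda> n (ind c)) - (\<Sum>c\<in>Cs. \<Lambda>' n (ind c)))"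
    by (simp add: sum_subtractf[symmetric] sum_distrib_left sum.distrib[symmetric] algebra_simps)
   also have "\<dots> = (\<Sum>c\<in>Cs. (f (rp c) - f z0) * (\<Lambda> n (ind c) - \<Lambda>' n (ind c)))"
    using total[OF elim(1)] total[OF elim(2)] by simp
   also have "\<bar>\<dots>\<bar> <= (\<Sum>c\<in>Cs. D * \<bar>\<Lambda> n (ind c) - \<Lambda>' n (ind c)\<bar>)"
    by (rule order_trans[OF sum_abs]) (unfold abs_mult, intro sum_mono mult_right_mono D f rp z0, simp)
   also have "\<dots> = D * (\<Sum>c\<in>Cs. \<bar>\<Lambda> n (ind c) - \<Lambda>' n (ind c)\<bar>)" by (simp add: sum_distrib_left)
   also have "\<dots> < \<epsilon> / 3" by (rule elim(3))
   finally have "\<bar>(\<Sum>c\<in>Cs. f (rp c) * \<Lambda> n (ind c)) - (\<Sum>c\<in>Cs. f (rp c) * \<Lambda>' n (ind c))\<bar> < \<epsilon> / 3" .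
   with approx[OF elim(1) f] approx[OF elim(2) f] show "\<bar>\<Lambda> n f - \<Lambda>' n f\<bar> <= \<epsilon>" by arith
  qed
 qed
qed

lemma equicontinuous_singleton:
 assumes "compact Z" "continuous_on Z f" shows "equicontinuous_class Z {f}"
proof -
 have "uniformly_continuous_on Z f" by (rule compact_uniformly_continuous[OF assms(2,1)])
 then have 1: "\<exists>\<delta>>0. \<forall>z\<in>Z. \<forall>z'\<in>Z. dist z z' < \<delta> \<longrightarrow> \<bar>f z - f z'\<bar> <= \<epsilon>" if "\<epsilon> > 0" for \<epsilon>
 proof -
  from \<open>uniformly_continuous_on Z f\<close> that obtain \<delta> where \<delta>: "\<delta> > 0"
   "\<And>z z'. z \<in> Z ==> z' \<in> Z ==> dist z' z < \<delta> ==> dist (f z') (f z) < \<epsilon>"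
   unfolding uniformly_continuous_on_def by blast
  show ?thesis
  proof (intro exI[of _ \<delta>] conjI ballI impI)
   fix z z' assume "z \<in> Z" "z' \<in> Z" "dist z z' < \<delta>"
   then show "\<bar>f z - f z'\<bar> <= \<epsilon>" using \<delta>(2)[of z' z] by (simp add: dist_real_def)
  qed (rule \<delta>(1))
 qed
 obtain K where K: "\<And>z. z \<in> Z ==> \<bar>f z\<bar> <= K"
  using test_functions_bounded[OF continuous_test_function[OF assms]] by blast
 have "\<bar>f z - f z'\<bar> <= 2 * K" if "z \<in> Z" "z' \<in> Z" for z z' using K[OF that(1)] K[OF that(2)] by arith
 then have 2: "\<exists>D. \<forall>z\<in>Z. \<forall>z'\<in>Z. \<bar>f z - f z'\<bar> <= D" by blast
 show ?thesis unfolding equicontinuous_class_def ball_simps using 1 2 by simp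
qed

lemma integral_weighted_empirical:
 assumes "\<And>i. i < n ==> 0 <= w i"
 shows "(\<integral>x. f x \<partial>weighted_empirical n w z) = sample_mean n w z f"
proof -
 have "(\<integral>x. f x \<partial>weighted_empirical n w z) = (\<integral>i. f (z i) \<partial>point_measure {..<n} (\<lambda>i. ennreal (w i)))"
  unfolding weighted_empirical_def by (rule integral_distr) (simp_all add: measurable_point_measure_eq1)
 also have "\<dots> = (\<Sum>i<n. w i *\<^sub>R f (z i))"
  by (rule lebesgue_integral_point_measure_finite) (use assms in auto)
 finally show ?thesis unfolding sample_mean_def by simp
qed

lemma integral_empirical_target:
 assumes "0 < n" shows "(\<integral>x. f x \<partial>empirical_target n z) = target_mean n z f"
proof -
 have pp: "pair_pmf (pmf_of_set {..<n}) (pmf_of_set {..<n}) = pmf_of_set ({..<n} \<times> {..<n})"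
 proof (rule pmf_eqI)
  fix p :: "nat \<times> nat"
  show "pmf (pair_pmf (pmf_of_set {..<n}) (pmf_of_set {..<n})) p = pmf (pmf_of_set ({..<n} \<times> {..<n})) p"
   using assms by (cases p) (simp add: pmf_pair pmf_of_set lessThan_empty_iff split: split_indicator)
 qed
 have "(\<integral>x. f x \<partial>empirical_target n z) = measure_pmf.expectation (pmf_of_set ({..<n} \<times> {..<n})) (\<lambda>(i, j). f (fst (z i), snd (z j)))"
  unfolding empirical_target_def empirical_pmf_def map_pair[symmetric] pp by (simp add: case_prod_unfold)
 also have "\<dots> = (\<Sum>p\<in>{..<n} \<times> {..<n}. (\<lambda>(i, j). f (fst (z i), snd (z j))) p) / real (card ({..<n} \<times> {..<n}))"
  using assms by (intro integral_pmf_of_set) auto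
 finally show ?thesis
  unfolding target_mean_def by (simp add: sum.cartesian_product power2_eq_square case_prod_unfold)
qed

lemma ipm_empirical:
 assumes "0 < n" "\<And>i. i < n ==> 0 <= w i"
 shows "ipm F (weighted_empirical n w z) (empirical_target n z) = (SUP f\<in>F. \<bar>sample_mean n w z f - target_mean n z f\<bar>)"
 unfolding ipm_def by (simp only: integral_weighted_empirical[OF assms(2)] integral_empirical_target[OF assms(1)])

text \<open>Both means lie within the oscillation of f from \<open>f z0\<close>. The uniform bound
  makes the supremum in \<open>ipm\<close> range over a bounded set of reals, so that it dominates
  each discrepancy.\<close>

lemma means_bounded_difference:
 assumes Zc: "compact Z" and z0: "z0 \<in> Z" and F: "equicontinuous_class Z F"
 shows "\<exists>D. \<forall>f\<in>F. \<forall>\<Lambda> \<Lambda>'. mean_on Z \<Lambda> \<longrightarrow> mean_on Z \<Lambda>' \<longrightarrow> \<bar>\<Lambda> f - \<Lambda>' f\<bar> <= D"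
proof -
 have Z: "Z \<in> sets borel" using compact_imp_closed[OF Zc] by auto
 obtain D where D: "\<And>f z z'. f \<in> F ==> z \<in> Z ==> z' \<in> Z ==> \<bar>f z - f z'\<bar> <= D"
  using F unfolding equicontinuous_class_def by blast
 have near: "\<bar>\<Lambda> f - f z0\<bar> <= D" if M: "mean_on Z \<Lambda>" and f: "f \<in> F" for \<Lambda> f
 proof -
  have fT: "f \<in> test_functions Z" by (rule continuous_test_function[OF Zc equicontinuous_class_continuous_on[OF F f]])
  have "\<bar>\<Lambda> f - \<Lambda> (\<lambda>_. f z0)\<bar> <= D" by (rule mean_on_close[OF Z M fT test_functions_const[OF Z]]) (rule D[OF f _ z0])
  moreover have "\<Lambda> (\<lambda>_. f z0 * 1 + 0 * 1) = f z0"
   using mean_on_combination[OF M test_functions_const[OF Z, of 1] test_functions_const[OF Z, of 1], of "f z0" 0] mean_on_one[OF M] by simp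
  ultimately show ?thesis by simp
 qed
 then have "\<bar>\<Lambda> f - \<Lambda>' f\<bar> <= 2 * D" if "mean_on Z \<Lambda>" "mean_on Z \<Lambda>'" "f \<in> F" for \<Lambda> \<Lambda>' f
 proof -
  show ?thesis using near[OF that(1,3)] near[OF that(2,3)] by arith
 qed
 then show ?thesis by blast
qed

section \<open>Density-ratio weights\<close>

locale dose_sample = dose_response M T X Ypot Y P Q PT PX W\<^sub>0
 for M :: "'w measure" and T :: "'w => 'a::euclidean_space" and X :: "'w => 'b::euclidean_space"
  and Ypot Y P Q PT PX W\<^sub>0 +
 fixes Ts :: "nat => 'w => 'a" and Xs :: "nat => 'w => 'b" and Ys :: "nat => 'w => real" and Z :: "('a \<times> 'b) set"
 assumes sample_measurable: "\<And>i. (\<lambda>\<omega>. (Ts i \<omega>, Xs i \<omega>, Ys i \<omega>)) \<in> borel_measurable M"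
  and sample_indep: "indep_vars (\<lambda>_. borel) (\<lambda>i \<omega>. (Ts i \<omega>, Xs i \<omega>, Ys i \<omega>)) UNIV"
  and sample_law: "\<And>i. distr M borel (\<lambda>\<omega>. (Ts i \<omega>, Xs i \<omega>, Ys i \<omega>)) = distr M borel (\<lambda>\<omega>. (T \<omega>, X \<omega>, Y \<omega>))"
  and Z_def: "Z = measure_support P" and compact_Z: "compact Z"
begin

abbreviation obs :: "nat => 'w => 'a \<times> 'b \<times> real" where "obs i \<omega> \<equiv> (Ts i \<omega>, Xs i \<omega>, Ys i \<omega>)"

definition L :: "('a \<times> 'b \<times> real) measure" where "L = distr M borel (\<lambda>\<omega>. (T \<omega>, X \<omega>, Y \<omega>))"

definition zs :: "'w => nat => 'a \<times> 'b" where "zs \<omega> i = (Ts i \<omega>, Xs i \<omega>)"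

sublocale S: iid_sample M "\<lambda>i \<omega>. (obs i \<omega>)" borel L
 by unfold_locales (use sample_indep sample_law L_def in auto)

lemma iid_image:
 assumes f: "f \<in> borel_measurable borel"
 shows "iid_sample M (\<lambda>i \<omega>. f (obs i \<omega>)) borel (distr M borel (\<lambda>\<omega>. f (T \<omega>, X \<omega>, Y \<omega>)))"
proof
 show "indep_vars (\<lambda>_. borel) (\<lambda>i \<omega>. f (obs i \<omega>)) UNIV"
  by (rule indep_vars_compose2[OF sample_indep f])
 have m: "(\<lambda>\<omega>. (T \<omega>, X \<omega>, Y \<omega>)) \<in> borel_measurable M"
  by (intro borel_measurable_Pair T_measurable X_measurable Y_measurable)
 show "distr M borel (\<lambda>\<omega>. f (obs i \<omega>)) = distr M borel (\<lambda>\<omega>. f (T \<omega>, X \<omega>, Y \<omega>))" for i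
  using arg_cong[OF sample_law[of i], of "\<lambda>N. distr N borel f"] f m sample_measurable[of i]
  by (simp add: distr_distr comp_def)
qed

lemma borel_projections:
 "(\<lambda>s :: 'a \<times> 'b \<times> real. (fst s, fst (snd s))) \<in> borel_measurable borel"
 "(\<lambda>s :: 'a \<times> 'b \<times> real. fst s) \<in> borel_measurable borel"
 "(\<lambda>s :: 'a \<times> 'b \<times> real. fst (snd s)) \<in> borel_measurable borel"
 "(\<lambda>s :: 'a \<times> 'b \<times> real. snd (snd s)) \<in> borel_measurable borel"
 "(\<lambda>z :: 'a \<times> 'b. fst z) \<in> borel_measurable borel" "(\<lambda>z :: 'a \<times> 'b. snd z) \<in> borel_measurable borel"
 by (intro borel_measurable_continuous_onI continuous_intros)+

sublocale ZS: iid_sample M "\<lambda>i \<omega>. zs \<omega> i" borel P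
 using iid_image[OF borel_projections(1)] unfolding P_def zs_def by simp

sublocale TS: iid_sample M Ts borel PT
 using iid_image[OF borel_projections(2)] unfolding PT_def by simp

sublocale XS: iid_sample M Xs borel PX
 using iid_image[OF borel_projections(3)] unfolding PX_def by simp

text \<open>For distinct indices the treatment of one observation and the covariates of the other
  are independent, so the pair has law Q. On the diagonal the law is P, hence the
  restriction.\<close>

lemma AE_cross_sample:
 assumes "AE z in Q. \<phi> z" shows "AE \<omega> in M. \<forall>i j. i ~= j \<longrightarrow> \<phi> (Ts i \<omega>, Xs j \<omega>)"
proof -
 have "AE \<omega> in M. \<phi> (Ts i \<omega>, Xs j \<omega>)" if ij: "i ~= j" for i j
 proof -
  let ?S = "\<lambda>i \<omega>. (obs i \<omega>)"
  have "indep_var (Pi\<^sub>M {i} (\<lambda>_. borel)) (\<lambda>\<omega>. \<lambda>l\<in>{i}. ?S l \<omega>) (Pi\<^sub>M {j} (\<lambda>_. borel)) (\<lambda>\<omega>. \<lambda>l\<in>{j}. ?S l \<omega>)"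
   using ij by (intro indep_var_restrict[OF sample_indep]) auto
  then have "indep_var borel ((\<lambda>v. v i) \<circ> (\<lambda>\<omega>. \<lambda>l\<in>{i}. ?S l \<omega>)) borel ((\<lambda>v. v j) \<circ> (\<lambda>\<omega>. \<lambda>l\<in>{j}. ?S l \<omega>))"
   by (rule indep_var_compose) auto
  then have "indep_var borel (?S i) borel (?S j)" by (simp add: comp_def)
  then have LL: "L \<Otimes>\<^sub>M L = distr M (borel \<Otimes>\<^sub>M borel) (\<lambda>\<omega>. (?S i \<omega>, ?S j \<omega>))"
   unfolding indep_var_distribution_eq S.law by simp
  have PT: "PT = distr L borel (\<lambda>s. fst s)" and PX: "PX = distr L borel (\<lambda>s. fst (snd s))"
   using distr_distr[OF borel_projections(2) S.S_measurable[of i]] distr_distr[OF borel_projections(3) S.S_measurable[of j]]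
   unfolding S.law TS.law[of i, symmetric] XS.law[of j, symmetric] by (simp_all add: comp_def)
  have m: "(\<lambda>(x, y). (fst x, fst (snd y))) \<in> measurable (L \<Otimes>\<^sub>M L) (borel \<Otimes>\<^sub>M borel)"
   unfolding case_prod_beta
  proof (rule measurable_Pair)
   have f1: "(\<lambda>s. fst s) \<in> borel_measurable L" and f2: "(\<lambda>s. fst (snd s)) \<in> borel_measurable L"
    unfolding S.measurable_L by (rule borel_projections)+
   show "(\<lambda>p. fst (fst p)) \<in> borel_measurable (L \<Otimes>\<^sub>M L)" by (rule measurable_compose[OF measurable_fst f1])
   show "(\<lambda>p. fst (snd (snd p))) \<in> borel_measurable (L \<Otimes>\<^sub>M L)" by (rule measurable_compose[OF measurable_snd f2])
  qed
  have "PT \<Otimes>\<^sub>M PX = distr (L \<Otimes>\<^sub>M L) (borel \<Otimes>\<^sub>M borel) (\<lambda>(x, y). (fst x, fst (snd y)))"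
  proof -
   have "sigma_finite_measure (distr L borel (\<lambda>s. fst (snd s)))"
    unfolding PX[symmetric] by (rule PX.sigma_finite_measure_axioms)
   then show ?thesis
    by (subst PT, subst PX, intro pair_measure_distr) (simp_all add: S.measurable_L borel_projections(2,3))
  qed
  also have "\<dots> = distr M (borel \<Otimes>\<^sub>M borel) (\<lambda>\<omega>. (Ts i \<omega>, Xs j \<omega>))"
  proof -
   have "(\<lambda>(x, y). (fst x, fst (snd y))) \<in> measurable (borel \<Otimes>\<^sub>M borel :: (('a \<times> 'b \<times> real) \<times> ('a \<times> 'b \<times> real)) measure) (borel \<Otimes>\<^sub>M borel)"
    using m by (simp only: measurable_cong_sets[OF sets_pair_measure_cong[OF S.sets_L S.sets_L] refl])
   then show ?thesis unfolding LL
    by (subst distr_distr) (auto simp: comp_def intro!: measurable_Pair S.S_measurable)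
  qed
  finally have "Q = distr M (borel \<Otimes>\<^sub>M borel) (\<lambda>\<omega>. (Ts i \<omega>, Xs j \<omega>))" unfolding Q_def .
  from assms[unfolded this] have "AE z in distr M (borel \<Otimes>\<^sub>M borel) (\<lambda>\<omega>. (Ts i \<omega>, Xs j \<omega>)). \<phi> z" .
  then show ?thesis by (rule AE_distrD[rotated]) (intro measurable_Pair TS.S_measurable XS.S_measurable)
 qed
 then show ?thesis unfolding AE_all_countable by auto
qed

lemma Z_borel [measurable]: "Z \<in> sets borel" using compact_imp_closed[OF compact_Z] by auto

lemma AE_Z_P: "AE z in P. z \<in> Z" unfolding Z_def by (rule AE_measure_support) simp

lemma AE_Z_Q: "AE z in Q. z \<in> Z" by (rule AE_Q[OF AE_Z_P])

lemma Z_nonempty: "Z ~= {}"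
proof
 assume "Z = {}"
 then have "AE z in P. False" using AE_Z_P by simp
 then show False by simp
qed

lemma AE_sample_Z: "AE \<omega> in M. \<forall>i j. (Ts i \<omega>, Xs j \<omega>) \<in> Z"
proof -
 have "AE \<omega> in M. \<forall>i. zs \<omega> i \<in> Z" unfolding AE_all_countable using ZS.AE_S[OF AE_Z_P] by auto
 with AE_cross_sample[OF AE_Z_Q] show ?thesis
 proof eventually_elim
  case (elim \<omega>)
  show ?case
  proof (intro allI)
   fix i j show "(Ts i \<omega>, Xs j \<omega>) \<in> Z" using elim by (cases "i = j") (auto simp: zs_def)
  qed
 qed
qed

text \<open>The indicator makes this an expectation under Q for functions that are specified on Z
  only.\<close>

definition QZ :: "('a \<times> 'b => real) => real" where "QZ f = (\<integral>z. indicator Z z * f z \<partial>Q)"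

lemma mean_on_QZ: "mean_on Z QZ"
 unfolding QZ_def[abs_def] by (rule population_mean_on[OF Q.prob_space_axioms sets_Q AE_Z_Q Z_borel])

lemma QZ_eq: "f \<in> borel_measurable borel ==> QZ f = (\<integral>z. f z \<partial>Q)"
 unfolding QZ_def by (rule integral_cong_AE) (use AE_Z_Q in \<open>auto elim!: eventually_mono simp: measurable_cong_sets[OF sets_Q refl]\<close>)

text \<open>Self-normalised importance weights: feasibility demands total weight exactly one, which
  the unnormalised r/n attains only in the limit.\<close>

definition ratio_weights :: "nat => 'w => nat => real" where
 "ratio_weights n \<omega> i = r (zs \<omega> i) / (\<Sum>j<n. r (zs \<omega> j))"

lemma ratio_lln:
 assumes f [measurable]: "f \<in> borel_measurable borel" and K: "\<And>z. \<bar>f z\<bar> <= K"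
 shows "AE \<omega> in M. (\<lambda>n. (\<Sum>i<n. r (zs \<omega> i) * f (zs \<omega> i)) / real n) \<longlonglongrightarrow> (\<integral>z. f z \<partial>Q)"
proof -
 have "\<bar>r z * f z\<bar> <= W\<^sub>0 * K" for z
  unfolding abs_mult using r_abs_le K[of z] W0_pos by (intro mult_mono) auto
 then show ?thesis unfolding integral_Q[OF f]
  by (intro ZS.slln[where h = "\<lambda>z. r z * f z" and b = "W\<^sub>0 * K"]) measurable
qed

text \<open>For a product cell the double average is the product of two ordinary averages, each with
  its own law of large numbers.\<close>

lemma target_cell_lln:
 assumes q1 [measurable]: "q1 \<in> measurable borel (count_space UNIV)" and q2 [measurable]: "q2 \<in> measurable borel (count_space UNIV)"
 shows "AE \<omega> in M. (\<lambda>n. target_mean n (zs \<omega>) (\<lambda>z. of_bool (q1 (fst z) = (a :: nat) \<and> q2 (snd z) = (b :: nat))))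
   \<longlonglongrightarrow> (\<integral>z. of_bool (q1 (fst z) = a \<and> q2 (snd z) = b) \<partial>Q)"
proof -
 define A where "A = q1 -` {a}"
 define B where "B = q2 -` {b}"
 have A [measurable]: "A \<in> sets borel" unfolding A_def using measurable_sets[OF q1, of "{a}"] by simp
 have B [measurable]: "B \<in> sets borel" unfolding B_def using measurable_sets[OF q2, of "{b}"] by simp
 have AB: "A \<times> B \<in> sets borel" using A B by (simp add: borel_prod[symmetric])
 have eq: "(of_bool (q1 (fst z) = a \<and> q2 (snd z) = b) :: real) = indicator A (fst z) * indicator B (snd z)" for z
  unfolding A_def B_def by (auto simp: indicator_def)
 have eq2: "(of_bool (q1 (fst z) = a \<and> q2 (snd z) = b) :: real) = indicator (A \<times> B) z" for z
  unfolding A_def B_def by (auto simp: indicator_def mem_Times_iff)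
 have "emeasure Q (A \<times> B) = emeasure PT A * emeasure PX B"
  unfolding Q_def using A B by (intro PX.emeasure_pair_measure_Times) auto
 then have "measure Q (A \<times> B) = measure PT A * measure PX B"
  unfolding measure_def by (simp add: enn2real_mult)
 then have int: "(\<integral>z. of_bool (q1 (fst z) = a \<and> q2 (snd z) = b) \<partial>Q) = measure PT A * measure PX B"
  unfolding eq2 using AB by simp
 have 1: "AE \<omega> in M. (\<lambda>n. (\<Sum>i<n. indicator A (Ts i \<omega>)) / real n) \<longlonglongrightarrow> (\<integral>t. indicator A t \<partial>PT)"
  by (rule TS.slln[where b = 1]) (auto simp: indicator_def)
 have 2: "AE \<omega> in M. (\<lambda>n. (\<Sum>i<n. indicator B (Xs i \<omega>)) / real n) \<longlonglongrightarrow> (\<integral>t. indicator B t \<partial>PX)"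
  by (rule XS.slln[where b = 1]) (auto simp: indicator_def)
 from 1 2 show ?thesis
 proof eventually_elim
  case (elim \<omega>)
  have "(\<lambda>n. target_mean n (zs \<omega>) (\<lambda>z. of_bool (q1 (fst z) = a \<and> q2 (snd z) = b)))
   = (\<lambda>n. ((\<Sum>i<n. indicator A (Ts i \<omega>)) / real n) * ((\<Sum>i<n. indicator B (Xs i \<omega>)) / real n))"
   unfolding target_mean_def eq zs_def by (auto simp: sum_product power2_eq_square)
  moreover have "\<dots> \<longlonglongrightarrow> measure PT A * measure PX B"
   using tendsto_mult[OF elim] A B by simp
  ultimately show ?case unfolding int by simp
 qed
qed

text \<open>The exceptional null set does not depend on the class \<open>G\<close>: only countably many cells enter.\<close>

lemma uniform_balance:
 "AE \<omega> in M. \<forall>G. equicontinuous_class Z G \<longrightarrow> (\<forall>\<epsilon>>0. \<forall>\<^sub>F n in sequentially. \<forall>f\<in>G.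
   \<bar>target_mean n (zs \<omega>) f - QZ f\<bar> <= \<epsilon> \<and> \<bar>sample_mean n (ratio_weights n \<omega>) (zs \<omega>) f - QZ f\<bar> <= \<epsilon>)"
proof -
 obtain q1 q2 N where q1: "\<And>m :: nat. q1 m \<in> measurable (borel :: 'a measure) (count_space (UNIV :: nat set))"
  and q2: "\<And>m. q2 m \<in> measurable (borel :: 'b measure) (count_space (UNIV :: nat set))"
  and N: "\<And>m z. z \<in> Z ==> q1 m (fst z) < N m" "\<And>m z. z \<in> Z ==> q2 m (snd z) < N m"
  and cell: "\<And>m z z'. z \<in> Z ==> z' \<in> Z ==> q1 m (fst z) = q1 m (fst z') ==> q2 m (snd z) = q2 m (snd z') ==> dist z z' < 1 / real (Suc m)"
  by (rule cell_system[OF compact_Z]) blast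
 define c where "c m a b z = (of_bool (q1 m (fst z) = a \<and> q2 m (snd z) = b) :: real)" for m a b z
 have cm [measurable]: "c m a b \<in> borel_measurable borel" for m a b
 proof -
  have "(\<lambda>z :: 'a \<times> 'b. q1 m (fst z)) \<in> measurable borel (count_space UNIV)"
   by (rule measurable_compose[OF borel_projections(5) q1])
  moreover have "(\<lambda>z :: 'a \<times> 'b. q2 m (snd z)) \<in> measurable borel (count_space UNIV)"
   by (rule measurable_compose[OF borel_projections(6) q2])
  ultimately have "{z. q1 m (fst z) = a} \<inter> {z. q2 m (snd z) = b} \<in> sets borel"
   using measurable_sets[of "\<lambda>z. q1 m (fst z)" borel "count_space UNIV" "{a}"]
    measurable_sets[of "\<lambda>z. q2 m (snd z)" borel "count_space UNIV" "{b}"]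
   by (intro sets.Int) (auto simp: vimage_def)
  moreover have "c m a b = indicator ({z. q1 m (fst z) = a} \<inter> {z. q2 m (snd z) = b})"
   unfolding c_def by (auto simp: indicator_def)
  ultimately show ?thesis by simp
 qed
 have "AE \<omega> in M. \<forall>m a b. (\<lambda>n. target_mean n (zs \<omega>) (c m a b)) \<longlonglongrightarrow> (\<integral>z. c m a b z \<partial>Q)"
  unfolding AE_all_countable c_def using target_cell_lln[OF q1 q2] by blast
 moreover have "AE \<omega> in M. \<forall>m a b. (\<lambda>n. (\<Sum>i<n. r (zs \<omega> i) * c m a b (zs \<omega> i)) / real n) \<longlonglongrightarrow> (\<integral>z. c m a b z \<partial>Q)"
  unfolding AE_all_countable by (intro allI ratio_lln[where K = 1] cm) (auto simp: c_def)
 moreover have "AE \<omega> in M. (\<lambda>n. (\<Sum>i<n. r (zs \<omega> i) * 1) / real n) \<longlonglongrightarrow> (\<integral>z. 1 \<partial>Q)"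
  by (rule ratio_lln[where K = 1]) auto
 ultimately show ?thesis using AE_sample_Z
 proof eventually_elim
  case (elim \<omega>)
  define s where "s n = (\<Sum>j<n. r (zs \<omega> j))" for n
  have s1: "(\<lambda>n. s n / real n) \<longlonglongrightarrow> 1" using elim(3) unfolding s_def by (simp add: Q.prob_space[simplified])
  have spos: "\<forall>\<^sub>F n in sequentially. s n > 0"
  proof -
   have "\<forall>\<^sub>F n in sequentially. s n / real n > 0" by (rule order_tendstoD(1)[OF s1]) simp
   then show ?thesis by eventually_elim (auto simp: zero_less_divide_iff)
  qed
  have m1: "\<forall>\<^sub>F n in sequentially. mean_on Z (sample_mean n (ratio_weights n \<omega>) (zs \<omega>))"
   using spos
  proof eventually_elim
   case (elim n)
   show ?case
   proof (rule sample_mean_mean_on)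
    show "zs \<omega> i \<in> Z" for i using \<open>\<forall>i j. (Ts i \<omega>, Xs j \<omega>) \<in> Z\<close> by (simp add: zs_def)
    show "0 <= ratio_weights n \<omega> i" for i unfolding ratio_weights_def s_def[symmetric] using elim r_bounds by simp
    show "(\<Sum>i<n. ratio_weights n \<omega> i) = 1"
     unfolding ratio_weights_def s_def[symmetric] sum_divide_distrib[symmetric] using elim by (simp add: s_def)
   qed
  qed
  have m2: "\<forall>\<^sub>F n in sequentially. mean_on Z (target_mean n (zs \<omega>))"
   using eventually_gt_at_top[of 0]
   by eventually_elim (rule target_mean_mean_on, use \<open>\<forall>i j. (Ts i \<omega>, Xs j \<omega>) \<in> Z\<close> in \<open>auto simp: zs_def\<close>)
  have m3: "\<forall>\<^sub>F n in sequentially. mean_on Z QZ" using mean_on_QZ by simp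
  have l2: "(\<lambda>n. target_mean n (zs \<omega>) (\<lambda>z. of_bool (q1 m (fst z) = a \<and> q2 m (snd z) = b)) - QZ (\<lambda>z. of_bool (q1 m (fst z) = a \<and> q2 m (snd z) = b))) \<longlonglongrightarrow> 0" for m a b
   using elim(1)[rule_format, of m a b] QZ_eq[OF cm[of m a b]] unfolding c_def by (intro LIM_zero) simp
  have l1: "(\<lambda>n. sample_mean n (ratio_weights n \<omega>) (zs \<omega>) (\<lambda>z. of_bool (q1 m (fst z) = a \<and> q2 m (snd z) = b)) - QZ (\<lambda>z. of_bool (q1 m (fst z) = a \<and> q2 m (snd z) = b))) \<longlonglongrightarrow> 0" for m a b
  proof (rule LIM_zero)
   \<comment> \<open>Numerator and normalising sum are both divided by n; the latter tends to 1, the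
     total mass of Q.\<close>
   have "(\<lambda>n. ((\<Sum>i<n. r (zs \<omega> i) * c m a b (zs \<omega> i)) / real n) / (s n / real n)) \<longlonglongrightarrow> (\<integral>z. c m a b z \<partial>Q) / 1"
    by (rule tendsto_divide[OF elim(2)[rule_format] s1]) simp
   moreover have "\<forall>\<^sub>F n in sequentially. ((\<Sum>i<n. r (zs \<omega> i) * c m a b (zs \<omega> i)) / real n) / (s n / real n) = sample_mean n (ratio_weights n \<omega>) (zs \<omega>) (c m a b)"
    using eventually_gt_at_top[of "0 :: nat"]
   proof eventually_elim
    case (elim n)
    have "sample_mean n (ratio_weights n \<omega>) (zs \<omega>) (c m a b) = (\<Sum>i<n. r (zs \<omega> i) * c m a b (zs \<omega> i)) / s n"
     by (simp add: sample_mean_def ratio_weights_def s_def[symmetric] sum_divide_distrib)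
    moreover have "(x / real n) / (y / real n) = x / y" for x y using elim by simp
    ultimately show ?case by (simp only:)
   qed
   ultimately have "(\<lambda>n. sample_mean n (ratio_weights n \<omega>) (zs \<omega>) (c m a b)) \<longlonglongrightarrow> (\<integral>z. c m a b z \<partial>Q) / 1"
    by (rule Lim_transform_eventually)
   then show "(\<lambda>n. sample_mean n (ratio_weights n \<omega>) (zs \<omega>) (\<lambda>z. of_bool (q1 m (fst z) = a \<and> q2 m (snd z) = b))) \<longlonglongrightarrow> QZ (\<lambda>z. of_bool (q1 m (fst z) = a \<and> q2 m (snd z) = b))"
    using QZ_eq[OF cm[of m a b]] unfolding c_def by simp
  qed
  show ?case
  proof (intro allI impI)
   fix G and \<epsilon> :: real assume G: "equicontinuous_class Z G" and "\<epsilon> > 0"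
   have "\<forall>\<^sub>F n in sequentially. \<forall>f\<in>G. \<bar>target_mean n (zs \<omega>) f - QZ f\<bar> <= \<epsilon>"
    by (rule means_agree_uniformly[where ?q1.0 = q1 and ?q2.0 = q2 and N = N])
     (fact compact_Z Z_nonempty G q1 q2 N cell m2 m3 l2 \<open>\<epsilon> > 0\<close>)+
   moreover have "\<forall>\<^sub>F n in sequentially. \<forall>f\<in>G. \<bar>sample_mean n (ratio_weights n \<omega>) (zs \<omega>) f - QZ f\<bar> <= \<epsilon>"
    by (rule means_agree_uniformly[where ?q1.0 = q1 and ?q2.0 = q2 and N = N])
     (fact compact_Z Z_nonempty G q1 q2 N cell m1 m3 l1 \<open>\<epsilon> > 0\<close>)+
   ultimately show "\<forall>\<^sub>F n in sequentially. \<forall>f\<in>G. \<bar>target_mean n (zs \<omega>) f - QZ f\<bar> <= \<epsilon> \<and> \<bar>sample_mean n (ratio_weights n \<omega>) (zs \<omega>) f - QZ f\<bar> <= \<epsilon>"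
    by eventually_elim blast
  qed
 qed
qed

text \<open>A normalised ratio can exceed W/n only if the mean of the ratios falls below
  \<open>W\<^sub>0\<close> / W, which is less than 1, while that mean tends to 1. The strict
  inequality between the two caps pays for the normalisation.\<close>

lemma ratio_weights_feasible:
 assumes "W\<^sub>0 < W" shows "AE \<omega> in M. \<forall>\<^sub>F n in sequentially. feasible_weights n W (ratio_weights n \<omega>)"
proof -
 have "AE \<omega> in M. (\<lambda>n. (\<Sum>i<n. r (zs \<omega> i) * 1) / real n) \<longlonglongrightarrow> (\<integral>z. 1 \<partial>Q)"
  by (rule ratio_lln[where K = 1]) auto
 then show ?thesis
 proof eventually_elim
  case (elim \<omega>)
  define s where "s n = (\<Sum>j<n. r (zs \<omega> j))" for n
  have s1: "(\<lambda>n. s n / real n) \<longlonglongrightarrow> 1" using elim unfolding s_def by (simp add: Q.prob_space[simplified])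
  have "\<forall>\<^sub>F n in sequentially. s n / real n > W\<^sub>0 / W" by (rule order_tendstoD(1)[OF s1]) (use assms W0_pos in simp)
  then show ?case using eventually_gt_at_top[of 0]
  proof eventually_elim
   case (elim n)
   have W: "W > 0" using assms W0_pos by simp
   have sp: "s n > 0"
   proof -
    have "0 < W\<^sub>0 / W" using W W0_pos by simp
    then have "0 < s n / real n" using elim by linarith
    then show ?thesis using elim(2) by (simp add: zero_less_divide_iff)
   qed
   have le: "W\<^sub>0 / s n <= W / real n" using elim sp W by (simp add: field_simps)
   show ?case
    unfolding feasible_weights_def ratio_weights_def s_def[symmetric]
   proof (intro conjI allI impI)
    fix i
    have "r (zs \<omega> i) / s n <= W\<^sub>0 / s n" using r_bounds(2)[of "zs \<omega> i"] sp by (intro divide_right_mono) auto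
    then show "r (zs \<omega> i) / s n <= W / real n" using le by linarith
    show "0 <= r (zs \<omega> i) / s n" using r_bounds(1)[of "zs \<omega> i"] sp by simp
   next
    show "(\<Sum>i<n. r (zs \<omega> i) / s n) = 1"
     unfolding sum_divide_distrib[symmetric] using sp by (simp add: s_def)
   qed
  qed
 qed
qed

end

text \<open>Positivity from the norm bound: v^2 takes values in [0, K] on Z, so it is within K/2 of
  the constant K/2, and so is its mean.\<close>

lemma mean_on_square_nonneg:
 assumes "Z \<in> sets borel" and M: "mean_on Z \<Lambda>" and v: "v \<in> test_functions Z"
 shows "0 <= \<Lambda> (\<lambda>z. v z * v z)"
proof -
 have v2: "(\<lambda>z. v z * v z) \<in> test_functions Z" by (intro test_functions_mult v)
 obtain K where K: "\<And>z. z \<in> Z ==> \<bar>v z * v z\<bar> <= K" using test_functions_bounded[OF v2] by blast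
 have "\<bar>\<Lambda> (\<lambda>z. v z * v z) - \<Lambda> (\<lambda>_. K / 2)\<bar> <= K / 2"
 proof (rule mean_on_close[OF assms(1) M v2 test_functions_const[OF assms(1)]])
  fix z assume "z \<in> Z"
  from K[OF this] have "0 <= v z * v z" "v z * v z <= K" by auto
  then show "\<bar>v z * v z - K / 2\<bar> <= K / 2" by (simp only: abs_le_iff) linarith
 qed
 moreover have "\<Lambda> (\<lambda>_. K / 2 * 1 + 0 * 1) = K / 2"
  using mean_on_combination[OF M test_functions_const[OF assms(1), of 1] test_functions_const[OF assms(1), of 1], of "K / 2" 0] mean_on_one[OF M] by simp
 then have "\<Lambda> (\<lambda>_. K / 2) = K / 2" by simp
 ultimately show ?thesis by (simp only: abs_le_iff) linarith
qed

text \<open>Degenerate Cauchy-Schwarz: if v has zero square mean, the nonnegative quadratic t^2 U +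
  2 t A has no constant term, and a small t of the right sign forces A = 0.\<close>

lemma mean_on_null:
 assumes "Z \<in> sets borel" and M: "mean_on Z \<Lambda>" and v: "v \<in> test_functions Z" and u: "u \<in> test_functions Z"
  and 0: "\<Lambda> (\<lambda>z. v z * v z) = 0"
 shows "\<Lambda> (\<lambda>z. v z * u z) = 0"
proof -
 define A where "A = \<Lambda> (\<lambda>z. v z * u z)"
 define U where "U = \<Lambda> (\<lambda>z. u z * u z)"
 have U: "0 <= U" unfolding U_def by (rule mean_on_square_nonneg[OF assms(1) M u])
 have q: "0 <= t\<^sup>2 * U + 2 * t * A" for t
 proof -
  have vu: "(\<lambda>z. v z * u z) \<in> test_functions Z" "(\<lambda>z. u z * u z) \<in> test_functions Z" "(\<lambda>z. v z * v z) \<in> test_functions Z"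
   by (intro test_functions_mult u v)+
  have "(\<lambda>z. v z + t * u z) \<in> test_functions Z" by (intro test_functions_add test_functions_scale assms v u)
  from mean_on_square_nonneg[OF assms(1) M this]
  have "0 <= \<Lambda> (\<lambda>z. (v z + t * u z) * (v z + t * u z))" .
  also have "(\<lambda>z. (v z + t * u z) * (v z + t * u z)) = (\<lambda>z. 1 * (v z * v z) + 1 * (t\<^sup>2 * (u z * u z) + (2 * t) * (v z * u z)))"
   by (auto simp: algebra_simps power2_eq_square)
  also have "\<Lambda> \<dots> = 1 * \<Lambda> (\<lambda>z. v z * v z) + 1 * \<Lambda> (\<lambda>z. t\<^sup>2 * (u z * u z) + (2 * t) * (v z * u z))"
   by (intro mean_on_combination[OF M] test_functions_add test_functions_scale assms vu)
  also have "\<Lambda> (\<lambda>z. t\<^sup>2 * (u z * u z) + (2 * t) * (v z * u z)) = t\<^sup>2 * U + (2 * t) * A"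
   unfolding U_def A_def by (intro mean_on_combination[OF M] vu)
  finally show ?thesis using 0 by simp
 qed
 have "A = 0"
 proof (rule ccontr)
  assume "A ~= 0"
  \<comment> \<open>The minimiser of the quadratic would be -A/U; the added 1 admits U = 0.\<close>
  define t where "t = - A / (U + 1)"
  have "t\<^sup>2 * U + 2 * t * A = (A\<^sup>2 / (U + 1)) * (U / (U + 1) - 2)"
  proof -
   have "(- A / p)\<^sup>2 * U + 2 * (- A / p) * A = (A\<^sup>2 / p) * (U / p - 2)" for p
    by (simp add: power2_eq_square algebra_simps)
   then show ?thesis unfolding t_def .
  qed
  also have "\<dots> < 0"
  proof (rule mult_pos_neg)
   show "A\<^sup>2 / (U + 1) > 0" using U \<open>A ~= 0\<close> by simp
   have "U / (U + 1) <= 1" using U by simp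
   then show "U / (U + 1) - 2 < 0" by linarith
  qed
  finally show False using q[of t] by simp
 qed
 then show ?thesis unfolding A_def .
qed

text \<open>The mean gives only a semi-inner product, so the span is asked to contain S up to null
  residuals. The first element is the constant 1, whose moment is the total weight.\<close>

definition orthonormal_system ::
 "(('z => real) => real) => ('z => real) set => ('z => real) set => nat => (nat => 'z => real) => bool" where
 "orthonormal_system \<Lambda> V S d e \<longleftrightarrow> 0 < d \<and> e 0 = (\<lambda>_. 1) \<and> (\<forall>k<d. e k \<in> V) \<and>
  (\<forall>j<d. \<forall>k<d. \<Lambda> (\<lambda>z. e j z * e k z) = (if j = k then 1 else 0)) \<and>
  (\<forall>s\<in>S. \<Lambda> (\<lambda>z. (s z - (\<Sum>k<d. \<Lambda> (\<lambda>z. s z * e k z) * e k z)) * (s z - (\<Sum>k<d. \<Lambda> (\<lambda>z. s z * e k z) * e k z))) = 0)"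

lemma orthonormal_systemD:
 assumes "orthonormal_system \<Lambda> V S d e"
 shows "0 < d" "e 0 = (\<lambda>_. 1)" "k < d ==> e k \<in> V"
  "j < d ==> k < d ==> \<Lambda> (\<lambda>z. e j z * e k z) = (if j = k then 1 else 0)"
  "s \<in> S ==> \<Lambda> (\<lambda>z. (s z - (\<Sum>k<d. \<Lambda> (\<lambda>z. s z * e k z) * e k z)) * (s z - (\<Sum>k<d. \<Lambda> (\<lambda>z. s z * e k z) * e k z))) = 0"
proof -
 note A = assms[unfolded orthonormal_system_def]
 show "0 < d" by (rule A[THEN conjunct1])
 show "e 0 = (\<lambda>_. 1)" by (rule A[THEN conjunct2, THEN conjunct1])
 show "k < d ==> e k \<in> V" by (rule A[THEN conjunct2, THEN conjunct2, THEN conjunct1, rule_format])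
 show "j < d ==> k < d ==> \<Lambda> (\<lambda>z. e j z * e k z) = (if j = k then 1 else 0)"
  by (rule A[THEN conjunct2, THEN conjunct2, THEN conjunct2, THEN conjunct1, rule_format])
 show "s \<in> S ==> \<Lambda> (\<lambda>z. (s z - (\<Sum>k<d. \<Lambda> (\<lambda>z. s z * e k z) * e k z)) * (s z - (\<Sum>k<d. \<Lambda> (\<lambda>z. s z * e k z) * e k z))) = 0"
  by (rule A[THEN conjunct2, THEN conjunct2, THEN conjunct2, THEN conjunct2, rule_format])
qed

text \<open>The procedure starts from the constant function; a residual of seminorm zero is
  discarded, any other is normalised and appended.\<close>

lemma Gram_Schmidt_mean:
 assumes Z: "Z \<in> sets borel" and M: "mean_on Z \<Lambda>" and V: "V \<subseteq> test_functions Z"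
  and V1: "(\<lambda>_. 1) \<in> V" and Vc: "\<And>v u c. v \<in> V ==> u \<in> V ==> (\<lambda>z. v z + c * u z) \<in> V"
  and Vs: "\<And>v c. v \<in> V ==> (\<lambda>z. c * v z) \<in> V"
  and S: "finite S" "S \<subseteq> V"
 shows "\<exists>d e. orthonormal_system \<Lambda> V S d e"
 using S
proof (induction S rule: finite_induct)
 case empty
 show ?case
  unfolding orthonormal_system_def
  by (intro exI[of _ "1 :: nat"] exI[of _ "\<lambda>_ _. 1"]) (use V1 mean_on_one[OF M] in auto)
next
 case (insert s S)
 then have "S \<subseteq> V" by blast
 from insert.IH[OF this] obtain d e where os: "orthonormal_system \<Lambda> V S d e" by (elim exE)
 note d = orthonormal_systemD(1)[OF os] and e0 = orthonormal_systemD(2)[OF os] and eV = orthonormal_systemD(3)[OF os]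
  and orth = orthonormal_systemD(4)[OF os] and null = orthonormal_systemD(5)[OF os]
 have sV: "s \<in> V" and SV: "\<And>s. s \<in> S ==> s \<in> V" using insert by auto
 have VT: "v \<in> V ==> v \<in> test_functions Z" for v using V by blast
 have resV: "(\<lambda>z. s z - (\<Sum>k<m. a k * e k z)) \<in> V" if "s \<in> V" "m <= d" for s m and a :: "nat => real"
  using that(2)
 proof (induction m)
  case 0 then show ?case using that by simp
 next
  case (Suc m)
  then have "(\<lambda>z. (s z - (\<Sum>k<m. a k * e k z)) + (- a m) * e m z) \<in> V" by (intro Vc eV) auto
  then show ?case by (simp add: algebra_simps)
 qed
 define res where "res s z = s z - (\<Sum>k<d. \<Lambda> (\<lambda>z. s z * e k z) * e k z)" for s z
 have resin: "res s \<in> V" if "s \<in> V" for s unfolding res_def[abs_def] by (rule resV[OF that]) simp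
 have resorth: "\<Lambda> (\<lambda>z. res s z * e j z) = 0" if s: "s \<in> V" and j: "j < d" for s j
 proof -
  have eq: "res s z * e j z = 1 * (s z * e j z) + (-1) * (\<Sum>k<d. \<Lambda> (\<lambda>z. s z * e k z) * (e k z * e j z))" for z
   unfolding res_def by (simp add: algebra_simps sum_distrib_left sum_negf)
  have T: "(\<lambda>z. e k z * e j z) \<in> test_functions Z" if "k \<in> {..<d}" for k using that j by (intro test_functions_mult VT eV) auto
  have "\<Lambda> (\<lambda>z. res s z * e j z) = 1 * \<Lambda> (\<lambda>z. s z * e j z) + (-1) * \<Lambda> (\<lambda>z. \<Sum>k<d. \<Lambda> (\<lambda>z. s z * e k z) * (e k z * e j z))"
   unfolding eq using j by (intro mean_on_combination[OF M] test_functions_mult test_functions_sum Z VT s eV T) auto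
  also have "\<Lambda> (\<lambda>z. \<Sum>k<d. \<Lambda> (\<lambda>z. s z * e k z) * (e k z * e j z)) = (\<Sum>k<d. \<Lambda> (\<lambda>z. s z * e k z) * \<Lambda> (\<lambda>z. e k z * e j z))"
   by (rule mean_on_sum[OF Z M _ T]) simp
  also have "\<dots> = (\<Sum>k<d. if k = j then \<Lambda> (\<lambda>z. s z * e k z) else 0)"
   using j by (intro sum.cong) (auto simp: orth)
  also have "\<dots> = \<Lambda> (\<lambda>z. s z * e j z)" using j by simp
  finally show ?thesis by simp
 qed
 define N where "N = \<Lambda> (\<lambda>z. res s z * res s z)"
 have N0: "0 <= N" unfolding N_def by (rule mean_on_square_nonneg[OF Z M VT[OF resin[OF sV]]])
 show ?case
 proof (cases "N = 0")
  case True
  have ns: "\<Lambda> (\<lambda>z. (t z - (\<Sum>k<d. \<Lambda> (\<lambda>z. t z * e k z) * e k z)) * (t z - (\<Sum>k<d. \<Lambda> (\<lambda>z. t z * e k z) * e k z))) = 0"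
   if "t \<in> insert s S" for t
  proof (cases "t \<in> S")
   case False
   then have "t = s" using that by blast
   then show ?thesis using True unfolding N_def res_def by blast
  qed (rule null)
  show ?thesis
   unfolding orthonormal_system_def
   by (intro exI[of _ d] exI[of _ e] conjI allI impI ballI) (fact d e0 eV orth ns)+
 next
  case False
  then have N: "N > 0" using N0 by simp
  define q where "q = 1 / sqrt N"
  have qq: "q * q * N = 1" and qN: "q * N = sqrt N" and sq: "sqrt N * q = 1"
   unfolding q_def using N by (simp_all add: real_div_sqrt)
  define e' where "e' = e(d := (\<lambda>z. q * res s z))"
  have e'd: "e' d = (\<lambda>z. q * res s z)" and e'k: "k < d ==> e' k = e k" for k unfolding e'_def by auto
  have Tm: "(\<lambda>z. res s z * v z) \<in> test_functions Z" if "v \<in> V" for v by (intro test_functions_mult VT resin sV that)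
  have scl: "\<Lambda> (\<lambda>z. c * f z) = c * \<Lambda> f" if "f \<in> test_functions Z" for c f
   using mean_on_combination[OF M that that, of c 0] by simp
  have e'V: "e' k \<in> V" if "k < Suc d" for k
  proof (cases "k = d")
   case True
   show ?thesis unfolding True e'd by (rule Vs[OF resin[OF sV]])
  next
   case False
   then show ?thesis using that eV e'k by simp
  qed
  have dd: "\<Lambda> (\<lambda>z. e' d z * e' d z) = 1"
  proof -
   have "(\<lambda>z. e' d z * e' d z) = (\<lambda>z. (q * q) * (res s z * res s z))"
    unfolding e'd by (auto simp: mult_ac)
   then show ?thesis using scl[OF Tm[OF resin[OF sV]], of "q * q"] qq unfolding N_def[symmetric] by simp
  qed
  have dj: "\<Lambda> (\<lambda>z. e' d z * e' j z) = 0" "\<Lambda> (\<lambda>z. e' j z * e' d z) = 0" if "j < d" for j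
  proof -
   have "(\<lambda>z. e' d z * e' j z) = (\<lambda>z. q * (res s z * e j z))" unfolding e'd e'k[OF that] by (auto simp: mult_ac)
   then show "\<Lambda> (\<lambda>z. e' d z * e' j z) = 0" using scl[OF Tm[OF eV[OF that]]] resorth[OF sV that] by simp
   then show "\<Lambda> (\<lambda>z. e' j z * e' d z) = 0" by (simp only: mult.commute)
  qed
  have orth': "\<Lambda> (\<lambda>z. e' j z * e' k z) = (if j = k then 1 else 0)" if jk: "j < Suc d" "k < Suc d" for j k
  proof -
   consider "j < d" "k < d" | "j = d" "k = d" | "j = d" "k < d" | "j < d" "k = d" using jk by (auto simp: less_Suc_eq)
   then show ?thesis using orth dd dj by cases (auto simp: e'k)
  qed
  have sum': "(\<Sum>k<Suc d. \<Lambda> (\<lambda>z. t z * e' k z) * e' k z) = (\<Sum>k<d. \<Lambda> (\<lambda>z. t z * e k z) * e k z) + \<Lambda> (\<lambda>z. t z * e' d z) * e' d z" for t z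
   by (simp add: e'k)
  have split: "\<Lambda> (\<lambda>z. t z * e' d z) = \<Lambda> (\<lambda>z. res t z * e' d z)" if t: "t \<in> V" for t
  proof -
   have T: "(\<lambda>z. e k z * e' d z) \<in> test_functions Z" if "k \<in> {..<d}" for k using that e'V by (intro test_functions_mult VT eV) auto
   have eq: "t z * e' d z = 1 * (res t z * e' d z) + 1 * (\<Sum>k<d. \<Lambda> (\<lambda>z. t z * e k z) * (e k z * e' d z))" for z
    unfolding res_def by (simp add: algebra_simps sum_distrib_left sum_negf)
   have "\<Lambda> (\<lambda>z. t z * e' d z) = 1 * \<Lambda> (\<lambda>z. res t z * e' d z) + 1 * \<Lambda> (\<lambda>z. \<Sum>k<d. \<Lambda> (\<lambda>z. t z * e k z) * (e k z * e' d z))"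
    by (subst eq, intro mean_on_combination[OF M] test_functions_mult test_functions_sum Z VT resin t T e'V) auto
   also have "\<Lambda> (\<lambda>z. \<Sum>k<d. \<Lambda> (\<lambda>z. t z * e k z) * (e k z * e' d z)) = (\<Sum>k<d. \<Lambda> (\<lambda>z. t z * e k z) * \<Lambda> (\<lambda>z. e k z * e' d z))"
    by (rule mean_on_sum[OF Z M _ T]) simp
   also have "\<dots> = 0" using dj(2) by (intro sum.neutral) (auto simp: e'k)
   finally show ?thesis by simp
  qed
  have null': "\<Lambda> (\<lambda>z. (t z - (\<Sum>k<Suc d. \<Lambda> (\<lambda>z. t z * e' k z) * e' k z)) * (t z - (\<Sum>k<Suc d. \<Lambda> (\<lambda>z. t z * e' k z) * e' k z))) = 0"
   if t: "t \<in> insert s S" for t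
  proof (cases "t \<in> S")
   case True
   have "\<Lambda> (\<lambda>z. res t z * res t z) = 0" unfolding res_def by (rule null[OF True])
   \<comment> \<open>For t in the old set the residual is null, hence orthogonal to the new element,
     and its expansion does not change.\<close>
   from mean_on_null[OF Z M VT[OF resin[OF SV[OF True]]] VT[OF e'V] this, of d]
   have "\<Lambda> (\<lambda>z. t z * e' d z) = 0" unfolding split[OF SV[OF True]] by simp
   then show ?thesis by (simp only: sum' mult_zero_left add_0_right null[OF True])
  next
   case False
   then have t: "t = s" using that by simp
   have "\<Lambda> (\<lambda>z. res s z * e' d z) = sqrt N"
   proof -
    have "(\<lambda>z. res s z * e' d z) = (\<lambda>z. q * (res s z * res s z))" unfolding e'd by (auto simp: mult_ac)
    then show ?thesis using scl[OF Tm[OF resin[OF sV]], of q] qN unfolding N_def[symmetric] by (simp only:)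
   qed
   note sN = this
   have c: "\<Lambda> (\<lambda>z. s z * e' d z) * e' d z = res s z" for z
   proof -
    have "sqrt N * (q * res s z) = (sqrt N * q) * res s z" by (simp only: mult.assoc)
    then show ?thesis using split[OF sV] sN sq unfolding e'd by simp
   qed
   have "s z - (\<Sum>k<Suc d. \<Lambda> (\<lambda>z. s z * e' k z) * e' k z) = 0" for z
    unfolding sum' c by (simp add: res_def)
   moreover have "\<Lambda> (\<lambda>z. 0) = 0" using scl[OF test_functions_const[OF Z, of 1], of 0] by simp
   ultimately show ?thesis unfolding t by (simp only: mult_zero_left)
  qed
  have "e' 0 = (\<lambda>_. 1)" using d e0 e'k by simp
  show ?thesis
   unfolding orthonormal_system_def
   by (intro exI[of _ "Suc d"] exI[of _ e'] conjI allI impI ballI) (fact zero_less_Suc \<open>e' 0 = (\<lambda>_. 1)\<close> e'V orth' null')+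
 qed
qed

section \<open>Optimal weights\<close>

locale cbdm_sample = dose_sample M T X Ypot Y P Q PT PX W\<^sub>0 Ts Xs Ys Z + strictly_convex_cost W \<rho>
 for M :: "'w measure" and T :: "'w => 'a::euclidean_space" and X :: "'w => 'b::euclidean_space"
  and Ypot Y P Q PT PX W\<^sub>0 Ts Xs Ys Z W \<rho> +
 fixes F :: "('a \<times> 'b => real) set" and lam :: real and w :: "nat => 'w => nat => real"
 assumes F: "F = lipschitz_class Z \<or> (\<exists>K H ip. continuous_kernel_rkhs Z K H ip \<and> F = rkhs_unit_ball Z H ip)"
  and lam_nonneg: "0 <= lam" and W0_less: "W\<^sub>0 < W"
  and optimal: "AE \<omega> in M. \<forall>n\<ge>1. cbdm_weights F lam \<rho> W n (zs \<omega>) (w n \<omega>)"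
begin

lemma equi_F: "equicontinuous_class Z F"
 by (rule equicontinuous_balancing_class[OF compact_Z F])

lemma F_nonempty: "F ~= {}"
proof -
 have "(\<lambda>_. 0) \<in> lipschitz_class Z" unfolding lipschitz_class_def by (simp add: lipschitz_on_def)
 moreover have "(\<lambda>_. 0) \<in> rkhs_unit_ball Z H ip" if k: "continuous_kernel_rkhs Z K H ip" for K H ip
 proof -
  interpret rkhs_space Z K H ip by unfold_locales (fact k compact_Z)+
  have "ip (\<lambda>_. 0) (\<lambda>_. 0) = 0" using ip_scale[OF H_zero H_zero, of 0] by simp
  then show ?thesis unfolding rkhs_unit_ball_def using H_zero by (auto intro!: bexI[of _ "\<lambda>_. 0"])
 qed
 ultimately show ?thesis using F by blast
qed

lemma cost_bounded: "\<exists>\<rho>m\<ge>0. \<forall>y\<in>{0..W}. \<bar>\<rho> y\<bar> <= \<rho>m"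
proof -
 have "bounded (\<rho> ` {0..W})" by (intro compact_imp_bounded compact_continuous_image cont) simp
 then obtain K where "\<forall>y\<in>{0..W}. \<bar>\<rho> y\<bar> <= K" by (auto simp: bounded_iff)
 then show ?thesis by (intro exI[of _ "\<bar>K\<bar>"]) (auto intro: order_trans)
qed

lemma feasible_scaled: "feasible_weights n W v ==> i < n ==> real n * v i \<in> {0..W}"
 unfolding feasible_weights_def by (auto simp: field_simps)

text \<open>The scaled weights stay in [0, W], where \<rho> is bounded, so the regulariser is
  O(1/n): negligible when only balance is at stake, but the leading term once the imbalance is
  O(1/n).\<close>

lemma regularizer_bound:
 assumes "\<forall>y\<in>{0..W}. \<bar>\<rho> y\<bar> <= \<rho>m" "feasible_weights n W v" "1 <= n"
 shows "\<bar>weight_regularizer n \<rho> v\<bar> <= \<rho>m / real n"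
proof -
 have "\<bar>\<Sum>i<n. \<rho> (real n * v i)\<bar> <= real n * \<rho>m"
  using assms(1) feasible_scaled[OF assms(2)] by (intro sum_abs_le_card) auto
 then have "\<bar>\<Sum>i<n. \<rho> (real n * v i)\<bar> / (real n)\<^sup>2 <= real n * \<rho>m / (real n)\<^sup>2" by (intro divide_right_mono) auto
 also have "\<dots> = \<rho>m / real n" using assms(3) by (simp add: power2_eq_square)
 finally show ?thesis unfolding weight_regularizer_def by (simp add: abs_divide)
qed

lemma feasible_mean_on:
 "feasible_weights n W v ==> (\<And>i. i < n ==> z i \<in> Z) ==> mean_on Z (sample_mean n v z)"
 unfolding feasible_weights_def by (intro sample_mean_mean_on) auto

text \<open>Comparison of objectives. Both terms are kept on the left, as
  \<open>weights_balance\<close> exploits the squared imbalance and \<open>weights_converge\<close>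
  the regulariser.\<close>

lemma cbdm_optimality:
 assumes opt: "cbdm_weights F lam \<rho> W n z v" and feas: "feasible_weights n W v'" and n: "1 <= n"
  and Zin: "\<And>i j. i < n ==> j < n ==> (fst (z i), snd (z j)) \<in> Z"
  and b: "\<And>f. f \<in> F ==> \<bar>sample_mean n v' z f - target_mean n z f\<bar> <= b" and "f \<in> F"
 shows "(sample_mean n v z f - target_mean n z f)\<^sup>2 + lam * weight_regularizer n \<rho> v <= b\<^sup>2 + lam * weight_regularizer n \<rho> v'"
  and "feasible_weights n W v"
proof -
 let ?ipm = "\<lambda>v. ipm F (weighted_empirical n v z) (empirical_target n z)"
 show fv: "feasible_weights n W v" using opt unfolding cbdm_weights_def is_arg_min_def by blast
 have J: "(?ipm v)\<^sup>2 + lam * weight_regularizer n \<rho> v <= (?ipm v')\<^sup>2 + lam * weight_regularizer n \<rho> v'"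
  using opt feas unfolding cbdm_weights_def is_arg_min_def by (meson not_le)
 have eq: "?ipm v = (SUP f\<in>F. \<bar>sample_mean n v z f - target_mean n z f\<bar>)" if "feasible_weights n W v" for v
  using that n unfolding feasible_weights_def by (intro ipm_empirical) auto
 have zi: "z i \<in> Z" if "i < n" for i using Zin[OF that that] by simp
 have Mt: "mean_on Z (target_mean n z)" using Zin n by (intro target_mean_mean_on) auto
 obtain z0 where z0: "z0 \<in> Z" using Z_nonempty by blast
 have Ms: "mean_on Z (sample_mean n v z)" by (rule feasible_mean_on[OF fv zi])
 obtain D where D: "\<And>f. f \<in> F ==> \<bar>sample_mean n v z f - target_mean n z f\<bar> <= D"
  using means_bounded_difference[OF compact_Z z0 equi_F] Ms Mt by blast
 have up: "\<bar>sample_mean n v z f - target_mean n z f\<bar> <= ?ipm v"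
  unfolding eq[OF fv] using \<open>f \<in> F\<close> D by (intro cSUP_upper) (auto simp: bdd_above_def)
 have lo: "?ipm v' <= b" unfolding eq[OF feas] by (rule cSUP_least[OF F_nonempty b])
 have "0 <= ?ipm v'"
 proof -
  have "bdd_above ((\<lambda>f. \<bar>sample_mean n v' z f - target_mean n z f\<bar>) ` F)" using b by (auto simp: bdd_above_def)
  then have "\<bar>sample_mean n v' z f - target_mean n z f\<bar> <= ?ipm v'" unfolding eq[OF feas] by (rule cSUP_upper[OF \<open>f \<in> F\<close>])
  then show ?thesis by linarith
 qed
 then have "(?ipm v')\<^sup>2 <= b\<^sup>2" using lo by (intro power_mono)
 moreover have "(sample_mean n v z f - target_mean n z f)\<^sup>2 <= (?ipm v)\<^sup>2"
  using up power_mono[OF up, of 2] by simp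
 ultimately show "(sample_mean n v z f - target_mean n z f)\<^sup>2 + lam * weight_regularizer n \<rho> v <= b\<^sup>2 + lam * weight_regularizer n \<rho> v'"
  using J by linarith
qed

lemma AE_pairs_Z: "AE \<omega> in M. \<forall>i j. (fst (zs \<omega> i), snd (zs \<omega> j)) \<in> Z"
 using AE_sample_Z by (simp add: zs_def)

text \<open>The ratio weights serve as competitor: their imbalance vanishes by
  \<open>uniform_balance\<close>, and the regularisers of the two weightings differ by O(1/n), so
  the imbalance of the optimum vanishes too.\<close>

theorem weights_balance:
 "AE \<omega> in M. \<forall>\<epsilon>>0. \<forall>\<^sub>F n in sequentially. \<forall>f\<in>F. \<bar>sample_mean n (w n \<omega>) (zs \<omega>) f - QZ f\<bar> <= \<epsilon>"
 using optimal AE_pairs_Z uniform_balance ratio_weights_feasible[OF W0_less]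
proof eventually_elim
 case (elim \<omega>)
 obtain \<rho>m where \<rho>m: "0 <= \<rho>m" "\<forall>y\<in>{0..W}. \<bar>\<rho> y\<bar> <= \<rho>m" using cost_bounded by blast
 show ?case
 proof (intro allI impI)
  fix \<epsilon> :: real assume \<epsilon>: "\<epsilon> > 0"
  have "\<forall>\<^sub>F n in sequentially. \<forall>f\<in>F. \<bar>target_mean n (zs \<omega>) f - QZ f\<bar> <= \<epsilon> / 8 \<and> \<bar>sample_mean n (ratio_weights n \<omega>) (zs \<omega>) f - QZ f\<bar> <= \<epsilon> / 8"
   by (rule elim(3)[rule_format, OF equi_F]) (use \<epsilon> in simp)
  moreover have "\<forall>\<^sub>F n in sequentially. lam * (2 * \<rho>m / real n) <= (\<epsilon> / 4)\<^sup>2"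
  proof -
   have "(\<lambda>n. lam * (2 * \<rho>m / real n)) \<longlonglongrightarrow> lam * 0"
    by (intro tendsto_intros lim_const_over_n)
   then have "\<forall>\<^sub>F n in sequentially. lam * (2 * \<rho>m / real n) < (\<epsilon> / 4)\<^sup>2"
    using \<epsilon> by (intro order_tendstoD(2)) auto
   then show ?thesis by eventually_elim simp
  qed
  ultimately show "\<forall>\<^sub>F n in sequentially. \<forall>f\<in>F. \<bar>sample_mean n (w n \<omega>) (zs \<omega>) f - QZ f\<bar> <= \<epsilon>"
   using elim(4) eventually_ge_at_top[of 1]
  proof eventually_elim
   case (elim n)
   show ?case
   proof
    fix f assume f: "f \<in> F"
    have b: "\<bar>sample_mean n (ratio_weights n \<omega>) (zs \<omega>) f - target_mean n (zs \<omega>) f\<bar> <= \<epsilon> / 4" if "f \<in> F" for f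
    proof -
     have "\<bar>target_mean n (zs \<omega>) f - QZ f\<bar> <= \<epsilon> / 8" "\<bar>sample_mean n (ratio_weights n \<omega>) (zs \<omega>) f - QZ f\<bar> <= \<epsilon> / 8"
      using elim(1) that by auto
     then show ?thesis by arith
    qed
    have opt: "cbdm_weights F lam \<rho> W n (zs \<omega>) (w n \<omega>)" using \<open>\<forall>n\<ge>1. cbdm_weights F lam \<rho> W n (zs \<omega>) (w n \<omega>)\<close> elim(4) by blast
    note o = cbdm_optimality[OF opt elim(3,4) _ b f]
    have Zin: "\<And>i j. i < n ==> j < n ==> (fst (zs \<omega> i), snd (zs \<omega> j)) \<in> Z"
     using \<open>\<forall>i j. (fst (zs \<omega> i), snd (zs \<omega> j)) \<in> Z\<close> by blast
    have R: "weight_regularizer n \<rho> (ratio_weights n \<omega>) - weight_regularizer n \<rho> (w n \<omega>) <= 2 * \<rho>m / real n"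
     using regularizer_bound[OF \<rho>m(2) elim(3,4)] regularizer_bound[OF \<rho>m(2) o(2)[OF Zin] elim(4)] by auto
    have "(sample_mean n (w n \<omega>) (zs \<omega>) f - target_mean n (zs \<omega>) f)\<^sup>2
     <= (\<epsilon> / 4)\<^sup>2 + lam * (weight_regularizer n \<rho> (ratio_weights n \<omega>) - weight_regularizer n \<rho> (w n \<omega>))"
     using o(1)[OF Zin] by (simp add: algebra_simps)
    also have "\<dots> <= (\<epsilon> / 4)\<^sup>2 + lam * (2 * \<rho>m / real n)"
     using R lam_nonneg by (intro add_left_mono mult_left_mono)
    also have "\<dots> <= (\<epsilon> / 2)\<^sup>2"
    proof -
     have "(\<epsilon> / 4)\<^sup>2 + (\<epsilon> / 4)\<^sup>2 <= (\<epsilon> / 2)\<^sup>2" by (simp add: power2_eq_square)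
     then show ?thesis using elim(2) by linarith
    qed
    finally have "\<bar>sample_mean n (w n \<omega>) (zs \<omega>) f - target_mean n (zs \<omega>) f\<bar> <= \<epsilon> / 2"
     using \<epsilon> by (simp add: abs_le_square_iff[symmetric])
    moreover have "\<bar>target_mean n (zs \<omega>) f - QZ f\<bar> <= \<epsilon> / 8" using elim(1) f by blast
    ultimately show "\<bar>sample_mean n (w n \<omega>) (zs \<omega>) f - QZ f\<bar> <= \<epsilon>" using \<epsilon> by arith
   qed
  qed
 qed
qed

lemma integrable_test_function:
 assumes "f \<in> test_functions Z" shows "integrable Q (\<lambda>z. indicator Z z * f z)"
proof -
 obtain K where K: "\<And>z. z \<in> Z ==> \<bar>f z\<bar> <= K" using test_functions_bounded[OF assms] by blast
 show ?thesis
 proof (rule Q.integrable_bounded)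
  show "(\<lambda>z. indicator Z z * f z) \<in> borel_measurable Q"
   using test_functions_measurable[OF assms] by (simp only: measurable_cong_sets[OF sets_Q refl])
  show "\<bar>indicator Z z * f z\<bar> <= \<bar>K\<bar>" for z using K[of z] by (cases "z \<in> Z") auto
 qed
qed

text \<open>Since Q has density r against P, a property true Q-almost everywhere holds P-almost
  everywhere where r is positive; the factor r takes care of the rest.\<close>

lemma AE_null_test_function:
 assumes v: "v \<in> test_functions Z" and 0: "QZ (\<lambda>z. v z * v z) = 0"
 shows "AE z in Q. v z = 0" "AE z in P. r z * v z = 0"
proof -
 have v2: "(\<lambda>z. v z * v z) \<in> test_functions Z" by (intro test_functions_mult v)
 have "AE z in Q. indicator Z z * (v z * v z) = 0"
  using 0 integral_nonneg_eq_0_iff_AE[OF integrable_test_function[OF v2]] unfolding QZ_def by simp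
 with AE_Z_Q show 1: "AE z in Q. v z = 0" by eventually_elim auto
 have rm: "(\<lambda>z. ennreal (r z)) \<in> borel_measurable P" unfolding measurable_P by measurable
 from 1 have "AE z in density P (\<lambda>z. ennreal (r z)). v z = 0" by (simp only: Q_density[symmetric])
 then have "AE z in P. 0 < ennreal (r z) \<longrightarrow> v z = 0" by (simp only: AE_density[OF rm])
 then show "AE z in P. r z * v z = 0"
 proof eventually_elim
  case (elim z)
  then show ?case using r_bounds(1)[of z] by (cases "r z = 0") auto
 qed
qed

lemma ratio_test_lln:
 assumes f: "f \<in> test_functions Z"
 shows "AE \<omega> in M. (\<lambda>n. (\<Sum>i<n. r (zs \<omega> i) * f (zs \<omega> i)) / real n) \<longlonglongrightarrow> QZ f"
proof -
 obtain K where K: "\<And>z. z \<in> Z ==> \<bar>f z\<bar> <= K" using test_functions_bounded[OF f] by blast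
 have "AE \<omega> in M. (\<lambda>n. (\<Sum>i<n. r (zs \<omega> i) * (indicator Z (zs \<omega> i) * f (zs \<omega> i))) / real n) \<longlonglongrightarrow> (\<integral>z. indicator Z z * f z \<partial>Q)"
 proof (rule ratio_lln[OF test_functions_measurable[OF f]])
  show "\<bar>indicator Z z * f z\<bar> <= \<bar>K\<bar>" for z using K[of z] by (cases "z \<in> Z") auto
 qed
 with AE_pairs_Z show ?thesis
 proof eventually_elim
  case (elim \<omega>)
  have "zs \<omega> i \<in> Z" for i using elim(1)[rule_format, of i i] by simp
  then show ?case using elim(2) unfolding QZ_def by simp
 qed
qed

text \<open>Reweighting \<open>r\<close> by a small element of the span of the constants and \<open>H\<close> restores the moments of
 all of \<open>H\<close> exactly, up to the diagonal terms of the empirical product measure, which contribute \<open>O(1/n)\<close>.\<close>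

lemma balanced_comparator:
 assumes ker: "continuous_kernel_rkhs Z K H ip" and fd: "finite_dimensional_class H" and FH: "F = rkhs_unit_ball Z H ip"
 shows "\<exists>C. AE \<omega> in M. \<forall>\<eta>>0. \<forall>\<^sub>F n in sequentially. \<exists>v. feasible_weights n W v \<and>
  (\<forall>f\<in>F. \<bar>sample_mean n v (zs \<omega>) f - target_mean n (zs \<omega>) f\<bar> <= C / real n) \<and>
  (\<forall>i<n. \<bar>real n * v i - r (zs \<omega> i)\<bar> <= \<eta>)"
proof -
 interpret R: rkhs_space Z K H ip by unfold_locales (fact ker compact_Z)+
 obtain S where S: "S \<subseteq> H" "finite S" "\<And>f. f \<in> H ==> \<exists>c. f = (\<lambda>z. \<Sum>b\<in>S. c b * b z)"
  using fd unfolding finite_dimensional_class_def by blast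
 \<comment> \<open>Constants are adjoined so that total weight one is among the moments to be
   matched.\<close>
 define V where "V = {v. \<exists>\<alpha>. \<exists>h\<in>H. v = (\<lambda>z. \<alpha> + h z)}"
 have Vcont: "continuous_on Z v" if vV: "v \<in> V" for v
 proof -
  obtain \<alpha> h where h: "h \<in> H" and v: "v = (\<lambda>z. \<alpha> + h z)" using vV unfolding V_def by blast
  show ?thesis unfolding v by (rule continuous_on_add[OF continuous_on_const R.H_continuous_on[OF h]])
 qed
 have VT: "v \<in> test_functions Z" if "v \<in> V" for v by (rule continuous_test_function[OF compact_Z Vcont[OF that]])
 have HT: "h \<in> test_functions Z" if "h \<in> H" for h by (rule continuous_test_function[OF compact_Z R.H_continuous_on[OF that]])
 have "\<exists>d e. orthonormal_system QZ V S d e"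
 proof (rule Gram_Schmidt_mean[OF Z_borel mean_on_QZ])
  show "V \<subseteq> test_functions Z" using VT by blast
  show "(\<lambda>_. 1) \<in> V" unfolding V_def by (intro CollectI exI[of _ 1] bexI[OF _ R.H_zero]) simp
  show "(\<lambda>z. v z + c * u z) \<in> V" if vu: "v \<in> V" "u \<in> V" for v u c
  proof -
   obtain \<alpha> h \<beta> g where "h \<in> H" "g \<in> H" "v = (\<lambda>z. \<alpha> + h z)" "u = (\<lambda>z. \<beta> + g z)" using vu unfolding V_def by blast
   then show ?thesis unfolding V_def
    by (intro CollectI exI[of _ "\<alpha> + c * \<beta>"] bexI[of _ "\<lambda>z. h z + c * g z"]) (auto simp: algebra_simps intro!: R.H_add R.H_scale)
  qed
  show "(\<lambda>z. c * v z) \<in> V" if vV: "v \<in> V" for v c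
  proof -
   obtain \<alpha> h where "h \<in> H" "v = (\<lambda>z. \<alpha> + h z)" using vV unfolding V_def by blast
   then show ?thesis unfolding V_def
    by (intro CollectI exI[of _ "c * \<alpha>"] bexI[of _ "\<lambda>z. c * h z"]) (auto simp: algebra_simps intro!: R.H_scale)
  qed
  show "finite S" by fact
  show "S \<subseteq> V" unfolding V_def using S(1) by (auto intro!: exI[of _ 0])
 qed
 then obtain d e where os: "orthonormal_system QZ V S d e" by blast
 note d = orthonormal_systemD(1)[OF os] and e0 = orthonormal_systemD(2)[OF os] and eV = orthonormal_systemD(3)[OF os]
  and orth = orthonormal_systemD(4)[OF os] and null = orthonormal_systemD(5)[OF os]
 have eT: "e k \<in> test_functions Z" if "k < d" for k by (rule VT[OF eV[OF that]])
 \<comment> \<open>What the orthonormal system misses of h. For h in the spanning set it vanishes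
   Q-almost everywhere, hence at all off-diagonal pairs and at sample points with positive r; only
   the diagonal of the empirical product can see it.\<close>
 define res where "res h z = h z - (\<Sum>k<d. QZ (\<lambda>z. h z * e k z) * e k z)" for h z
 have resT: "res h \<in> test_functions Z" if "h \<in> test_functions Z" for h
 proof -
  have "(\<lambda>z. h z + (-1) * (\<Sum>k<d. QZ (\<lambda>z. h z * e k z) * e k z)) \<in> test_functions Z"
   using that eT by (intro test_functions_add test_functions_scale test_functions_sum Z_borel) auto
  then show ?thesis unfolding res_def[abs_def] by simp
 qed
 have res0: "QZ (\<lambda>z. res b z * res b z) = 0" if "b \<in> S" for b unfolding res_def by (rule null[OF that])
 have reslin: "res h z = (\<Sum>b\<in>S. c b * res b z)" if h: "h = (\<lambda>z. \<Sum>b\<in>S. c b * b z)" for h c z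
 proof -
  have "QZ (\<lambda>z. h z * e k z) = (\<Sum>b\<in>S. c b * QZ (\<lambda>z. b z * e k z))" if k: "k < d" for k
  proof -
   have "QZ (\<lambda>z. \<Sum>b\<in>S. c b * (b z * e k z)) = (\<Sum>b\<in>S. c b * QZ (\<lambda>z. b z * e k z))"
    using S eT[OF k] HT by (intro mean_on_sum[OF Z_borel mean_on_QZ] test_functions_mult) auto
   then show ?thesis unfolding h by (simp only: sum_distrib_right mult.assoc)
  qed
  then have "res h z = (\<Sum>b\<in>S. c b * b z) - (\<Sum>k<d. \<Sum>b\<in>S. c b * QZ (\<lambda>z. b z * e k z) * e k z)"
   unfolding res_def by (simp add: h sum_distrib_right)
  also have "(\<Sum>k<d. \<Sum>b\<in>S. c b * QZ (\<lambda>z. b z * e k z) * e k z) = (\<Sum>b\<in>S. c b * (\<Sum>k<d. QZ (\<lambda>z. b z * e k z) * e k z))"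
   by (subst sum.swap) (simp add: sum_distrib_left mult.assoc)
  finally show ?thesis unfolding res_def by (simp add: sum_subtractf right_diff_distrib)
 qed
 obtain C0 where C0: "0 <= C0" "\<And>h z. h \<in> H ==> ip h h <= 1 ==> z \<in> Z ==> \<bar>h z\<bar> <= C0" using R.unit_ball_bounded by blast
 have "\<exists>E\<ge>0. \<forall>k<d. \<forall>z\<in>Z. \<bar>e k z\<bar> <= E"
 proof -
  have "\<forall>k. \<exists>b. k < d \<longrightarrow> (\<forall>z\<in>Z. \<bar>e k z\<bar> <= b)" using test_functions_bounded[OF eT] by blast
  then obtain b where b: "\<And>k z. k < d ==> z \<in> Z ==> \<bar>e k z\<bar> <= b k" by metis
  show ?thesis
  proof (intro exI[of _ "\<Sum>k<d. \<bar>b k\<bar>"] conjI allI impI ballI)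
   fix k z assume "k < d" "z \<in> Z"
   then have "\<bar>e k z\<bar> <= \<bar>b k\<bar>" using b[of k z] by linarith
   also have "\<dots> <= (\<Sum>k<d. \<bar>b k\<bar>)" using \<open>k < d\<close> by (intro member_le_sum) auto
   finally show "\<bar>e k z\<bar> <= (\<Sum>k<d. \<bar>b k\<bar>)" .
  qed (simp add: sum_nonneg)
 qed
 then obtain E where E: "0 <= E" "\<And>k z. k < d ==> z \<in> Z ==> \<bar>e k z\<bar> <= E" by blast
 define C where "C = C0 + real d * (C0 * E * E)"
 have resb: "\<bar>res h z\<bar> <= C" if h: "h \<in> H" "ip h h <= 1" and z: "z \<in> Z" for h z
 proof -
  have q: "\<bar>QZ (\<lambda>z. h z * e k z)\<bar> <= C0 * E" if k: "k < d" for k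
   using C0 E h k by (intro mean_on_bound[OF mean_on_QZ] test_functions_mult HT eT) (auto simp: abs_mult intro!: mult_mono)
  have "\<bar>\<Sum>k<d. QZ (\<lambda>z. h z * e k z) * e k z\<bar> <= real d * (C0 * E * E)"
   unfolding abs_mult using q E(2)[OF _ z] C0(1) E(1) by (intro sum_abs_le_card) (auto simp: abs_mult intro!: mult_mono)
  moreover have "\<bar>h z\<bar> <= C0" by (rule C0(2)[OF h z])
  ultimately show ?thesis unfolding res_def C_def by arith
 qed
 have Hout: "AE \<omega> in M. \<forall>b\<in>S. (\<forall>i j. i ~= j \<longrightarrow> res b (Ts i \<omega>, Xs j \<omega>) = 0) \<and> (\<forall>i. r (zs \<omega> i) * res b (zs \<omega> i) = 0)"
 proof (rule AE_finite_allI[OF S(2)])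
  fix b assume b: "b \<in> S"
  have bT: "res b \<in> test_functions Z" using b S(1) by (intro resT HT) auto
  note nz = AE_null_test_function[OF bT res0[OF b]]
  have "AE \<omega> in M. \<forall>i. r (zs \<omega> i) * res b (zs \<omega> i) = 0"
   unfolding AE_all_countable using ZS.AE_S[OF nz(2)] by blast
  with AE_cross_sample[OF nz(1)]
  show "AE \<omega> in M. (\<forall>i j. i ~= j \<longrightarrow> res b (Ts i \<omega>, Xs j \<omega>) = 0) \<and> (\<forall>i. r (zs \<omega> i) * res b (zs \<omega> i) = 0)"
   by eventually_elim blast
 qed
 have Gram: "AE \<omega> in M. \<forall>l\<in>{..<d}. \<forall>k\<in>{..<d}. (\<lambda>n. (\<Sum>i<n. r (zs \<omega> i) * (e l (zs \<omega> i) * e k (zs \<omega> i))) / real n) \<longlonglongrightarrow> QZ (\<lambda>z. e l z * e k z)"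
  by (intro AE_finite_allI finite_lessThan ratio_test_lln test_functions_mult eT) auto
 show ?thesis
 proof (rule exI[of _ C])
  show "AE \<omega> in M. \<forall>\<eta>>0. \<forall>\<^sub>F n in sequentially. \<exists>v. feasible_weights n W v \<and>
   (\<forall>f\<in>F. \<bar>sample_mean n v (zs \<omega>) f - target_mean n (zs \<omega>) f\<bar> <= C / real n) \<and>
   (\<forall>i<n. \<bar>real n * v i - r (zs \<omega> i)\<bar> <= \<eta>)"
   using AE_pairs_Z uniform_balance Hout Gram
  proof eventually_elim
   case (elim \<omega>)
   define z where "z = zs \<omega>"
   have zZ: "(fst (z i), snd (z j)) \<in> Z" for i j using elim(1) unfolding z_def by blast
   have zi: "z i \<in> Z" for i using zZ[of i i] by simp
   define A where "A n l k = (\<Sum>i<n. r (z i) * (e l (z i) * e k (z i))) / real n" for n l k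
   have Alim: "(\<lambda>n. A n l k) \<longlonglongrightarrow> (if l = k then 1 else 0)" if "l < d" "k < d" for l k
    unfolding A_def z_def orth[OF that, symmetric] using elim(4) that by blast
   have tlim: "(\<lambda>n. target_mean n z (e l)) \<longlonglongrightarrow> (if l = 0 then 1 else 0)" if l: "l < d" for l
   proof -
    have "QZ (e l) = (if l = 0 then 1 else 0)" using orth[OF l d] unfolding e0 by simp
    moreover have "(\<lambda>n. target_mean n z (e l)) \<longlonglongrightarrow> QZ (e l)"
    proof (rule tendstoI)
     fix \<epsilon> :: real assume \<epsilon>: "\<epsilon> > 0"
     have "equicontinuous_class Z {e l}" by (rule equicontinuous_singleton[OF compact_Z Vcont[OF eV[OF l]]])
     from elim(2)[rule_format, OF this, of "\<epsilon> / 2"] \<epsilon>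
     have "\<forall>\<^sub>F n in sequentially. \<bar>target_mean n z (e l) - QZ (e l)\<bar> <= \<epsilon> / 2"
      unfolding z_def by (auto elim!: eventually_mono)
     then show "\<forall>\<^sub>F n in sequentially. dist (target_mean n z (e l)) (QZ (e l)) < \<epsilon>"
      by eventually_elim (use \<epsilon> in \<open>simp add: dist_real_def\<close>)
    qed
    ultimately show ?thesis by simp
   qed
   show ?case
   proof (intro allI impI)
    fix \<eta> :: real assume \<eta>: "\<eta> > 0"
    \<comment> \<open>Bound on the relative change of the ratios: at most 1 for nonnegativity, and
      small enough for closeness \<eta> and for the cap W.\<close>
    define \<gamma> where "\<gamma> = Min {1, \<eta> / W\<^sub>0, (W - W\<^sub>0) / W\<^sub>0}"
    have \<gamma>: "\<gamma> > 0" "\<gamma> <= 1" "W\<^sub>0 * \<gamma> <= \<eta>" "W\<^sub>0 * \<gamma> <= W - W\<^sub>0"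
    proof -
     show "\<gamma> > 0" unfolding \<gamma>_def using \<eta> W0_pos W0_less by simp
     show "\<gamma> <= 1" unfolding \<gamma>_def by simp
     have "\<gamma> <= \<eta> / W\<^sub>0" "\<gamma> <= (W - W\<^sub>0) / W\<^sub>0" unfolding \<gamma>_def by simp_all
     then show "W\<^sub>0 * \<gamma> <= \<eta>" "W\<^sub>0 * \<gamma> <= W - W\<^sub>0" using W0_pos by (simp_all add: field_simps)
    qed
    \<comment> \<open>Coefficients bounded by 2 m and d basis functions bounded by E give a change
      of at most 2 m d E <= \<gamma>; the added 1 covers E = 0.\<close>
    define m where "m = \<gamma> / (2 * real d * (E + 1))"
    have m: "m > 0" unfolding m_def using \<gamma> d E by simp
    have ev1: "\<forall>\<^sub>F n in sequentially. \<forall>l\<in>{..<d}. \<forall>k\<in>{..<d}. \<bar>(if l = k then 1 else 0) - A n l k\<bar> <= 1 / (2 * real d)"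
    proof (intro eventually_ball_finite finite_lessThan ballI)
     fix l k assume "l \<in> {..<d}" "k \<in> {..<d}"
     then have "\<forall>\<^sub>F n in sequentially. dist (A n l k) (if l = k then 1 else 0) < 1 / (2 * real d)"
      using d by (intro tendstoD[OF Alim]) auto
     then show "\<forall>\<^sub>F n in sequentially. \<bar>(if l = k then 1 else 0) - A n l k\<bar> <= 1 / (2 * real d)"
      by eventually_elim (simp add: dist_real_def abs_minus_commute)
    qed
    have ev2: "\<forall>\<^sub>F n in sequentially. \<forall>l\<in>{..<d}. \<bar>target_mean n z (e l) - A n l 0\<bar> <= m"
    proof (intro eventually_ball_finite finite_lessThan ballI)
     fix l assume "l \<in> {..<d}"
     then have "(\<lambda>n. target_mean n z (e l) - A n l 0) \<longlonglongrightarrow> (if l = 0 then 1 else 0) - (if l = 0 then 1 else 0)"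
      using d by (intro tendsto_diff tlim Alim) auto
     then have "(\<lambda>n. target_mean n z (e l) - A n l 0) \<longlonglongrightarrow> 0" by simp
     from tendstoD[OF this m] show "\<forall>\<^sub>F n in sequentially. \<bar>target_mean n z (e l) - A n l 0\<bar> <= m"
      by eventually_elim (simp add: dist_real_def)
    qed
    show "\<forall>\<^sub>F n in sequentially. \<exists>v. feasible_weights n W v \<and>
     (\<forall>f\<in>F. \<bar>sample_mean n v (zs \<omega>) f - target_mean n (zs \<omega>) f\<bar> <= C / real n) \<and>
     (\<forall>i<n. \<bar>real n * v i - r (zs \<omega> i)\<bar> <= \<eta>)"
     using ev1 ev2 eventually_gt_at_top[of 0]
    proof eventually_elim
     case (elim n)
     \<comment> \<open>Weights (r / n)(1 + y) with y in the span have as l-th moment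
       \<open>A n l 0\<close> plus the l-th entry of \<open>A n\<close> applied to x; equating it to
       the target moment is this system. As \<open>A n\<close> tends to the identity and the
       right-hand side to 0, it has a small solution.\<close>
     obtain x where x: "\<forall>l<d. (\<Sum>k<d. A n l k * x k) = target_mean n z (e l) - A n l 0" "\<forall>l<d. \<bar>x l\<bar> <= 2 * m"
      using perturbed_identity_solvable[of d "A n" "\<lambda>l. target_mean n z (e l) - A n l 0" m] elim(1,2) by auto
     define y where "y i = (\<Sum>k<d. x k * e k (z i))" for i
     define v where "v i = r (z i) / real n * (1 + y i)" for i
     have y: "\<bar>y i\<bar> <= \<gamma>" for i
     proof -
      have "\<bar>y i\<bar> <= real d * (2 * m * E)"
       unfolding y_def using x(2) E(1) E(2)[OF _ zi] m by (intro sum_abs_le_card) (auto simp: abs_mult intro!: mult_mono)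
      also have "\<dots> <= real d * (2 * m * (E + 1))" using m E by (intro mult_left_mono) auto
      also have "\<dots> = \<gamma>" unfolding m_def using d E by simp
      finally show ?thesis .
     qed
     have rn: "0 <= r (z i) / real n" for i using r_bounds(1) by simp
     have vr: "\<bar>real n * v i - r (z i)\<bar> <= W\<^sub>0 * \<gamma>" for i
     proof -
      have "real n * v i - r (z i) = r (z i) * y i" unfolding v_def using elim(3) by (simp add: field_simps)
      moreover have "\<bar>r (z i) * y i\<bar> <= W\<^sub>0 * \<gamma>"
       unfolding abs_mult using r_abs_le[of "z i"] y[of i] W0_pos by (intro mult_mono) auto
      ultimately show ?thesis by simp
     qed
     have v0: "0 <= v i" for i unfolding v_def using rn[of i] y[of i] \<gamma>(2) by (intro mult_nonneg_nonneg) auto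
     have se: "sample_mean n v z (e l) = target_mean n z (e l)" if l: "l < d" for l
     proof -
      have "sample_mean n v z (e l) = (\<Sum>i<n. r (z i) * (e l (z i) * e 0 (z i)) / real n + (\<Sum>k<d. (r (z i) * (e l (z i) * e k (z i)) / real n) * x k))"
       unfolding sample_mean_def v_def y_def e0
       by (intro sum.cong refl) (simp add: algebra_simps sum_distrib_left add_divide_distrib sum_divide_distrib)
      also have "\<dots> = A n l 0 + (\<Sum>k<d. A n l k * x k)"
       unfolding A_def sum.distrib by (subst sum.swap) (simp add: sum_distrib_right sum_divide_distrib)
      finally show ?thesis using x(1) l by simp
     qed
     have feas: "feasible_weights n W v"
      unfolding feasible_weights_def
     proof (intro conjI allI impI v0)
      have "sample_mean n v z (e 0) = target_mean n z (e 0)" by (rule se[OF d])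
      then show "(\<Sum>i<n. v i) = 1" unfolding e0 sample_mean_def target_mean_def using elim(3) by (simp add: power2_eq_square)
      fix i assume "i < n"
      have "real n * v i <= W" using vr[of i] \<gamma>(4) r_bounds(2)[of "z i"] by (simp add: abs_le_iff)
      then show "v i <= W / real n" using elim(3) by (simp add: field_simps)
     qed
     have Ms: "mean_on Z (sample_mean n v z)" by (rule feasible_mean_on[OF feas zi])
     have Mt: "mean_on Z (target_mean n z)" by (rule target_mean_mean_on[OF zZ elim(3)])
     have dec: "M' h = M' (res h) + (\<Sum>k<d. QZ (\<lambda>z. h z * e k z) * M' (e k))" if M': "mean_on Z M'" and h: "h \<in> H" for M' h
     proof -
      have sT: "(\<lambda>z. \<Sum>k<d. QZ (\<lambda>z. h z * e k z) * e k z) \<in> test_functions Z"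
       by (rule test_functions_sum[OF Z_borel]) (use eT in auto)
      have "M' (\<lambda>z. 1 * res h z + 1 * (\<Sum>k<d. QZ (\<lambda>z. h z * e k z) * e k z)) = 1 * M' (res h) + 1 * M' (\<lambda>z. \<Sum>k<d. QZ (\<lambda>z. h z * e k z) * e k z)"
       by (rule mean_on_combination[OF M' resT[OF HT[OF h]] sT])
      moreover have "M' (\<lambda>z. \<Sum>k<d. QZ (\<lambda>z. h z * e k z) * e k z) = (\<Sum>k<d. QZ (\<lambda>z. h z * e k z) * M' (e k))"
       using eT by (intro mean_on_sum[OF Z_borel M']) auto
      moreover have "(\<lambda>z. 1 * res h z + 1 * (\<Sum>k<d. QZ (\<lambda>z. h z * e k z) * e k z)) = h" unfolding res_def by auto
      ultimately show ?thesis by simp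
     qed
     have bal: "\<bar>sample_mean n v z f - target_mean n z f\<bar> <= C / real n" if f: "f \<in> F" for f
     proof -
      obtain h where h: "h \<in> H" "ip h h <= 1" "\<And>z. z \<in> Z ==> f z = h z" using f unfolding FH rkhs_unit_ball_def by blast
      obtain c where c: "h = (\<lambda>z. \<Sum>b\<in>S. c b * b z)" using S(3)[OF h(1)] by blast
      have fh: "sample_mean n v z f = sample_mean n v z h" "target_mean n z f = target_mean n z h"
       unfolding sample_mean_def target_mean_def using h(3) zi zZ by simp_all
      have "sample_mean n v z h - target_mean n z h = sample_mean n v z (res h) - target_mean n z (res h)"
       unfolding dec[OF Ms h(1)] dec[OF Mt h(1)] using se by simp
      also have "sample_mean n v z (res h) = 0"
       unfolding sample_mean_def
      proof (rule sum.neutral, rule ballI)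
       fix i
       have "r (z i) * res h (z i) = (\<Sum>b\<in>S. c b * (r (z i) * res b (z i)))"
        unfolding reslin[OF c] by (simp add: sum_distrib_left mult_ac)
       also have "\<dots> = 0" using \<open>\<forall>b\<in>S. (\<forall>i j. i ~= j \<longrightarrow> res b (Ts i \<omega>, Xs j \<omega>) = 0) \<and> (\<forall>i. r (zs \<omega> i) * res b (zs \<omega> i) = 0)\<close>
        unfolding z_def by (intro sum.neutral) simp
       finally show "v i * res h (z i) = 0" unfolding v_def by auto
      qed
      finally have dif: "sample_mean n v z h - target_mean n z h = - target_mean n z (res h)" by simp
      \<comment> \<open>Off the diagonal the pairs have law Q, where the residual vanishes, so only
        n of the n^2 terms survive: this is the source of the rate C/n.\<close>
      have off: "res h (fst (z i), snd (z j)) = 0" if "i ~= j" for i j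
       using that \<open>\<forall>b\<in>S. (\<forall>i j. i ~= j \<longrightarrow> res b (Ts i \<omega>, Xs j \<omega>) = 0) \<and> (\<forall>i. r (zs \<omega> i) * res b (zs \<omega> i) = 0)\<close>
       unfolding reslin[OF c] z_def zs_def by (intro sum.neutral) simp
      have "(\<Sum>i<n. \<Sum>j<n. res h (fst (z i), snd (z j))) = (\<Sum>i<n. \<Sum>j<n. if j = i then res h (z i) else 0)"
       using off by (intro sum.cong refl) auto
      then have "target_mean n z (res h) = (\<Sum>i<n. res h (z i)) / (real n)\<^sup>2" unfolding target_mean_def by simp
      moreover have "\<bar>\<Sum>i<n. res h (z i)\<bar> <= real n * C" by (rule sum_abs_le_card) (rule resb[OF h(1,2) zi])
      ultimately have "\<bar>target_mean n z (res h)\<bar> <= real n * C / (real n)\<^sup>2"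
       by (simp add: abs_divide divide_right_mono)
      also have "\<dots> = C / real n" using elim(3) by (simp add: power2_eq_square)
      finally show ?thesis unfolding fh dif by simp
     qed
     show ?case
      using feas bal vr \<gamma>(3) unfolding z_def[symmetric] by (intro exI[of _ v] conjI) (auto intro: order_trans)
    qed
   qed
  qed
 qed
qed

lemma ratio_is_maximizer:
 assumes "AE z in P. RN_deriv P Q z = ennreal (deriv (legendre W \<rho>) (c + f z))"
 shows "AE \<omega> in M. \<forall>i. r (zs \<omega> i) = maximizer (c + f (zs \<omega> i))"
proof -
 have "AE z in P. r z = maximizer (c + f z)"
  using assms AE_r_eq
 proof eventually_elim
  case (elim z)
  have "ennreal (r z) = ennreal (maximizer (c + f z))" using elim deriv_legendre[of "c + f z"] by simp
  moreover have "0 <= maximizer (c + f z)" using maximizer(1)[of "c + f z"] by simp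
  ultimately show ?case using r_bounds(1)[of z] by (simp only: ennreal_inj)
 qed
 then show ?thesis unfolding AE_all_countable using ZS.AE_S by blast
qed

text \<open>Under well-specification the density ratio is the unconstrained minimiser of
 \<open>\<rho>(y) - (c + f(z)) y\<close>, so the excess regularisation of the optimal weights, whose mean of \<open>f\<close> is
 asymptotically right, is a sum of Bregman divergences that control the distance to the ratio.\<close>

theorem weights_converge:
 assumes lam: "0 < lam" and ws: "well_specified Z P Q F W \<rho>"
 shows "AE \<omega> in M. (\<lambda>n. (\<Sum>i<n. \<bar>real n * w n \<omega> i - r (zs \<omega> i)\<bar>) / real n) \<longlonglongrightarrow> 0"
proof -
 obtain K H ip c f where ker: "continuous_kernel_rkhs Z K H ip" and fd: "finite_dimensional_class H"
  and FH: "F = rkhs_unit_ball Z H ip" and f: "f \<in> H"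
  and dens: "AE z in P. RN_deriv P Q z = ennreal (deriv (legendre W \<rho>) (c + f z))"
  using ws unfolding well_specified_def by blast
 interpret R: rkhs_space Z K H ip by unfold_locales (fact ker compact_Z)+
 have fT: "f \<in> test_functions Z" by (rule continuous_test_function[OF compact_Z R.H_continuous_on[OF f]])
 have oT: "(\<lambda>_. 1) \<in> test_functions Z" by (rule test_functions_const[OF Z_borel])
 \<comment> \<open>A positive multiple of f lies in the unit ball, so balance over \<open>F\<close>
   controls the mean of f.\<close>
 obtain a where a: "a > 0" "(\<lambda>z. a * f z) \<in> H" "ip (\<lambda>z. a * f z) (\<lambda>z. a * f z) <= 1"
  using R.H_in_scaled_ball[OF f] by blast
 have aF: "(\<lambda>z. a * f z) \<in> F" unfolding FH rkhs_unit_ball_def using a by auto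
 have Qa: "QZ (\<lambda>z. a * f z) = a * QZ f"
  using mean_on_combination[OF mean_on_QZ fT fT, of a 0] by simp
 obtain C where cmp: "AE \<omega> in M. \<forall>\<eta>>0. \<forall>\<^sub>F n in sequentially. \<exists>v. feasible_weights n W v \<and>
  (\<forall>f\<in>F. \<bar>sample_mean n v (zs \<omega>) f - target_mean n (zs \<omega>) f\<bar> <= C / real n) \<and>
  (\<forall>i<n. \<bar>real n * v i - r (zs \<omega> i)\<bar> <= \<eta>)"
  using balanced_comparator[OF ker fd FH] by blast
 have uc: "uniformly_continuous_on {0..W} \<rho>" by (rule compact_uniformly_continuous[OF cont]) simp
 have rW: "r z \<in> {0..W}" for z using r_bounds[of z] W0_less by simp
 show ?thesis
  using optimal AE_pairs_Z weights_balance cmp ratio_test_lln[OF fT] ratio_test_lln[OF oT] ratio_is_maximizer[OF dens]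
 proof eventually_elim
  case (elim \<omega>)
  define z where "z = zs \<omega>"
  define s where "s i = c + f (z i)" for i
  define x where "x n i = real n * w n \<omega> i" for n i
  \<comment> \<open>Bregman divergence of the scaled weight from the ratio, nonnegative since the
    ratio maximises s y - \<rho>(y).\<close>
  define D where "D n i = (\<rho> (x n i) - s i * x n i) - (\<rho> (r (z i)) - s i * r (z i))" for n i
  have Zin: "(fst (z i), snd (z j)) \<in> Z" for i j using elim(2) unfolding z_def by blast
  have rs: "r (z i) = maximizer (s i)" for i using elim(7) unfolding s_def z_def by blast
  have opt: "cbdm_weights F lam \<rho> W n z (w n \<omega>)" if "1 <= n" for n using elim(1) that unfolding z_def by blast
  have feas: "feasible_weights n W (w n \<omega>)" if "1 <= n" for n
   using opt[OF that] unfolding cbdm_weights_def is_arg_min_def by blast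
  have xW: "x n i \<in> {0..W}" if "i < n" for n i
   unfolding x_def using that by (intro feasible_scaled[OF feas]) auto
  have D0: "0 <= D n i" if "i < n" for n i
   using maximizer(2)[OF xW[OF that], of "s i"] unfolding D_def rs by (simp add: mult.commute)
  have small: "\<forall>\<^sub>F n in sequentially. (\<Sum>i<n. D n i) / real n <= \<epsilon>" if \<epsilon>: "\<epsilon> > 0" for \<epsilon>
  proof -
   \<comment> \<open>Uniform continuity turns closeness of the comparator to the ratios into
     closeness of the two mean costs, up to \<epsilon> / 4.\<close>
   obtain \<eta> where \<eta>: "\<eta> > 0" "\<And>y y'. y \<in> {0..W} ==> y' \<in> {0..W} ==> dist y' y < \<eta> ==> dist (\<rho> y') (\<rho> y) < \<epsilon> / 4"
    using uc \<epsilon> unfolding uniformly_continuous_on_def by (metis zero_less_divide_iff zero_less_numeral)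
   have e1: "\<forall>\<^sub>F n in sequentially. \<exists>v. feasible_weights n W v \<and>
     (\<forall>f\<in>F. \<bar>sample_mean n v z f - target_mean n z f\<bar> <= C / real n) \<and> (\<forall>i<n. \<bar>real n * v i - r (z i)\<bar> <= \<eta> / 2)"
    using elim(4)[THEN spec, of "\<eta> / 2"] \<eta>(1) unfolding z_def by (simp del: divide_le_eq_numeral1 le_divide_eq_numeral1)
   have e2: "\<forall>\<^sub>F n in sequentially. \<forall>g\<in>F. \<bar>sample_mean n (w n \<omega>) z g - QZ g\<bar> <= a * (\<epsilon> / 4)"
   proof -
    have "a * (\<epsilon> / 4) > 0" using \<epsilon> a(1) by simp
    from elim(3)[THEN spec, THEN mp, OF this] show ?thesis unfolding z_def .
   qed
   have e3: "\<forall>\<^sub>F n in sequentially. C\<^sup>2 / lam / real n < \<epsilon> / 4"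
    using \<epsilon> by (intro order_tendstoD(2)[OF lim_const_over_n]) auto
   have "(\<lambda>n. c * ((\<Sum>i<n. r (z i) * 1) / real n) + (\<Sum>i<n. r (z i) * f (z i)) / real n) \<longlonglongrightarrow> c * QZ (\<lambda>_. 1) + QZ f"
    using elim(5,6) unfolding z_def by (intro tendsto_intros)
   then have lim: "(\<lambda>n. c * ((\<Sum>i<n. r (z i) * 1) / real n) + (\<Sum>i<n. r (z i) * f (z i)) / real n) \<longlonglongrightarrow> c + QZ f"
    by (simp add: mean_on_one[OF mean_on_QZ])
   have e4: "\<forall>\<^sub>F n in sequentially. c * ((\<Sum>i<n. r (z i) * 1) / real n) + (\<Sum>i<n. r (z i) * f (z i)) / real n < c + QZ f + \<epsilon> / 4"
    using \<epsilon> by (intro order_tendstoD(2)[OF lim]) auto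
   show ?thesis using e1 e2 e3 e4 eventually_ge_at_top[of 1]
   proof eventually_elim
    case (elim n)
    have n: "real n > 0" using elim(5) by simp
    obtain v where v: "feasible_weights n W v" "\<And>g. g \<in> F ==> \<bar>sample_mean n v z g - target_mean n z g\<bar> <= C / real n"
     "\<And>i. i < n ==> \<bar>real n * v i - r (z i)\<bar> <= \<eta> / 2" using elim(1) by blast
    have "(sample_mean n (w n \<omega>) z (\<lambda>z. a * f z) - target_mean n z (\<lambda>z. a * f z))\<^sup>2 + lam * weight_regularizer n \<rho> (w n \<omega>)
      <= (C / real n)\<^sup>2 + lam * weight_regularizer n \<rho> v"
     by (rule cbdm_optimality(1)[OF opt[OF elim(5)] v(1) elim(5) Zin v(2) aF])
    \<comment> \<open>The squared imbalance of the optimum is nonnegative and dropped. Dividing by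
      \<open>lam\<close> and multiplying by n turns (C/n)^2 into C^2 / (lam n), which still
      vanishes.\<close>
    then have "lam * weight_regularizer n \<rho> (w n \<omega>) <= (C / real n)\<^sup>2 + lam * weight_regularizer n \<rho> v"
     by (smt (verit) zero_le_power2)
    then have "weight_regularizer n \<rho> (w n \<omega>) - weight_regularizer n \<rho> v <= (C / real n)\<^sup>2 / lam"
     using lam by (simp add: pos_le_divide_eq right_diff_distrib mult.commute)
    then have "real n * (weight_regularizer n \<rho> (w n \<omega>) - weight_regularizer n \<rho> v) <= real n * ((C / real n)\<^sup>2 / lam)"
     by (intro mult_left_mono) auto
    moreover have "real n * ((C / real n)\<^sup>2 / lam) = C\<^sup>2 / lam / real n"
     using n by (simp add: power2_eq_square)
    ultimately have R: "real n * weight_regularizer n \<rho> (w n \<omega>) - real n * weight_regularizer n \<rho> v <= C\<^sup>2 / lam / real n"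
     by (simp add: right_diff_distrib)
    have reg: "real n * weight_regularizer n \<rho> v = (\<Sum>i<n. \<rho> (real n * v i)) / real n" for v
     unfolding weight_regularizer_def using n by (simp add: power2_eq_square)
    have "(\<Sum>i<n. \<rho> (real n * v i)) <= (\<Sum>i<n. \<rho> (r (z i)) + \<epsilon> / 4)"
    proof (rule sum_mono)
     fix i assume "i \<in> {..<n}"
     then have i: "i < n" by simp
     have "dist (\<rho> (real n * v i)) (\<rho> (r (z i))) < \<epsilon> / 4"
     proof (rule \<eta>(2)[OF rW feasible_scaled[OF v(1) i]])
      show "dist (real n * v i) (r (z i)) < \<eta>" using v(3)[OF i] \<eta>(1) by (simp add: dist_real_def)
     qed
     then show "\<rho> (real n * v i) <= \<rho> (r (z i)) + \<epsilon> / 4" unfolding dist_real_def by arith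
    qed
    then have "(\<Sum>i<n. \<rho> (real n * v i)) <= (\<Sum>i<n. \<rho> (r (z i))) + real n * (\<epsilon> / 4)"
     by (simp only: sum.distrib sum_constant card_lessThan)
    then have "(\<Sum>i<n. \<rho> (real n * v i)) / real n <= ((\<Sum>i<n. \<rho> (r (z i))) + real n * (\<epsilon> / 4)) / real n"
     using n by (intro divide_right_mono) auto
    also have "\<dots> = (\<Sum>i<n. \<rho> (r (z i))) / real n + \<epsilon> / 4" using n by (simp add: add_divide_distrib)
    finally have "(\<Sum>i<n. \<rho> (real n * v i)) / real n <= (\<Sum>i<n. \<rho> (r (z i))) / real n + \<epsilon> / 4" .
    then have A: "(\<Sum>i<n. \<rho> (x n i)) / real n - (\<Sum>i<n. \<rho> (r (z i))) / real n <= \<epsilon> / 2"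
     using R elim(3) unfolding reg x_def by linarith
    have "sample_mean n (w n \<omega>) z (\<lambda>z. a * f z) = a * sample_mean n (w n \<omega>) z f"
     unfolding sample_mean_def by (simp add: sum_distrib_left mult_ac)
    then have "\<bar>a * (sample_mean n (w n \<omega>) z f - QZ f)\<bar> <= a * (\<epsilon> / 4)"
     using elim(2)[rule_format, OF aF] unfolding Qa by (simp add: algebra_simps)
    then have "a * \<bar>sample_mean n (w n \<omega>) z f - QZ f\<bar> <= a * (\<epsilon> / 4)" using a(1) by (simp add: abs_mult)
    then have sm: "\<bar>sample_mean n (w n \<omega>) z f - QZ f\<bar> <= \<epsilon> / 4" using a(1) by (simp only: mult_le_cancel_left_pos)
    have sx: "(\<Sum>i<n. s i * x n i) / real n = c + sample_mean n (w n \<omega>) z f"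
    proof -
     have "(\<Sum>i<n. s i * x n i) / real n = (\<Sum>i<n. c * w n \<omega> i + w n \<omega> i * f (z i))"
      unfolding sum_divide_distrib x_def s_def using n by (intro sum.cong refl) (simp add: field_simps)
     also have "\<dots> = c * (\<Sum>i<n. w n \<omega> i) + sample_mean n (w n \<omega>) z f"
      unfolding sum.distrib sample_mean_def by (simp add: sum_distrib_left)
     finally show ?thesis using feas[OF elim(5)] unfolding feasible_weights_def by simp
    qed
    have sr: "(\<Sum>i<n. s i * r (z i)) / real n = c * ((\<Sum>i<n. r (z i) * 1) / real n) + (\<Sum>i<n. r (z i) * f (z i)) / real n"
     unfolding s_def by (simp add: algebra_simps sum.distrib sum_distrib_left add_divide_distrib)
    have "(\<Sum>i<n. D n i) / real n = ((\<Sum>i<n. \<rho> (x n i)) / real n - (\<Sum>i<n. \<rho> (r (z i))) / real n)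
      - (\<Sum>i<n. s i * x n i) / real n + (\<Sum>i<n. s i * r (z i)) / real n"
     unfolding D_def by (simp add: sum_subtractf sum.distrib diff_divide_distrib)
    then show ?case using A sm[unfolded abs_le_iff, THEN conjunct2] elim(4) unfolding sx sr by linarith
   qed
  qed
  show ?case
  proof (rule tendstoI)
   fix \<delta> :: real assume \<delta>: "\<delta> > 0"
   then have "\<delta> / 2 > 0" by simp
   from bregman_gap[OF this] obtain \<kappa> where \<kappa>: "\<kappa> > 0"
    "\<And>s y. y \<in> {0..W} ==> \<delta> / 2 <= \<bar>y - maximizer s\<bar> ==> \<rho> (maximizer s) - s * maximizer s + \<kappa> <= \<rho> y - s * y" by blast
   have "\<kappa> * \<delta> / (4 * W) > 0" using \<kappa> \<delta> W_pos by simp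
   from small[OF this] show "\<forall>\<^sub>F n in sequentially. dist ((\<Sum>i<n. \<bar>real n * w n \<omega> i - r (zs \<omega> i)\<bar>) / real n) 0 < \<delta>"
    using eventually_ge_at_top[of 1]
   proof eventually_elim
    case (elim n)
    have n: "real n > 0" using elim(2) by simp
    \<comment> \<open>A Markov-type estimate: a deviation of at least \<delta> / 2 forces D >=
      \<kappa>, and no deviation exceeds W, so W D / \<kappa> dominates it.\<close>
    have "(\<Sum>i<n. \<bar>x n i - r (z i)\<bar>) <= (\<Sum>i<n. \<delta> / 2 + W / \<kappa> * D n i)"
    proof (rule sum_mono)
     fix i assume "i \<in> {..<n}"
     then have i: "i < n" by simp
     have k: "W / \<kappa> >= 0" using W_pos \<kappa>(1) by simp
     show "\<bar>x n i - r (z i)\<bar> <= \<delta> / 2 + W / \<kappa> * D n i"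
     proof (cases "\<delta> / 2 <= \<bar>x n i - r (z i)\<bar>")
      case True
      then have "\<kappa> <= D n i" using \<kappa>(2)[OF xW[OF i], of "s i"] unfolding D_def rs by simp
      then have "W / \<kappa> * \<kappa> <= W / \<kappa> * D n i" using k by (rule mult_left_mono)
      moreover have "\<bar>x n i - r (z i)\<bar> <= W" using xW[OF i] rW[of "z i"] by (auto simp: abs_le_iff)
      ultimately show ?thesis using \<delta> \<kappa>(1) by simp
     next
      case False
      then show ?thesis using mult_nonneg_nonneg[OF k D0[OF i]] by linarith
     qed
    qed
    also have "\<dots> = real n * (\<delta> / 2) + W / \<kappa> * (\<Sum>i<n. D n i)" by (simp add: sum.distrib sum_distrib_left)
    finally have "(\<Sum>i<n. \<bar>x n i - r (z i)\<bar>) / real n <= \<delta> / 2 + W / \<kappa> * ((\<Sum>i<n. D n i) / real n)"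
     using n by (simp add: field_simps)
    also have "\<dots> <= \<delta> / 2 + W / \<kappa> * (\<kappa> * \<delta> / (4 * W))"
     using elim(1) W_pos \<kappa>(1) by (intro add_left_mono mult_left_mono) auto
    also have "\<dots> < \<delta>" using W_pos \<kappa>(1) \<delta> by simp
    finally have "(\<Sum>i<n. \<bar>x n i - r (z i)\<bar>) / real n < \<delta>" .
    moreover have "0 <= (\<Sum>i<n. \<bar>x n i - r (z i)\<bar>) / real n" by (intro divide_nonneg_nonneg sum_nonneg) auto
    ultimately show ?case unfolding x_def z_def by (simp add: dist_real_def)
   qed
  qed
 qed
qed

end

section \<open>Weighted regression\<close>

lemma is_arg_min_iff: "is_arg_min f A x \<longleftrightarrow> A x \<and> (\<forall>y. A y \<longrightarrow> f x <= (f y :: real))"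
 unfolding is_arg_min_def by (auto simp: not_less)

locale weighted_regression = cbdm_sample M T X Ypot Y P Q PT PX W\<^sub>0 Ts Xs Ys Z W \<rho> F lam w
 for M :: "'w measure" and T :: "'w => 'a::euclidean_space" and X :: "'w => 'b::euclidean_space"
  and Ypot Y P Q PT PX W\<^sub>0 Ts Xs Ys Z W \<rho> F lam w +
 fixes \<tau> :: "'a \<times> 'b => real" and G :: "('a => real) set" and B C :: real and ghat :: "nat => 'w => 'a => real"
  and g0 :: "'a => real"
 assumes \<tau>_measurable [measurable]: "\<tau> \<in> borel_measurable borel"
  and regression: "AE \<omega> in M. real_cond_exp M (gen_subalgebra M borel TX) Y \<omega> = \<tau> (TX \<omega>)"
  and Y_bounded: "AE \<omega> in M. \<bar>Y \<omega>\<bar> <= C" and C_nonneg: "0 <= C"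
  and w_measurable: "\<And>n i. i < n ==> (\<lambda>\<omega>. w n \<omega> i) \<in> borel_measurable
      (gen_subalgebra M (\<Pi>\<^sub>M j\<in>{..<n}. borel) (\<lambda>\<omega>. \<lambda>j\<in>{..<n}. (Ts j \<omega>, Xs j \<omega>)))"
  and G_measurable: "\<And>g. g \<in> G ==> g \<in> borel_measurable (restrict_space borel (measure_support PT))"
  and separable: "pointwise_separable (measure_support PT) G"
  and G_bounded: "bounded_class B Z G"
  and rademacher: "AE \<omega> in M. (\<lambda>n. rademacher_complexity n G (\<lambda>i. Ts i \<omega>)) \<longlonglongrightarrow> 0"
  and erm: "AE \<omega> in M. \<forall>n\<ge>1.
      is_arg_min (\<lambda>g. \<Sum>i<n. w n \<omega> i * (Ys i \<omega> - g (Ts i \<omega>))\<^sup>2) (\<lambda>g. g \<in> G) (ghat n \<omega>)"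
  and g0: "g0 \<in> G"
begin

abbreviation D :: "'a set" where "D \<equiv> measure_support PT"

text \<open>Elements of \<open>G\<close> are measurable on the support only. Extension by zero makes
  them Borel functions and changes neither risks nor, almost surely, the values at the
  sample.\<close>

definition on_support :: "('a => real) => 'a => real" where "on_support g t = indicator D t * g t"

text \<open>The quantity that \<open>bounded_class\<close> controls: the base point may be
  unbounded, the excess of g in \<open>G\<close> is at most B everywhere.\<close>

definition excess :: "('a => real) => 'a => real" where "excess g t = on_support g t - on_support g0 t"

text \<open>Agrees with \<tau> almost everywhere under P, since outcomes are bounded by C, and is
  bounded at every point.\<close>

definition \<tau>c :: "'a \<times> 'b => real" where "\<tau>c z = max (- C) (min C (\<tau> z))"

text \<open>On the support this is (g - \<tau>)^2 - (g0 - \<tau>)^2 with clipped \<tau>, written so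
  that its only unbounded part is \<open>g0\<close> times the bounded excess.\<close>

definition excess_loss :: "('a => real) => 'a \<times> 'b => real" where
 "excess_loss g z = (excess g (fst z))\<^sup>2 + 2 * (on_support g0 (fst z) - \<tau>c z) * excess g (fst z)"

lemma \<tau>c_measurable [measurable]: "\<tau>c \<in> borel_measurable borel" unfolding \<tau>c_def[abs_def] by measurable

lemma \<tau>c_bounds: "\<bar>\<tau>c z\<bar> <= C" unfolding \<tau>c_def using C_nonneg by auto

lemma D_borel [measurable]: "D \<in> sets borel" using closed_measure_support by (rule borel_closed)

lemma on_support_measurable: "g \<in> G ==> on_support g \<in> borel_measurable borel"
 using G_measurable[of g] D_borel unfolding on_support_def[abs_def]
 by (subst (asm) borel_measurable_restrict_space_iff) (auto simp: mult.commute)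

lemma excess_measurable: "g \<in> G ==> excess g \<in> borel_measurable borel"
 unfolding excess_def[abs_def] by (intro borel_measurable_diff on_support_measurable g0)

lemma fst_measurable: "h \<in> borel_measurable borel ==> (\<lambda>z :: 'a \<times> 'b. h (fst z) :: real) \<in> borel_measurable borel"
 by (rule measurable_compose[OF borel_projections(5)])

lemma excess_loss_measurable: "g \<in> G ==> excess_loss g \<in> borel_measurable borel"
 unfolding excess_loss_def[abs_def]
 by (intro borel_measurable_add borel_measurable_times borel_measurable_power borel_measurable_diff borel_measurable_const
   \<tau>c_measurable fst_measurable excess_measurable on_support_measurable g0)

text \<open>Compactness makes the projection of Z closed, and it carries full mass; conversely a
  neighbourhood of a projected point lifts to an open cylinder of positive mass. Bounds stated on Z
  thereby reach every point of the support of T.\<close>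

lemma D_eq_fst: "D = fst ` Z"
proof
 have cl: "closed (fst ` Z)"
  by (intro compact_imp_closed compact_continuous_image[OF _ compact_Z] continuous_intros)
 have "emeasure PT (- fst ` Z) = 0"
 proof -
  have "AE \<omega> in M. (TX \<omega>) \<in> Z"
   using AE_Z_P unfolding P_def by (rule AE_distrD[rotated]) measurable
  then have "AE \<omega> in M. T \<omega> \<notin> - fst ` Z" by eventually_elim force
  then have "emeasure M (T -` (- fst ` Z) \<inter> space M) = 0"
   using cl by (intro AE_iff_measurable[THEN iffD1, of _ M "\<lambda>\<omega>. T \<omega> \<notin> - fst ` Z"]) (auto intro!: measurable_sets[OF T_measurable])
  then show ?thesis unfolding PT_def using cl by (subst emeasure_distr) auto
 qed
 with measure_support_nullI[of "- fst ` Z" PT] cl show "D \<subseteq> fst ` Z" by (auto simp: open_Compl)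
 show "fst ` Z \<subseteq> D"
 proof
  fix t assume "t \<in> fst ` Z"
  then obtain x where tx: "(t, x) \<in> measure_support P" unfolding Z_def by auto
  show "t \<in> D" unfolding measure_support_def
  proof (intro CollectI allI impI)
   fix U :: "'a set" assume U: "open U" "t \<in> U"
   have o: "open (U \<times> (UNIV :: 'b set))" using U by (intro open_Times) auto
   have "emeasure P (U \<times> UNIV) > 0" using tx o U(2) unfolding measure_support_def by auto
   moreover have "emeasure P (U \<times> UNIV) = emeasure PT U"
    unfolding P_def PT_def using o U(1) by (subst (1 2) emeasure_distr) (auto intro!: arg_cong[where f = "emeasure M"])
   ultimately show "emeasure PT U > 0" by simp
  qed
 qed
qed

lemma B_nonneg: "0 <= B"
 using G_bounded g0 Z_nonempty unfolding bounded_class_def by fastforce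

lemma excess_bounded: "g \<in> G ==> \<bar>excess g t\<bar> <= B"
proof (cases "t \<in> D")
 case True
 assume g: "g \<in> G"
 obtain x where "(t, x) \<in> Z" using True unfolding D_eq_fst by auto
 moreover have "\<forall>p\<in>Z. case p of (t, x) => \<bar>g t - g0 t\<bar> <= B" using G_bounded g g0 unfolding bounded_class_def by blast
 ultimately have "\<bar>g t - g0 t\<bar> <= B" by blast
 then show ?thesis using True unfolding excess_def on_support_def by simp
qed (simp add: excess_def on_support_def B_nonneg)

lemma AE_Ts_D: "AE \<omega> in M. \<forall>i. Ts i \<omega> \<in> D"
 using AE_sample_Z by eventually_elim (force simp: D_eq_fst)

lemma AE_feasible: "AE \<omega> in M. \<forall>n\<ge>1. feasible_weights n W (w n \<omega>)"
 using optimal by eventually_elim (auto simp: cbdm_weights_def is_arg_min_def)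

text \<open>An enumeration of the dense subset provided by \<open>pointwise_separable\<close>;
  suprema over it are measurable.\<close>

definition countable_class :: "nat => 'a => real" where
 "countable_class = (SOME gk. (\<forall>k. gk k \<in> G) \<and>
  (\<forall>g\<in>G. \<exists>s. \<forall>t\<in>D. (\<lambda>m. gk (s m :: nat) t) \<longlonglongrightarrow> g t))"

lemma countable_class:
 "countable_class k \<in> G"
 "g \<in> G ==> \<exists>s. \<forall>t\<in>D. (\<lambda>m. countable_class (s m) t) \<longlonglongrightarrow> g t"
proof -
 obtain G' where G': "G' \<subseteq> G" "countable G'"
  "\<And>g. g \<in> G ==> \<exists>s. (\<forall>m. s m \<in> G') \<and> (\<forall>t\<in>D. (\<lambda>m. s m t) \<longlonglongrightarrow> g t)"
  using separable unfolding pointwise_separable_def by blast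
 obtain s0 where "\<forall>m. s0 m \<in> G'" using G'(3)[OF g0] by blast
 then have ne: "G' ~= {}" by blast
 have "\<exists>gk. (\<forall>k. gk k \<in> G) \<and> (\<forall>g\<in>G. \<exists>s. \<forall>t\<in>D. (\<lambda>m. gk (s m :: nat) t) \<longlonglongrightarrow> g t)"
 proof (intro exI[of _ "from_nat_into G'"] conjI allI ballI)
  show "from_nat_into G' k \<in> G" for k using from_nat_into[OF ne] G'(1) by blast
  fix g assume "g \<in> G"
  then obtain s where s: "\<And>m. s m \<in> G'" "\<And>t. t \<in> D ==> (\<lambda>m. s m t) \<longlonglongrightarrow> g t" using G'(3) by blast
  show "\<exists>s. \<forall>t\<in>D. (\<lambda>m. from_nat_into G' (s m) t) \<longlonglongrightarrow> g t"
   by (intro exI[of _ "\<lambda>m. to_nat_on G' (s m)"]) (use s G'(2) in simp)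
 qed
 from someI_ex[OF this] show "countable_class k \<in> G"
  "g \<in> G ==> \<exists>s. \<forall>t\<in>D. (\<lambda>m. countable_class (s m) t) \<longlonglongrightarrow> g t"
  unfolding countable_class_def by blast+
qed

definition u :: "nat => 'a => real" where "u k = excess (countable_class k)"

text \<open>The bound is B + 1 because \<open>noise_model\<close> asks for a positive one and B may
  be 0.\<close>

lemma u_bounded_functions: "bounded_functions u borel (B + 1)"
proof
 show "u k \<in> borel_measurable borel" for k unfolding u_def by (rule excess_measurable[OF countable_class(1)])
 show "\<bar>u k t\<bar> <= B + 1" for k t unfolding u_def using excess_bounded[OF countable_class(1), of k t] by simp
qed

lemma u_dense:
 assumes "g \<in> G" obtains s where "\<And>t. (\<lambda>m. u (s m) t) \<longlonglongrightarrow> excess g t"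
proof -
 obtain s where s: "\<And>t. t \<in> D ==> (\<lambda>m. countable_class (s m) t) \<longlonglongrightarrow> g t" using countable_class(2)[OF assms] by blast
 show ?thesis
 proof (rule that[of s])
  fix t show "(\<lambda>m. u (s m) t) \<longlonglongrightarrow> excess g t"
   by (cases "t \<in> D") (auto simp: u_def excess_def on_support_def intro!: tendsto_intros s)
 qed
qed

text \<open>The shift by \<open>g0\<close> contributes a fixed linear form in the signs, of mean
  zero, and pointwise limits add nothing to a supremum of finite sums.\<close>

lemma rademacher_u:
 assumes t: "\<And>i. i < n ==> t i \<in> D"
 shows "rademacher_complexity n G t = 2 * rademacher_avg u n t"
proof -
 interpret bounded_functions u borel "B + 1" by (rule u_bounded_functions)
 have ex: "(\<Sum>i<n. \<xi> i * g (t i)) = (\<Sum>i<n. \<xi> i * excess g (t i)) + (\<Sum>i<n. \<xi> i * g0 (t i))" for g \<xi>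
  unfolding sum.distrib[symmetric] using t by (intro sum.cong refl) (simp add: excess_def on_support_def algebra_simps)
 have "cube_avg n (\<lambda>\<xi>. SUP g\<in>G. \<Sum>i<n. \<xi> i * g (t i)) = cube_avg n (\<lambda>\<xi>. (SUP k. \<Sum>i<n. \<xi> i * u k (t i)) + (\<Sum>i<n. \<xi> i * g0 (t i)))"
 proof (rule cube_avg_cong, rule antisym)
  fix \<xi> assume \<xi>: "\<xi> \<in> sign_cube n"
  have bd: "bdd_above (range (\<lambda>k. \<Sum>i<n. \<xi> i * u k (t i)))" by (rule bdd_above_rangeI) (rule signed_sum_bound[OF \<xi>])
  have up: "(\<Sum>i<n. \<xi> i * g (t i)) <= (SUP k. \<Sum>i<n. \<xi> i * u k (t i)) + (\<Sum>i<n. \<xi> i * g0 (t i))" if g: "g \<in> G" for g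
  proof -
   obtain s where s: "\<And>t. (\<lambda>m. u (s m) t) \<longlonglongrightarrow> excess g t" using u_dense[OF g] by blast
   have "(\<lambda>m. \<Sum>i<n. \<xi> i * u (s m) (t i)) \<longlonglongrightarrow> (\<Sum>i<n. \<xi> i * excess g (t i))" by (intro tendsto_intros s)
   then have "(\<Sum>i<n. \<xi> i * excess g (t i)) <= (SUP k. \<Sum>i<n. \<xi> i * u k (t i))"
    by (rule LIMSEQ_le_const2) (auto intro!: cSUP_upper bd)
   then show ?thesis unfolding ex[of \<xi> g] by simp
  qed
  show "(SUP g\<in>G. \<Sum>i<n. \<xi> i * g (t i)) <= (SUP k. \<Sum>i<n. \<xi> i * u k (t i)) + (\<Sum>i<n. \<xi> i * g0 (t i))"
   by (rule cSUP_least) (use g0 up in auto)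
  have "bdd_above ((\<lambda>g. \<Sum>i<n. \<xi> i * g (t i)) ` G)" using up by (auto simp: bdd_above_def)
  then have "(\<Sum>i<n. \<xi> i * u k (t i)) + (\<Sum>i<n. \<xi> i * g0 (t i)) <= (SUP g\<in>G. \<Sum>i<n. \<xi> i * g (t i))" for k
   unfolding u_def ex[symmetric] by (intro cSUP_upper countable_class(1))
  then have "(\<Sum>i<n. \<xi> i * u k (t i)) <= (SUP g\<in>G. \<Sum>i<n. \<xi> i * g (t i)) - (\<Sum>i<n. \<xi> i * g0 (t i))" for k
   by (simp add: le_diff_eq)
  then have "(SUP k. \<Sum>i<n. \<xi> i * u k (t i)) <= (SUP g\<in>G. \<Sum>i<n. \<xi> i * g (t i)) - (\<Sum>i<n. \<xi> i * g0 (t i))"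
   by (intro cSUP_least) auto
  then show "(SUP k. \<Sum>i<n. \<xi> i * u k (t i)) + (\<Sum>i<n. \<xi> i * g0 (t i)) <= (SUP g\<in>G. \<Sum>i<n. \<xi> i * g (t i))" by simp
 qed
 also have "\<dots> = cube_avg n (\<lambda>\<xi>. SUP k. \<Sum>i<n. \<xi> i * u k (t i))"
  unfolding cube_avg_add cube_avg_coordinate by simp
 finally show ?thesis unfolding rademacher_complexity_cube rademacher_avg_def by simp
qed

lemma rademacher_u_vanishes: "AE \<omega> in M. (\<lambda>n. rademacher_avg u n (\<lambda>i. Ts i \<omega>)) \<longlonglongrightarrow> 0"
 using rademacher AE_Ts_D
proof eventually_elim
 case (elim \<omega>)
 have "rademacher_complexity n G (\<lambda>i. Ts i \<omega>) = 2 * rademacher_avg u n (\<lambda>i. Ts i \<omega>)" for n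
  using elim(2) by (intro rademacher_u) auto
 then have "(\<lambda>n. 2 * rademacher_avg u n (\<lambda>i. Ts i \<omega>)) \<longlonglongrightarrow> 0" using elim(1) by simp
 from tendsto_mult_left[OF this, of "1 / 2"] show ?case by simp
qed

text \<open>Outcome and regression function are both clipped, so that the noise is bounded at every
  point; almost surely it is Y - \<tau>(T, X).\<close>

definition noise :: "'a \<times> 'b \<times> real => real" where
 "noise s = max (- C) (min C (snd (snd s))) - \<tau>c (fst s, fst (snd s))"

lemma noise_measurable [measurable]: "noise \<in> borel_measurable borel"
proof -
 note [measurable] = borel_projections(4)
 have "(\<lambda>s :: 'a \<times> 'b \<times> real. \<tau>c (fst s, fst (snd s))) \<in> borel_measurable borel"
  by (rule measurable_compose[OF borel_projections(1) \<tau>c_measurable])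
 then show ?thesis unfolding noise_def[abs_def] by measurable
qed

lemma noise_bounded: "\<bar>noise s\<bar> <= 2 * C + 1"
proof -
 have "\<bar>max (- C) (min C (snd (snd s)))\<bar> <= C" using C_nonneg by auto
 with \<tau>c_bounds[of "(fst s, fst (snd s))"] C_nonneg show ?thesis unfolding noise_def by arith
qed

text \<open>The defining property of \<tau> as conditional mean, once the clipping is removed on a
  set of full measure.\<close>

lemma noise_centred:
 assumes h [measurable]: "h \<in> borel_measurable borel" and K: "\<And>z. \<bar>h z\<bar> <= K"
 shows "(\<integral>s. h (fst s, fst (snd s)) * noise s \<partial>L) = 0"
proof -
 have hm: "(\<lambda>s :: 'a \<times> 'b \<times> real. h (fst s, fst (snd s))) \<in> borel_measurable borel"
  by (rule measurable_compose[OF borel_projections(1) h])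
 have m: "(\<lambda>\<omega>. (T \<omega>, X \<omega>, Y \<omega>)) \<in> borel_measurable M"
  by (intro borel_measurable_Pair T_measurable X_measurable Y_measurable)
 have "(\<integral>s. h (fst s, fst (snd s)) * noise s \<partial>L) = (\<integral>\<omega>. h (TX \<omega>) * noise (T \<omega>, X \<omega>, Y \<omega>) \<partial>M)"
  unfolding L_def by (subst integral_distr[OF m]) (use hm in auto)
 also have "\<dots> = (\<integral>\<omega>. h (TX \<omega>) * Y \<omega> - h (TX \<omega>) * \<tau> (TX \<omega>) \<partial>M)"
 proof (rule integral_cong_AE)
  show "AE \<omega> in M. h (TX \<omega>) * noise (T \<omega>, X \<omega>, Y \<omega>) = h (TX \<omega>) * Y \<omega> - h (TX \<omega>) * \<tau> (TX \<omega>)"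
   using Y_bounded regression_bounded[OF \<tau>_measurable regression Y_bounded]
  proof eventually_elim
   case (elim \<omega>)
   have "max (- C) (min C (Y \<omega>)) = Y \<omega>" "\<tau>c (TX \<omega>) = \<tau> (TX \<omega>)" using elim unfolding \<tau>c_def by auto
   then show ?case unfolding noise_def by (simp add: algebra_simps)
  qed
  show "(\<lambda>\<omega>. h (TX \<omega>) * noise (T \<omega>, X \<omega>, Y \<omega>)) \<in> borel_measurable M"
   by (intro borel_measurable_times measurable_compose[OF TX_measurable h] measurable_compose[OF m noise_measurable])
 qed measurable
 also have "\<dots> = (\<integral>\<omega>. h (TX \<omega>) * Y \<omega> \<partial>M) - (\<integral>\<omega>. h (TX \<omega>) * \<tau> (TX \<omega>) \<partial>M)"
 proof (rule Bochner_Integration.integral_diff)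
  have hb: "\<bar>h (TX \<omega>) * y\<bar> <= \<bar>K\<bar> * C" if "\<bar>y\<bar> <= C" for \<omega> y
   unfolding abs_mult using that K[of "(TX \<omega>)"] C_nonneg by (intro mult_mono) auto
  show "integrable M (\<lambda>\<omega>. h (TX \<omega>) * Y \<omega>)"
  proof (rule integrable_const_bound[where B = "\<bar>K\<bar> * C"])
   show "AE \<omega> in M. norm (h (TX \<omega>) * Y \<omega>) <= \<bar>K\<bar> * C"
    using Y_bounded by eventually_elim (simp only: real_norm_def hb)
  qed measurable
  show "integrable M (\<lambda>\<omega>. h (TX \<omega>) * \<tau> (TX \<omega>))"
  proof (rule integrable_const_bound[where B = "\<bar>K\<bar> * C"])
   show "AE \<omega> in M. norm (h (TX \<omega>) * \<tau> (TX \<omega>)) <= \<bar>K\<bar> * C"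
    using regression_bounded[OF \<tau>_measurable regression Y_bounded] by eventually_elim (simp only: real_norm_def hb)
  qed measurable
 qed
 also have "\<dots> = 0" using regression_integral[OF \<tau>_measurable regression Y_bounded h K] by simp
 finally show ?thesis .
qed

text \<open>The tail bound is one-sided; the cases \<sigma> = 1 and \<sigma> = -1 together bound the
  modulus.\<close>

lemma noise_model_signed:
 assumes \<sigma>: "\<bar>\<sigma>\<bar> = 1"
 shows "noise_model (\<lambda>k z. u k (fst z)) borel (B + 1) L (\<lambda>s. (fst s, fst (snd s))) (\<lambda>s. \<sigma> * noise s) (2 * C + 1)"
proof -
 interpret U: bounded_functions u borel "B + 1" by (rule u_bounded_functions)
 show ?thesis
 proof
  show "(\<lambda>z :: 'a \<times> 'b. u k (fst z)) \<in> borel_measurable borel" for k by (rule fst_measurable[OF U.u_measurable])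
  show "\<bar>u k (fst z)\<bar> <= B + 1" for k and z :: "'a \<times> 'b" by (rule U.u_bounded)
  show "(\<lambda>s. (fst s, fst (snd s))) \<in> measurable L borel" unfolding S.measurable_L by (rule borel_projections(1))
  show "(\<lambda>s. \<sigma> * noise s) \<in> borel_measurable L" unfolding S.measurable_L by measurable
  show "\<bar>\<sigma> * noise s\<bar> <= 2 * C + 1" for s using noise_bounded[of s] \<sigma> by (simp add: abs_mult)
  show "0 < 2 * C + 1" "0 < B + 1" using C_nonneg B_nonneg by auto
  fix h :: "'a \<times> 'b => real" and K assume h: "h \<in> borel_measurable borel" and K: "\<And>x. \<bar>h x\<bar> <= K"
  have "(\<integral>s. h (fst s, fst (snd s)) * (\<sigma> * noise s) \<partial>L) = (\<integral>s. \<sigma> * (h (fst s, fst (snd s)) * noise s) \<partial>L)"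
   by (simp only: mult_ac)
  then show "(\<integral>s. h (fst s, fst (snd s)) * (\<sigma> * noise s) \<partial>L) = 0"
   using noise_centred[OF h K] by simp
 qed
qed

text \<open>Each weight is measurable in treatments and covariates, so n times the weight factors
  through a Borel function of these: this is the coefficient that
  \<open>weighted_noise_vanishes\<close> takes.\<close>

lemma noise_vanishes_countable:
 assumes \<sigma>: "\<bar>\<sigma>\<bar> = 1"
 shows "AE \<omega> in M. \<forall>\<delta>>0. \<forall>\<^sub>F n in sequentially. \<forall>k.
  (\<Sum>i<n. w n \<omega> i * (\<sigma> * noise (obs i \<omega>)) * u k (Ts i \<omega>)) <= \<delta>"
proof -
 \<comment> \<open>Clipping to [0, W] bounds the factorised weight at every point; for feasible
   weights it does nothing.\<close>
 define cw where "cw n i \<omega> = max 0 (min W (real n * w n \<omega> i))" for n i \<omega>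
 define V where "V n \<omega> = (\<lambda>j\<in>{..<n}. (Ts j \<omega>, Xs j \<omega>))" for n :: nat and \<omega>
 define \<phi> where "\<phi> n i a \<longleftrightarrow> i < n \<longrightarrow> a \<in> borel_measurable (Pi\<^sub>M {..<n} (\<lambda>_. borel)) \<and>
  (\<forall>\<omega>\<in>space M. a (V n \<omega>) = cw n i \<omega>) \<and> (\<forall>v. \<bar>a v\<bar> <= W)" for n i and a :: "(nat => 'a \<times> 'b) => real"
 have "\<exists>a. \<phi> n i a" for n i
 proof (cases "i < n")
  case True
  have m: "cw n i \<in> borel_measurable (vimage_algebra (space M) (V n) (Pi\<^sub>M {..<n} (\<lambda>_. borel)))"
   using w_measurable[OF True] unfolding cw_def[abs_def] gen_subalgebra_def V_def[abs_def]
   by (intro borel_measurable_max borel_measurable_min borel_measurable_times borel_measurable_const)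
  have V: "V n \<in> space M \<rightarrow> space (Pi\<^sub>M {..<n} (\<lambda>_. borel))" unfolding V_def by (auto simp: space_PiM)
  have b: "\<bar>cw n i \<omega>\<bar> <= W" for \<omega> unfolding cw_def using W_pos by auto
  obtain a where "a \<in> borel_measurable (Pi\<^sub>M {..<n} (\<lambda>_. borel))" "\<And>\<omega>. \<omega> \<in> space M ==> a (V n \<omega>) = cw n i \<omega>" "\<And>v. \<bar>a v\<bar> <= \<bar>W\<bar>"
   using vimage_algebra_factorization[OF m V b] by blast
  then show ?thesis unfolding \<phi>_def using W_pos by auto
 qed (simp add: \<phi>_def)
 then obtain a where "\<And>n i. \<phi> n i (a n i)" by metis
 then have a: "\<And>n i. i < n ==> a n i \<in> borel_measurable (Pi\<^sub>M {..<n} (\<lambda>_. borel))"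
  "\<And>n i \<omega>. i < n ==> \<omega> \<in> space M ==> a n i (V n \<omega>) = cw n i \<omega>" "\<And>n i v. i < n ==> \<bar>a n i v\<bar> <= W"
  unfolding \<phi>_def by blast+
 define a' where "a' n i v = (if i < n then a n i v else 0)" for n i v
 have "AE \<omega> in M. \<forall>\<delta>>0. \<forall>\<^sub>F n in sequentially. \<forall>k.
  (\<Sum>i<n. a' n i (\<lambda>i\<in>{..<n}. (fst (obs i \<omega>), fst (snd (obs i \<omega>)))) *
    (\<sigma> * noise (obs i \<omega>)) * u k (fst (fst (obs i \<omega>), fst (snd (obs i \<omega>))))) <= \<delta> * real n"
 proof (rule S.weighted_noise_vanishes[OF noise_model_signed[OF \<sigma>]])
  show "a' n i \<in> borel_measurable (Pi\<^sub>M {..<n} (\<lambda>_. borel))" if "i < n" for n i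
   using a(1)[OF that] that unfolding a'_def[abs_def] by simp
  show "\<bar>a' n i v\<bar> <= W" for n i v unfolding a'_def using a(3)[of i n v] W_pos by simp
  show "AE \<omega> in M. (\<lambda>n. rademacher_avg (\<lambda>k z. u k (fst z)) n (\<lambda>i. (fst (obs i \<omega>), fst (snd (obs i \<omega>))))) \<longlonglongrightarrow> 0"
   using rademacher_u_vanishes unfolding rademacher_avg_def by simp
 qed (rule W_pos)
 then show ?thesis using AE_feasible AE_space
 proof eventually_elim
  case (elim \<omega>)
  show ?case
  proof (intro allI impI)
   fix \<delta> :: real assume \<delta>: "\<delta> > 0"
   from elim(1)[THEN spec, THEN mp, OF \<delta>] eventually_ge_at_top[of "1 :: nat"]
   show "\<forall>\<^sub>F n in sequentially. \<forall>k. (\<Sum>i<n. w n \<omega> i * (\<sigma> * noise (obs i \<omega>)) * u k (Ts i \<omega>)) <= \<delta>"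
   proof eventually_elim
    case (elim n)
    have eq: "a' n i (\<lambda>i\<in>{..<n}. (fst (obs i \<omega>), fst (snd (obs i \<omega>)))) = real n * w n \<omega> i" if "i < n" for i
    proof -
     have "feasible_weights n W (w n \<omega>)" using \<open>\<forall>n\<ge>1. feasible_weights n W (w n \<omega>)\<close> elim(2) by blast
     from feasible_scaled[OF this that] have "cw n i \<omega> = real n * w n \<omega> i" unfolding cw_def by auto
     then show ?thesis unfolding a'_def using that a(2)[OF that \<open>\<omega> \<in> space M\<close>] unfolding V_def by simp
    qed
    show ?case
    proof
     fix k
     have "(\<Sum>i<n. (real n * w n \<omega> i) * (\<sigma> * noise (obs i \<omega>)) * u k (Ts i \<omega>)) <= \<delta> * real n"
      using elim(1)[THEN spec, of k] eq by simp
     then have "real n * (\<Sum>i<n. w n \<omega> i * (\<sigma> * noise (obs i \<omega>)) * u k (Ts i \<omega>)) <= real n * \<delta>"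
      by (simp only: sum_distrib_left mult_ac)
     then show "(\<Sum>i<n. w n \<omega> i * (\<sigma> * noise (obs i \<omega>)) * u k (Ts i \<omega>)) <= \<delta>"
      using elim(2) by simp
    qed
   qed
  qed
 qed
qed

text \<open>For fixed n the sum is finite, so the bound passes from the countable class to its
  pointwise limits.\<close>

lemma noise_vanishes:
 "AE \<omega> in M. \<forall>\<delta>>0. \<forall>\<^sub>F n in sequentially. \<forall>g\<in>G.
  \<bar>\<Sum>i<n. w n \<omega> i * noise (obs i \<omega>) * excess g (Ts i \<omega>)\<bar> <= \<delta>"
 using noise_vanishes_countable[of 1, simplified] noise_vanishes_countable[of "-1", simplified]
proof eventually_elim
 case (elim \<omega>)
 show ?case
 proof (intro allI impI)
  fix \<delta> :: real assume \<delta>: "\<delta> > 0"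
  from elim(1)[THEN spec, THEN mp, OF \<delta>] elim(2)[THEN spec, THEN mp, OF \<delta>]
  show "\<forall>\<^sub>F n in sequentially. \<forall>g\<in>G. \<bar>\<Sum>i<n. w n \<omega> i * noise (obs i \<omega>) * excess g (Ts i \<omega>)\<bar> <= \<delta>"
  proof eventually_elim
   case (elim n)
   show ?case
   proof
    fix g assume "g \<in> G"
    then obtain s where s: "\<And>t. (\<lambda>m. u (s m) t) \<longlonglongrightarrow> excess g t" using u_dense by blast
    define e where "e i = noise (obs i \<omega>)" for i
    have lim: "(\<lambda>m. \<Sum>i<n. w n \<omega> i * e i * u (s m) (Ts i \<omega>)) \<longlonglongrightarrow> (\<Sum>i<n. w n \<omega> i * e i * excess g (Ts i \<omega>))"
     by (intro tendsto_intros s)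
    have "(\<Sum>i<n. w n \<omega> i * e i * u k (Ts i \<omega>)) <= \<delta>" "- (\<Sum>i<n. w n \<omega> i * e i * u k (Ts i \<omega>)) <= \<delta>" for k
     using elim(1)[THEN spec, of k] elim(2)[THEN spec, of k] unfolding e_def by (simp_all add: sum_negf)
    then have "\<bar>\<Sum>i<n. w n \<omega> i * e i * u k (Ts i \<omega>)\<bar> <= \<delta>" for k by (simp add: abs_le_iff)
    then have "\<bar>\<Sum>i<n. w n \<omega> i * e i * excess g (Ts i \<omega>)\<bar> <= \<delta>"
     by (intro LIMSEQ_le_const2[OF tendsto_rabs[OF lim]]) auto
    then show "\<bar>\<Sum>i<n. w n \<omega> i * noise (obs i \<omega>) * excess g (Ts i \<omega>)\<bar> <= \<delta>" unfolding e_def .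
   qed
  qed
 qed
qed

section \<open>Risks and their differences\<close>

definition mean_outcome :: "'a => real" where "mean_outcome t = (\<integral>x. \<tau>c (t, x) \<partial>PX)"

lemma measurable_PT: "measurable PT K = measurable borel K" by (rule measurable_cong_sets) simp_all
lemma measurable_Q: "measurable Q K = measurable borel K" by (rule measurable_cong_sets) simp_all

lemma g0_measurable [measurable]: "on_support g0 \<in> borel_measurable borel" by (rule on_support_measurable[OF g0])

lemma mean_outcome_measurable [measurable]: "mean_outcome \<in> borel_measurable borel"
proof -
 have "(\<lambda>(t, x). \<tau>c (t, x)) \<in> borel_measurable (PT \<Otimes>\<^sub>M PX)"
  unfolding Q_def[symmetric] measurable_Q by simp
 then have "(\<lambda>t. \<integral>x. \<tau>c (t, x) \<partial>PX) \<in> borel_measurable PT" by (rule PX.borel_measurable_lebesgue_integral)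
 then show ?thesis unfolding mean_outcome_def[abs_def] measurable_PT .
qed

lemma mean_outcome_bounded: "\<bar>mean_outcome t\<bar> <= C"
proof -
 have q: "\<tau>c \<in> borel_measurable (PT \<Otimes>\<^sub>M PX)"
  using \<tau>c_measurable by (simp only: Q_def[symmetric] measurable_Q)
 have "Pair t \<in> measurable PX (PT \<Otimes>\<^sub>M PX)" by (rule measurable_Pair1') simp
 then have "(\<lambda>x. \<tau>c (t, x)) \<in> borel_measurable PX" by (rule measurable_compose[OF _ q])
 then show ?thesis unfolding mean_outcome_def by (rule PX.abs_integral_le[OF _ \<tau>c_bounds])
qed

text \<open>The causal input: \<open>dose_response_identified\<close> replaces the dose-response
  function by an average of the regression function, and from here on the risk speaks of observable
  quantities.\<close>

lemma dose_risk_mean_outcome: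
 "dose_risk PT (\<lambda>t. \<integral>\<omega>. Ypot t \<omega> \<partial>M) g = (\<integral>\<^sup>+t. ennreal ((mean_outcome t - on_support g t)\<^sup>2) \<partial>PT)"
 unfolding dose_risk_def
proof (rule nn_integral_cong_AE)
 show "AE t in PT. ennreal (((\<integral>\<omega>. Ypot t \<omega> \<partial>M) - g t)\<^sup>2) = ennreal ((mean_outcome t - on_support g t)\<^sup>2)"
  using dose_response_identified[OF \<tau>_measurable regression Y_bounded C_nonneg] AE_measure_support[OF sets_PT]
 proof eventually_elim
  case (elim t)
  then show ?case unfolding mean_outcome_def \<tau>c_def on_support_def by simp
 qed
qed

text \<open>By the parallelogram identity \<open>g0\<close> is square integrable as soon as its
  distance to the bounded function \<open>mean_outcome\<close> is.\<close>

lemma finite_risk_square_integrable: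
 assumes "dose_risk PT (\<lambda>t. \<integral>\<omega>. Ypot t \<omega> \<partial>M) g0 < \<infinity>"
 shows "integrable PT (\<lambda>t. (on_support g0 t)\<^sup>2)"
proof (rule integrableI_bounded)
 show "(\<lambda>t. (on_support g0 t)\<^sup>2) \<in> borel_measurable PT" unfolding measurable_PT by measurable
 have le: "(on_support g0 t)\<^sup>2 <= 2 * (mean_outcome t - on_support g0 t)\<^sup>2 + 2 * C\<^sup>2" for t
 proof -
  have "(mean_outcome t)\<^sup>2 <= C\<^sup>2" using power_mono[OF mean_outcome_bounded[of t], of 2] by simp
  moreover have "(on_support g0 t)\<^sup>2 + (2 * mean_outcome t - on_support g0 t)\<^sup>2 = 2 * (mean_outcome t - on_support g0 t)\<^sup>2 + 2 * (mean_outcome t)\<^sup>2"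
   by (simp add: power2_eq_square algebra_simps)
  ultimately show ?thesis using zero_le_power2[of "2 * mean_outcome t - on_support g0 t"] by linarith
 qed
 have "(\<integral>\<^sup>+t. ennreal (norm ((on_support g0 t)\<^sup>2)) \<partial>PT)
  <= (\<integral>\<^sup>+t. 2 * ennreal ((mean_outcome t - on_support g0 t)\<^sup>2) + ennreal (2 * C\<^sup>2) \<partial>PT)"
 proof (rule nn_integral_mono)
  fix t
  have "ennreal (norm ((on_support g0 t)\<^sup>2)) <= ennreal (2 * (mean_outcome t - on_support g0 t)\<^sup>2 + 2 * C\<^sup>2)"
   using le[of t] by (intro ennreal_leI) simp
  also have "\<dots> = 2 * ennreal ((mean_outcome t - on_support g0 t)\<^sup>2) + ennreal (2 * C\<^sup>2)"
   by (subst ennreal_plus) (simp_all add: ennreal_mult)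
  finally show "ennreal (norm ((on_support g0 t)\<^sup>2)) <= 2 * ennreal ((mean_outcome t - on_support g0 t)\<^sup>2) + ennreal (2 * C\<^sup>2)" .
 qed
 also have "\<dots> = 2 * dose_risk PT (\<lambda>t. \<integral>\<omega>. Ypot t \<omega> \<partial>M) g0 + ennreal (2 * C\<^sup>2)"
 proof -
  have m: "(\<lambda>t. ennreal ((mean_outcome t - on_support g0 t)\<^sup>2)) \<in> borel_measurable PT" unfolding measurable_PT by measurable
  then have "(\<lambda>t. 2 * ennreal ((mean_outcome t - on_support g0 t)\<^sup>2)) \<in> borel_measurable PT" by (intro borel_measurable_times_ennreal borel_measurable_const)
  then show ?thesis
   unfolding dose_risk_mean_outcome by (simp add: nn_integral_add nn_integral_cmult[OF m] PT.emeasure_space_1[simplified])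
 qed
 also have "\<dots> < \<infinity>" using assms by (simp add: ennreal_mult_less_top)
 finally show "(\<integral>\<^sup>+t. ennreal (norm ((on_support g0 t)\<^sup>2)) \<partial>PT) < \<infinity>" .
qed

end

locale finite_risk_regression = weighted_regression M T X Ypot Y P Q PT PX W\<^sub>0 Ts Xs Ys Z W \<rho> F lam w \<tau> G B C ghat g0
 for M :: "'w measure" and T :: "'w => 'a::euclidean_space" and X :: "'w => 'b::euclidean_space"
  and Ypot Y P Q PT PX W\<^sub>0 Ts Xs Ys Z W \<rho> F lam w \<tau> G B C ghat g0 +
 assumes g0_square_integrable: "integrable PT (\<lambda>t. (on_support g0 t)\<^sup>2)"
begin

definition risk :: "('a => real) => real" where "risk g = (\<integral>t. (mean_outcome t - on_support g t)\<^sup>2 \<partial>PT)"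

lemma g0_integrable: "integrable PT (on_support g0)"
proof -
 have "on_support g0 \<in> borel_measurable PT" by (simp only: measurable_PT g0_measurable)
 then show ?thesis by (rule PT.square_integrable_imp_integrable[OF _ g0_square_integrable])
qed

lemma excess_integrable: "g \<in> G ==> integrable PT (\<lambda>t. (excess g t)\<^sup>2)"
proof (rule PT.integrable_bounded[where c = "B\<^sup>2"])
 assume g: "g \<in> G"
 show "(\<lambda>t. (excess g t)\<^sup>2) \<in> borel_measurable PT" unfolding measurable_PT using excess_measurable[OF g] by measurable
 show "\<bar>(excess g t)\<^sup>2\<bar> <= B\<^sup>2" for t using power_mono[OF excess_bounded[OF g, of t], of 2] by simp
qed

lemma cross_integrable:
 assumes g: "g \<in> G" shows "integrable PT (\<lambda>t. (on_support g0 t - mean_outcome t) * excess g t)"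
proof (rule Bochner_Integration.integrable_bound[where f = "\<lambda>t. B * (\<bar>on_support g0 t\<bar> + C)"])
 show "integrable PT (\<lambda>t. B * (\<bar>on_support g0 t\<bar> + C))"
  by (intro integrable_mult_right Bochner_Integration.integrable_add integrable_abs g0_integrable) simp
 show "(\<lambda>t. (on_support g0 t - mean_outcome t) * excess g t) \<in> borel_measurable PT"
  unfolding measurable_PT using excess_measurable[OF g] by measurable
 have "\<bar>on_support g0 t - mean_outcome t\<bar> * \<bar>excess g t\<bar> <= (\<bar>on_support g0 t\<bar> + C) * B" for t
  using excess_bounded[OF g, of t] mean_outcome_bounded[of t] C_nonneg by (intro mult_mono) auto
 then show "AE t in PT. norm ((on_support g0 t - mean_outcome t) * excess g t) <= norm (B * (\<bar>on_support g0 t\<bar> + C))"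
  using B_nonneg C_nonneg by (simp add: abs_mult mult.commute)
qed

lemma base_integrable: "integrable PT (\<lambda>t. (mean_outcome t - on_support g0 t)\<^sup>2)"
proof (rule Bochner_Integration.integrable_bound[where f = "\<lambda>t. 2 * C\<^sup>2 + 2 * (on_support g0 t)\<^sup>2"])
 show "integrable PT (\<lambda>t. 2 * C\<^sup>2 + 2 * (on_support g0 t)\<^sup>2)"
  by (intro Bochner_Integration.integrable_add integrable_mult_right g0_square_integrable) simp
 have "(mean_outcome t - on_support g0 t)\<^sup>2 <= 2 * C\<^sup>2 + 2 * (on_support g0 t)\<^sup>2" for t
 proof -
  have "(mean_outcome t)\<^sup>2 <= C\<^sup>2" using power_mono[OF mean_outcome_bounded[of t], of 2] by simp
  moreover have "(mean_outcome t - on_support g0 t)\<^sup>2 + (mean_outcome t + on_support g0 t)\<^sup>2 = 2 * (mean_outcome t)\<^sup>2 + 2 * (on_support g0 t)\<^sup>2"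
   by (simp add: power2_eq_square algebra_simps)
  ultimately show ?thesis using zero_le_power2[of "mean_outcome t + on_support g0 t"] by linarith
 qed
 then show "AE t in PT. norm ((mean_outcome t - on_support g0 t)\<^sup>2) <= norm (2 * C\<^sup>2 + 2 * (on_support g0 t)\<^sup>2)" by simp
qed (unfold measurable_PT, measurable)

lemma risk_split: "(mean_outcome t - on_support g t)\<^sup>2 = (mean_outcome t - on_support g0 t)\<^sup>2 +
  ((excess g t)\<^sup>2 + 2 * ((on_support g0 t - mean_outcome t) * excess g t))"
 unfolding excess_def by (simp add: power2_eq_square algebra_simps)

lemma risk_integrable: "g \<in> G ==> integrable PT (\<lambda>t. (mean_outcome t - on_support g t)\<^sup>2)"
 unfolding risk_split[of _ g] by (intro Bochner_Integration.integrable_add integrable_mult_right base_integrable excess_integrable cross_integrable)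

lemma excess_loss_split:
 "excess_loss g z = (excess g (fst z))\<^sup>2 + 2 * (on_support g0 (fst z) * excess g (fst z)) - 2 * (\<tau>c z * excess g (fst z))"
 unfolding excess_loss_def by (simp add: algebra_simps)

lemma integrable_fst_Q:
 fixes f :: "'a => real"
 assumes "integrable PT f" shows "integrable Q (\<lambda>z. f (fst z))"
proof -
 have "distr Q PT fst = PT" unfolding Q_def by (rule PX.distr_pair_fst)
 then show ?thesis using assms integrable_distr[of fst Q PT f] unfolding Q_def by simp
qed

lemma integral_fst_Q:
 fixes f :: "'a => real"
 assumes "f \<in> borel_measurable borel" shows "(\<integral>z. f (fst z) \<partial>Q) = (\<integral>t. f t \<partial>PT)"
proof -
 have "distr Q PT fst = PT" unfolding Q_def by (rule PX.distr_pair_fst)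
 then show ?thesis using assms integral_distr[of fst Q PT f] unfolding Q_def by (simp add: measurable_PT)
qed

text \<open>Under the product Q the covariates can be integrated first, which turns \<tau>(t, x)
  into the mean outcome at t.\<close>

lemma regression_excess:
 assumes g: "g \<in> G"
 shows "integrable Q (\<lambda>z. \<tau>c z * excess g (fst z))"
  and "(\<integral>z. \<tau>c z * excess g (fst z) \<partial>Q) = (\<integral>t. mean_outcome t * excess g t \<partial>PT)"
proof -
 have em: "(\<lambda>z :: 'a \<times> 'b. excess g (fst z)) \<in> borel_measurable borel" by (rule fst_measurable[OF excess_measurable[OF g]])
 show i: "integrable Q (\<lambda>z. \<tau>c z * excess g (fst z))"
 proof (rule Q.integrable_bounded[where c = "C * B"])
  show "(\<lambda>z. \<tau>c z * excess g (fst z)) \<in> borel_measurable Q" unfolding measurable_Q using em by measurable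
  show "\<bar>\<tau>c z * excess g (fst z)\<bar> <= C * B" for z
   unfolding abs_mult using \<tau>c_bounds[of z] excess_bounded[OF g, of "fst z"] C_nonneg by (intro mult_mono) auto
 qed
 have "(\<integral>z. \<tau>c z * excess g (fst z) \<partial>Q) = (\<integral>t. (\<integral>x. \<tau>c (t, x) * excess g (fst (t, x)) \<partial>PX) \<partial>PT)"
  using PTX.integral_fst'[of "\<lambda>z. \<tau>c z * excess g (fst z)"] i unfolding Q_def by simp
 then show "(\<integral>z. \<tau>c z * excess g (fst z) \<partial>Q) = (\<integral>t. mean_outcome t * excess g t \<partial>PT)"
  unfolding mean_outcome_def by simp
qed

text \<open>Q has treatment marginal P_T, and \<tau> is multiplied by functions of t only, so it may
  be replaced by its covariate mean; \<open>risk_split\<close> then recognises the two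
  squares.\<close>

lemma excess_loss_integral:
 assumes g: "g \<in> G"
 shows "integrable Q (excess_loss g)" and "(\<integral>z. excess_loss g z \<partial>Q) = risk g - risk g0"
proof -
 note [measurable] = excess_measurable[OF g]
 have ig: "integrable PT (\<lambda>t. on_support g0 t * excess g t)"
 proof -
  have "integrable PT (\<lambda>t. mean_outcome t * excess g t)"
  proof (rule PT.integrable_bounded[where c = "C * B"])
   show "\<bar>mean_outcome t * excess g t\<bar> <= C * B" for t
    unfolding abs_mult using mean_outcome_bounded[of t] excess_bounded[OF g, of t] C_nonneg by (intro mult_mono) auto
  qed (unfold measurable_PT, measurable)
  from Bochner_Integration.integrable_add[OF cross_integrable[OF g] this] show ?thesis by (simp add: algebra_simps)
 qed
 have im: "integrable PT (\<lambda>t. mean_outcome t * excess g t)"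
  using Bochner_Integration.integrable_diff[OF ig cross_integrable[OF g]] by (simp add: algebra_simps)
 note i1 = integrable_fst_Q[OF excess_integrable[OF g]] and i2 = integrable_fst_Q[OF ig] and i3 = regression_excess(1)[OF g]
 show "integrable Q (excess_loss g)"
  unfolding excess_loss_split[abs_def]
  by (intro Bochner_Integration.integrable_diff Bochner_Integration.integrable_add integrable_mult_right i1 i2 i3)
 have "(\<integral>z. excess_loss g z \<partial>Q) = (\<integral>z. (excess g (fst z))\<^sup>2 \<partial>Q) + 2 * (\<integral>z. on_support g0 (fst z) * excess g (fst z) \<partial>Q)
   - 2 * (\<integral>z. \<tau>c z * excess g (fst z) \<partial>Q)"
  unfolding excess_loss_split using i1 i2 i3 by simp
 also have "\<dots> = (\<integral>t. (excess g t)\<^sup>2 \<partial>PT) + 2 * (\<integral>t. on_support g0 t * excess g t \<partial>PT) - 2 * (\<integral>t. mean_outcome t * excess g t \<partial>PT)"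
  unfolding regression_excess(2)[OF g]
  by (subst integral_fst_Q[of "\<lambda>t. (excess g t)\<^sup>2"], measurable, subst integral_fst_Q[of "\<lambda>t. on_support g0 t * excess g t"], measurable)
 also have "\<dots> = (\<integral>t. (excess g t)\<^sup>2 + 2 * (on_support g0 t * excess g t) - 2 * (mean_outcome t * excess g t) \<partial>PT)"
  using excess_integrable[OF g] ig im by simp
 also have "\<dots> = (\<integral>t. (mean_outcome t - on_support g t)\<^sup>2 - (mean_outcome t - on_support g0 t)\<^sup>2 \<partial>PT)"
  unfolding risk_split[of _ g] by (simp add: algebra_simps)
 also have "\<dots> = risk g - risk g0"
  unfolding risk_def by (rule Bochner_Integration.integral_diff[OF risk_integrable[OF g] base_integrable])
 finally show "(\<integral>z. excess_loss g z \<partial>Q) = risk g - risk g0" .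
qed

lemma dose_risk_eq:
 "g \<in> G ==> dose_risk PT (\<lambda>t. \<integral>\<omega>. Ypot t \<omega> \<partial>M) g = ennreal (risk g)"
 unfolding dose_risk_mean_outcome risk_def by (rule nn_integral_eq_integral[OF risk_integrable]) simp_all

text \<open>Uniform control of the excess loss and of the noise makes differences of the empirical
  objective uniformly close to differences of risks; comparing the empirical minimiser with every g
  gives its risk up to \<epsilon>.\<close>

theorem erm_consistent:
 assumes key: "AE \<omega> in M. \<forall>\<epsilon>>0. \<forall>\<^sub>F n in sequentially. \<forall>g\<in>G.
  \<bar>(\<Sum>i<n. w n \<omega> i * excess_loss g (zs \<omega> i)) - (\<integral>z. excess_loss g z \<partial>Q)\<bar> <= \<epsilon>"
 shows "AE \<omega> in M. (\<lambda>n. dose_risk PT (\<lambda>t. \<integral>\<omega>. Ypot t \<omega> \<partial>M) (ghat n \<omega>)) \<longlonglongrightarrow> (INF g\<in>G. dose_risk PT (\<lambda>t. \<integral>\<omega>. Ypot t \<omega> \<partial>M) g)"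
proof -
 have Yb: "AE \<omega> in M. \<forall>i. \<bar>Ys i \<omega>\<bar> <= C"
  unfolding AE_all_countable
 proof
  fix i
  have m: "(\<lambda>\<omega>. (T \<omega>, X \<omega>, Y \<omega>)) \<in> borel_measurable M"
   by (intro borel_measurable_Pair T_measurable X_measurable Y_measurable)
  have "{s :: 'a \<times> 'b \<times> real. \<bar>snd (snd s)\<bar> <= C} \<in> sets borel"
   by (intro borel_closed closed_Collect_le continuous_intros)
  then have "AE s in L. \<bar>snd (snd s)\<bar> <= C"
   unfolding L_def using Y_bounded by (subst AE_distr_iff[OF m]) auto
  from S.AE_S[OF this, of i] show "AE \<omega> in M. \<bar>Ys i \<omega>\<bar> <= C" by simp
 qed
 have inf0: "bdd_below (risk ` G)" unfolding risk_def by (intro bdd_belowI2[where m = 0]) simp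
 define \<iota> where "\<iota> = (INF g\<in>G. risk g)"
 have "AE \<omega> in M. (\<forall>\<^sub>F n in sequentially. ghat n \<omega> \<in> G) \<and> (\<lambda>n. risk (ghat n \<omega>)) \<longlonglongrightarrow> \<iota>"
  using key noise_vanishes Yb AE_Ts_D erm
 proof eventually_elim
  case (elim \<omega>)
  define J where "J n g = (\<Sum>i<n. w n \<omega> i * (Ys i \<omega> - g (Ts i \<omega>))\<^sup>2)" for n g
  have min: "ghat n \<omega> \<in> G" "g \<in> G ==> J n (ghat n \<omega>) <= J n g" if "1 <= n" for n g
   using elim(5) that unfolding is_arg_min_iff J_def by auto
  \<comment> \<open>With Y = \<tau> + noise the squared noise cancels in the difference, so the
    noise enters only linearly.\<close>
  have Jeq: "J n g - J n g0 = (\<Sum>i<n. w n \<omega> i * excess_loss g (zs \<omega> i))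
    - 2 * (\<Sum>i<n. w n \<omega> i * noise (obs i \<omega>) * excess g (Ts i \<omega>))" for n g
   unfolding J_def sum_subtractf[symmetric] sum_distrib_left
  proof (rule sum.cong[OF refl])
   fix i
   have "max (- C) (min C (Ys i \<omega>)) = Ys i \<omega>" using elim(3)[rule_format, of i] by (auto simp: abs_le_iff)
   then have n: "noise (obs i \<omega>) = Ys i \<omega> - \<tau>c (Ts i \<omega>, Xs i \<omega>)" unfolding noise_def by simp
   show "w n \<omega> i * (Ys i \<omega> - g (Ts i \<omega>))\<^sup>2 - w n \<omega> i * (Ys i \<omega> - g0 (Ts i \<omega>))\<^sup>2 =
    w n \<omega> i * excess_loss g (zs \<omega> i) - 2 * (w n \<omega> i * noise (obs i \<omega>) * excess g (Ts i \<omega>))"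
    unfolding n excess_loss_def excess_def on_support_def zs_def using elim(4)
    by (simp add: power2_eq_square algebra_simps)
  qed
  have ev: "\<forall>\<^sub>F n in sequentially. ghat n \<omega> \<in> G" using eventually_ge_at_top[of 1] by eventually_elim (rule min(1))
  have "(\<lambda>n. risk (ghat n \<omega>)) \<longlonglongrightarrow> \<iota>"
  proof (rule tendstoI)
   fix \<epsilon> :: real assume "\<epsilon> > 0"
   then have e: "\<epsilon> / 8 > 0" by simp
   from elim(1)[THEN spec, THEN mp, OF e] elim(2)[THEN spec, THEN mp, OF e] eventually_ge_at_top[of 1]
   show "\<forall>\<^sub>F n in sequentially. dist (risk (ghat n \<omega>)) \<iota> < \<epsilon>"
   proof eventually_elim
    case (elim n)
    note gh = min(1)[OF elim(3)]
    \<comment> \<open>One \<epsilon> / 8 comes from the loss and, because of the factor 2, two from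
      the noise.\<close>
    have dev: "\<bar>(J n g - J n g0) - (risk g - risk g0)\<bar> <= 3 * (\<epsilon> / 8)" if g: "g \<in> G" for g
     using elim(1)[rule_format, OF g] elim(2)[rule_format, OF g] unfolding Jeq excess_loss_integral(2)[OF g] by arith
    have "risk (ghat n \<omega>) - 6 * (\<epsilon> / 8) <= risk g" if g: "g \<in> G" for g
     using dev[OF gh] dev[OF g] min(2)[OF elim(3) g] by arith
    then have "risk (ghat n \<omega>) - 6 * (\<epsilon> / 8) <= \<iota>" unfolding \<iota>_def using g0 by (intro cINF_greatest) auto
    moreover have "\<iota> <= risk (ghat n \<omega>)" unfolding \<iota>_def by (rule cINF_lower[OF inf0 gh])
    ultimately show ?case using \<open>\<epsilon> > 0\<close> unfolding dist_real_def by arith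
   qed
  qed
  with ev show ?case by blast
 qed
 then show ?thesis
 proof eventually_elim
  case (elim \<omega>)
  have inf: "(INF g\<in>G. dose_risk PT (\<lambda>t. \<integral>\<omega>. Ypot t \<omega> \<partial>M) g) = (INF g\<in>G. ennreal (risk g))"
   by (intro INF_cong refl dose_risk_eq)
  have lim: "(\<lambda>n. ennreal (risk (ghat n \<omega>))) \<longlonglongrightarrow> ennreal \<iota>" using elim by (intro tendsto_ennrealI) blast
  have "(INF g\<in>G. ennreal (risk g)) <= ennreal \<iota>"
   by (rule tendsto_lowerbound[OF lim]) (use elim in \<open>auto elim!: eventually_mono intro: INF_lower\<close>)
  moreover have "ennreal \<iota> <= (INF g\<in>G. ennreal (risk g))"
   unfolding \<iota>_def by (intro INF_greatest ennreal_leI cINF_lower[OF inf0])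
  ultimately have "(\<lambda>n. ennreal (risk (ghat n \<omega>))) \<longlonglongrightarrow> (INF g\<in>G. ennreal (risk g))" using lim by (simp add: antisym)
  moreover have "\<forall>\<^sub>F n in sequentially. ennreal (risk (ghat n \<omega>)) = dose_risk PT (\<lambda>t. \<integral>\<omega>. Ypot t \<omega> \<partial>M) (ghat n \<omega>)"
   using elim by (auto elim!: eventually_mono simp: dose_risk_eq)
  ultimately show ?case unfolding inf by (rule Lim_transform_eventually)
 qed
qed

end

section \<open>Balance of the loss in case (a)\<close>

lemma sum_pairs: "(\<Sum>p\<in>A \<times> A'. c (fst p) * d (snd p)) = (\<Sum>i\<in>A. c i) * (\<Sum>j\<in>A'. d j :: real)"
 by (simp add: sum_product sum.cartesian_product case_prod_unfold)

lemma mean_on_sum_difference: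
 assumes Z: "Z \<in> sets borel" and M: "mean_on Z \<Lambda>" "mean_on Z \<Lambda>'" and I: "finite I" "\<And>i. i \<in> I ==> f i \<in> test_functions Z"
  and \<eta>: "\<And>i. i \<in> I ==> \<bar>\<Lambda> (f i) - \<Lambda>' (f i)\<bar> <= \<eta>"
 shows "\<bar>\<Lambda> (\<lambda>z. \<Sum>i\<in>I. c i * f i z) - \<Lambda>' (\<lambda>z. \<Sum>i\<in>I. c i * f i z)\<bar> <= (\<Sum>i\<in>I. \<bar>c i\<bar>) * \<eta>"
proof -
 have "\<Lambda> (\<lambda>z. \<Sum>i\<in>I. c i * f i z) - \<Lambda>' (\<lambda>z. \<Sum>i\<in>I. c i * f i z) = (\<Sum>i\<in>I. c i * (\<Lambda> (f i) - \<Lambda>' (f i)))"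
  by (simp add: mean_on_sum[OF Z M(1) I] mean_on_sum[OF Z M(2) I] sum_subtractf right_diff_distrib)
 also have "\<bar>\<dots>\<bar> <= (\<Sum>i\<in>I. \<bar>c i\<bar> * \<eta>)"
  by (rule order_trans[OF sum_abs sum_mono]) (auto simp: abs_mult intro!: mult_left_mono \<eta>)
 finally show ?thesis by (simp add: sum_distrib_right)
qed

lemma test_functions_subset:
 assumes "Z' \<subseteq> Z" "Z' \<in> sets borel" "f \<in> test_functions Z" shows "f \<in> test_functions Z'"
proof -
 have "(\<lambda>z. indicator Z' z * f z) = (\<lambda>z. indicator Z' z * (indicator Z z * f z))" using assms(1) by (intro ext) (auto split: split_indicator)
 moreover have "(\<lambda>z. indicator Z' z * (indicator Z z * f z)) \<in> borel_measurable borel"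
  by (rule borel_measurable_times[OF borel_measurable_indicator[OF assms(2)] test_functions_measurable[OF assms(3)]])
 ultimately show ?thesis using assms(1) test_functions_bounded[OF assms(3)] unfolding test_functions_def by auto
qed

context finite_risk_regression
begin

text \<open>The loss is g^2 - 2 \<tau> g minus the same for \<open>g0\<close>. Replacing \<tau> by a
  combination from \<open>F\<^sub>0\<close> and g by one from \<open>G\<^sub>0\<close> gives a
  combination of products in \<open>F\<close>, with coefficients of total modulus at most \<gamma>^2
  + \<gamma>1 \<gamma>. Since \<gamma> does not depend on g, and \<gamma>1 is chosen from the
  accuracy alone, balance over \<open>F\<close> becomes uniform over \<open>G\<close>.\<close>

lemma approximable_balance:
 assumes F0: "F\<^sub>0 ~= {}" and \<tau>_appr: "approximable Z F\<^sub>0 \<tau>" and G_appr: "\<And>g. g \<in> G ==> approximable_within D G\<^sub>0 \<gamma> 0 g"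
  and incl: "{(\<lambda>(t, x). 2 * f (t, x) * g t + g' t * g'' t) | f g g' g''.
       f \<in> F\<^sub>0 \<and> g \<in> G\<^sub>0 \<union> {\<lambda>_. 0} \<and> g' \<in> G\<^sub>0 \<union> {\<lambda>_. 0} \<and> g'' \<in> G\<^sub>0 \<union> {\<lambda>_. 0}} \<subseteq> F"
 shows "AE \<omega> in M. \<forall>\<epsilon>>0. \<forall>\<^sub>F n in sequentially. \<forall>g\<in>G.
  \<bar>(\<Sum>i<n. w n \<omega> i * excess_loss g (zs \<omega> i)) - (\<integral>z. excess_loss g z \<partial>Q)\<bar> <= \<epsilon>"
proof -
 have inF: "(\<lambda>z. 2 * f z * g (fst z) + g' (fst z) * g'' (fst z)) \<in> F"
  if "f \<in> F\<^sub>0" "g \<in> G\<^sub>0 \<union> {\<lambda>_. 0}" "g' \<in> G\<^sub>0 \<union> {\<lambda>_. 0}" "g'' \<in> G\<^sub>0 \<union> {\<lambda>_. 0}" for f g g' g''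
 proof -
  have "(\<lambda>z. 2 * f z * g (fst z) + g' (fst z) * g'' (fst z)) = (\<lambda>(t, x). 2 * f (t, x) * g t + g' t * g'' t)"
   by (simp only: case_prod_unfold prod.collapse)
  moreover have "(\<lambda>(t, x). 2 * f (t, x) * g t + g' t * g'' t) \<in> F"
   by (rule subsetD[OF incl]) (intro CollectI exI conjI, rule refl, (rule that)+)
  ultimately show ?thesis by (simp only:)
 qed
 have FF: "(\<lambda>z. 2 * f z * g (fst z)) \<in> F" if "f \<in> F\<^sub>0" "g \<in> G\<^sub>0" for f g
  using inF[OF that(1), of g "\<lambda>_. 0" "\<lambda>_. 0"] that(2) by simp
 \<comment> \<open>Nonemptiness of \<open>F\<^sub>0\<close> provides an f to multiply with g =
   0.\<close>
 have GG: "(\<lambda>z. g' (fst z) * g'' (fst z)) \<in> F" if "g' \<in> G\<^sub>0" "g'' \<in> G\<^sub>0" for g' g''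
 proof -
  obtain f where "f \<in> F\<^sub>0" using F0 by blast
  from inF[OF this, of "\<lambda>_. 0" g' g''] that show ?thesis by simp
 qed
 have FT: "f \<in> test_functions Z" if "f \<in> F" for f
  by (rule continuous_test_function[OF compact_Z equicontinuous_class_continuous_on[OF equi_F that]])
 \<comment> \<open>Squares of elements of \<open>G\<^sub>0\<close> lie in \<open>F\<close> and are
   therefore bounded on Z. This bounds \<open>g0\<close> on the support, and with it all of
   \<open>G\<close>.\<close>
 obtain K0 where K0: "\<And>t. t \<in> D ==> \<bar>g0 t\<bar> <= K0"
 proof -
  obtain m gs a where gs: "\<And>j. j < m ==> gs j \<in> G\<^sub>0" "\<And>t. t \<in> D ==> \<bar>g0 t - (\<Sum>j<m::nat. a j * gs j t)\<bar> <= 0"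
   using G_appr[OF g0] unfolding approximable_within_def by blast
  have "\<exists>\<kappa>. \<forall>t\<in>D. \<bar>gs j t\<bar> <= \<kappa>" if j: "j < m" for j
  proof -
   obtain \<kappa> where \<kappa>: "\<forall>z\<in>Z. \<bar>gs j (fst z) * gs j (fst z)\<bar> <= \<kappa>" using test_functions_bounded[OF FT[OF GG[OF gs(1)[OF j] gs(1)[OF j]]]] by blast
   have "\<bar>gs j t\<bar> <= \<kappa> + 1" if "t \<in> D" for t
   proof -
    obtain x where "(t, x) \<in> Z" using \<open>t \<in> D\<close> unfolding D_eq_fst by auto
    then have "\<bar>gs j t\<bar> * \<bar>gs j t\<bar> <= \<kappa>" using \<kappa> by (auto simp: abs_mult)
    moreover have "0 <= (\<bar>gs j t\<bar> - 1)\<^sup>2" by simp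
    ultimately show ?thesis by (simp add: power2_eq_square algebra_simps)
   qed
   then show ?thesis by blast
  qed
  then obtain \<kappa> where \<kappa>: "\<And>j t. j < m ==> t \<in> D ==> \<bar>gs j t\<bar> <= \<kappa> j" by metis
  show ?thesis
  proof (rule that[of "\<Sum>j<m. \<bar>a j\<bar> * \<kappa> j"])
   fix t assume t: "t \<in> D"
   have "g0 t = (\<Sum>j<m. a j * gs j t)" using gs(2)[OF t] by simp
   also have "\<bar>\<dots>\<bar> <= (\<Sum>j<m. \<bar>a j\<bar> * \<kappa> j)"
    by (rule order_trans[OF sum_abs sum_mono]) (auto simp: abs_mult intro!: mult_left_mono \<kappa> t)
   finally show "\<bar>g0 t\<bar> <= (\<Sum>j<m. \<bar>a j\<bar> * \<kappa> j)" .
  qed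
 qed
 define K where "K = \<bar>K0\<bar> + B + 1"
 have K: "K > 0" unfolding K_def using B_nonneg by simp
 have gK: "\<bar>g t\<bar> <= K" if g: "g \<in> G" and t: "t \<in> D" for g t
  using excess_bounded[OF g, of t] K0[OF t] t unfolding excess_def on_support_def K_def by simp
 \<comment> \<open>Approximability concerns \<tau>, the loss contains its clipped version. They
   agree on this set of full measure, which takes over the role of Z for the means.\<close>
 define Z' where "Z' = {z \<in> Z. \<tau> z = \<tau>c z}"
 have Z': "Z' \<subseteq> Z" "Z' \<in> sets borel"
 proof -
  have "{z \<in> space borel. \<tau> z = \<tau>c z} \<in> sets borel" by measurable
  then have "Z \<inter> {z. \<tau> z = \<tau>c z} \<in> sets borel" using Z_borel by auto
  then show "Z' \<subseteq> Z" "Z' \<in> sets borel" unfolding Z'_def by (auto simp: Int_def)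
 qed
 have \<tau>eq: "AE z in P. z \<in> Z'"
 proof -
  have "{z. \<tau> z = \<tau>c z} = {z \<in> space borel. \<tau> z = \<tau>c z}" by simp
  also have "\<dots> \<in> sets borel" by measurable
  finally have "AE z in P. \<tau> z = \<tau>c z"
   using regression_bounded[OF \<tau>_measurable regression Y_bounded] by (subst AE_P_iff) (auto elim!: eventually_mono simp: \<tau>c_def)
  with AE_Z_P show ?thesis by eventually_elim (simp add: Z'_def)
 qed
 have \<tau>eqQ: "AE z in Q. z \<in> Z'" by (rule AE_Q[OF \<tau>eq])
 have AE_zs: "AE \<omega> in M. \<forall>i. zs \<omega> i \<in> Z'" unfolding AE_all_countable using ZS.AE_S[OF \<tau>eq] by blast
 define \<Lambda> where "\<Lambda> f = (\<integral>z. indicator Z' z * f z \<partial>Q)" for f :: "'a \<times> 'b => real"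
 have \<Lambda>: "mean_on Z' \<Lambda>"
  unfolding \<Lambda>_def[abs_def] by (rule population_mean_on[OF Q.prob_space_axioms sets_Q \<tau>eqQ Z'(2)])
 have FT': "f \<in> test_functions Z'" if "f \<in> F" for f by (rule test_functions_subset[OF Z' FT[OF that]])
 have \<Lambda>QZ: "\<Lambda> f = QZ f" if "f \<in> F" for f
  unfolding \<Lambda>_def QZ_def
 proof (rule integral_cong_AE)
  show "(\<lambda>z. indicator Z' z * f z) \<in> borel_measurable Q" "(\<lambda>z. indicator Z z * f z) \<in> borel_measurable Q"
   unfolding measurable_Q by (rule test_functions_measurable[OF FT'[OF that]], rule test_functions_measurable[OF FT[OF that]])
  show "AE z in Q. indicator Z' z * f z = indicator Z z * f z"
   using \<tau>eqQ by eventually_elim (use Z'(1) in auto)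
 qed
 have \<gamma>0: "0 <= \<gamma>"
 proof -
  obtain m and a :: "nat => real" where "(\<Sum>j<m. \<bar>a j\<bar>) <= \<gamma>" using G_appr[OF g0] unfolding approximable_within_def by blast
  then show ?thesis by (meson abs_ge_zero order_trans sum_nonneg)
 qed
 show ?thesis
  using AE_zs AE_feasible weights_balance
 proof eventually_elim
  case (elim \<omega>)
  show ?case
  proof (intro allI impI)
   fix \<epsilon> :: real assume \<epsilon>: "\<epsilon> > 0"
   \<comment> \<open>The error in \<tau> costs \<open>2 * \<epsilon>1 * K\<close> for g and again
     for \<open>g0\<close>, in each of two means: together \<open>8 * \<epsilon>1 * K\<close>, half
     of \<epsilon>.\<close>
   define \<epsilon>1 where "\<epsilon>1 = \<epsilon> / (16 * K)"
   have \<epsilon>1: "\<epsilon>1 > 0" unfolding \<epsilon>1_def using \<epsilon> K by simp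
   obtain \<gamma>1 where \<gamma>1: "0 <= \<gamma>1" "approximable_within Z F\<^sub>0 \<gamma>1 \<epsilon>1 \<tau>"
    using \<tau>_appr[unfolded approximable_def, rule_format, OF \<epsilon>1] by blast
   obtain k fs cs where fs: "\<And>i. i < k ==> fs i \<in> F\<^sub>0" "(\<Sum>i<k::nat. \<bar>cs i\<bar>) <= \<gamma>1"
    "\<And>z. z \<in> Z ==> \<bar>\<tau> z - (\<Sum>i<k. cs i * fs i z)\<bar> <= \<epsilon>1"
    using \<gamma>1(2) unfolding approximable_within_def by blast
   have psi: "\<exists>\<psi>\<in>test_functions Z'. (\<forall>z\<in>Z'. \<bar>(g (fst z))\<^sup>2 - 2 * \<tau> z * g (fst z) - \<psi> z\<bar> <= 2 * \<epsilon>1 * K) \<and>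
    (\<forall>\<Lambda>' \<eta>. mean_on Z' \<Lambda>' \<longrightarrow> 0 <= \<eta> \<longrightarrow> (\<forall>f\<in>F. \<bar>\<Lambda>' f - \<Lambda> f\<bar> <= \<eta>) \<longrightarrow> \<bar>\<Lambda>' \<psi> - \<Lambda> \<psi>\<bar> <= (\<gamma> * \<gamma> + \<gamma>1 * \<gamma>) * \<eta>)"
    if g: "g \<in> G" for g
   proof -
    obtain m gs b where gs: "\<And>j. j < m ==> gs j \<in> G\<^sub>0" "(\<Sum>j<m::nat. \<bar>b j\<bar>) <= \<gamma>"
     "\<And>t. t \<in> D ==> \<bar>g t - (\<Sum>j<m. b j * gs j t)\<bar> <= 0"
     using G_appr[OF g] unfolding approximable_within_def by blast
    define I1 where "I1 = {..<m} \<times> {..<m}"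
    define I2 where "I2 = {..<k} \<times> {..<m}"
    have fin: "finite I1" "finite I2" unfolding I1_def I2_def by auto
    define c1 where "c1 p = b (fst p) * b (snd p)" for p
    define c2 where "c2 p = cs (fst p) * b (snd p)" for p
    define f1 where "f1 p z = gs (fst p) (fst z) * gs (snd p) (fst z)" for p and z :: "'a \<times> 'b"
    define f2 where "f2 p z = 2 * fs (fst p) z * gs (snd p) (fst z)" for p and z :: "'a \<times> 'b"
    have f1F: "f1 p \<in> F" if "p \<in> I1" for p unfolding f1_def[abs_def] using that by (intro GG gs(1)) (auto simp: I1_def)
    have f2F: "f2 p \<in> F" if "p \<in> I2" for p unfolding f2_def[abs_def] using that by (intro FF gs(1) fs(1)) (auto simp: I2_def)
    define \<psi>1 where "\<psi>1 z = (\<Sum>p\<in>I1. c1 p * f1 p z)" for z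
    define \<psi>2 where "\<psi>2 z = (\<Sum>p\<in>I2. c2 p * f2 p z)" for z
    have T1: "\<psi>1 \<in> test_functions Z'" unfolding \<psi>1_def[abs_def] by (intro test_functions_sum Z' FT' f1F)
    have T2: "\<psi>2 \<in> test_functions Z'" unfolding \<psi>2_def[abs_def] by (intro test_functions_sum Z' FT' f2F)
    show ?thesis
    proof (intro bexI[of _ "\<lambda>z. 1 * \<psi>1 z + (-1) * \<psi>2 z"] conjI ballI allI impI)
     show "(\<lambda>z. 1 * \<psi>1 z + (-1) * \<psi>2 z) \<in> test_functions Z'"
      by (intro test_functions_add test_functions_scale Z' T1 T2)
    next
     fix z assume z: "z \<in> Z'"
     then have zZ: "z \<in> Z" using Z'(1) by blast
     then have tD: "fst z \<in> D" unfolding D_eq_fst by blast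
     have geq: "g (fst z) = (\<Sum>j<m. b j * gs j (fst z))" using gs(3)[OF tD] by simp
     have "\<psi>1 z = (\<Sum>p\<in>I1. (b (fst p) * gs (fst p) (fst z)) * (b (snd p) * gs (snd p) (fst z)))"
      unfolding \<psi>1_def c1_def f1_def by (intro sum.cong refl) (simp only: mult_ac)
     then have p1: "\<psi>1 z = g (fst z) * g (fst z)" unfolding I1_def sum_pairs[of "\<lambda>i. b i * gs i (fst z)" "\<lambda>i. b i * gs i (fst z)"] geq .
     have "\<psi>2 z = (\<Sum>p\<in>I2. (2 * (cs (fst p) * fs (fst p) z)) * (b (snd p) * gs (snd p) (fst z)))"
      unfolding \<psi>2_def c2_def f2_def by (intro sum.cong refl) (simp only: mult_ac)
     then have p2: "\<psi>2 z = 2 * (\<Sum>i<k. cs i * fs i z) * g (fst z)"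
      unfolding I2_def sum_pairs[of "\<lambda>i. 2 * (cs i * fs i z)" "\<lambda>i. b i * gs i (fst z)"] geq sum_distrib_left[symmetric] .
     have "(g (fst z))\<^sup>2 - 2 * \<tau> z * g (fst z) - (1 * \<psi>1 z + (-1) * \<psi>2 z) = 2 * (- (\<tau> z - (\<Sum>i<k. cs i * fs i z)) * g (fst z))"
      unfolding p1 p2 by (simp add: power2_eq_square algebra_simps)
     moreover have "\<bar>- (\<tau> z - (\<Sum>i<k. cs i * fs i z)) * g (fst z)\<bar> <= \<epsilon>1 * K"
      unfolding abs_mult abs_minus_cancel using fs(3)[OF zZ] gK[OF g tD] \<epsilon>1 by (intro mult_mono) auto
     ultimately show "\<bar>(g (fst z))\<^sup>2 - 2 * \<tau> z * g (fst z) - (1 * \<psi>1 z + (-1) * \<psi>2 z)\<bar> <= 2 * \<epsilon>1 * K" by (simp add: abs_mult)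
    next
     fix \<Lambda>' \<eta> assume \<Lambda>': "mean_on Z' \<Lambda>'" and \<eta>0: "0 <= (\<eta> :: real)" and \<eta>: "\<forall>f\<in>F. \<bar>\<Lambda>' f - \<Lambda> f\<bar> <= \<eta>"
     have "\<bar>\<Lambda>' \<psi>1 - \<Lambda> \<psi>1\<bar> <= (\<Sum>p\<in>I1. \<bar>c1 p\<bar>) * \<eta>"
      unfolding \<psi>1_def[abs_def] using \<eta> f1F by (intro mean_on_sum_difference[OF Z'(2) \<Lambda>' \<Lambda> fin(1)] FT') auto
     also have "(\<Sum>p\<in>I1. \<bar>c1 p\<bar>) = (\<Sum>j<m. \<bar>b j\<bar>) * (\<Sum>j<m. \<bar>b j\<bar>)"
      unfolding c1_def abs_mult I1_def by (rule sum_pairs)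
     also have "(\<Sum>j<m. \<bar>b j\<bar>) * (\<Sum>j<m. \<bar>b j\<bar>) * \<eta> <= \<gamma> * \<gamma> * \<eta>"
      using gs(2) \<gamma>0 \<eta>0 by (intro mult_right_mono mult_mono) (auto intro: sum_nonneg)
     finally have d1: "\<bar>\<Lambda>' \<psi>1 - \<Lambda> \<psi>1\<bar> <= \<gamma> * \<gamma> * \<eta>" .
     have "\<bar>\<Lambda>' \<psi>2 - \<Lambda> \<psi>2\<bar> <= (\<Sum>p\<in>I2. \<bar>c2 p\<bar>) * \<eta>"
      unfolding \<psi>2_def[abs_def] using \<eta> f2F by (intro mean_on_sum_difference[OF Z'(2) \<Lambda>' \<Lambda> fin(2)] FT') auto
     also have "(\<Sum>p\<in>I2. \<bar>c2 p\<bar>) = (\<Sum>i<k. \<bar>cs i\<bar>) * (\<Sum>j<m. \<bar>b j\<bar>)"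
      unfolding c2_def abs_mult I2_def by (rule sum_pairs)
     also have "(\<Sum>i<k. \<bar>cs i\<bar>) * (\<Sum>j<m. \<bar>b j\<bar>) * \<eta> <= \<gamma>1 * \<gamma> * \<eta>"
      using gs(2) fs(2) \<gamma>1(1) \<eta>0 by (intro mult_right_mono mult_mono) (auto intro: sum_nonneg)
     finally have d2: "\<bar>\<Lambda>' \<psi>2 - \<Lambda> \<psi>2\<bar> <= \<gamma>1 * \<gamma> * \<eta>" .
     show "\<bar>\<Lambda>' (\<lambda>z. 1 * \<psi>1 z + (-1) * \<psi>2 z) - \<Lambda> (\<lambda>z. 1 * \<psi>1 z + (-1) * \<psi>2 z)\<bar> <= (\<gamma> * \<gamma> + \<gamma>1 * \<gamma>) * \<eta>"
      unfolding mean_on_combination[OF \<Lambda>' T1 T2] mean_on_combination[OF \<Lambda> T1 T2] distrib_right using d1 d2 by arith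
    qed
   qed
   define \<gamma>2 where "\<gamma>2 = \<gamma> * \<gamma> + \<gamma>1 * \<gamma>"
   have \<gamma>2: "0 <= \<gamma>2" unfolding \<gamma>2_def using \<gamma>0 \<gamma>1(1) by simp
   \<comment> \<open>Balance over \<open>F\<close> within \<open>\<epsilon>2\<close> costs at most
     \<epsilon> / 4 for g and for \<open>g0\<close>: the other half.\<close>
   define \<epsilon>2 where "\<epsilon>2 = \<epsilon> / (4 * (\<gamma>2 + 1))"
   have \<epsilon>2: "\<epsilon>2 > 0" unfolding \<epsilon>2_def using \<epsilon> \<gamma>2 by simp
   have e2: "\<gamma>2 * \<epsilon>2 <= \<epsilon> / 4" unfolding \<epsilon>2_def using \<epsilon> \<gamma>2 by (simp add: field_simps)
   have e1: "\<epsilon>1 * K = \<epsilon> / 16" unfolding \<epsilon>1_def using K by simp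
   from elim(3)[THEN spec, THEN mp, OF \<epsilon>2] eventually_ge_at_top[of "1 :: nat"]
   show "\<forall>\<^sub>F n in sequentially. \<forall>g\<in>G. \<bar>(\<Sum>i<n. w n \<omega> i * excess_loss g (zs \<omega> i)) - (\<integral>z. excess_loss g z \<partial>Q)\<bar> <= \<epsilon>"
   proof eventually_elim
    case (elim n)
    define \<Lambda>' where "\<Lambda>' = sample_mean n (w n \<omega>) (zs \<omega>)"
    have \<Lambda>': "mean_on Z' \<Lambda>'"
     unfolding \<Lambda>'_def using \<open>\<forall>i. zs \<omega> i \<in> Z'\<close> \<open>\<forall>n\<ge>1. feasible_weights n W (w n \<omega>)\<close> elim(2)
     by (intro sample_mean_mean_on) (auto simp: feasible_weights_def)
    have bal: "\<forall>f\<in>F. \<bar>\<Lambda>' f - \<Lambda> f\<bar> <= \<epsilon>2" using elim(1) \<Lambda>QZ unfolding \<Lambda>'_def by simp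
    show ?case
    proof
     fix g assume g: "g \<in> G"
     obtain \<psi> where \<psi>: "\<psi> \<in> test_functions Z'" "\<And>z. z \<in> Z' ==> \<bar>(g (fst z))\<^sup>2 - 2 * \<tau> z * g (fst z) - \<psi> z\<bar> <= 2 * \<epsilon>1 * K"
      "\<bar>\<Lambda>' \<psi> - \<Lambda> \<psi>\<bar> <= \<gamma>2 * \<epsilon>2" using psi[OF g, folded \<gamma>2_def] \<Lambda>' bal less_imp_le[OF \<epsilon>2] by blast
     obtain \<psi>' where \<psi>': "\<psi>' \<in> test_functions Z'" "\<And>z. z \<in> Z' ==> \<bar>(g0 (fst z))\<^sup>2 - 2 * \<tau> z * g0 (fst z) - \<psi>' z\<bar> <= 2 * \<epsilon>1 * K"
      "\<bar>\<Lambda>' \<psi>' - \<Lambda> \<psi>'\<bar> <= \<gamma>2 * \<epsilon>2" using psi[OF g0, folded \<gamma>2_def] \<Lambda>' bal less_imp_le[OF \<epsilon>2] by blast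
     have el: "excess_loss g z = ((g (fst z))\<^sup>2 - 2 * \<tau> z * g (fst z)) - ((g0 (fst z))\<^sup>2 - 2 * \<tau> z * g0 (fst z))"
      and ez: "fst z \<in> D" if "z \<in> Z'" for z
     proof -
      show "fst z \<in> D" using that Z'(1) unfolding D_eq_fst by blast
      then show "excess_loss g z = ((g (fst z))\<^sup>2 - 2 * \<tau> z * g (fst z)) - ((g0 (fst z))\<^sup>2 - 2 * \<tau> z * g0 (fst z))"
       using that unfolding excess_loss_def excess_def on_support_def Z'_def by (simp add: power2_eq_square algebra_simps)
     qed
     have eb: "\<bar>excess_loss g z\<bar> <= B\<^sup>2 + 2 * ((K + C) * B)" if "z \<in> Z'" for z
     proof -
      have "\<bar>(excess g (fst z))\<^sup>2\<bar> <= B\<^sup>2" using power_mono[OF excess_bounded[OF g, of "fst z"], of 2] by simp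
      moreover have "\<bar>(on_support g0 (fst z) - \<tau>c z) * excess g (fst z)\<bar> <= (K + C) * B"
       unfolding abs_mult using gK[OF g0 ez[OF that]] \<tau>c_bounds[of z] ez[OF that] excess_bounded[OF g, of "fst z"] K C_nonneg
       by (intro mult_mono) (auto simp: on_support_def)
      ultimately show ?thesis unfolding excess_loss_def mult.assoc by arith
     qed
     have lT: "excess_loss g \<in> test_functions Z'" by (rule borel_test_function[OF Z'(2) excess_loss_measurable[OF g] eb])
     have cT: "(\<lambda>z. 1 * \<psi> z + (-1) * \<psi>' z) \<in> test_functions Z'" by (intro test_functions_add test_functions_scale Z' \<psi> \<psi>')
     have near: "\<bar>excess_loss g z - (1 * \<psi> z + (-1) * \<psi>' z)\<bar> <= 4 * (\<epsilon>1 * K)" if "z \<in> Z'" for z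
      using \<psi>(2)[OF that] \<psi>'(2)[OF that] unfolding el[OF that] by arith
     note n1 = mean_on_close[OF Z'(2) \<Lambda>' lT cT near] and n2 = mean_on_close[OF Z'(2) \<Lambda> lT cT near]
     have "\<bar>\<Lambda>' (excess_loss g) - \<Lambda> (excess_loss g)\<bar> <= \<epsilon>"
      using n1 n2 \<psi>(3) \<psi>'(3) e1 e2
      unfolding mean_on_combination[OF \<Lambda>' \<psi>(1) \<psi>'(1)] mean_on_combination[OF \<Lambda> \<psi>(1) \<psi>'(1)] by arith
     moreover have "\<Lambda> (excess_loss g) = (\<integral>z. excess_loss g z \<partial>Q)"
      unfolding \<Lambda>_def
     proof (rule integral_cong_AE)
      show "AE z in Q. indicator Z' z * excess_loss g z = excess_loss g z" using \<tau>eqQ by eventually_elim simp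
     qed (use test_functions_measurable[OF lT] excess_loss_measurable[OF g] in \<open>simp_all add: measurable_Q\<close>)
     ultimately show "\<bar>(\<Sum>i<n. w n \<omega> i * excess_loss g (zs \<omega> i)) - (\<integral>z. excess_loss g z \<partial>Q)\<bar> <= \<epsilon>"
      unfolding \<Lambda>'_def sample_mean_def by simp
    qed
   qed
  qed
 qed
qed

section \<open>Balance of the loss in case (b)\<close>

definition tail :: "nat => 'a => real" where "tail K t = (if real K < \<bar>on_support g0 t\<bar> then \<bar>on_support g0 t\<bar> else 0)"

definition truncated :: "nat => 'a => real" where "truncated K t = (if real K < \<bar>on_support g0 t\<bar> then 0 else on_support g0 t)"

text \<open>\<open>g0\<close> is square integrable but possibly unbounded, while
  \<open>uniform_lln\<close> takes bounded losses. Cutting \<open>g0\<close> at level K in the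
  linear term leaves a loss that is bounded and Lipschitz in the excess.\<close>

definition truncated_loss :: "nat => ('a => real) => 'a \<times> 'b => real" where
 "truncated_loss K g z = (excess g (fst z))\<^sup>2 + 2 * (truncated K (fst z) - \<tau>c z) * excess g (fst z)"

lemma tail_measurable [measurable]: "tail K \<in> borel_measurable borel"
 and truncated_measurable [measurable]: "truncated K \<in> borel_measurable borel"
 unfolding tail_def[abs_def] truncated_def[abs_def] by measurable

lemma truncated_loss_measurable: "g \<in> G ==> truncated_loss K g \<in> borel_measurable borel"
 unfolding truncated_loss_def[abs_def]
 by (intro borel_measurable_add borel_measurable_times borel_measurable_power borel_measurable_diff borel_measurable_const
   \<tau>c_measurable fst_measurable excess_measurable truncated_measurable)

lemma tail_bounds: "0 <= tail K t" "tail K t <= \<bar>on_support g0 t\<bar>"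
 unfolding tail_def by auto

lemma truncated_bound: "\<bar>truncated K t\<bar> <= real K" unfolding truncated_def by auto

lemma truncation_error:
 assumes g: "g \<in> G" shows "\<bar>excess_loss g z - truncated_loss K g z\<bar> <= 2 * B * tail K (fst z)"
proof -
 have "excess_loss g z - truncated_loss K g z = 2 * ((on_support g0 (fst z) - truncated K (fst z)) * excess g (fst z))"
  unfolding excess_loss_def truncated_loss_def by (simp add: algebra_simps)
 moreover have "\<bar>(on_support g0 (fst z) - truncated K (fst z)) * excess g (fst z)\<bar> <= tail K (fst z) * B"
  unfolding abs_mult using excess_bounded[OF g, of "fst z"]
  by (intro mult_mono) (auto simp: tail_def truncated_def)
 ultimately show ?thesis by (simp add: abs_mult mult.commute)
qed

lemma truncated_loss_bounded:
 assumes g: "g \<in> G" shows "\<bar>truncated_loss K g z\<bar> <= B\<^sup>2 + 2 * ((real K + C) * B)"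
proof -
 have "\<bar>(excess g (fst z))\<^sup>2\<bar> <= B\<^sup>2" using power_mono[OF excess_bounded[OF g, of "fst z"], of 2] by simp
 moreover have "\<bar>(truncated K (fst z) - \<tau>c z) * excess g (fst z)\<bar> <= (real K + C) * B"
  unfolding abs_mult using truncated_bound[of K "fst z"] \<tau>c_bounds[of z] excess_bounded[OF g, of "fst z"] C_nonneg
  by (intro mult_mono) auto
 ultimately show ?thesis unfolding truncated_loss_def mult.assoc by arith
qed

lemma truncated_loss_Lipschitz:
 assumes g: "g \<in> G" "g' \<in> G"
 shows "\<bar>truncated_loss K g z - truncated_loss K g' z\<bar> <= (2 * B + 2 * (real K + C)) * \<bar>excess g (fst z) - excess g' (fst z)\<bar>"
proof -
 have "truncated_loss K g z - truncated_loss K g' z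
  = (excess g (fst z) + excess g' (fst z) + 2 * (truncated K (fst z) - \<tau>c z)) * (excess g (fst z) - excess g' (fst z))"
  unfolding truncated_loss_def by (simp add: power2_eq_square algebra_simps)
 moreover have "\<bar>excess g (fst z) + excess g' (fst z) + 2 * (truncated K (fst z) - \<tau>c z)\<bar> <= 2 * B + 2 * (real K + C)"
  using excess_bounded[OF g(1), of "fst z"] excess_bounded[OF g(2), of "fst z"] truncated_bound[of K "fst z"] \<tau>c_bounds[of z]
  by (auto simp: abs_le_iff)
 ultimately show ?thesis by (simp only: abs_mult mult_right_mono abs_ge_zero)
qed

lemma tail_vanishes: "(\<lambda>K. \<integral>t. tail K t \<partial>PT) \<longlonglongrightarrow> 0"
proof -
 have "(\<lambda>K. \<integral>t. tail K t \<partial>PT) \<longlonglongrightarrow> (\<integral>t. 0 \<partial>PT)"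
 proof (rule integral_dominated_convergence[where w = "\<lambda>t. \<bar>on_support g0 t\<bar>"])
  show "AE t in PT. (\<lambda>K. tail K t) \<longlonglongrightarrow> 0"
  proof (intro AE_I2 tendsto_eventually)
   fix t
   obtain k :: nat where "\<bar>on_support g0 t\<bar> <= real k" using real_arch_simple by blast
   then show "\<forall>\<^sub>F K in sequentially. tail K t = 0"
    by (intro eventually_mono[OF eventually_ge_at_top[of k]]) (auto simp: tail_def)
  qed
  show "integrable PT (\<lambda>t. \<bar>on_support g0 t\<bar>)" by (intro integrable_abs g0_integrable)
  show "AE t in PT. norm (tail K t) <= \<bar>on_support g0 t\<bar>" for K using tail_bounds by simp
  show "(\<lambda>t. 0) \<in> borel_measurable PT" by simp
  show "tail K \<in> borel_measurable PT" for K unfolding measurable_PT by (rule tail_measurable)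
 qed
 then show ?thesis by simp
qed

lemma tail_integrable: "integrable PT (tail K)"
proof (rule Bochner_Integration.integrable_bound[OF integrable_abs[OF g0_integrable]])
 show "tail K \<in> borel_measurable PT" unfolding measurable_PT by (rule tail_measurable)
 show "AE t in PT. norm (tail K t) <= norm \<bar>on_support g0 t\<bar>" using tail_bounds by simp
qed

lemma tail_square_integrable: "integrable PT (\<lambda>t. (tail K t)\<^sup>2)"
proof (rule Bochner_Integration.integrable_bound[OF g0_square_integrable])
 show "(\<lambda>t. (tail K t)\<^sup>2) \<in> borel_measurable PT" unfolding measurable_PT by measurable
 show "AE t in PT. norm ((tail K t)\<^sup>2) <= norm ((on_support g0 t)\<^sup>2)" unfolding tail_def by simp
qed

text \<open>The term 1/(K+1) provides the strict inequality that \<open>dyadic_upper_lln\<close>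
  asks for. Its factor 2 is harmless since the tail mean tends to 0.\<close>

lemma AE_tail_sum:
 "AE \<omega> in M. \<forall>K. \<forall>\<^sub>F n in sequentially. (\<Sum>i<n. tail K (Ts i \<omega>)) <= 2 * ((\<integral>t. tail K t \<partial>PT) + 1 / real (Suc K)) * real n"
 unfolding AE_all_countable
 by (intro allI TS.dyadic_upper_lln tail_measurable tail_bounds tail_square_integrable) simp

text \<open>The factor r turns means under P into means under Q, and the truncated loss is Lipschitz
  in the excess, whose Rademacher averages vanish; so \<open>uniform_lln\<close> applies to the
  ratio-weighted loss.\<close>

lemma truncated_lln_one_sided:
 assumes \<sigma>: "\<bar>\<sigma>\<bar> = 1"
 shows "AE \<omega> in M. \<forall>\<delta>>0. \<forall>\<^sub>F n in sequentially. \<forall>k.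
  (\<Sum>i<n. \<sigma> * (r (zs \<omega> i) * truncated_loss K (countable_class k) (zs \<omega> i)) -
   \<sigma> * (\<integral>z. truncated_loss K (countable_class k) z \<partial>Q)) <= \<delta> * real n"
proof -
 interpret U: bounded_functions u borel "B + 1" by (rule u_bounded_functions)
 define l where "l k z = \<sigma> * (r z * truncated_loss K (countable_class k) z)" for k z
 have E: "(\<integral>z. l k z \<partial>P) = \<sigma> * (\<integral>z. truncated_loss K (countable_class k) z \<partial>Q)" for k
  unfolding l_def integral_Q[OF truncated_loss_measurable[OF countable_class(1)]] by simp
 have "AE \<omega> in M. \<forall>\<delta>>0. \<forall>\<^sub>F n in sequentially. \<forall>k. (\<Sum>i<n. l k (zs \<omega> i) - (\<integral>z. l k z \<partial>P)) <= \<delta> * real n"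
 proof (rule ZS.uniform_lln[where u = "\<lambda>k z. u k (fst z)" and B = "B + 1" and C = "W\<^sub>0 * (2 * B + 2 * (real K + C))"
    and b = "W\<^sub>0 * (B\<^sup>2 + 2 * ((real K + C) * B))"])
  show "bounded_functions (\<lambda>k z. u k (fst z)) (borel :: ('a \<times> 'b) measure) (B + 1)"
  proof
   show "(\<lambda>z :: 'a \<times> 'b. u k (fst z)) \<in> borel_measurable borel" for k by (rule fst_measurable[OF U.u_measurable])
   show "\<bar>u k (fst z)\<bar> <= B + 1" for k and z :: "'a \<times> 'b" by (rule U.u_bounded)
  qed
  show "l k \<in> borel_measurable borel" for k
   unfolding l_def[abs_def]
   by (intro borel_measurable_times borel_measurable_const r_measurable truncated_loss_measurable countable_class(1))
  show "\<bar>l k z\<bar> <= W\<^sub>0 * (B\<^sup>2 + 2 * ((real K + C) * B))" for k z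
   unfolding l_def abs_mult \<sigma> mult_1
   using r_abs_le[of z] truncated_loss_bounded[OF countable_class(1), of K k z] W0_pos by (intro mult_mono) auto
  show "\<bar>l k z - l j z\<bar> <= W\<^sub>0 * (2 * B + 2 * (real K + C)) * \<bar>u k (fst z) - u j (fst z)\<bar>" for k j z
  proof -
   have "l k z - l j z = \<sigma> * (r z * (truncated_loss K (countable_class k) z - truncated_loss K (countable_class j) z))"
    unfolding l_def by (simp only: right_diff_distrib)
   then have "\<bar>l k z - l j z\<bar> = \<bar>r z\<bar> * \<bar>truncated_loss K (countable_class k) z - truncated_loss K (countable_class j) z\<bar>"
    by (simp only: abs_mult \<sigma> mult_1)
   also have "\<dots> <= W\<^sub>0 * ((2 * B + 2 * (real K + C)) * \<bar>u k (fst z) - u j (fst z)\<bar>)"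
    unfolding u_def using r_abs_le[of z] truncated_loss_Lipschitz[OF countable_class(1) countable_class(1), of K k z j] W0_pos
    by (intro mult_mono) auto
   finally show ?thesis by (simp only: mult.assoc)
  qed
  show "0 <= W\<^sub>0 * (2 * B + 2 * (real K + C))" using W0_pos B_nonneg C_nonneg by simp
  show "AE \<omega> in M. (\<lambda>n. rademacher_avg (\<lambda>k z. u k (fst z)) n (\<lambda>i. zs \<omega> i)) \<longlonglongrightarrow> 0"
   using rademacher_u_vanishes unfolding rademacher_avg_def zs_def by simp
 qed
 then show ?thesis unfolding E unfolding l_def .
qed

lemma truncated_lln:
 "AE \<omega> in M. \<forall>K. \<forall>\<delta>>0. \<forall>\<^sub>F n in sequentially. \<forall>k.
  \<bar>(\<Sum>i<n. r (zs \<omega> i) * truncated_loss K (countable_class k) (zs \<omega> i)) / real n -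
   (\<integral>z. truncated_loss K (countable_class k) z \<partial>Q)\<bar> <= \<delta>"
 unfolding AE_all_countable
proof
 fix K
 show "AE \<omega> in M. \<forall>\<delta>>0. \<forall>\<^sub>F n in sequentially. \<forall>k.
  \<bar>(\<Sum>i<n. r (zs \<omega> i) * truncated_loss K (countable_class k) (zs \<omega> i)) / real n -
   (\<integral>z. truncated_loss K (countable_class k) z \<partial>Q)\<bar> <= \<delta>"
  using truncated_lln_one_sided[of 1 K, simplified] truncated_lln_one_sided[of "-1" K, simplified]
 proof eventually_elim
  case (elim \<omega>)
  show ?case
  proof (intro allI impI)
   fix \<delta> :: real assume \<delta>: "\<delta> > 0"
   from elim(1)[THEN spec, THEN mp, OF \<delta>] elim(2)[THEN spec, THEN mp, OF \<delta>] eventually_ge_at_top[of "1 :: nat"]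
   show "\<forall>\<^sub>F n in sequentially. \<forall>k.
    \<bar>(\<Sum>i<n. r (zs \<omega> i) * truncated_loss K (countable_class k) (zs \<omega> i)) / real n -
     (\<integral>z. truncated_loss K (countable_class k) z \<partial>Q)\<bar> <= \<delta>"
   proof eventually_elim
    case (elim n)
    have n: "real n > 0" using elim(3) by simp
    show ?case
    proof
     fix k
     define s where "s = (\<Sum>i<n. r (zs \<omega> i) * truncated_loss K (countable_class k) (zs \<omega> i))"
     define E where "E = (\<integral>z. truncated_loss K (countable_class k) z \<partial>Q)"
     have "s - real n * E <= \<delta> * real n" "real n * E - s <= \<delta> * real n"
      using elim(1)[THEN spec, of k] elim(2)[THEN spec, of k] unfolding s_def E_def
      by (simp_all add: sum_subtractf sum.distrib sum_negf)
     moreover have "s / real n - E = (s - real n * E) / real n" using n by (simp add: diff_divide_distrib)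
     ultimately have "\<bar>s / real n - E\<bar> <= \<delta>" using n by (simp add: abs_le_iff pos_divide_le_eq minus_divide_left)
     then show "\<bar>(\<Sum>i<n. r (zs \<omega> i) * truncated_loss K (countable_class k) (zs \<omega> i)) / real n -
      (\<integral>z. truncated_loss K (countable_class k) z \<partial>Q)\<bar> <= \<delta>" unfolding s_def E_def .
    qed
   qed
  qed
 qed
qed

lemma truncated_loss_integral:
 assumes g: "g \<in> G"
 shows "\<bar>(\<integral>z. truncated_loss K g z \<partial>Q) - (\<integral>z. excess_loss g z \<partial>Q)\<bar> <= 2 * B * (\<integral>t. tail K t \<partial>PT)"
proof -
 have i: "integrable Q (truncated_loss K g)"
  by (rule Q.integrable_bounded[OF _ truncated_loss_bounded[OF g]]) (simp only: measurable_Q truncated_loss_measurable[OF g])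
 note ie = excess_loss_integral(1)[OF g]
 have it: "integrable Q (\<lambda>z. 2 * B * tail K (fst z))" by (intro integrable_mult_right integrable_fst_Q tail_integrable)
 have "(\<integral>z. truncated_loss K g z \<partial>Q) - (\<integral>z. excess_loss g z \<partial>Q) = (\<integral>z. truncated_loss K g z - excess_loss g z \<partial>Q)"
  using i ie by simp
 also have "\<bar>\<dots>\<bar> <= (\<integral>z. \<bar>truncated_loss K g z - excess_loss g z\<bar> \<partial>Q)" by (rule integral_abs_bound)
 also have "\<dots> <= (\<integral>z. 2 * B * tail K (fst z) \<partial>Q)"
  using truncation_error[OF g, of _ K] by (intro integral_mono it integrable_abs Bochner_Integration.integrable_diff i ie) (simp add: abs_minus_commute)
 also have "\<dots> = 2 * B * (\<integral>t. tail K t \<partial>PT)" using integral_fst_Q[OF tail_measurable, of K] by simp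
 finally show ?thesis .
qed

lemma excess_loss_dominated:
 assumes g: "g \<in> G" shows "\<bar>excess_loss g z\<bar> <= B\<^sup>2 + 2 * ((\<bar>on_support g0 (fst z)\<bar> + C) * B)"
proof -
 have "\<bar>(excess g (fst z))\<^sup>2\<bar> <= B\<^sup>2" using power_mono[OF excess_bounded[OF g, of "fst z"], of 2] by simp
 moreover have "\<bar>(on_support g0 (fst z) - \<tau>c z) * excess g (fst z)\<bar> <= (\<bar>on_support g0 (fst z)\<bar> + C) * B"
  unfolding abs_mult using \<tau>c_bounds[of z] excess_bounded[OF g, of "fst z"] C_nonneg by (intro mult_mono) auto
 ultimately show ?thesis unfolding excess_loss_def mult.assoc by arith
qed

text \<open>Four errors: truncation in the weighted sum, exchange of the optimal weights for the
  ratios, the law of large numbers for the ratio-weighted truncated loss, and truncation under Q.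
  Weights of at most W/n make the first a tail average; the second is the mean deviation of
  \<open>weights_converge\<close> times the bound of the loss.\<close>

lemma well_specified_balance:
 assumes lam: "0 < lam" and ws: "well_specified Z P Q F W \<rho>"
 shows "AE \<omega> in M. \<forall>\<epsilon>>0. \<forall>\<^sub>F n in sequentially. \<forall>g\<in>G.
  \<bar>(\<Sum>i<n. w n \<omega> i * excess_loss g (zs \<omega> i)) - (\<integral>z. excess_loss g z \<partial>Q)\<bar> <= \<epsilon>"
 using weights_converge[OF lam ws] AE_feasible AE_tail_sum truncated_lln
proof eventually_elim
 case (elim \<omega>)
 show ?case
 proof (intro allI impI)
  fix \<epsilon> :: real assume \<epsilon>: "\<epsilon> > 0"
  define m where "m K = (\<integral>t. tail K t \<partial>PT) + 1 / real (Suc K)" for K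
  have "(\<lambda>K. (4 * W * B + 2 * B) * m K) \<longlonglongrightarrow> (4 * W * B + 2 * B) * (0 + 0)"
   unfolding m_def by (intro tendsto_intros tail_vanishes LIMSEQ_inverse_real_of_nat[unfolded inverse_eq_divide])
  then have "\<forall>\<^sub>F K in sequentially. (4 * W * B + 2 * B) * m K < \<epsilon> / 2" using \<epsilon> by (intro order_tendstoD(2)) auto
  \<comment> \<open>The truncation level is fixed before n: 4 W B accounts for the weighted sum,
    including the factor 2 of \<open>AE_tail_sum\<close>, and 2 B for the integral under Q.\<close>
  then obtain K where K: "(4 * W * B + 2 * B) * m K < \<epsilon> / 2" unfolding eventually_sequentially by blast
  define b where "b = B\<^sup>2 + 2 * ((real K + C) * B)"
  have b: "0 <= b" unfolding b_def using B_nonneg C_nonneg by simp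
  have "(\<lambda>n. b * ((\<Sum>i<n. \<bar>real n * w n \<omega> i - r (zs \<omega> i)\<bar>) / real n)) \<longlonglongrightarrow> b * 0" by (intro tendsto_mult_left elim(1))
  then have e1: "\<forall>\<^sub>F n in sequentially. b * ((\<Sum>i<n. \<bar>real n * w n \<omega> i - r (zs \<omega> i)\<bar>) / real n) < \<epsilon> / 4"
   using \<epsilon> by (intro order_tendstoD(2)) auto
  have e: "\<epsilon> / 4 > 0" using \<epsilon> by simp
  note e2 = elim(3)[THEN spec, of K, folded m_def] and e3 = elim(4)[THEN spec, of K, THEN spec, THEN mp, OF e]
  from e1 e2 e3 eventually_ge_at_top[of "1 :: nat"]
  show "\<forall>\<^sub>F n in sequentially. \<forall>g\<in>G. \<bar>(\<Sum>i<n. w n \<omega> i * excess_loss g (zs \<omega> i)) - (\<integral>z. excess_loss g z \<partial>Q)\<bar> <= \<epsilon>"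
  proof eventually_elim
   case (elim n)
   have n: "real n > 0" using elim(4) by simp
   have feas: "feasible_weights n W (w n \<omega>)" using \<open>\<forall>n\<ge>1. feasible_weights n W (w n \<omega>)\<close> elim(4) by blast
   have wb: "0 <= w n \<omega> i" "w n \<omega> i <= W / real n" if "i < n" for i using feas that unfolding feasible_weights_def by auto
   have cc: "\<bar>(\<Sum>i<n. w n \<omega> i * excess_loss (countable_class k) (zs \<omega> i)) - (\<integral>z. excess_loss (countable_class k) z \<partial>Q)\<bar> <= \<epsilon>" for k
   proof -
    define g where "g = countable_class k"
    have g: "g \<in> G" unfolding g_def by (rule countable_class(1))
    have "\<bar>(\<Sum>i<n. w n \<omega> i * excess_loss g (zs \<omega> i)) - (\<Sum>i<n. w n \<omega> i * truncated_loss K g (zs \<omega> i))\<bar>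
     <= (\<Sum>i<n. \<bar>w n \<omega> i * (excess_loss g (zs \<omega> i) - truncated_loss K g (zs \<omega> i))\<bar>)"
     unfolding sum_subtractf[symmetric] right_diff_distrib[symmetric] by (rule sum_abs)
    also have "\<dots> <= (\<Sum>i<n. W / real n * (2 * B * tail K (Ts i \<omega>)))"
    proof (rule sum_mono)
     fix i assume "i \<in> {..<n}"
     then show "\<bar>w n \<omega> i * (excess_loss g (zs \<omega> i) - truncated_loss K g (zs \<omega> i))\<bar> <= W / real n * (2 * B * tail K (Ts i \<omega>))"
      unfolding abs_mult using wb[of i] truncation_error[OF g, of "zs \<omega> i" K] by (intro mult_mono) (auto simp: zs_def)
    qed
    also have "\<dots> = 2 * W * B / real n * (\<Sum>i<n. tail K (Ts i \<omega>))"
     unfolding sum_distrib_left by (intro sum.cong refl) simp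
    also have "\<dots> <= 2 * W * B / real n * (2 * m K * real n)"
     using elim(2) W_pos B_nonneg by (intro mult_left_mono) auto
    also have "\<dots> = 4 * W * B * m K" using n by simp
    finally have 1: "\<bar>(\<Sum>i<n. w n \<omega> i * excess_loss g (zs \<omega> i)) - (\<Sum>i<n. w n \<omega> i * truncated_loss K g (zs \<omega> i))\<bar> <= 4 * W * B * m K" .
    have "(\<Sum>i<n. w n \<omega> i * truncated_loss K g (zs \<omega> i)) - (\<Sum>i<n. r (zs \<omega> i) * truncated_loss K g (zs \<omega> i)) / real n
     = (\<Sum>i<n. (real n * w n \<omega> i - r (zs \<omega> i)) * truncated_loss K g (zs \<omega> i)) / real n"
     using n unfolding sum_divide_distrib sum_subtractf[symmetric] by (intro sum.cong refl) (simp add: field_simps)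
    also have "\<bar>\<dots>\<bar> <= (\<Sum>i<n. \<bar>(real n * w n \<omega> i - r (zs \<omega> i)) * truncated_loss K g (zs \<omega> i)\<bar>) / real n"
     unfolding abs_divide using n by (simp add: divide_right_mono sum_abs)
    also have "\<dots> <= (\<Sum>i<n. b * \<bar>real n * w n \<omega> i - r (zs \<omega> i)\<bar>) / real n"
    proof (intro divide_right_mono sum_mono)
     fix i
     show "\<bar>(real n * w n \<omega> i - r (zs \<omega> i)) * truncated_loss K g (zs \<omega> i)\<bar> <= b * \<bar>real n * w n \<omega> i - r (zs \<omega> i)\<bar>"
      using mult_right_mono[OF truncated_loss_bounded[OF g, of K "zs \<omega> i"], of "\<bar>real n * w n \<omega> i - r (zs \<omega> i)\<bar>"]
      unfolding b_def[symmetric] by (simp add: abs_mult mult.commute)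
    qed simp
    also have "\<dots> = b * ((\<Sum>i<n. \<bar>real n * w n \<omega> i - r (zs \<omega> i)\<bar>) / real n)" by (simp add: sum_distrib_left)
    finally have 2: "\<bar>(\<Sum>i<n. w n \<omega> i * truncated_loss K g (zs \<omega> i)) - (\<Sum>i<n. r (zs \<omega> i) * truncated_loss K g (zs \<omega> i)) / real n\<bar> <= \<epsilon> / 4"
     using elim(1) by linarith
    have 3: "\<bar>(\<Sum>i<n. r (zs \<omega> i) * truncated_loss K g (zs \<omega> i)) / real n - (\<integral>z. truncated_loss K g z \<partial>Q)\<bar> <= \<epsilon> / 4"
     using elim(3) unfolding g_def by blast
    have "2 * B * (\<integral>t. tail K t \<partial>PT) <= 2 * B * m K" unfolding m_def using B_nonneg by (intro mult_left_mono) auto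
    then have 4: "\<bar>(\<integral>z. truncated_loss K g z \<partial>Q) - (\<integral>z. excess_loss g z \<partial>Q)\<bar> <= 2 * B * m K"
     using truncated_loss_integral[OF g, of K] by linarith
    have 5: "4 * W * B * m K + 2 * B * m K < \<epsilon> / 2" using K by (simp only: distrib_right)
    show ?thesis using 1 2 3 4 5 unfolding g_def by arith
   qed
   show ?case
   proof
    \<comment> \<open>From the countable class to all of \<open>G\<close>: at fixed n the sum passes
      to the pointwise limit, and so does the integral, dominated through the integrability of
      \<open>g0\<close>.\<close>
    fix g assume g: "g \<in> G"
    then obtain s where s: "\<And>t. (\<lambda>m. u (s m) t) \<longlonglongrightarrow> excess g t" using u_dense by blast
    have pw: "(\<lambda>m. excess_loss (countable_class (s m)) z) \<longlonglongrightarrow> excess_loss g z" for z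
     unfolding excess_loss_def using s[of "fst z"] unfolding u_def by (intro tendsto_intros)
    have "(\<lambda>m. \<integral>z. excess_loss (countable_class (s m)) z \<partial>Q) \<longlonglongrightarrow> (\<integral>z. excess_loss g z \<partial>Q)"
    proof (rule integral_dominated_convergence[where w = "\<lambda>z. B\<^sup>2 + 2 * ((\<bar>on_support g0 (fst z)\<bar> + C) * B)"])
     show "integrable Q (\<lambda>z. B\<^sup>2 + 2 * ((\<bar>on_support g0 (fst z)\<bar> + C) * B))"
      by (intro Bochner_Integration.integrable_add integrable_mult_right integrable_mult_left integrable_abs integrable_fst_Q g0_integrable Q.integrable_const)
     show "AE z in Q. norm (excess_loss (countable_class (s m)) z) <= B\<^sup>2 + 2 * ((\<bar>on_support g0 (fst z)\<bar> + C) * B)" for m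
      unfolding real_norm_def by (intro AE_I2 excess_loss_dominated countable_class(1))
    qed (simp_all only: measurable_Q excess_loss_measurable[OF g] excess_loss_measurable[OF countable_class(1)] pw AE_I2)
    then have "(\<lambda>m. \<bar>(\<Sum>i<n. w n \<omega> i * excess_loss (countable_class (s m)) (zs \<omega> i)) - (\<integral>z. excess_loss (countable_class (s m)) z \<partial>Q)\<bar>)
     \<longlonglongrightarrow> \<bar>(\<Sum>i<n. w n \<omega> i * excess_loss g (zs \<omega> i)) - (\<integral>z. excess_loss g z \<partial>Q)\<bar>"
     by (intro tendsto_intros pw)
    then show "\<bar>(\<Sum>i<n. w n \<omega> i * excess_loss g (zs \<omega> i)) - (\<integral>z. excess_loss g z \<partial>Q)\<bar> <= \<epsilon>"
     by (rule LIMSEQ_le_const2) (use cc in blast)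
   qed
  qed
 qed
qed

end

theorem theorem3:
  fixes M :: "'w measure"
    and T :: "'w \<Rightarrow> 'a::euclidean_space" and X :: "'w \<Rightarrow> 'b::euclidean_space"
    and Ypot :: "'a \<Rightarrow> 'w \<Rightarrow> real" and Y :: "'w \<Rightarrow> real"
    and Ts :: "nat \<Rightarrow> 'w \<Rightarrow> 'a" and Xs :: "nat \<Rightarrow> 'w \<Rightarrow> 'b" and Ys :: "nat \<Rightarrow> 'w \<Rightarrow> real"
    and P Q :: "('a \<times> 'b) measure" and PT :: "'a measure" and PX :: "'b measure"
    and \<T> :: "'a set" and \<Z> :: "('a \<times> 'b) set"
    and \<mu> :: "'a \<Rightarrow> real" and \<tau> :: "'a \<times> 'b \<Rightarrow> real"
    and F :: "('a \<times> 'b \<Rightarrow> real) set" and G :: "('a \<Rightarrow> real) set"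
    and \<rho> :: "real \<Rightarrow> real" and lam W\<^sub>0 W B :: real
    and w :: "nat \<Rightarrow> 'w \<Rightarrow> nat \<Rightarrow> real" and ghat :: "nat \<Rightarrow> 'w \<Rightarrow> 'a \<Rightarrow> real"
  assumes "prob_space M"
    \<comment> \<open>population: treatment, covariates, potential and observed outcomes\<close>
    and "T \<in> borel_measurable M" and "X \<in> borel_measurable M"
    and "(\<lambda>(t, \<omega>). Ypot t \<omega>) \<in> borel_measurable (borel \<Otimes>\<^sub>M M)"
    and "regular_outcomes M T Ypot"
    and Y: "\<And>\<omega>. Y \<omega> = Ypot (T \<omega>) \<omega>"
    and P: "P = distr M borel (\<lambda>\<omega>. (T \<omega>, X \<omega>))"
    and PT: "PT = distr M borel T" and PX: "PX = distr M borel X" and Q: "Q = PT \<Otimes>\<^sub>M PX"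
    and "\<T> = measure_support PT" and "\<Z> = measure_support P"
    and "compact \<Z>" and "compact (measure_support (distr M borel Y))"
    and "\<And>t. \<mu> t = (\<integral>\<omega>. Ypot t \<omega> \<partial>M)"
    and "\<tau> \<in> borel_measurable borel"
    and "AE \<omega> in M. real_cond_exp M (gen_subalgebra M borel (\<lambda>\<omega>. (T \<omega>, X \<omega>))) Y \<omega> = \<tau> (T \<omega>, X \<omega>)"
    \<comment> \<open>sample\<close>
    and "\<And>i. (\<lambda>\<omega>. (Ts i \<omega>, Xs i \<omega>, Ys i \<omega>)) \<in> borel_measurable M"
    and "prob_space.indep_vars M (\<lambda>_. borel) (\<lambda>i \<omega>. (Ts i \<omega>, Xs i \<omega>, Ys i \<omega>)) UNIV"
    and "\<And>i. distr M borel (\<lambda>\<omega>. (Ts i \<omega>, Xs i \<omega>, Ys i \<omega>)) = distr M borel (\<lambda>\<omega>. (T \<omega>, X \<omega>, Y \<omega>))"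
    \<comment> \<open>ignorability and overlap\<close>
    and "\<And>t. t \<in> \<T> \<Longrightarrow> cond_indep M borel (Ypot t) borel T borel X"
    and "absolutely_continuous P Q" and "0 < W\<^sub>0" and "AE z in P. RN_deriv P Q z \<le> ennreal W\<^sub>0"
    \<comment> \<open>weights, as a measurable function of the treatments and covariates\<close>
    and "F = lipschitz_class \<Z> \<or>
         (\<exists>K H ip. continuous_kernel_rkhs \<Z> K H ip \<and> F = rkhs_unit_ball \<Z> H ip)"
    and "0 \<le> lam" and "W\<^sub>0 < W"
    and "strictly_convex_on {0..W} \<rho>" and "continuous_on {0..W} \<rho>"
    and "\<And>x. x \<in> {0<..<W} \<Longrightarrow> \<rho> differentiable (at x)"
    and "\<And>n i. i < n \<Longrightarrow> (\<lambda>\<omega>. w n \<omega> i) \<in> borel_measurable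
           (gen_subalgebra M (\<Pi>\<^sub>M j\<in>{..<n}. borel) (\<lambda>\<omega>. \<lambda>j\<in>{..<n}. (Ts j \<omega>, Xs j \<omega>)))"
    and "AE \<omega> in M. \<forall>n\<ge>1. cbdm_weights F lam \<rho> W n (\<lambda>i. (Ts i \<omega>, Xs i \<omega>)) (w n \<omega>)"
    \<comment> \<open>hypothesis class and weighted least squares\<close>
    and "\<And>g. g \<in> G \<Longrightarrow> g \<in> borel_measurable (restrict_space borel \<T>)"
    and "pointwise_separable \<T> G"
    and "bounded_class B \<Z> G"
    and "AE \<omega> in M. (\<lambda>n. rademacher_complexity n G (\<lambda>i. Ts i \<omega>)) \<longlonglongrightarrow> 0"
    and "AE \<omega> in M. \<forall>n\<ge>1.
           is_arg_min (\<lambda>g. \<Sum>i<n. w n \<omega> i * (Ys i \<omega> - g (Ts i \<omega>))\<^sup>2) (\<lambda>g. g \<in> G) (ghat n \<omega>)"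
  shows
    "((\<exists>F\<^sub>0 G\<^sub>0. F\<^sub>0 \<noteq> {} \<and> approximable \<Z> F\<^sub>0 \<tau> \<and>
          (\<exists>\<gamma>. \<forall>g\<in>G. approximable_within \<T> G\<^sub>0 \<gamma> 0 g) \<and>
          {(\<lambda>(t, x). 2 * f (t, x) * g t + g' t * g'' t) | f g g' g''.
             f \<in> F\<^sub>0 \<and> g \<in> G\<^sub>0 \<union> {\<lambda>_. 0} \<and> g' \<in> G\<^sub>0 \<union> {\<lambda>_. 0} \<and> g'' \<in> G\<^sub>0 \<union> {\<lambda>_. 0}} \<subseteq> F)
      \<or> (0 < lam \<and> well_specified \<Z> P Q F W \<rho> \<and> legendre_regular W \<rho>)
      \<longrightarrow> (AE \<omega> in M. (\<lambda>n. dose_risk PT \<mu> (ghat n \<omega>)) \<longlonglongrightarrow> (INF g\<in>G. dose_risk PT \<mu> g)))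
     \<and> legendre_regular W (\<lambda>x. x\<^sup>2) \<and> legendre_regular W (\<lambda>x. x * ln x)"
proof (intro conjI impI)
  have W: "0 < W" using assms(23,27) by linarith
  then show "legendre_regular W (\<lambda>x. x\<^sup>2)" "legendre_regular W (\<lambda>x. x * ln x)"
    by (rule legendre_regular_square, intro legendre_regular_entropy W)
  assume cases: "(\<exists>F\<^sub>0 G\<^sub>0. F\<^sub>0 \<noteq> {} \<and> approximable \<Z> F\<^sub>0 \<tau> \<and>
          (\<exists>\<gamma>. \<forall>g\<in>G. approximable_within \<T> G\<^sub>0 \<gamma> 0 g) \<and>
          {(\<lambda>(t, x). 2 * f (t, x) * g t + g' t * g'' t) | f g g' g''.
             f \<in> F\<^sub>0 \<and> g \<in> G\<^sub>0 \<union> {\<lambda>_. 0} \<and> g' \<in> G\<^sub>0 \<union> {\<lambda>_. 0} \<and> g'' \<in> G\<^sub>0 \<union> {\<lambda>_. 0}} \<subseteq> F)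
      \<or> (0 < lam \<and> well_specified \<Z> P Q F W \<rho> \<and> legendre_regular W \<rho>)"
  have ign: "\<And>t. t \<in> measure_support PT \<Longrightarrow> cond_indep M borel (Ypot t) borel T borel X"
    using assms(21) unfolding assms(11) .
  interpret DS: dose_sample M T X Ypot Y P Q PT PX W\<^sub>0 Ts Xs Ys \<Z>
    by (intro dose_sample.intro dose_response.intro dose_response_axioms.intro dose_sample_axioms.intro)
      (fact assms ign)+
  have zs: "DS.zs \<omega> = (\<lambda>i. (Ts i \<omega>, Xs i \<omega>))" for \<omega> by (rule ext) (rule DS.zs_def)
  interpret CS: cbdm_sample M T X Ypot Y P Q PT PX W\<^sub>0 Ts Xs Ys \<Z> W \<rho> F lam w
    by (intro cbdm_sample.intro cbdm_sample_axioms.intro strictly_convex_cost.intro DS.dose_sample_axioms, unfold zs)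
      (fact assms W)+
  \<comment> \<open>The compact support of Y supplies the level at which outcomes and regression
    function are clipped.\<close>
  obtain C where C: "0 \<le> C" "AE \<omega> in M. \<bar>Y \<omega>\<bar> \<le> C"
  proof -
    obtain c where c: "\<And>y. y \<in> measure_support (distr M borel Y) \<Longrightarrow> \<bar>y\<bar> \<le> c"
      using compact_imp_bounded[OF assms(14)] unfolding bounded_iff by auto
    have "AE y in distr M borel Y. y \<in> measure_support (distr M borel Y)" by (rule AE_measure_support) simp
    then have "AE \<omega> in M. Y \<omega> \<in> measure_support (distr M borel Y)" by (rule AE_distrD[OF DS.Y_measurable])
    then have "AE \<omega> in M. \<bar>Y \<omega>\<bar> \<le> \<bar>c\<bar>" by eventually_elim (use c in force)
    then show ?thesis by (intro that[of "\<bar>c\<bar>"]) simp_all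
  qed
  have \<mu>: "\<mu> = (\<lambda>t. \<integral>\<omega>. Ypot t \<omega> \<partial>M)" by (rule ext) (rule assms(15))
  have ghat: "AE \<omega> in M. \<forall>n\<ge>1. ghat n \<omega> \<in> G"
    using assms(37) by eventually_elim (auto simp: is_arg_min_def)
  show "AE \<omega> in M. (\<lambda>n. dose_risk PT \<mu> (ghat n \<omega>)) \<longlonglongrightarrow> (INF g\<in>G. dose_risk PT \<mu> g)"
  proof (cases "\<exists>g\<in>G. dose_risk PT \<mu> g < \<infinity>")
    \<comment> \<open>No g has finite risk: the infimum is infinite, and so are all terms from n = 1
      on, because the empirical minimiser lies in \<open>G\<close>.\<close>
    case False
    then have top: "dose_risk PT \<mu> g = \<infinity>" if "g \<in> G" for g using that by (metis infinity_ennreal_def top.not_eq_extremum)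
    then have inf: "(INF g\<in>G. dose_risk PT \<mu> g) = \<infinity>" by (auto intro!: antisym INF_greatest)
    show ?thesis using ghat
    proof eventually_elim
      case (elim \<omega>)
      have "\<forall>\<^sub>F n in sequentially. dose_risk PT \<mu> (ghat n \<omega>) = \<infinity>"
        using eventually_ge_at_top[of "1 :: nat"] by eventually_elim (use elim top in blast)
      then show ?case unfolding inf by (rule tendsto_eventually)
    qed
  next
    case True
    \<comment> \<open>Any g of finite risk serves as base point; finiteness makes it square
      integrable, on which the decomposition of the risk and the tail estimates rest.\<close>
    then obtain g0 where g0: "g0 \<in> G" "dose_risk PT \<mu> g0 < \<infinity>" by blast
    interpret WR: weighted_regression M T X Ypot Y P Q PT PX W\<^sub>0 Ts Xs Ys \<Z> W \<rho> F lam w \<tau> G B C ghat g0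
      by (intro weighted_regression.intro weighted_regression_axioms.intro CS.cbdm_sample_axioms)
        (fact assms[unfolded assms(11)] C g0)+
    interpret FR: finite_risk_regression M T X Ypot Y P Q PT PX W\<^sub>0 Ts Xs Ys \<Z> W \<rho> F lam w \<tau> G B C ghat g0
      by (intro finite_risk_regression.intro finite_risk_regression_axioms.intro WR.weighted_regression_axioms
          WR.finite_risk_square_integrable g0(2)[unfolded \<mu>])
    from cases show ?thesis unfolding \<mu>
    proof (elim disjE exE conjE)
      fix F\<^sub>0 G\<^sub>0 \<gamma>
      assume "F\<^sub>0 \<noteq> {}" "approximable \<Z> F\<^sub>0 \<tau>" and \<gamma>: "\<forall>g\<in>G. approximable_within \<T> G\<^sub>0 \<gamma> 0 g"
        and "{(\<lambda>(t, x). 2 * f (t, x) * g t + g' t * g'' t) | f g g' g''.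
             f \<in> F\<^sub>0 \<and> g \<in> G\<^sub>0 \<union> {\<lambda>_. 0} \<and> g' \<in> G\<^sub>0 \<union> {\<lambda>_. 0} \<and> g'' \<in> G\<^sub>0 \<union> {\<lambda>_. 0}} \<subseteq> F"
      then show "AE \<omega> in M. (\<lambda>n. dose_risk PT (\<lambda>t. \<integral>\<omega>. Ypot t \<omega> \<partial>M) (ghat n \<omega>)) \<longlonglongrightarrow> (INF g\<in>G. dose_risk PT (\<lambda>t. \<integral>\<omega>. Ypot t \<omega> \<partial>M) g)"
        using \<gamma>[unfolded assms(11)] by (intro FR.erm_consistent FR.approximable_balance) blast+
    next
      assume "0 < lam" "well_specified \<Z> P Q F W \<rho>"
      then show "AE \<omega> in M. (\<lambda>n. dose_risk PT (\<lambda>t. \<integral>\<omega>. Ypot t \<omega> \<partial>M) (ghat n \<omega>)) \<longlonglongrightarrow> (INF g\<in>G. dose_risk PT (\<lambda>t. \<integral>\<omega>. Ypot t \<omega> \<partial>M) g)"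
        by (intro FR.erm_consistent FR.well_specified_balance)
    qed
  qed
qed

end
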